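(* Let $\Omega\subset\mathbb{R}^n$ be open and bounded, let $1<p<\infty$ and $g\in W^{1,p}(\mathbb{R}^n)$. For each $s\in(0,1)$, let $u_s\in H^{s,p}_g(\Omega)$ be such that the family $\{D^su_s\}_{s\in(0,1)}$ is bounded in $L^p(\mathbb{R}^n,\mathbb{R}^n)$. Then there exist $u\in W^{1,p}(\mathbb{R}^n)$ and an increasing sequence $\{s_j\}_{j\in\mathbb{N}}\subset(0,1)$ with $\lim_{j\to\infty}s_j=1$ such that for every $q$ satisfying $$\begin{cases} q\in[p,p^* ) & \text{if } p<n,\\ q\in[p,\infty) & \text{if } p=n,\\ q\in[p,\infty] & \text{if } p>n,\end{cases}$$ there exists $j_q\in\mathbb{N}$ for which $\{u_{s_j}\}_{j\ge j_q}\subset L^q(\mathbb{R}^n)$ and the convergences $$u_{s_j}\to u \text{ in } L^q(\mathbb{R}^n)\quad\text{and}\quad D^{s_j}u_{s_j}\rightharpoonup Du \text{ in } L^p(\mathbb{R}^n,\mathbb{R}^n)$$ hold as $j\to\infty$.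
   Context: For $0<s<1$ let $$c_{n,s}=(n+s-1)\frac{\Gamma\left(\frac{n+s-1}{2}\right)}{\pi^{n/2}\,2^{1-s}\,\Gamma\left(\frac{1-s}{2}\right)}.$$ For $u\in C_c^\infty(\mathbb{R}^n)$ the $s$-fractional gradient is $$D^su(x)=c_{n,s}\int_{\mathbb{R}^n}\frac{u(x)-u(y)}{|x-y|^{n+s}}\frac{x-y}{|x-y|}\,dy\in\mathbb{R}^n .$$ For $1\le p<\infty$, $H^{s,p}(\mathbb{R}^n)$ is the completion of $C_c^\infty(\mathbb{R}^n)$ under the norm $\|u\|_{L^p(\mathbb{R}^n)}+\|D^su\|_{L^p(\mathbb{R}^n)}$, i.e. the set of $u\in L^p(\mathbb{R}^n)$ for which there are $u_j\in C_c^\infty(\mathbb{R}^n)$ with $u_j\to u$ in $L^p$ and $\{D^su_j\}$ Cauchy in $L^p$; then $D^su$ is defined as the $L^p$ limit of $D^su_j$ (independent of the sequence and of $p$). One has $W^{1,p}(\mathbb{R}^n)\subset H^{s,p}(\mathbb{R}^n)$. For an open set $\Omega$, $H^{s,p}_0(\Omega)$ is the closure of $C_c^\infty(\Omega)$ (functions extended by zero) in $H^{s,p}(\mathbb{R}^n)$, and for $g\in H^{s,p}(\mathbb{R}^n)$, $H^{s,p}_g(\Omega)=g+H^{s,p}_0(\Omega)$. For $p<n$, $p^*=\frac{pn}{n-p}$. *)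

theory Defs
  imports "HOL-Probability.Probability"
begin

section \<open>Lebesgue spaces on Euclidean space\<close>

text \<open>Elements of Lebesgue and Sobolev spaces are represented by functions; every notion below
  is invariant under changes on null sets. Exponents are extended reals in $[1,\infty]$.\<close>

definition Lp :: "ereal \<Rightarrow> ('a::euclidean_space \<Rightarrow> 'b::euclidean_space) set" where
  "Lp q = {f \<in> borel_measurable lebesgue.
     if q = \<infinity> then \<exists>C. AE x in lebesgue. norm (f x) \<le> C
     else integrable lebesgue (\<lambda>x. norm (f x) powr real_of_ereal q)}"

text \<open>Meaningful only for members of \<open>Lp q\<close>.\<close>

definition Lp_norm :: "ereal \<Rightarrow> ('a::euclidean_space \<Rightarrow> 'b::euclidean_space) \<Rightarrow> real" where
  "Lp_norm q f =
     (if q = \<infinity> then real_of_ereal (esssup lebesgue (\<lambda>x. ereal (norm (f x))))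
      else (LINT x|lebesgue. norm (f x) powr real_of_ereal q) powr (1 / real_of_ereal q))"

definition Lp_tendsto ::
  "ereal \<Rightarrow> (nat \<Rightarrow> 'a::euclidean_space \<Rightarrow> 'b::euclidean_space) \<Rightarrow> ('a \<Rightarrow> 'b) \<Rightarrow> bool" where
  "Lp_tendsto q f F \<longleftrightarrow>
     F \<in> Lp q \<and> (\<forall>\<^sub>F j in sequentially. f j \<in> Lp q) \<and>
     (\<lambda>j. Lp_norm q (\<lambda>x. f j x - F x)) \<longlonglongrightarrow> 0"

definition Lp_Cauchy ::
  "ereal \<Rightarrow> (nat \<Rightarrow> 'a::euclidean_space \<Rightarrow> 'b::euclidean_space) \<Rightarrow> bool" where
  "Lp_Cauchy q f \<longleftrightarrow>
     (\<forall>j. f j \<in> Lp q) \<and>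
     (\<forall>e>0. \<exists>N. \<forall>i\<ge>N. \<forall>j\<ge>N. Lp_norm q (\<lambda>x. f i x - f j x) < e)"

text \<open>Weak convergence for $1 < p < \infty$, with the dual of $L^p$ identified as usual with
  $L^{p'}$, $p' = p/(p-1)$.\<close>

definition Lp_weak_tendsto ::
  "real \<Rightarrow> (nat \<Rightarrow> 'a::euclidean_space \<Rightarrow> 'b::euclidean_space) \<Rightarrow> ('a \<Rightarrow> 'b) \<Rightarrow> bool" where
  "Lp_weak_tendsto p f F \<longleftrightarrow>
     F \<in> Lp p \<and> (\<forall>j. f j \<in> Lp p) \<and>
     (\<forall>w \<in> Lp (ereal (p / (p - 1))).
        (\<lambda>j. LINT x|lebesgue. f j x \<bullet> w x) \<longlonglongrightarrow> (LINT x|lebesgue. F x \<bullet> w x))"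


section \<open>Test functions\<close>

primrec Ck :: "nat \<Rightarrow> ('a::euclidean_space \<Rightarrow> real) \<Rightarrow> bool" where
  "Ck 0 f \<longleftrightarrow> continuous_on UNIV f"
| "Ck (Suc k) f \<longleftrightarrow>
     f differentiable_on UNIV \<and> (\<forall>b\<in>Basis. Ck k (\<lambda>x. frechet_derivative f (at x) b))"

text \<open>$C_c^\infty(\Omega)$, its members extended by zero to the whole space.\<close>

definition Cc_inf :: "'a::euclidean_space set \<Rightarrow> ('a \<Rightarrow> real) set" where
  "Cc_inf \<Omega> =
     {f. (\<forall>k. Ck k f) \<and> compact (closure {x. f x \<noteq> 0}) \<and> closure {x. f x \<noteq> 0} \<subseteq> \<Omega>}"


section \<open>Weak gradient and the Sobolev space $W^{1,p}$\<close>

definition locally_integrable :: "('a::euclidean_space \<Rightarrow> 'b::euclidean_space) \<Rightarrow> bool" where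
  "locally_integrable f \<longleftrightarrow> (\<forall>K. compact K \<longrightarrow> set_integrable lebesgue K f)"

definition has_weak_grad :: "('a::euclidean_space \<Rightarrow> real) \<Rightarrow> ('a \<Rightarrow> 'a) \<Rightarrow> bool" where
  "has_weak_grad u v \<longleftrightarrow>
     locally_integrable u \<and> locally_integrable v \<and>
     (\<forall>\<phi> \<in> Cc_inf UNIV. \<forall>b\<in>Basis.
        (LINT x|lebesgue. u x * frechet_derivative \<phi> (at x) b) =
        - (LINT x|lebesgue. (v x \<bullet> b) * \<phi> x))"

text \<open>The weak gradient is unique up to null sets; the choice operator picks a representative.\<close>

definition weak_grad :: "('a::euclidean_space \<Rightarrow> real) \<Rightarrow> 'a \<Rightarrow> 'a" where
  "weak_grad u = (SOME v. has_weak_grad u v)"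

definition W1p :: "real \<Rightarrow> ('a::euclidean_space \<Rightarrow> real) set" where
  "W1p p = {u \<in> Lp p. \<exists>v \<in> Lp p. has_weak_grad u v}"


section \<open>The fractional gradient and the spaces $H^{s,p}$\<close>

definition frac_const :: "nat \<Rightarrow> real \<Rightarrow> real" where
  "frac_const n s =
     (real n + s - 1) * (Gamma ((real n + s - 1) / 2) /
       (pi powr (real n / 2) * 2 powr (1 - s) * Gamma ((1 - s) / 2)))"

text \<open>The fractional gradient of a test function. The integrand is totalised to 0 at $y = x$.\<close>

definition frac_grad_test :: "real \<Rightarrow> ('a::euclidean_space \<Rightarrow> real) \<Rightarrow> 'a \<Rightarrow> 'a" where
  "frac_grad_test s u x =
     frac_const DIM('a) s *\<^sub>R
       (LINT y|lebesgue. ((u x - u y) / norm (x - y) powr (real DIM('a) + s)) *\<^sub>R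
          ((x - y) /\<^sub>R norm (x - y)))"

definition Hsp :: "real \<Rightarrow> real \<Rightarrow> ('a::euclidean_space \<Rightarrow> real) set" where
  "Hsp s p =
     {u \<in> Lp p. \<exists>\<phi>. (\<forall>j. \<phi> j \<in> Cc_inf UNIV) \<and> Lp_tendsto p \<phi> u \<and>
        Lp_Cauchy p (\<lambda>j. frac_grad_test s (\<phi> j))}"

definition has_frac_grad ::
  "real \<Rightarrow> real \<Rightarrow> ('a::euclidean_space \<Rightarrow> real) \<Rightarrow> ('a \<Rightarrow> 'a) \<Rightarrow> bool" where
  "has_frac_grad s p u v \<longleftrightarrow>
     (\<exists>\<phi>. (\<forall>j. \<phi> j \<in> Cc_inf UNIV) \<and> Lp_tendsto p \<phi> u \<and>
        Lp_tendsto p (\<lambda>j. frac_grad_test s (\<phi> j)) v)"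

text \<open>The limit exists for \<open>u \<in> Hsp s p\<close> and is unique up to null sets, independently of the
  approximating sequence; the choice operator picks a representative.\<close>

definition frac_grad :: "real \<Rightarrow> real \<Rightarrow> ('a::euclidean_space \<Rightarrow> real) \<Rightarrow> 'a \<Rightarrow> 'a" where
  "frac_grad s p u = (SOME v. has_frac_grad s p u v)"

definition Hsp_norm :: "real \<Rightarrow> real \<Rightarrow> ('a::euclidean_space \<Rightarrow> real) \<Rightarrow> real" where
  "Hsp_norm s p u = Lp_norm p u + Lp_norm p (frac_grad s p u)"

text \<open>Closure of $C_c^\infty(\Omega)$ in $H^{s,p}$, and the affine space $g + H^{s,p}_0(\Omega)$.\<close>

definition Hsp0 ::
  "real \<Rightarrow> real \<Rightarrow> 'a::euclidean_space set \<Rightarrow> ('a \<Rightarrow> real) set" where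
  "Hsp0 s p \<Omega> =
     {v \<in> Hsp s p. \<exists>\<phi>. (\<forall>j. \<phi> j \<in> Cc_inf \<Omega>) \<and>
        (\<lambda>j. Hsp_norm s p (\<lambda>x. \<phi> j x - v x)) \<longlonglongrightarrow> 0}"

definition Hsp_aff ::
  "real \<Rightarrow> real \<Rightarrow> 'a::euclidean_space set \<Rightarrow> ('a \<Rightarrow> real) \<Rightarrow> ('a \<Rightarrow> real) set" where
  "Hsp_aff s p \<Omega> g = {(\<lambda>x. g x + v x) |v. v \<in> Hsp0 s p \<Omega>}"


section \<open>Exponents\<close>

definition sobolev_exponent :: "nat \<Rightarrow> real \<Rightarrow> real" where
  "sobolev_exponent n p = p * real n / (real n - p)"

definition subcritical_exponents :: "nat \<Rightarrow> real \<Rightarrow> ereal set" where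
  "subcritical_exponents n p =
     (if p < real n then {ereal p..<ereal (sobolev_exponent n p)}
      else if p = real n then {ereal p..<\<infinity>}
      else {ereal p..\<infinity>})"

end

theory Submission
  imports Defs
begin

text \<open>
  With \<open>\<beta> = (1 - s) / 2\<close> the fractional gradient is an average of heat semigroups,
  \<open>D\<^sup>s \<phi> = 1 / Gamma \<beta> * (integral of r powr (\<beta> - 1) * P\<^sub>r (D \<phi>) over r > 0)\<close>, and a Beta integral inverts
  this: \<open>P\<^sub>e \<phi> = - 1 / Gamma (1 - \<beta>) * (integral of t powr - \<beta> * div (P\<^bsub>t + e\<^esub> D\<^sup>s \<phi>) over t > 0)\<close> for all
  \<open>e \<ge> 0\<close>. Hence \<open>u - P\<^sub>e u\<close> is bounded in every subcritical \<open>L\<^sup>q\<close> by a positive power of \<open>e\<close> times the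
  \<open>L\<^sup>p\<close> norm of \<open>D\<^sup>s u\<close>, uniformly for \<open>s\<close> near 1. For large \<open>e\<close> this gives a Poincare inequality; for
  small \<open>e\<close>, together with the equicontinuity of \<open>P\<^sub>e u\<close>, it gives compactness. The weak limit of the
  fractional gradients is identified by integration by parts, since \<open>D\<^sup>s \<psi>\<close> tends to \<open>D \<psi>\<close> for test
  functions \<open>\<psi>\<close>.
\<close>

section \<open>Powers of norms and their integrals\<close>

text \<open>The difficulty is uniformity as \<open>s\<close> tends to 1. There
  \<open>frac_const\<close> tends to 0 while the singular integral in \<open>fgrad\<close> diverges,
  so the two factors must never be estimated separately. In the heat form the degeneration is
  explicit: as \<open>be\<close> tends to 0, the weight \<open>r powr (be - 1) / Gamma be\<close> on
  (0, 1] tends to a unit mass at \<open>r = 0\<close>, and the constant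
  \<open>1 / Gamma (1 - be)\<close> of the inverse formula stays bounded. The power of
  \<open>e\<close> is dictated by scaling. A derivative of the heat flow costs
  \<open>t powr (- (1/2))\<close>, passing from exponent \<open>p\<close> to \<open>q\<close> costs
  \<open>t powr (- (n/2) * (1/p - 1/q))\<close>, and the inverse formula has the weight
  \<open>t powr (- be)\<close>. Over times of order \<open>e\<close> this leaves
  \<open>e powr \<gamma>\<close> with \<open>\<gamma> = s/2 - n/2 * (1/p - 1/q)\<close>. For
  \<open>s = 1\<close> and \<open>q >= p\<close>, positivity of \<open>\<gamma>\<close> is exactly
  subcriticality; for a given \<open>q\<close> only \<open>s\<close> close to 1 are admissible,
  which is why the starting index depends on \<open>q\<close>. The boundary values enter only
  through the fact that all functions agree outside a bounded set.\<close>

definition pint :: "'x measure => real => ('x => 'b::euclidean_space) => bool" where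
 "pint M p f \<longleftrightarrow> f : borel_measurable M & integrable M (%x. norm (f x) powr p)"

text \<open>The \<open>p\<close>-th power of the norm: without the root it is a plain integral, to
  which monotonicity, Fatou and dominated convergence apply directly. The price is a factor
  \<open>2 powr p\<close> in the triangle inequality, harmless where only finiteness or convergence
  is at stake.\<close>

definition pnorm :: "'x measure => real => ('x => 'b::euclidean_space) => real" where
 "pnorm M p f = (LINT x|M. norm (f x) powr p)"

text \<open>The name \<open>L_\<close> marks the Bochner versions of facts whose short names denote Henstock-Kurzweil ones.\<close>

lemmas L_integrable_add = Bochner_Integration.integrable_add
  and L_integrable_bound = Bochner_Integration.integrable_bound
  and L_integrable_diff = Bochner_Integration.integrable_diff
  and L_integrable_sum = Bochner_Integration.integrable_sum
  and L_integral_add = Bochner_Integration.integral_add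
  and L_integral_cong = Bochner_Integration.integral_cong
  and L_integral_diff = Bochner_Integration.integral_diff
  and L_integral_nonneg = Bochner_Integration.integral_nonneg
  and L_integral_norm_bound_integral = Bochner_Integration.integral_norm_bound_integral
  and L_integral_sum = Bochner_Integration.integral_sum

abbreviation "inLp \<equiv> pint lborel"
abbreviation "nrm \<equiv> pnorm lborel"
abbreviation "itg \<equiv> integrable lborel"
abbreviation "Bb \<equiv> borel_measurable borel"
abbreviation "Bl \<equiv> borel_measurable lborel"
abbreviation "BL \<equiv> borel_measurable lebesgue"
abbreviation "Cc \<equiv> Cc_inf UNIV"
abbreviation "ind \<equiv> indicator"
abbreviation "dual (p::real) \<equiv> p / (p - 1)"
abbreviation "fgrad \<equiv> frac_grad_test"
abbreviation seq_limit (infixr "---->" 60) where "X ----> l \<equiv> X \<longlonglongrightarrow> l"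


lemma powr_add_le:
 fixes a b p :: real
 assumes "0 <= a" "0 <= b" "0 <= p"
 shows "(a + b) powr p <= 2 powr p * (a powr p + b powr p)"
proof -
 have "(a + b) powr p <= (2 * max a b) powr p"
  using assms by (intro powr_mono2) auto
 also have "... = 2 powr p * (max a b) powr p"
  using assms by (simp add: powr_mult)
 also have "... <= 2 powr p * (a powr p + b powr p)"
  by (intro mult_left_mono) (auto simp: max_def)
 finally show ?thesis .
qed

lemma norm_add_powr_le:
 fixes a b :: "'b::real_normed_vector"
 assumes "0 <= p"
 shows "norm (a + b) powr p <= 2 powr p * (norm a powr p + norm b powr p)"
proof -
 have "norm (a + b) powr p <= (norm a + norm b) powr p"
  using assms by (intro powr_mono2 norm_triangle_ineq) auto
 also have "... <= 2 powr p * (norm a powr p + norm b powr p)"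
  using assms by (intro powr_add_le) auto
 finally show ?thesis .
qed

lemma pnorm_nonneg [simp]: "0 <= pnorm M p f"
 unfolding pnorm_def by (intro integral_nonneg_AE) auto

lemma pint_measurable [measurable_dest]: "pint M p f ==> f : borel_measurable M"
 by (simp add: pint_def)

lemma pint_integrable: "pint M p f ==> integrable M (%x. norm (f x) powr p)"
 by (simp add: pint_def)

lemma pint_bound:
 assumes [measurable]: "f : borel_measurable M" and "integrable M h"
  and "AE x in M. norm (f x) powr p <= h x"
 shows "pint M p f" "pnorm M p f <= (LINT x|M. h x)"
proof -
 show 1: "pint M p f"
  unfolding pint_def using assms
  by (auto intro!: L_integrable_bound[OF assms(2)] elim!: eventually_mono)
 show "pnorm M p f <= (LINT x|M. h x)"
  unfolding pnorm_def using assms 1 by (intro integral_mono_AE) (auto simp: pint_def)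
qed

lemma pint_mono:
 assumes "f : borel_measurable M" "pint M p g" "AE x in M. norm (f x) <= norm (g x)" "0 <= p"
 shows "pint M p f" "pnorm M p f <= pnorm M p g"
proof -
 have *: "AE x in M. norm (f x) powr p <= norm (g x) powr p"
  using assms(3) by eventually_elim (use assms(4) in "auto intro: powr_mono2")
 show "pint M p f" "pnorm M p f <= pnorm M p g"
  using pint_bound[OF assms(1) pint_integrable[OF assms(2)] *] by (auto simp: pnorm_def)
qed

lemma pint_add:
 assumes "pint M p f" "pint M p g" "0 <= p"
 shows "pint M p (%x. f x + g x)"
  "pnorm M p (%x. f x + g x) <= 2 powr p * (pnorm M p f + pnorm M p g)"
proof -
 have [measurable]: "f : borel_measurable M" "g : borel_measurable M"
  using assms by (auto simp: pint_def)
 have i: "integrable M (%x. 2 powr p * (norm (f x) powr p + norm (g x) powr p))"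
  using assms by (auto simp: pint_def)
 note b = pint_bound[OF _ i, of "%x. f x + g x" p]
 show "pint M p (%x. f x + g x)"
  by (rule b) (use assms in "auto intro!: norm_add_powr_le")
 have "pnorm M p (%x. f x + g x) <= (LINT x|M. 2 powr p * (norm (f x) powr p + norm (g x) powr p))"
  by (rule b) (use assms in "auto intro!: norm_add_powr_le")
 also have "... = 2 powr p * (pnorm M p f + pnorm M p g)"
  using assms by (simp add: pnorm_def pint_def)
 finally show "pnorm M p (%x. f x + g x) <= 2 powr p * (pnorm M p f + pnorm M p g)" .
qed

lemma pint_scaleR:
 assumes "pint M p f"
 shows "pint M p (%x. c *\<^sub>R f x)" "pnorm M p (%x. c *\<^sub>R f x) = \<bar>c\<bar> powr p * pnorm M p f"
proof -
 have [measurable]: "f : borel_measurable M" using assms by (auto simp: pint_def)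
 show "pint M p (%x. c *\<^sub>R f x)" "pnorm M p (%x. c *\<^sub>R f x) = \<bar>c\<bar> powr p * pnorm M p f"
  using assms by (auto simp: pint_def pnorm_def powr_mult)
qed

lemma pint_cmult:
 fixes f :: "'x => real"
 assumes "pint M p f"
 shows "pint M p (%x. c * f x)" "pnorm M p (%x. c * f x) = \<bar>c\<bar> powr p * pnorm M p f"
 using pint_scaleR[OF assms, of c] by simp_all

lemma pnorm_uminus: "pnorm M p (%x. - f x) = pnorm M p f"
 by (simp add: pnorm_def)

lemma pnorm_minus_commute: "pnorm M p (%x. f x - g x) = pnorm M p (%x. g x - f x)"
 by (simp add: pnorm_def norm_minus_commute)

lemma pint_uminus: "pint M p f ==> pint M p (%x. - f x)"
 by (auto simp: pint_def)

lemma pint_diff: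
 assumes "pint M p f" "pint M p g" "0 <= p"
 shows "pint M p (%x. f x - g x)"
  "pnorm M p (%x. f x - g x) <= 2 powr p * (pnorm M p f + pnorm M p g)"
 using pint_add[OF assms(1) pint_uminus[OF assms(2)] assms(3)] by (simp_all add: pnorm_uminus)

lemma pint_cong_AE:
 assumes "pint M p f" "g : borel_measurable M" "AE x in M. f x = g x"
 shows "pint M p g" "pnorm M p g = pnorm M p f"
proof -
 have [measurable]: "f : borel_measurable M" "g : borel_measurable M"
  using assms by (auto simp: pint_def)
 have "integrable M (%x. norm (f x) powr p) \<longleftrightarrow> integrable M (%x. norm (g x) powr p)"
  using assms by (intro integrable_cong_AE) (auto elim!: eventually_mono)
 with assms show "pint M p g" by (simp add: pint_def)
 show "pnorm M p g = pnorm M p f" unfolding pnorm_def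
  using assms by (intro integral_cong_AE) (auto elim!: eventually_mono)
qed

lemma pint_component:
 assumes "pint M p f" "b : Basis" "0 <= p"
 shows "pint M p (%x. f x \<bullet> b)" "pnorm M p (%x. f x \<bullet> b) <= pnorm M p f"
proof -
 have [measurable]: "f : borel_measurable M" using assms by (auto simp: pint_def)
 have *: "AE x in M. norm (f x \<bullet> b) <= norm (f x)"
  using Basis_le_norm[OF assms(2)] by auto
 show "pint M p (%x. f x \<bullet> b)" "pnorm M p (%x. f x \<bullet> b) <= pnorm M p f"
  by (rule pint_mono[OF _ assms(1) * assms(3)]; simp)+
qed

lemma pint_zero [simp]: "pint M p (%x. 0)" "pnorm M p (%x. 0) = 0"
 by (simp_all add: pint_def pnorm_def)

lemma pint_sum:
 assumes "finite I" "!!i. i : I ==> pint M p (f i)" "0 <= p"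
 shows "pint M p (%x. SUM i:I. f i x)"
 using assms by (induction I rule: finite_induct) (auto intro!: pint_add)

text \<open>Each further summand costs one quasi-triangle inequality, so \<open>K\<close> depends
  only on the index set and on \<open>p\<close>. It is quantified ahead of \<open>f\<close> in order
  to serve all families indexed by \<open>Basis\<close> at once.\<close>

lemma pnorm_sum_le:
 fixes M :: "'x measure"
 assumes "finite (I :: 'i set)" "0 <= p"
 shows "EX K>=0. ALL f :: 'i => 'x => 'b::euclidean_space. (ALL i:I. pint M p (f i)) --> pnorm M p (%x. SUM i:I. f i x) <= K * (SUM i:I. pnorm M p (f i))"
 using assms(1)
proof (induction I rule: finite_induct)
 case empty
 show ?case by (auto intro!: exI[of _ 0])
next
 case (insert i I)
 from insert.IH obtain K where K: "0 <= K" "ALL f :: 'i => 'x => 'b. (ALL i:I. pint M p (f i)) --> pnorm M p (%x. SUM i:I. f i x) <= K * (SUM i:I. pnorm M p (f i))"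
  by auto
 have "pnorm M p (%x. SUM i:insert i I. f i x) <= 2 powr p * (1 + K) * (SUM i:insert i I. pnorm M p (f i))"
  if f: "ALL i:insert i I. pint M p (f i)" for f :: "'i => 'x => 'b"
 proof -
  have "pnorm M p (%x. SUM i:insert i I. f i x) = pnorm M p (%x. f i x + (SUM i:I. f i x))"
   using insert by simp
  also have "... <= 2 powr p * (pnorm M p (f i) + pnorm M p (%x. SUM i:I. f i x))"
   using f insert assms by (intro pint_add pint_sum) auto
  also have "... <= 2 powr p * ((1 + K) * pnorm M p (f i) + (1 + K) * (SUM i:I. pnorm M p (f i)))"
  proof (intro mult_left_mono add_mono)
   show "pnorm M p (f i) <= (1 + K) * pnorm M p (f i)"
    using K(1) by (simp add: algebra_simps)
   have "0 <= (SUM i:I. pnorm M p (f i))" by (intro sum_nonneg) simp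
   then show "pnorm M p (%x. SUM i:I. f i x) <= (1 + K) * (SUM i:I. pnorm M p (f i))"
    using K(2)[rule_format, of f] f by (simp add: algebra_simps)
  qed simp
  also have "... = 2 powr p * (1 + K) * (SUM i:insert i I. pnorm M p (f i))"
   using insert by (simp add: algebra_simps)
  finally show ?thesis .
 qed
 then show ?case using K(1) by (intro exI[of _ "2 powr p * (1 + K)"]) auto
qed

text \<open>Young's inequality for \<open>c * a\<close> and \<open>b / c\<close> with
  \<open>c powr p = d\<close>: the weight of the first factor can be made as small as desired at the
  expense of the second.\<close>

lemma Young_weighted:
 fixes p d :: real
 assumes "1 < p" "0 < d"
 obtains C where "0 <= C" "!!a b. 0 <= a ==> 0 <= b ==> a * b <= d * a powr p + C * b powr (dual p)"
proof
 define c where "c = d powr (1 / p)"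
 have c: "c > 0" using assms by (simp add: c_def)
 have q: "p / (p - 1) > 1" "1 / p + 1 / (dual p) = 1"
  using assms by (simp_all add: field_simps)
 show "0 <= (1 / c) powr (dual p)" by simp
 fix a b :: real assume ab: "0 <= a" "0 <= b"
 have "a * b = (c * a) * (b / c)" using c by simp
 also have "... <= (c * a) powr p / p + (b / c) powr (dual p) / (dual p)"
  using ab c assms q by (intro Youngs_inequality) auto
 also have "... <= (c * a) powr p + (b / c) powr (dual p)"
 proof (intro add_mono)
  show "(c * a) powr p / p <= (c * a) powr p"
   using assms by (intro divide_le_eq[THEN iffD2]) (auto simp: mult_le_cancel_left1)
  show "(b / c) powr (dual p) / (dual p) <= (b / c) powr (dual p)"
   using divide_left_mono[of 1 "p / (p - 1)" "(b / c) powr (dual p)"] q by simp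
 qed
 also have "... = d * a powr p + (1 / c) powr (dual p) * b powr (dual p)"
  using ab c assms by (simp add: powr_mult powr_divide c_def powr_powr)
 finally show "a * b <= d * a powr p + (1 / c) powr (dual p) * b powr (dual p)" .
qed

lemma pint_inner_integrable:
 assumes "1 < p" "pint M p f" "pint M (dual p) w"
 shows "integrable M (%x. f x \<bullet> w x)"
proof -
 obtain C where C: "0 <= C" "!!a b. 0 <= a ==> 0 <= b ==> a * b <= 1 * a powr p + C * b powr (dual p)"
  using Young_weighted[OF assms(1), of 1] by auto
 have [measurable]: "f : borel_measurable M" "w : borel_measurable M"
  using assms by (auto simp: pint_def)
 show ?thesis
 proof (rule L_integrable_bound)
  show "integrable M (%x. 1 * norm (f x) powr p + C * norm (w x) powr (dual p))"
   using assms by (auto simp: pint_def)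
  have "\<bar>f x \<bullet> w x\<bar> <= 1 * norm (f x) powr p + C * norm (w x) powr (dual p)" for x
   using Cauchy_Schwarz_ineq2[of "f x" "w x"] C(2)[of "norm (f x)" "norm (w x)"] by simp
  then show "AE x in M. norm (f x \<bullet> w x) <= norm (1 * norm (f x) powr p + C * norm (w x) powr (dual p))"
   using C(1) by (auto intro: order_trans)
 qed auto
qed

text \<open>A substitute for Hoelder's inequality that fits the functional \<open>pnorm\<close>.\<close>

lemma pnorm_pairing_le:
 assumes "1 < p" "0 < d"
 obtains C where "0 <= C"
  "!!(f :: 'x => 'b::euclidean_space) w. pint M p f ==> pint M (dual p) w ==>
   \<bar>LINT x|M. f x \<bullet> w x\<bar> <= d * pnorm M p f + C * pnorm M (dual p) w"
proof -
 obtain C where C: "0 <= C" "!!a b. 0 <= a ==> 0 <= b ==> a * b <= d * a powr p + C * b powr (dual p)"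
  using Young_weighted[OF assms] by auto
 have "\<bar>LINT x|M. f x \<bullet> w x\<bar> <= d * pnorm M p f + C * pnorm M (dual p) w"
  if fw: "pint M p f" "pint M (dual p) w" for f w :: "'x => 'b"
 proof -
  have "\<bar>LINT x|M. f x \<bullet> w x\<bar> <= (LINT x|M. \<bar>f x \<bullet> w x\<bar>)"
   using integral_norm_bound[of M "%x. f x \<bullet> w x"] by simp
  also have "... <= (LINT x|M. d * norm (f x) powr p + C * norm (w x) powr (dual p))"
  proof (rule integral_mono)
   show "integrable M (%x. \<bar>f x \<bullet> w x\<bar>)"
    using pint_inner_integrable[OF assms(1) fw] by auto
   show "integrable M (%x. d * norm (f x) powr p + C * norm (w x) powr (dual p))"
    using fw by (auto simp: pint_def)
   show "\<bar>f x \<bullet> w x\<bar> <= d * norm (f x) powr p + C * norm (w x) powr (dual p)" for x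
    using Cauchy_Schwarz_ineq2[of "f x" "w x"] C(2)[of "norm (f x)" "norm (w x)"] by simp
  qed
  also have "... = d * pnorm M p f + C * pnorm M (dual p) w"
   using fw by (simp add: pint_def pnorm_def)
  finally show ?thesis .
 qed
 with C(1) that show ?thesis by blast
qed

lemma tendsto_0_powrD:
 fixes f :: "nat => real"
 assumes "(%n. f n powr p) ----> 0" "!!n. 0 <= f n" "0 < p"
 shows "f ----> 0"
proof -
 have "(%n. (f n powr p) powr (1 / p)) ----> 0 powr (1 / p)"
  using assms by (intro tendsto_powr' tendsto_const) auto
 then show ?thesis using assms by (simp add: powr_powr)
qed

lemma tendsto_0_powrI:
 fixes f :: "nat => real"
 assumes "f ----> 0" "!!n. 0 <= f n" "0 < p"
 shows "(%n. f n powr p) ----> 0"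
proof -
 have "(%n. f n powr p) ----> 0 powr p"
  using assms by (intro tendsto_powr' tendsto_const) auto
 then show ?thesis by simp
qed

lemma pnorm_AE_subseq:
 assumes "!!j. pint M p (%x. f j x - F x)" "(%j. pnorm M p (%x. f j x - F x)) ----> 0" "0 < p"
 obtains r :: "nat => nat" where "strict_mono r" "AE x in M. (%j. f (r j) x) ----> F x"
proof -
 have "EX r::nat=>nat. strict_mono r & (AE x in M. (%n. norm (f (r n) x - F x) powr p) ----> 0)"
  using assms by (intro tendsto_L1_AE_subseq) (auto simp: pint_def pnorm_def)
 then obtain r :: "nat => nat" where r: "strict_mono r" "AE x in M. (%n. norm (f (r n) x - F x) powr p) ----> 0"
  by blast
 from r(2) have "AE x in M. (%j. f (r j) x) ----> F x"
 proof eventually_elim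
  case (elim x)
  then have "(%n. norm (f (r n) x - F x)) ----> 0"
   by (rule tendsto_0_powrD) (use assms in auto)
  then have "(%n. f (r n) x - F x) ----> 0" by (rule tendsto_norm_zero_cancel)
  then show ?case by (rule LIM_zero_cancel)
 qed
 with r(1) that show thesis by blast
qed

section \<open>Fatou's lemma and completeness\<close>

lemma pint_nn:
 assumes "pint M p f"
 shows "(\<integral>\<^sup>+x. ennreal (norm (f x) powr p) \<partial>M) = ennreal (pnorm M p f)"
 unfolding pnorm_def using assms by (intro nn_integral_eq_integral) (auto simp: pint_def)

lemma pintI_nn:
 assumes [measurable]: "f : borel_measurable M"
  and B: "(\<integral>\<^sup>+x. ennreal (norm (f x) powr p) \<partial>M) <= ennreal B" "0 <= B"
 shows "pint M p f" "pnorm M p f <= B"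
proof -
 have "(\<integral>\<^sup>+x. ennreal (norm (f x) powr p) \<partial>M) < \<infinity>"
  using B(1) by (rule order.strict_trans1) simp
 then show *: "pint M p f"
  unfolding pint_def by (auto simp: integrable_iff_bounded)
 show "pnorm M p f <= B"
  using B pint_nn[OF *] by simp
qed

lemma pint_Fatou:
 assumes f: "!!j. pint M p (f j)" "!!j. pnorm M p (f j) <= B"
  and lim: "AE x in M. (%j. f j x) ----> F x" and [measurable]: "F : borel_measurable M" and "0 < p"
 shows "pint M p F" "pnorm M p F <= B"
proof -
 have [measurable]: "f j : borel_measurable M" for j using f by (auto simp: pint_def)
 have B: "0 <= B" using f(2)[of 0] pnorm_nonneg[of M p "f 0"] by linarith
 have "(\<integral>\<^sup>+x. ennreal (norm (F x) powr p) \<partial>M) <= (\<integral>\<^sup>+x. liminf (%j. ennreal (norm (f j x) powr p)) \<partial>M)"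
 proof (intro nn_integral_mono_AE, use lim in eventually_elim)
  case (elim x)
  have "(%j. ennreal (norm (f j x) powr p)) ----> ennreal (norm (F x) powr p)"
   using elim \<open>0 < p\<close> by (intro tendsto_ennrealI tendsto_powr' tendsto_norm tendsto_const) auto
  from lim_imp_Liminf[OF sequentially_bot this] show ?case by simp
 qed
 also have "... <= liminf (%j. \<integral>\<^sup>+x. ennreal (norm (f j x) powr p) \<partial>M)"
  by (intro nn_integral_liminf) auto
 also have "... <= ennreal B"
  using f by (intro Liminf_le) (auto simp: pint_nn intro!: ennreal_leI always_eventually)
 finally show "pint M p F" "pnorm M p F <= B"
  using B by (auto intro: pintI_nn)
qed

lemma le_suminf_ennreal: "a k <= (\<Sum>k. a k :: ennreal)"
 using sum_le_suminf[OF summableI, of "{k}" a] by simp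

text \<open>Riesz-Fischer. Along a fast subsequence the sum over \<open>k\<close> of the
  \<open>p\<close>-th powers of \<open>2 ^ k\<close> times the increments is integrable, so almost
  everywhere the increments are dominated by a geometric series. Fatou along this subsequence then
  controls the whole sequence.\<close>

lemma pint_complete:
 assumes f: "!!j. pint M p (f j)"
  and cauchy: "!!e. 0 < e ==> EX N. ALL i>=N. ALL j>=N. pnorm M p (%x. f i x - f j x) < e"
  and p: "0 < p"
 obtains F where "pint M p F" "(%j. pnorm M p (%x. f j x - F x)) ----> 0"
proof -
 have [measurable]: "f j : borel_measurable M" for j using f by (auto simp: pint_def)
 \<comment> \<open>Small enough that \<open>(2 ^ k) powr p * d k\<close> is still the summable
   \<open>(1/2) ^ k\<close>.\<close>
 define d :: "nat => real" where "d k = (1/2) ^ k * ((1/2) ^ k) powr p" for k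
 have d: "d k > 0" for k by (simp add: d_def)
 obtain N where N: "!!k i j. N k <= i ==> N k <= j ==> pnorm M p (%x. f i x - f j x) < d k"
  using cauchy[OF d] by metis
 \<comment> \<open>Adding up all thresholds makes \<open>r\<close> strictly increasing and at least
   \<open>N k\<close> at the same time.\<close>
 define r where "r k = k + (\<Sum>i\<le>k. N i)" for k
 have r: "strict_mono r" by (rule strict_monoI_Suc) (auto simp: r_def)
 have rN: "N k <= r k" for k
  using member_le_sum[of k "{..k}" N] by (auto simp: r_def)
 have rle: "r k <= r (Suc k)" for k using r by (simp add: strict_mono_less_eq)
 have "(\<integral>\<^sup>+x. (\<Sum>k. ennreal ((2 ^ k * norm (f (r (Suc k)) x - f (r k) x)) powr p)) \<partial>M)
   = (\<Sum>k. (\<integral>\<^sup>+x. ennreal ((2 ^ k * norm (f (r (Suc k)) x - f (r k) x)) powr p) \<partial>M))"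
  by (intro nn_integral_suminf) auto
 also have "... <= (\<Sum>k. ennreal ((1/2) ^ k))"
 proof (intro suminf_le allI)
  fix k
  have pi: "pint M p (%x. (2 ^ k) *\<^sub>R (f (r (Suc k)) x - f (r k) x))"
   using f p by (intro pint_scaleR pint_diff) auto
  have "(\<integral>\<^sup>+x. ennreal ((2 ^ k * norm (f (r (Suc k)) x - f (r k) x)) powr p) \<partial>M)
   = ennreal (pnorm M p (%x. (2 ^ k) *\<^sub>R (f (r (Suc k)) x - f (r k) x)))"
   using pint_nn[OF pi] by simp
  also have "pnorm M p (%x. (2 ^ k) *\<^sub>R (f (r (Suc k)) x - f (r k) x)) = (2 ^ k) powr p * pnorm M p (%x. f (r (Suc k)) x - f (r k) x)"
   using f p by (subst pint_scaleR) (auto intro!: pint_diff)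
  also have "ennreal ... <= ennreal ((2 ^ k) powr p * d k)"
   using N[of k "r (Suc k)" "r k"] rN[of k] rle[of k] by (intro ennreal_leI mult_left_mono) auto
  also have "(2 ^ k) powr p * d k = (1/2) ^ k"
   by (simp add: d_def powr_divide power_one_over field_simps)
  finally show "(\<integral>\<^sup>+x. ennreal ((2 ^ k * norm (f (r (Suc k)) x - f (r k) x)) powr p) \<partial>M) <= ennreal ((1/2) ^ k)" .
 qed auto
 also have "... = ennreal (\<Sum>k. (1/2) ^ k)"
  by (intro suminf_ennreal2) (auto intro!: summable_geometric)
 also have "... < \<infinity>" by simp
 finally have fin: "(\<integral>\<^sup>+x. (\<Sum>k. ennreal ((2 ^ k * norm (f (r (Suc k)) x - f (r k) x)) powr p)) \<partial>M) < \<infinity>" .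
 have "AE x in M. (\<Sum>k. ennreal ((2 ^ k * norm (f (r (Suc k)) x - f (r k) x)) powr p)) ~= \<infinity>"
  using fin by (intro nn_integral_noteq_infinite) auto
 then have conv: "AE x in M. convergent (%k. f (r k) x)"
 proof eventually_elim
  case (elim x)
  define c where "c = enn2real (\<Sum>k. ennreal ((2 ^ k * norm (f (r (Suc k)) x - f (r k) x)) powr p))"
  have c: "(2 ^ k * norm (f (r (Suc k)) x - f (r k) x)) powr p <= c" for k
  proof -
   have "ennreal ((2 ^ k * norm (f (r (Suc k)) x - f (r k) x)) powr p) <= (\<Sum>k. ennreal ((2 ^ k * norm (f (r (Suc k)) x - f (r k) x)) powr p))"
    by (rule le_suminf_ennreal)
   also have "... = ennreal c" unfolding c_def
    using elim by (simp add: less_top)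
   finally show ?thesis by (subst (asm) ennreal_le_iff) (simp_all add: c_def)
  qed
  have le: "norm (f (r (Suc k)) x - f (r k) x) <= c powr (1/p) * (1/2) ^ k" for k
  proof -
   have "2 ^ k * norm (f (r (Suc k)) x - f (r k) x) = ((2 ^ k * norm (f (r (Suc k)) x - f (r k) x)) powr p) powr (1/p)"
    using p by (simp add: powr_powr)
   also have "... <= c powr (1/p)" using c[of k] p by (intro powr_mono2) auto
   finally show ?thesis by (simp add: field_simps power_one_over)
  qed
  have "summable (%k. c powr (1/p) * (1/2) ^ k)"
   by (intro summable_mult summable_geometric) simp
  from summable_comparison_test'[OF this le] have "summable (%k. f (r (Suc k)) x - f (r k) x)" .
  then have "convergent (%n. (\<Sum>k<n. f (r (Suc k)) x - f (r k) x) + f (r 0) x)"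
   by (intro convergent_add convergent_const) (simp add: summable_iff_convergent)
  then show ?case by (simp add: sum_lessThan_telescope[of "%k. f (r k) x"])
 qed
 define F where "F x = lim (%k. f (r k) x)" for x
 have [measurable]: "F : borel_measurable M"
  unfolding F_def by measurable
 have lim: "AE x in M. (%k. f (r k) x) ----> F x"
  using conv by eventually_elim (simp add: F_def convergent_LIMSEQ_iff)
 have key: "pint M p (%x. f j x - F x) & pnorm M p (%x. f j x - F x) <= e"
  if "ALL i>=n. ALL j>=n. pnorm M p (%x. f i x - f j x) < e" "n <= j" for j n e
 proof -
  have rn: "n <= r (k + n)" for k using strict_mono_imp_increasing[OF r, of "k+n"] by linarith
  have l: "AE x in M. (%k. f j x - f (r (k + n)) x) ----> f j x - F x"
   using lim
  proof eventually_elim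
   case (elim x)
   show ?case by (intro tendsto_diff tendsto_const LIMSEQ_ignore_initial_segment[OF elim])
  qed
  have i: "pint M p (%x. f j x - f (r (k + n)) x)" for k
   using f p by (intro pint_diff) auto
  have le: "pnorm M p (%x. f j x - f (r (k + n)) x) <= e" for k
   using that rn[of k] by (auto intro: less_imp_le)
  have m: "(%x. f j x - F x) : borel_measurable M" by measurable
  show ?thesis
   using pint_Fatou[OF i le l m p] by blast
 qed
 obtain n where "ALL i>=n. ALL j>=n. pnorm M p (%x. f i x - f j x) < 1" using cauchy[of 1] by auto
 from key[OF this, of n] have "pint M p (%x. f n x - F x)" by auto
 from pint_diff(1)[OF f[of n] this] p have "pint M p F" by simp
 moreover have "(%j. pnorm M p (%x. f j x - F x)) ----> 0"
 proof (rule LIMSEQ_I)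
  fix e :: real assume "0 < e"
  then obtain n where n: "ALL i>=n. ALL j>=n. pnorm M p (%x. f i x - f j x) < e / 2" using cauchy[of "e/2"] by auto
  show "EX no. ALL j>=no. norm (pnorm M p (%x. f j x - F x) - 0) < e"
   using key[OF n] \<open>0 < e\<close> by (intro exI[of _ n]) fastforce
 qed
 ultimately show thesis by (rule that)
qed

section \<open>Convexity of powers and weak cluster points\<close>

lemma powr_tangent_less:
 fixes p u :: real
 assumes "1 < p" "0 <= u" "u ~= 1"
 shows "1 + p * (u - 1) < u powr p"
proof -
 have der: "((%t. t powr p) has_real_derivative p * t powr (p - 1)) (at t)" if "0 < t" for t
  using that by (auto intro!: derivative_eq_intros)
 consider "u = 0" | "0 < u" "u < 1" | "1 < u" using assms by linarith
 then show ?thesis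
 proof cases
  case 2
  obtain z where z: "u < z" "z < 1" "1 powr p - u powr p = (1 - u) * (p * z powr (p - 1))"
   using MVT2[of u 1 "%t. t powr p" "%t. p * t powr (p - 1)"] der 2 by auto
  have "z powr (p - 1) < 1 powr (p - 1)" using z 2 assms by (intro powr_less_mono2) auto
  then have "(1 - u) * (p * z powr (p - 1)) < (1 - u) * (p * 1)"
   using 2 assms by (intro mult_strict_left_mono) auto
  then show ?thesis using z by (simp add: algebra_simps)
 next
  case 3
  obtain z where z: "1 < z" "z < u" "u powr p - 1 powr p = (u - 1) * (p * z powr (p - 1))"
   using MVT2[of 1 u "%t. t powr p" "%t. p * t powr (p - 1)"] der 3 by auto
  have "1 powr (p - 1) < z powr (p - 1)" using z 3 assms by (intro powr_less_mono2) auto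
  then have "(u - 1) * (p * 1) < (u - 1) * (p * z powr (p - 1))"
   using 3 assms by (intro mult_strict_left_mono) auto
  then show ?thesis using z by (simp add: algebra_simps)
 qed (use assms in auto)
qed

lemma powr_tangent_le:
 fixes p a m :: real
 assumes "1 <= p" "0 <= a" "0 < m"
 shows "m powr p + p * m powr (p - 1) * (a - m) <= a powr p"
proof -
 have "1 + p * (a / m - 1) <= (a / m) powr p"
  using powr_tangent_less[of p "a / m"] assms by (cases "p = 1"; cases "a / m = 1") auto
 then have "m powr p * (1 + p * (a / m - 1)) <= m powr p * (a / m) powr p"
  by (intro mult_left_mono) auto
 then show ?thesis
  using assms by (simp add: powr_divide powr_diff field_simps)
qed

lemma powr_midpoint_less:
 fixes p x y :: real
 assumes "1 < p" "0 <= x" "0 <= y" "x ~= y"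
 shows "((x + y) / 2) powr p < (x powr p + y powr p) / 2"
proof -
 define m where "m = (x + y) / 2"
 have m: "m > 0" using assms by (auto simp: m_def)
 have "1 + p * (x / m - 1) < (x / m) powr p" "1 + p * (y / m - 1) < (y / m) powr p"
  using assms m by (auto intro!: powr_tangent_less simp: divide_eq_1_iff) (auto simp: m_def)
 \<comment> \<open>The linear terms of the two tangent inequalities at the midpoint cancel.\<close>
 moreover have "p * (x / m - 1) + p * (y / m - 1) = 0"
  using m by (simp add: field_simps m_def)
 ultimately have "2 < (x / m) powr p + (y / m) powr p" by linarith
 then have "m powr p * 2 < m powr p * ((x / m) powr p + (y / m) powr p)"
  using m by (intro mult_strict_left_mono) auto
 also have "m powr p * ((x / m) powr p + (y / m) powr p) = x powr p + y powr p"
  using m assms by (simp add: powr_divide distrib_left)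
 finally show ?thesis by (simp add: m_def)
qed

text \<open>If the norms differ, strict convexity of the power on the half-line suffices. If they
  agree, the parallelogram identity makes the midpoint strictly shorter; this is where the Euclidean
  norm of the target matters.\<close>

lemma norm_midpoint_powr_less:
 fixes a b :: "'b::euclidean_space"
 assumes "1 < p" "a ~= b"
 shows "norm ((1/2) *\<^sub>R (a + b)) powr p < (norm a powr p + norm b powr p) / 2"
proof (cases "norm a = norm b")
 case False
 have "norm ((1/2) *\<^sub>R (a + b)) powr p <= ((norm a + norm b) / 2) powr p"
  using norm_triangle_ineq[of a b] assms by (intro powr_mono2) auto
 also have "... < (norm a powr p + norm b powr p) / 2"
  using False assms by (intro powr_midpoint_less) auto
 finally show ?thesis .
next
 case True
 have "(norm (a + b))\<^sup>2 + (norm (a - b))\<^sup>2 = 2 * (norm a)\<^sup>2 + 2 * (norm b)\<^sup>2"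
  by (simp add: power2_norm_eq_inner inner_add_left inner_add_right inner_diff_left inner_diff_right)
 moreover have "0 < (norm (a - b))\<^sup>2" using assms by simp
 ultimately have "(norm (a + b))\<^sup>2 < 4 * (norm a)\<^sup>2" using True by (simp only:)
 then have "(norm (a + b))\<^sup>2 < (2 * norm a)\<^sup>2" by (simp add: power_mult_distrib)
 then have "norm (a + b) < 2 * norm a" by (rule power_less_imp_less_base) auto
 then have "norm ((1/2) *\<^sub>R (a + b)) powr p < norm a powr p"
  using assms by (intro powr_less_mono2) auto
 then show ?thesis using True by simp
qed

lemma norm_midpoint_powr_le:
 fixes a b :: "'b::euclidean_space"
 assumes "1 < p"
 shows "norm ((1/2) *\<^sub>R (a + b)) powr p <= (norm a powr p + norm b powr p) / 2"
proof (cases "a = b")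
 case True
 then have "(1/2) *\<^sub>R (a + b) = a" by (simp flip: scaleR_2)
 then show ?thesis using True by simp
qed (use norm_midpoint_powr_less[of p a b] assms in auto)

text \<open>Uniform convexity by homogeneity and compactness of the unit sphere.\<close>

lemma norm_powr_uniformly_convex:
 assumes "1 < p" "0 < (e::real)"
 obtains d where "0 < d" "!!a b :: 'b::euclidean_space. e * max (norm a) (norm b) <= norm (a - b) ==>
  d * (norm a powr p + norm b powr p) <= (norm a powr p + norm b powr p) / 2 - norm ((1/2) *\<^sub>R (a + b)) powr p"
proof -
 define h :: "'b \<times> 'b => real" where
  "h z = (norm (fst z) powr p + norm (snd z) powr p) / 2 - norm ((1/2) *\<^sub>R (fst z + snd z)) powr p" for z
 \<comment> \<open>Homogeneity reduces the claim to pairs with larger norm 1; the last constraint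
   keeps them off the diagonal, where \<open>h\<close> vanishes.\<close>
 define S :: "('b \<times> 'b) set" where
  "S = (cball 0 1 \<times> cball 0 1) \<inter> {z. max (norm (fst z)) (norm (snd z)) = 1} \<inter> {z. e <= norm (fst z - snd z)}"
 have "compact S" unfolding S_def
  by (intro compact_Int_closed compact_Times compact_cball closed_Collect_eq closed_Collect_le continuous_intros)
 have cont: "continuous_on S h" unfolding h_def using assms
  by (intro continuous_intros continuous_on_powr') auto
 obtain d where d: "0 < d" "!!z. z : S ==> d <= h z"
 proof (cases "S = {}")
  case False
  then obtain z where z: "z : S" "!!y. y : S ==> h z <= h y"
   using continuous_attains_inf[OF \<open>compact S\<close> _ cont] by blast
  have "fst z ~= snd z" using z(1) assms by (auto simp: S_def)
  then have "0 < h z" unfolding h_def using norm_midpoint_powr_less[of p "fst z" "snd z"] assms by simp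
  with z that show thesis by blast
 qed (use that[of 1] in auto)
 \<comment> \<open>The halving pays for the sum of two powers, each at most the power of the larger
   norm.\<close>
 have "d / 2 * (norm a powr p + norm b powr p) <= (norm a powr p + norm b powr p) / 2 - norm ((1/2) *\<^sub>R (a + b)) powr p"
  if ab: "e * max (norm a) (norm b) <= norm (a - b)" for a b :: 'b
 proof (cases "max (norm a) (norm b) = 0")
  case True
  then have "a = 0" "b = 0" by (auto simp: max_def split: if_splits)
  then show ?thesis by simp
 next
  case False
  define m where "m = max (norm a) (norm b)"
  have m: "m > 0" using False by (auto simp: m_def max_def split: if_splits)
  have "norm a / m <= 1" "norm b / m <= 1" using m by (auto simp: m_def)
  moreover have "max (norm a / m) (norm b / m) = 1" using m unfolding m_def by (auto simp: max_def)
  moreover have "e <= norm (a - b) / m" using ab m by (simp add: field_simps m_def)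
  moreover have "norm (a /\<^sub>R m - b /\<^sub>R m) = norm (a - b) / m"
   using m by (simp add: scaleR_diff_right[symmetric] divide_inverse mult.commute)
  ultimately have "(a /\<^sub>R m, b /\<^sub>R m) : S"
   using m by (auto simp: S_def divide_inverse mult.commute)
  from d(2)[OF this] have 1: "d <= h (a /\<^sub>R m, b /\<^sub>R m)" .
  have h: "h (a /\<^sub>R m, b /\<^sub>R m) = ((norm a powr p + norm b powr p) / 2 - norm ((1/2) *\<^sub>R (a + b)) powr p) / m powr p"
  proof -
   have "(1/2) *\<^sub>R (a /\<^sub>R m + b /\<^sub>R m) = inverse m *\<^sub>R ((1/2) *\<^sub>R (a + b))"
    by (simp only: scaleR_add_right scaleR_scaleR mult.commute)
   then have "norm ((1/2) *\<^sub>R (a /\<^sub>R m + b /\<^sub>R m)) = norm ((1/2) *\<^sub>R (a + b)) / m"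
    using m by (simp only: norm_scaleR) (simp add: field_simps)
   moreover have "norm (a /\<^sub>R m) = norm a / m" "norm (b /\<^sub>R m) = norm b / m" using m by (auto simp: divide_inverse)
   ultimately show ?thesis using m
    by (simp only: h_def fst_conv snd_conv powr_divide diff_divide_distrib add_divide_distrib)
     (simp add: mult.commute)
  qed
  have "norm a powr p <= m powr p" "norm b powr p <= m powr p"
   using assms by (auto simp: m_def intro!: powr_mono2)
  then have "d / 2 * (norm a powr p + norm b powr p) <= d / 2 * (2 * m powr p)"
   using d by (intro mult_left_mono) auto
  also have "... = d * m powr p" by simp
  also have "... <= (norm a powr p + norm b powr p) / 2 - norm ((1/2) *\<^sub>R (a + b)) powr p"
   using 1 m unfolding h by (simp add: field_simps)
  finally show ?thesis .
 qed
 with d(1) that[of "d/2"] show thesis by auto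
qed

text \<open>Dyadic convex combinations of the members with index at least \<open>m\<close>.
  Midpoints are all that uniform convexity asks for, and the inductive form lets convex conditions
  pass from the members to the hull by induction.\<close>

inductive_set tail_hull :: "(nat => 'x => 'b::real_vector) => nat => ('x => 'b) set" for F m where
 base: "m <= j ==> F j : tail_hull F m"
| mid: "g : tail_hull F m ==> h : tail_hull F m ==> (%x. (1/2) *\<^sub>R (g x + h x)) : tail_hull F m"

lemma tail_hull_antimono:
 assumes "g : tail_hull F k" "m <= k"
 shows "g : tail_hull F m"
 using assms by induction (auto intro: tail_hull.intros)

lemma pint_midpoint:
 assumes "pint M p g" "pint M p h" "1 < p"
 shows "pint M p (%x. (1/2) *\<^sub>R (g x + h x))"
  "pnorm M p (%x. (1/2) *\<^sub>R (g x + h x)) <= (pnorm M p g + pnorm M p h) / 2"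
proof -
 have [measurable]: "g : borel_measurable M" "h : borel_measurable M" using assms by (auto simp: pint_def)
 have i: "integrable M (%x. (norm (g x) powr p + norm (h x) powr p) / 2)"
  using assms by (auto simp: pint_def)
 have le: "AE x in M. norm ((1/2) *\<^sub>R (g x + h x)) powr p <= (norm (g x) powr p + norm (h x) powr p) / 2"
  using norm_midpoint_powr_le[OF assms(3)] by blast
 have m: "(%x. (1/2) *\<^sub>R (g x + h x)) : borel_measurable M" by measurable
 show "pint M p (%x. (1/2) *\<^sub>R (g x + h x))" by (rule pint_bound(1)[OF m i le])
 have "(LINT x|M. (norm (g x) powr p + norm (h x) powr p) / 2) = (pnorm M p g + pnorm M p h) / 2"
  using assms by (simp add: pint_def pnorm_def)
 then show "pnorm M p (%x. (1/2) *\<^sub>R (g x + h x)) <= (pnorm M p g + pnorm M p h) / 2"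
  using pint_bound(2)[OF m i le] by simp
qed

lemma tail_hull_pint:
 assumes "g : tail_hull F m" "!!j. pint M p (F j)" "!!j. pnorm M p (F j) <= C" "1 < p"
 shows "pint M p g & pnorm M p g <= C"
 using assms(1)
proof induction
 case (mid g h)
 then show ?case using pint_midpoint[of M p g h] assms(4) by fastforce
qed (use assms in auto)

text \<open>Pairing with \<open>w\<close> to within \<open>d\<close> of \<open>L\<close> is a convex
  condition, hence inherited by the hull. This ties a strong limit of hull elements to the weak
  behaviour of \<open>F\<close>.\<close>

lemma tail_hull_pairing:
 assumes "g : tail_hull F m" "!!j. pint M p (F j)" "1 < p" "pint M (dual p) w"
  "!!j. m <= j ==> \<bar>(LINT x|M. F j x \<bullet> w x) - L\<bar> <= d"
 shows "pint M p g & \<bar>(LINT x|M. g x \<bullet> w x) - L\<bar> <= d"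
 using assms(1)
proof induction
 case (mid g h)
 have "integrable M (%x. g x \<bullet> w x)" "integrable M (%x. h x \<bullet> w x)"
  using mid assms by (auto intro: pint_inner_integrable)
 then have eq: "(LINT x|M. ((1/2) *\<^sub>R (g x + h x)) \<bullet> w x) = ((LINT x|M. g x \<bullet> w x) + (LINT x|M. h x \<bullet> w x)) / 2"
  by (simp add: inner_add_left)
 have gh: "\<bar>(LINT x|M. g x \<bullet> w x) - L\<bar> <= d" "\<bar>(LINT x|M. h x \<bullet> w x) - L\<bar> <= d" using mid by auto
 have aux: "\<bar>a - L\<bar> <= d ==> \<bar>b - L\<bar> <= d ==> \<bar>(a + b) / 2 - L\<bar> <= d" for a b :: real
  by (simp add: abs_le_iff field_simps)
 have "\<bar>(LINT x|M. ((1/2) *\<^sub>R (g x + h x)) \<bullet> w x) - L\<bar> <= d" unfolding eq by (rule aux[OF gh])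
 then show ?case using mid assms by (auto intro!: pint_midpoint)
qed (use assms in auto)

text \<open>The pointwise convexity inequality, integrated. Points where \<open>g\<close> and
  \<open>h\<close> are close relative to their size contribute at most the \<open>e powr p\<close>
  term; elsewhere the convexity defect controls the difference, with a constant \<open>D\<close>
  that depends on \<open>e\<close> but not on the functions.\<close>

lemma pnorm_uniformly_convex:
 fixes M :: "'x measure"
 assumes p: "1 < p" and e: "0 < e"
 obtains D where "0 < D" "!!g h :: 'x => 'b::euclidean_space. pint M p g ==> pint M p h ==>
  pnorm M p (%x. g x - h x) <= e powr p * (pnorm M p g + pnorm M p h)
   + D * ((pnorm M p g + pnorm M p h) / 2 - pnorm M p (%x. (1/2) *\<^sub>R (g x + h x)))"
proof -
 obtain d where d: "0 < d" "!!a b :: 'b. e * max (norm a) (norm b) <= norm (a - b) ==>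
  d * (norm a powr p + norm b powr p) <= (norm a powr p + norm b powr p) / 2 - norm ((1/2) *\<^sub>R (a + b)) powr p"
  using norm_powr_uniformly_convex[OF assms] by blast
 have pw: "norm (a - b) powr p <= e powr p * (norm a powr p + norm b powr p)
   + 2 powr p / d * ((norm a powr p + norm b powr p) / 2 - norm ((1/2) *\<^sub>R (a + b)) powr p)" for a b :: 'b
 proof (cases "e * max (norm a) (norm b) <= norm (a - b)")
  case True
  have "norm (a - b) powr p <= 2 powr p * (norm a powr p + norm b powr p)"
   using norm_add_powr_le[of p a "-b"] p by simp
  also have "... <= 2 powr p * (((norm a powr p + norm b powr p) / 2 - norm ((1/2) *\<^sub>R (a + b)) powr p) / d)"
   using d(2)[OF True] d(1) by (intro mult_left_mono) (auto simp: field_simps)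
  finally show ?thesis using e by (auto intro!: add_increasing)
 next
  case False
  then have "norm (a - b) powr p <= (e * max (norm a) (norm b)) powr p" using p by (intro powr_mono2) auto
  also have "... = e powr p * (max (norm a) (norm b)) powr p" using e by (simp add: powr_mult)
  also have "... <= e powr p * (norm a powr p + norm b powr p)" by (intro mult_left_mono) (auto simp: max_def)
  finally show ?thesis
   using norm_midpoint_powr_le[OF p, of a b] d(1) by (intro add_increasing2) auto
 qed
 have "pnorm M p (%x. g x - h x) <= e powr p * (pnorm M p g + pnorm M p h)
   + 2 powr p / d * ((pnorm M p g + pnorm M p h) / 2 - pnorm M p (%x. (1/2) *\<^sub>R (g x + h x)))"
  if gh: "pint M p g" "pint M p h" for g h :: "'x => 'b"
 proof -
  have i: "integrable M (%x. norm (g x) powr p)" "integrable M (%x. norm (h x) powr p)"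
   "integrable M (%x. norm ((1/2) *\<^sub>R (g x + h x)) powr p)" "integrable M (%x. norm (g x - h x) powr p)"
   using gh pint_midpoint(1)[OF gh p] pint_diff(1)[OF gh] p by (auto simp only: pint_def)
  have "pnorm M p (%x. g x - h x) <= (LINT x|M. e powr p * (norm (g x) powr p + norm (h x) powr p)
   + 2 powr p / d * ((norm (g x) powr p + norm (h x) powr p) / 2 - norm ((1/2) *\<^sub>R (g x + h x)) powr p))"
   unfolding pnorm_def
   by (intro integral_mono i pw L_integrable_add L_integrable_diff
     integrable_mult_right integrable_divide_zero)
  also have "... = e powr p * (pnorm M p g + pnorm M p h)
   + 2 powr p / d * ((pnorm M p g + pnorm M p h) / 2 - pnorm M p (%x. (1/2) *\<^sub>R (g x + h x)))"
   unfolding pnorm_def using i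
   by (simp only: L_integral_add L_integral_diff integral_mult_right_zero
    integral_divide_zero L_integrable_add L_integrable_diff
    integrable_mult_right integrable_divide_zero)
  finally show ?thesis .
 qed
 with d(1) that[of "2 powr p / d"] show thesis by auto
qed

text \<open>Replaces weak sequential compactness of balls of \<open>L\<^sup>p\<close>: elements of almost minimal norm in
 the midpoint hulls of the tails form a Cauchy sequence by uniform convexity.\<close>

lemma pint_weak_cluster:
 fixes F :: "nat => 'x => 'b::euclidean_space"
 assumes F: "!!j. pint M p (F j)" "!!j. pnorm M p (F j) <= C" and p: "1 < p"
 obtains G where "pint M p G"
  "!!w L. pint M (dual p) w ==> (%j. LINT x|M. F j x \<bullet> w x) ----> L ==> (LINT x|M. G x \<bullet> w x) = L"
proof -
 \<comment> \<open>The infimum \<open>d m\<close> increases with \<open>m\<close>, since the hulls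
   shrink, and stays below \<open>C\<close>. Its convergence is what makes the near-minimisers
   \<open>g\<close> Cauchy.\<close>
 define d where "d m = Inf (pnorm M p ` tail_hull F m)" for m
 have bdd: "bdd_below (pnorm M p ` tail_hull F m)" for m by (rule bdd_belowI[of _ 0]) auto
 have ne: "tail_hull F m ~= {}" for m using tail_hull.base[of m m F] by auto
 have dle: "d m <= pnorm M p g" if "g : tail_hull F m" for g m
  unfolding d_def using bdd that by (intro cInf_lower) auto
 have "EX g:tail_hull F m. pnorm M p g < d m + 1 / Suc m" for m
 proof -
  have "Inf (pnorm M p ` tail_hull F m) < d m + 1 / Suc m" by (simp add: d_def)
  then show ?thesis using cInf_less_iff[OF _ bdd, of m] ne[of m] by auto
 qed
 then obtain g where g: "!!m. g m : tail_hull F m" "!!m. pnorm M p (g m) < d m + 1 / Suc m" by metis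
 have gp: "pint M p (g m)" "pnorm M p (g m) <= C" for m
  using tail_hull_pint[OF g(1) F p] by auto
 have dmono: "d m <= d k" if "m <= k" for m k
  unfolding d_def using bdd ne tail_hull_antimono[OF _ that] by (intro cInf_superset_mono image_mono subsetI) auto
 have dC: "d m <= C" for m using dle[OF g(1)] gp(2)[of m] by (rule order_trans)
 have "incseq d" using dmono by (auto simp: incseq_def)
 then obtain l where "d ----> l" using incseq_convergent[of d C] dC by blast
 then have dcau: "Cauchy d" by (rule LIMSEQ_imp_Cauchy)
 have cauchy1: "EX N. ALL k>=N. ALL m>=N. m <= k --> pnorm M p (%x. g m x - g k x) < e" if e: "0 < e" for e
 proof -
  have C0: "0 <= C" using gp(2)[of 0] pnorm_nonneg[of M p "g 0"] by linarith
  \<comment> \<open>Makes the first term of the convexity inequality at most \<open>e / 2\<close>,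
    both norms being at most \<open>C\<close>.\<close>
  define a where "a = (e / (4 * C + 4)) powr (1 / p)"
  have a: "0 < a" "a powr p = e / (4 * C + 4)" using e C0 p by (auto simp: a_def powr_powr)
  obtain D where D: "0 < D" "!!g h :: 'x => 'b::euclidean_space. pint M p g ==> pint M p h ==>
   pnorm M p (%x. g x - h x) <= a powr p * (pnorm M p g + pnorm M p h)
   + D * ((pnorm M p g + pnorm M p h) / 2 - pnorm M p (%x. (1/2) *\<^sub>R (g x + h x)))"
   using pnorm_uniformly_convex[OF p a(1)] by blast
  obtain N1 where N1: "!!m k. N1 <= m ==> N1 <= k ==> norm (d m - d k) < e / (4 * D)"
   using CauchyD[OF dcau, of "e / (4 * D)"] e D by (metis divide_pos_pos mult_pos_pos zero_less_numeral)
  obtain N2 :: nat where N2: "4 * D / e < real N2" using reals_Archimedean2 by blast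
  have "pnorm M p (%x. g m x - g k x) < e" if mk: "max N1 N2 <= m" "m <= k" for m k
  proof -
   \<comment> \<open>Both functions lie in the hull of the tail \<open>m\<close>, hence so does
     their midpoint, whose norm is therefore at least \<open>d m\<close>.\<close>
   have gk: "g k : tail_hull F m" using tail_hull_antimono[OF g(1) mk(2)] .
   have mid: "d m <= pnorm M p (%x. (1/2) *\<^sub>R (g m x + g k x))"
    by (rule dle) (rule tail_hull.mid[OF g(1) gk])
   have s: "1 / real (Suc k) <= 1 / real (Suc m)" using mk by (simp add: field_simps)
   have s2: "1 / real (Suc m) < e / (4 * D)"
   proof -
    have "4 * D / e < real (Suc m)" using N2 mk by simp
    then show ?thesis using e D by (simp add: field_simps)
   qed
   have N1': "\<bar>d k - d m\<bar> < e / (4 * D)"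
    using N1[of k m] mk by simp
   have "(A + B) / 2 - R <= h / 2 + h"
    if "A < d m + i" "B < d k + j" "d m <= R" "j <= i" "i < h" "\<bar>d k - d m\<bar> < h" for A B R h i j :: real
    using that by (simp add: abs_less_iff field_simps)
   from this[OF g(2)[of m] g(2)[of k] mid s s2 N1']
   have "(pnorm M p (g m) + pnorm M p (g k)) / 2 - pnorm M p (%x. (1/2) *\<^sub>R (g m x + g k x)) <= e / (4 * D) / 2 + e / (4 * D)" .
   also have "... = 3 * e / (8 * D)" using D by (simp add: field_simps)
   finally have 1: "D * ((pnorm M p (g m) + pnorm M p (g k)) / 2 - pnorm M p (%x. (1/2) *\<^sub>R (g m x + g k x))) <= D * (3 * e / (8 * D))"
    using D by (intro mult_left_mono) auto
   have "a powr p * (pnorm M p (g m) + pnorm M p (g k)) <= e / (4 * C + 4) * (C + C)"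
    unfolding a(2) using gp(2)[of m] gp(2)[of k] e C0 by (intro mult_left_mono) auto
   also have "... <= e / 2" using C0 e by (simp add: field_simps)
   finally have "pnorm M p (%x. g m x - g k x) <= e / 2 + D * (3 * e / (8 * D))"
    using D(2)[OF gp(1)[of m] gp(1)[of k]] 1 by linarith
   then show ?thesis using D e by (simp add: field_simps)
  qed
  then show ?thesis by (intro exI[of _ "max N1 N2"]) auto
 qed
 have "EX N. ALL i>=N. ALL j>=N. pnorm M p (%x. g i x - g j x) < e" if e: "0 < e" for e
 proof -
  obtain N where N: "ALL k>=N. ALL m>=N. m <= k --> pnorm M p (%x. g m x - g k x) < e" using cauchy1[OF e] by auto
  have "pnorm M p (%x. g i x - g j x) < e" if "N <= i" "N <= j" for i j
   by (metis N that pnorm_minus_commute nat_le_linear)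
  then show ?thesis by blast
 qed
 then have ca: "!!e. 0 < e ==> EX N. ALL i>=N. ALL j>=N. pnorm M p (%x. g i x - g j x) < e" .
 have p0: "0 < p" using p by simp
 obtain G where G: "pint M p G" "(%j. pnorm M p (%x. g j x - G x)) ----> 0"
  using pint_complete[of M p g, OF gp(1) ca p0] by blast
 have "(LINT x|M. G x \<bullet> w x) = L"
  if w: "pint M (dual p) w" and L: "(%j. LINT x|M. F j x \<bullet> w x) ----> L" for w L
 proof -
  have "\<bar>(LINT x|M. G x \<bullet> w x) - L\<bar> <= 3 * e" if e: "0 < e" for e
  proof -
   obtain N1 where N1: "!!j. N1 <= j ==> \<bar>(LINT x|M. F j x \<bullet> w x) - L\<bar> < e"
    using LIMSEQ_D[OF L e] by auto
   define W where "W = pnorm M (dual p) w"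
   define t where "t = e / (1 + W)"
   have t: "0 < t" "t * W <= e" using e by (auto simp: t_def W_def field_simps add_pos_nonneg)
   \<comment> \<open>Conjugation of exponents is an involution, so the pairing inequality may be
     used with \<open>w\<close> in the first place: the small weight \<open>t\<close> falls on the
     fixed \<open>w\<close>, the large one on the difference of \<open>g j\<close> and
     \<open>G\<close>, which tends to 0.\<close>
   have q: "1 < p / (p - 1)" "p / (p - 1) / (p / (p - 1) - 1) = p" using p by (auto simp: field_simps)
   obtain C' where C': "0 <= C'" "!!(f :: 'x => 'b) w. pint M (dual p) f ==> pint M p w ==>
    \<bar>LINT x|M. f x \<bullet> w x\<bar> <= t * pnorm M (dual p) f + C' * pnorm M p w"
    using pnorm_pairing_le[OF q(1) t(1), of M] unfolding q(2) by blast
   have "0 < e / (1 + C')" using e C' by auto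
   from LIMSEQ_D[OF G(2) this] obtain N2 where N2: "!!j. N2 <= j ==> pnorm M p (%x. g j x - G x) < e / (1 + C')"
    by fastforce
   define j where "j = max N1 N2"
   have gG: "pint M p (%x. g j x - G x)" using gp G p by (intro pint_diff) auto
   have 1: "\<bar>(LINT x|M. g j x \<bullet> w x) - L\<bar> <= e"
    using tail_hull_pairing[OF g(1)[of j] F(1) p w, of L e] N1 by (auto simp: j_def intro: less_imp_le)
   have "\<bar>LINT x|M. w x \<bullet> (g j x - G x)\<bar> <= t * W + C' * pnorm M p (%x. g j x - G x)"
    unfolding W_def by (rule C'(2)[OF w gG])
   also have "... <= e + C' * (e / (1 + C'))"
    using t N2[of j] C'(1) by (intro add_mono mult_left_mono) (auto simp: j_def)
   also have "... <= e + e" using C'(1) e by (simp add: field_simps)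
   finally have 2: "\<bar>LINT x|M. w x \<bullet> (g j x - G x)\<bar> <= e + e" .
   have "(LINT x|M. w x \<bullet> (g j x - G x)) = (LINT x|M. g j x \<bullet> w x) - (LINT x|M. G x \<bullet> w x)"
    using pint_inner_integrable[OF p gp(1) w] pint_inner_integrable[OF p G(1) w]
    by (simp add: inner_diff_right inner_commute[of "w _"])
   then show ?thesis using 1 2 by linarith
  qed
  then have "\<bar>(LINT x|M. G x \<bullet> w x) - L\<bar> <= 3 * (e / 3)" if "0 < e" for e
   using that by (metis zero_less_divide_iff zero_less_numeral)
  then have "\<bar>(LINT x|M. G x \<bullet> w x) - L\<bar> <= 0 + e" if "0 < e" for e
   using that by simp
  then have "\<bar>(LINT x|M. G x \<bullet> w x) - L\<bar> <= 0" by (rule field_le_epsilon)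
  then show ?thesis by simp
 qed
 with G(1) that show thesis by blast
qed

section \<open>Jensen's inequality and Minkowski's integral inequality\<close>

lemma weighted_Jensen:
 fixes k f :: "'x => real"
 assumes k: "integrable M k" "!!x. 0 <= k x" and f: "!!x. 0 <= f x" "f : borel_measurable M"
  and i: "integrable M (%x. k x * f x powr p)" and p: "1 <= p"
 shows "integrable M (%x. k x * f x)"
  "(LINT x|M. k x * f x) powr p <= (LINT x|M. k x) powr (p - 1) * (LINT x|M. k x * f x powr p)"
proof -
 have [measurable]: "k : borel_measurable M" using k by auto
 have [measurable]: "f : borel_measurable M" by fact
 have le: "f x <= 1 + f x powr p" for x
 proof (cases "f x <= 1")
  case False
  then have "f x powr 1 <= f x powr p" using p by (intro powr_mono) auto
  then show ?thesis using False by simp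
 qed (auto intro: order_trans)
 show I: "integrable M (%x. k x * f x)"
 proof (rule L_integrable_bound)
  show "integrable M (%x. k x * (1 + f x powr p))" using k i by (simp add: distrib_left)
  show "AE x in M. norm (k x * f x) <= norm (k x * (1 + f x powr p))"
  proof (intro AE_I2)
   fix x show "norm (k x * f x) <= norm (k x * (1 + f x powr p))"
    using mult_left_mono[OF le k(2), of x x] k(2)[of x] f(1)[of x] by (simp add: abs_mult)
  qed
 qed auto
 define K where "K = (LINT x|M. k x)"
 define J where "J = (LINT x|M. k x * f x)"
 have K0: "0 <= K" unfolding K_def using k by (intro L_integral_nonneg) auto
 have J0: "0 <= J" unfolding J_def using k f by (intro L_integral_nonneg) auto
 have R0: "0 <= (LINT x|M. k x * f x powr p)" using k f by (intro L_integral_nonneg) auto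
 have "J powr p <= K powr (p - 1) * (LINT x|M. k x * f x powr p)"
 proof (cases "J = 0 | K = 0")
  case True
  then have "J = 0"
  proof
   assume "K = 0"
   then have "AE x in M. k x = 0" using integral_nonneg_eq_0_iff_AE[of M k] k by (auto simp: K_def)
   then have "J = (LINT x|M. 0)" unfolding J_def by (intro integral_cong_AE) auto
   then show ?thesis by simp
  qed
  then show ?thesis using R0 by simp
 next
  case False
  then have pos: "0 < J" "0 < K" using J0 K0 by auto
  \<comment> \<open>The mean of \<open>f\<close> under the weight \<open>k\<close>. The tangent of
    the power at \<open>m\<close> is integrated against \<open>k\<close>, and its linear term drops
    out; \<open>k\<close> is left unnormalised, whence the factor \<open>K powr (p - 1)\<close> in
    the result.\<close>
  define m where "m = J / K"
  have m: "0 < m" using pos by (simp add: m_def)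
  have "K * m powr p = (LINT x|M. k x * (m powr p + p * m powr (p - 1) * (f x - m)))"
  proof -
   have "(LINT x|M. k x * (m powr p + p * m powr (p - 1) * (f x - m)))
     = (LINT x|M. m powr p * k x + (p * m powr (p - 1)) * (k x * f x) - (p * m powr (p - 1) * m) * k x)"
    by (simp add: algebra_simps)
   also have "... = m powr p * K + (p * m powr (p - 1)) * J - (p * m powr (p - 1) * m) * K"
    unfolding K_def J_def using k I by simp
   also have "... = K * m powr p" using pos by (simp add: m_def)
   finally show ?thesis by simp
  qed
  also have "... <= (LINT x|M. k x * f x powr p)"
  proof (intro integral_mono i)
   show "integrable M (%x. k x * (m powr p + p * m powr (p - 1) * (f x - m)))"
   proof -
    have "integrable M (%x. m powr p * k x + (p * m powr (p - 1)) * (k x * f x) - (p * m powr (p - 1) * m) * k x)"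
     using k I by (intro L_integrable_add L_integrable_diff integrable_mult_right)
    then show ?thesis by (simp add: algebra_simps)
   qed
   show "k x * (m powr p + p * m powr (p - 1) * (f x - m)) <= k x * f x powr p" for x
    using powr_tangent_le[OF p f(1) m] k by (intro mult_left_mono) auto
  qed
  finally have "K powr (p - 1) * (K * m powr p) <= K powr (p - 1) * (LINT x|M. k x * f x powr p)"
   by (intro mult_left_mono) auto
  moreover have "K powr (p - 1) * (K * m powr p) = J powr p"
   using pos by (simp add: m_def powr_divide powr_diff)
  ultimately show ?thesis by simp
 qed
 then show "(LINT x|M. k x * f x) powr p <= (LINT x|M. k x) powr (p - 1) * (LINT x|M. k x * f x powr p)"
  by (simp add: J_def K_def)
qed

text \<open>Jensen's inequality with weight \<open>k t * m t\<close>, applied to the quotient of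
  \<open>f t x\<close> by \<open>m t\<close>, and then Tonelli; no duality of Lebesgue spaces
  enters. The function \<open>m\<close> records the size of the slices, so that they may be singular
  in \<open>t\<close> as long as \<open>k t * m t\<close> is integrable.\<close>

lemma Minkowski_kernel:
 fixes k m :: "'t => real" and f :: "'t => 'x => real"
 assumes sf: "sigma_finite_measure M" "sigma_finite_measure N"
  and meas [measurable]: "k : borel_measurable N" "m : borel_measurable N"
   "(%(t, x). f t x) : borel_measurable (N \<Otimes>\<^sub>M M)"
  and nn: "!!t. 0 <= k t" "!!t x. 0 <= f t x" "!!t. k t ~= 0 ==> 0 < m t"
  and B: "!!t. k t ~= 0 ==> (\<integral>\<^sup>+x. ennreal (f t x powr q) \<partial>M) <= ennreal (B * m t powr q)" "0 <= B"
  and i: "integrable N (%t. k t * m t)" and q: "1 <= q"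
 shows "AE x in M. integrable N (%t. k t * f t x)"
  "(\<integral>\<^sup>+x. ennreal ((LINT t|N. k t * f t x) powr q) \<partial>M) <= ennreal ((LINT t|N. k t * m t) powr q * B)"
proof -
 interpret M: sigma_finite_measure M by fact
 interpret N: sigma_finite_measure N by fact
 interpret MN: pair_sigma_finite M N ..
 interpret NM: pair_sigma_finite N M ..
 have meas2 [measurable]: "(%(x, t). f t x) : borel_measurable (M \<Otimes>\<^sub>M N)"
  using measurable_compose[OF measurable_pair_swap' meas(3)] by (simp add: case_prod_unfold)
 define K where "K = (LINT t|N. k t * m t)"
 have km: "0 <= k t * m t" for t using nn(1)[of t] nn(3)[of t] by (cases "k t = 0") auto
 have K0: "0 <= K" unfolding K_def using km by (intro L_integral_nonneg) auto
 define h where "h t x = k t * m t * (f t x / m t) powr q" for t x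
 have h0: "0 <= h t x" for t x unfolding h_def using km by auto
 have [measurable]: "(%(x, t). h t x) : borel_measurable (M \<Otimes>\<^sub>M N)" unfolding h_def by measurable
 have "(\<integral>\<^sup>+x. \<integral>\<^sup>+t. ennreal (h t x) \<partial>N \<partial>M) = (\<integral>\<^sup>+t. \<integral>\<^sup>+x. ennreal (h t x) \<partial>M \<partial>N)"
  by (intro NM.Fubini') measurable
 also have "... <= (\<integral>\<^sup>+t. ennreal (k t * m t) * ennreal B \<partial>N)"
 proof (intro nn_integral_mono)
  fix t assume t: "t : space N"
  have ft [measurable]: "f t : borel_measurable M"
   using measurable_Pair2[OF meas(3) t] by simp
  show "(\<integral>\<^sup>+x. ennreal (h t x) \<partial>M) <= ennreal (k t * m t) * ennreal B"
  proof (cases "k t = 0")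
   case False
   have mt: "0 < m t" using nn(3)[OF False] .
   have "(\<integral>\<^sup>+x. ennreal (h t x) \<partial>M) = (\<integral>\<^sup>+x. ennreal (k t * m t * m t powr - q) * ennreal (f t x powr q) \<partial>M)"
   proof (intro nn_integral_cong)
    fix x
    have "h t x = k t * m t * m t powr - q * f t x powr q"
     unfolding h_def by (simp add: powr_divide powr_minus_divide)
    then show "ennreal (h t x) = ennreal (k t * m t * m t powr - q) * ennreal (f t x powr q)"
     using km[of t] by (simp add: ennreal_mult')
   qed
   also have "... = ennreal (k t * m t * m t powr - q) * (\<integral>\<^sup>+x. ennreal (f t x powr q) \<partial>M)"
    by (intro nn_integral_cmult) measurable
   also have "... <= ennreal (k t * m t * m t powr - q) * ennreal (B * m t powr q)"
    by (intro mult_left_mono B False) auto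
   also have "... = ennreal (k t * m t) * ennreal B"
    using km[of t] mt B(2) by (simp add: ennreal_mult'[symmetric] powr_minus field_simps)
   finally show ?thesis .
  qed (simp add: h_def)
 qed
 also have "... = (\<integral>\<^sup>+t. ennreal (k t * m t) \<partial>N) * ennreal B"
  by (intro nn_integral_multc) measurable
 also have "(\<integral>\<^sup>+t. ennreal (k t * m t) \<partial>N) = ennreal K"
  unfolding K_def using i km by (intro nn_integral_eq_integral) auto
 finally have le: "(\<integral>\<^sup>+x. \<integral>\<^sup>+t. ennreal (h t x) \<partial>N \<partial>M) <= ennreal K * ennreal B" .
 also have "... < \<infinity>" by (simp add: ennreal_mult_less_top)
 finally have "(\<integral>\<^sup>+x. \<integral>\<^sup>+t. ennreal (h t x) \<partial>N \<partial>M) ~= \<infinity>" by simp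
 then have "AE x in M. (\<integral>\<^sup>+t. ennreal (h t x) \<partial>N) ~= \<infinity>"
  by (intro nn_integral_noteq_infinite) measurable
 then have ae: "AE x in M. integrable N (%t. k t * f t x) &
  ennreal ((LINT t|N. k t * f t x) powr q) <= ennreal (K powr (q - 1)) * (\<integral>\<^sup>+t. ennreal (h t x) \<partial>N)"
  using AE_space
 proof eventually_elim
  case (elim x)
  have [measurable]: "(%t. f t x) : borel_measurable N"
   using measurable_Pair1[OF meas(3)] elim(2) by simp
  have hi: "integrable N (%t. k t * m t * (f t x / m t) powr q)"
   using elim(1) h0 unfolding h_def by (intro integrableI_nonneg) (auto simp: less_top)
  \<comment> \<open>Positivity of \<open>m\<close> is available only where \<open>k\<close> does not
    vanish, so the quotient is set to 0 elsewhere.\<close>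
  have fm: "0 <= (if k t = 0 then 0 else f t x / m t)" for t using nn(2)[of t x] nn(3)[of t] by auto
  have eq: "k t * m t * (if k t = 0 then 0 else f t x / m t) = k t * f t x" for t
   using nn(3)[of t] by auto
  have eq2: "k t * m t * (if k t = 0 then 0 else f t x / m t) powr q = h t x" for t
   by (auto simp: h_def)
  have "integrable N (%t. k t * m t * (if k t = 0 then 0 else f t x / m t))"
   "(LINT t|N. k t * m t * (if k t = 0 then 0 else f t x / m t)) powr q <= (LINT t|N. k t * m t) powr (q - 1) * (LINT t|N. k t * m t * (if k t = 0 then 0 else f t x / m t) powr q)"
   using hi by (intro weighted_Jensen[OF i km fm _ _ q]; simp add: eq2 h_def)+
  then have *: "integrable N (%t. k t * f t x)"
   "(LINT t|N. k t * f t x) powr q <= K powr (q - 1) * (LINT t|N. h t x)"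
   by (simp_all only: eq eq2 K_def)
  have "ennreal (LINT t|N. h t x) = (\<integral>\<^sup>+t. ennreal (h t x) \<partial>N)"
   using hi h0 by (intro nn_integral_eq_integral[symmetric]) (auto simp: h_def)
  then have "ennreal (K powr (q - 1) * (LINT t|N. h t x)) = ennreal (K powr (q - 1)) * (\<integral>\<^sup>+t. ennreal (h t x) \<partial>N)"
   by (simp add: ennreal_mult')
  with * show ?case by (metis ennreal_leI)
 qed
 from ae show "AE x in M. integrable N (%t. k t * f t x)" by eventually_elim auto
 have "(\<integral>\<^sup>+x. ennreal ((LINT t|N. k t * f t x) powr q) \<partial>M) <= (\<integral>\<^sup>+x. ennreal (K powr (q - 1)) * (\<integral>\<^sup>+t. ennreal (h t x) \<partial>N) \<partial>M)"
  using ae by (intro nn_integral_mono_AE) auto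
 also have "... = ennreal (K powr (q - 1)) * (\<integral>\<^sup>+x. \<integral>\<^sup>+t. ennreal (h t x) \<partial>N \<partial>M)"
  by (intro nn_integral_cmult) measurable
 also have "... <= ennreal (K powr (q - 1)) * (ennreal K * ennreal B)"
  by (intro mult_left_mono le) auto
 also have "... = ennreal (K powr q * B)"
  using K0 B(2) by (cases "K = 0") (auto simp: ennreal_mult'[symmetric] powr_diff field_simps)
 finally show "(\<integral>\<^sup>+x. ennreal ((LINT t|N. k t * f t x) powr q) \<partial>M) <= ennreal ((LINT t|N. k t * m t) powr q * B)"
  by (simp add: K_def)
qed

section \<open>Smooth functions with compact support\<close>

abbreviation pd :: "'a => ('a::euclidean_space => real) => 'a => real" where
 "pd b f \<equiv> (%x. frechet_derivative f (at x) b)"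

definition smooth :: "('a::euclidean_space => real) => bool" where
 "smooth f \<longleftrightarrow> (ALL k. Ck k f)"

lemma Ck_Suc_D: "Ck (Suc k) f ==> Ck k f"
proof (induction k arbitrary: f)
 case 0
 then show ?case by (simp add: differentiable_imp_continuous_on)
next
 case (Suc k)
 have "Ck k (pd b f)" if "b : Basis" for b
  using Suc.prems that by (intro Suc.IH) simp
 moreover have "f differentiable_on UNIV" using Suc.prems by simp
 ultimately show ?case by simp
qed

lemma smooth_differentiable: "smooth f ==> f differentiable (at x)"
 using Ck.simps(2)[of 0 f] by (auto simp: smooth_def differentiable_on_def simp del: Ck.simps)

lemma smooth_pd: "smooth f ==> b : Basis ==> smooth (pd b f)"
 unfolding smooth_def using Ck.simps(2) by blast

lemma smooth_has_derivative: "smooth f ==> (f has_derivative frechet_derivative f (at x)) (at x)"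
 using smooth_differentiable frechet_derivative_works by blast

lemma smooth_continuous: "smooth f ==> continuous_on S f"
 using Ck.simps(1)[of f] continuous_on_subset[of UNIV f S] by (auto simp: smooth_def simp del: Ck.simps)

lemma smooth_measurable [measurable_dest]: "smooth f ==> f : Bb"
 using smooth_continuous[of f UNIV] by (rule borel_measurable_continuous_onI)

text \<open>Induction on the order, generalised over a class closed under partial derivatives.
  Smoothness of an explicit family thus reduces to one derivative formula that stays in the
  family.\<close>

lemma smooth_coinduct:
 assumes "f : S" "!!f x. f : S ==> f differentiable (at x)"
  "!!f b. f : S ==> b : Basis ==> pd b f : S"
 shows "smooth f"
proof -
 have "Ck k f" if "f : S" for k f
  using that
 proof (induction k arbitrary: f)
  case 0
  then show ?case using assms(2)
   by (simp add: differentiable_on_def differentiable_imp_continuous_on)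
 next
  case (Suc k)
  then show ?case using assms(2,3) by (simp add: differentiable_on_def)
 qed
 with assms(1) show ?thesis by (simp add: smooth_def)
qed

lemma smooth_stepI:
 assumes "!!x. f differentiable (at x)" "!!b. b : Basis ==> smooth (pd b f)"
 shows "smooth f"
 unfolding smooth_def
proof
 fix k show "Ck k f"
 proof (cases k)
  case 0
  then show ?thesis using assms(1) by (simp add: differentiable_on_def differentiable_imp_continuous_on)
 next
  case (Suc m)
  then show ?thesis using assms by (simp add: differentiable_on_def smooth_def)
 qed
qed

lemma pd_unique: "(f has_derivative f') (at x) ==> pd b f x = f' b"
 using frechet_derivative_at[of f f' x] by simp

lemma smooth_const: "smooth (%x. c)"
proof (rule smooth_coinduct[of _ "{%x. c, %x. 0}"])
qed auto

lemma
 assumes "f differentiable (at x)" "g differentiable (at x)"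
 shows pd_add: "pd b (%x. f x + g x) x = pd b f x + pd b g x"
  and pd_mult: "pd b (%x. f x * g x) x = f x * pd b g x + pd b f x * g x"
 using has_derivative_add[OF assms[unfolded frechet_derivative_works]]
  has_derivative_mult[OF assms[unfolded frechet_derivative_works]]
 by (auto dest!: pd_unique)

lemma Ck_add: "Ck k f ==> Ck k g ==> Ck k (%x. f x + g x)"
proof (induction k arbitrary: f g)
 case 0
 then show ?case by (simp add: continuous_on_add)
next
 case (Suc k)
 then have d: "f differentiable (at x)" "g differentiable (at x)" for x
  by (auto simp: differentiable_on_def)
 then have "Ck k (pd b (%x. f x + g x))" if "b : Basis" for b
  using Suc that by (simp add: pd_add)
 then show ?case using d by (simp add: differentiable_on_def)
qed

lemma Ck_mult: "Ck k f ==> Ck k g ==> Ck k (%x. f x * g x)"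
proof (induction k arbitrary: f g)
 case 0
 then show ?case by (simp add: continuous_on_mult)
next
 case (Suc k)
 have d: "f differentiable (at x)" "g differentiable (at x)" for x
  using Suc.prems by (auto simp: differentiable_on_def)
 have "Ck k (pd b (%x. f x * g x))" if b: "b : Basis" for b
 proof -
  have "Ck k f" "Ck k g" "Ck k (pd b f)" "Ck k (pd b g)"
   using Suc.prems b Ck_Suc_D[of k f] Ck_Suc_D[of k g] by auto
  then have "Ck k (%x. f x * pd b g x + pd b f x * g x)"
   by (intro Ck_add Suc.IH)
  then show ?thesis using d by (simp add: pd_mult)
 qed
 then show ?case using d by (simp add: differentiable_on_def)
qed

lemma smooth_add: "smooth f ==> smooth g ==> smooth (%x. f x + g x)"
 by (simp add: smooth_def Ck_add)

lemma smooth_mult: "smooth f ==> smooth g ==> smooth (%x. f x * g x)"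
 by (simp add: smooth_def Ck_mult)

lemma smooth_cmult: "smooth f ==> smooth (%x. c * f x)"
 by (intro smooth_mult smooth_const)

lemma smooth_diff: "smooth f ==> smooth g ==> smooth (%x. f x - g x)"
 using smooth_add[of f "%x. (-1) * g x"] smooth_cmult[of g "-1"] by simp

lemma smooth_inner: "smooth (%x. x \<bullet> b)"
proof (rule smooth_stepI)
 have d: "((%x. x \<bullet> b) has_derivative (%h. h \<bullet> b)) (at x)" for x :: 'a
  by (auto intro!: derivative_eq_intros)
 then show "(%x. x \<bullet> b) differentiable (at x)" for x :: 'a by (auto simp: differentiable_def)
 show "smooth (pd c (%x. x \<bullet> b))" for c :: 'a
  using pd_unique[OF d] by (simp add: smooth_const)
qed

lemma smooth_sum: "(!!i. i : I ==> smooth (f i)) ==> smooth (%x. SUM i:I. f i x)"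
 by (induction I rule: infinite_finite_induct) (auto intro: smooth_const smooth_add)

lemma smooth_norm_sq: "smooth (%x::'a::euclidean_space. x \<bullet> x)"
proof -
 have "(%x::'a. x \<bullet> x) = (%x. SUM b:Basis. (x \<bullet> b) * (x \<bullet> b))"
  by (simp add: euclidean_inner[symmetric])
 then show ?thesis by (auto intro!: smooth_sum smooth_mult smooth_inner)
qed

text \<open>The chain rule produces the product \<open>pd b f x * h' (f x)\<close>, which leaves the
  class of compositions; the induction therefore goes through \<open>Ck_mult\<close> instead of
  \<open>smooth_coinduct\<close>. The set \<open>H\<close> is any class of outer functions closed
  under differentiation.\<close>

lemma smooth_compose:
 assumes "h : H" "!!h. h : H ==> EX h':H. ALL t. (h has_real_derivative h' t) (at t)" "smooth f"
 shows "smooth (%x. h (f x))"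
 unfolding smooth_def
proof
 fix k
 have "Ck k (%x. h (f x))" if "h : H" for h
  using that
 proof (induction k arbitrary: h)
  case (0 h)
  then obtain h' where h': "ALL t. (h has_real_derivative h' t) (at t)" using assms(2) by blast
  then have "continuous_on UNIV h" by (meson DERIV_continuous_on has_field_derivative_at_within)
  then show ?case
   using smooth_continuous[OF assms(3), of UNIV] by (auto intro: continuous_on_compose2)
 next
  case (Suc k h)
  then obtain h' where h': "h' : H" "!!t. (h has_real_derivative h' t) (at t)" using assms(2) by blast
  have d: "((%x. h (f x)) has_derivative (%v. frechet_derivative f (at x) v * h' (f x))) (at x)" for x
   using has_derivative_compose[OF smooth_has_derivative[OF assms(3), of x] h'(2)[of "f x", unfolded has_field_derivative_def]]
   by (simp add: mult.commute)
  have "Ck k (pd b (%x. h (f x)))" if b: "b : Basis" for b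
  proof -
   have "pd b (%x. h (f x)) = (%x. pd b f x * h' (f x))" using pd_unique[OF d] by auto
   moreover have "Ck k (%x. pd b f x * h' (f x))"
    using smooth_pd[OF assms(3) b] Suc.IH[OF h'(1)] by (intro Ck_mult) (auto simp: smooth_def)
   ultimately show ?thesis by simp
  qed
  moreover have "(%x. h (f x)) differentiable (at x)" for x using d by (auto simp: differentiable_def)
  ultimately show ?case by (simp add: differentiable_on_def)
 qed
 with assms(1) show "Ck k (%x. h (f x))" by blast
qed

text \<open>The classical function \<open>exp (- (1 / t))\<close> continued by 0, with a polynomial
  in \<open>1 / t\<close> as factor: the extra parameter closes the family under
  differentiation.\<close>

definition exp_flat :: "real poly => real => real" where
 "exp_flat P t = (if 0 < t then poly P (1 / t) * exp (- (1 / t)) else 0)"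

lemma poly_exp_tendsto_0: "((%t. poly P t * exp (- t)) \<longlongrightarrow> (0::real)) at_top"
proof (induction P)
 case (pCons a P)
 have 1: "((%t::real. t ^ i * exp (- t)) \<longlongrightarrow> 0) at_top" for i
  using tendsto_power_div_exp_0[of i] by (simp add: exp_minus divide_inverse)
 have "((%t::real. poly P t * exp (- t)) \<longlongrightarrow> 0) at_top" for P
 proof -
  have "((%t::real. \<Sum>i\<le>degree P. coeff P i * (t ^ i * exp (- t))) \<longlongrightarrow> (\<Sum>i\<le>degree P. coeff P i * 0)) at_top"
   by (intro tendsto_sum tendsto_mult tendsto_const 1)
  then show ?thesis by (simp add: poly_altdef sum_distrib_right mult.assoc)
 qed
 then show ?case .
qed simp

text \<open>In the variable \<open>y = 1 / t\<close> the derivative of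
  \<open>poly P y * exp (- y)\<close> with respect to \<open>t\<close> is
  \<open>y ^ 2 * (poly P y - poly (pderiv P) y) * exp (- y)\<close>; the coefficient list multiplies
  by \<open>y ^ 2\<close>. At 0 the right difference quotient is
  \<open>y * poly P y * exp (- y)\<close>, which tends to 0.\<close>

lemma exp_flat_deriv:
 "(exp_flat P has_real_derivative exp_flat ([:0, 0, 1:] * (P - pderiv P)) t) (at t)"
proof -
 consider "0 < t" | "t < 0" | "t = 0" by linarith
 then show ?thesis
 proof cases
  case 1
  have "((%t. poly P (1 / t) * exp (- (1 / t))) has_real_derivative exp_flat ([:0, 0, 1:] * (P - pderiv P)) t) (at t)"
   using 1 by (auto intro!: derivative_eq_intros DERIV_chain'[OF _ poly_DERIV]
     simp: exp_flat_def field_simps power2_eq_square)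
  then show ?thesis
   by (rule has_field_derivative_transform_within_open[where S = "{0<..}"]) (use 1 in "auto simp: exp_flat_def")
 next
  case 2
  have "((%t. 0) has_real_derivative exp_flat ([:0, 0, 1:] * (P - pderiv P)) t) (at t)"
   using 2 by (auto simp: exp_flat_def)
  then show ?thesis
   by (rule has_field_derivative_transform_within_open[where S = "{..<0}"]) (use 2 in "auto simp: exp_flat_def")
 next
  case 3
  have r: "((%h. exp_flat P h / h) \<longlongrightarrow> 0) (at_right 0)"
  proof -
   have "((%h. poly ([:0, 1:] * P) (inverse h) * exp (- inverse h)) \<longlongrightarrow> 0) (at_right 0)"
    by (rule filterlim_compose[OF poly_exp_tendsto_0 filterlim_inverse_at_top_right])
   moreover have "eventually (%h. poly ([:0, 1:] * P) (inverse h) * exp (- inverse h) = exp_flat P h / h) (at_right (0::real))"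
    by (auto simp: eventually_at_right_field exp_flat_def divide_inverse intro!: exI[of _ 1])
   ultimately show ?thesis by (rule Lim_transform_eventually)
  qed
  have l: "((%h. exp_flat P h / h) \<longlongrightarrow> 0) (at_left 0)"
   by (rule Lim_transform_eventually[of "%_. 0"])
    (auto simp: eventually_at_left_field exp_flat_def intro!: exI[of _ "-1"])
  have "((%h. exp_flat P h / h) \<longlongrightarrow> 0) (at 0)"
   using l r by (simp add: filterlim_split_at_real)
  then show ?thesis using 3 by (simp add: DERIV_def exp_flat_def)
 qed
qed

lemma smooth_exp_flat: "smooth f ==> smooth (%x. exp_flat P (f x))"
 using smooth_compose[of "exp_flat P" "range exp_flat" f] exp_flat_deriv by blast

section \<open>Test functions and mollifiers\<close>

lemma Cc_inf_iff:
 "f : Cc_inf \<Omega> \<longleftrightarrow> smooth f & (EX K. compact K & K \<subseteq> \<Omega> & (ALL x. x \<notin> K --> f x = 0))"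
proof safe
 assume "f : Cc_inf \<Omega>"
 then have "smooth f" "compact (closure {x. f x ~= 0})" "closure {x. f x ~= 0} \<subseteq> \<Omega>"
  by (auto simp: Cc_inf_def smooth_def)
 moreover have "f x = 0" if "x \<notin> closure {x. f x ~= 0}" for x
  using that closure_subset[of "{x. f x ~= 0}"] by auto
 ultimately show "smooth f" "EX K. compact K & K \<subseteq> \<Omega> & (ALL x. x \<notin> K --> f x = 0)" by blast+
next
 fix K assume *: "smooth f" "compact K" "K \<subseteq> \<Omega>" "ALL x. x \<notin> K --> f x = 0"
 then have "closure {x. f x ~= 0} \<subseteq> K"
  by (intro closure_minimal) (auto intro: compact_imp_closed)
 moreover from this have "compact (closure {x. f x ~= 0})"
  using compact_Int_closed[OF \<open>compact K\<close> closed_closure, of "{x. f x ~= 0}"] by (simp only: inf.absorb2)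
 ultimately show "f : Cc_inf \<Omega>" using * by (auto simp: Cc_inf_def smooth_def)
qed

lemma Cc_inf_mono: "f : Cc_inf \<Omega> ==> \<Omega> \<subseteq> \<Omega>' ==> f : Cc_inf \<Omega>'"
 by (auto simp: Cc_inf_def)

lemma Cc_inf_smooth: "f : Cc_inf \<Omega> ==> smooth f"
 by (simp add: Cc_inf_iff)

lemma Cc_inf_support:
 assumes "f : Cc_inf \<Omega>"
 obtains R where "0 < R" "!!x. R < norm x ==> f x = 0"
proof -
 obtain K where "compact K" "ALL x. x \<notin> K --> f x = 0" using assms by (auto simp: Cc_inf_iff)
 then show thesis using that compact_imp_bounded[of K] unfolding bounded_pos
  by (metis linorder_not_le)
qed

lemma Cc_infI_ball:
 assumes "smooth f" "!!x. R < norm x ==> f x = 0"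
 shows "f : Cc"
 unfolding Cc_inf_iff using assms by (auto intro!: exI[of _ "cball 0 R"] simp: not_le)

lemma Cc_inf_zero: "(%x. 0) : Cc_inf \<Omega>"
 by (auto simp: Cc_inf_iff intro!: smooth_const exI[of _ "{}"])

lemma Cc_inf_add: "f : Cc_inf \<Omega> ==> g : Cc_inf \<Omega> ==> (%x. f x + g x) : Cc_inf \<Omega>"
proof -
 assume "f : Cc_inf \<Omega>" "g : Cc_inf \<Omega>"
 then obtain K L where "smooth f" "smooth g" "compact K" "compact L" "K \<subseteq> \<Omega>" "L \<subseteq> \<Omega>"
  "ALL x. x \<notin> K --> f x = 0" "ALL x. x \<notin> L --> g x = 0"
  unfolding Cc_inf_iff by blast
 then show ?thesis
  unfolding Cc_inf_iff by (auto intro!: smooth_add exI[of _ "K \<union> L"] compact_Un)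
qed

lemma Cc_inf_mult_smooth: "smooth f ==> g : Cc_inf \<Omega> ==> (%x. f x * g x) : Cc_inf \<Omega>"
 unfolding Cc_inf_iff using smooth_mult[of f g] by auto

lemma Cc_inf_cmult: "g : Cc_inf \<Omega> ==> (%x. c * g x) : Cc_inf \<Omega>"
 by (intro Cc_inf_mult_smooth smooth_const)

lemma Cc_inf_diff: "f : Cc_inf \<Omega> ==> g : Cc_inf \<Omega> ==> (%x. f x - g x) : Cc_inf \<Omega>"
 using Cc_inf_add[of f \<Omega> "%x. (-1) * g x"] Cc_inf_cmult[of g \<Omega> "-1"] by simp

lemma Cc_inf_pd:
 assumes "f : Cc_inf \<Omega>" "b : Basis"
 shows "pd b f : Cc_inf \<Omega>"
proof -
 obtain K where K: "smooth f" "compact K" "K \<subseteq> \<Omega>" "!!x. x \<notin> K ==> f x = 0" using assms by (auto simp: Cc_inf_iff)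
 have "pd b f x = 0" if "x \<notin> K" for x
 proof -
  have "((%x. 0) has_derivative (%h. 0)) (at x)" by simp
  then have "(f has_derivative (%h. 0)) (at x)"
   by (rule has_derivative_transform_within_open[where s = "- K"])
    (use that K in "auto intro: compact_imp_closed")
  then show ?thesis by (simp add: pd_unique)
 qed
 then show ?thesis using K smooth_pd[OF K(1) assms(2)] by (auto simp: Cc_inf_iff)
qed

lemma Cc_inf_bounded:
 assumes "f : Cc_inf \<Omega>"
 obtains M where "0 < M" "!!x. \<bar>f x\<bar> <= M"
proof -
 obtain R where R: "0 < R" "!!x. R < norm x ==> f x = 0" using Cc_inf_support[OF assms] by blast
 have "compact (f ` cball 0 R)"
  using smooth_continuous[OF Cc_inf_smooth[OF assms]] by (intro compact_continuous_image) auto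
 then obtain M where M: "0 < M" "!!x. x : cball 0 R ==> norm (f x) <= M"
  using compact_imp_bounded bounded_pos by (metis imageI)
 have "\<bar>f x\<bar> <= M" for x using M R(2)[of x] by (cases "norm x <= R") auto
 with M(1) that show thesis by blast
qed

lemma Cc_inf_measurable [measurable_dest]: "f : Cc_inf \<Omega> ==> f : Bb"
 by (rule smooth_measurable[OF Cc_inf_smooth])

lemma Cc_inf_powr_integrable:
 assumes "f : Cc_inf \<Omega>" "0 < p"
 shows "itg (%x. \<bar>f x\<bar> powr p)"
proof -
 obtain R where R: "0 < R" "!!x. R < norm x ==> f x = 0" using Cc_inf_support[OF assms(1)] by blast
 obtain M where M: "0 < M" "!!x. \<bar>f x\<bar> <= M" using Cc_inf_bounded[OF assms(1)] by blast
 have [measurable]: "f : Bb" using assms by measurable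
 show ?thesis
 proof (rule L_integrable_bound)
  show "itg (%x. M powr p * ind (cball 0 R) x)"
   by (intro integrable_mult_right integrable_real_indicator) (use emeasure_lborel_cball_finite[of 0 R] in auto)
  show "AE x in lborel. norm (\<bar>f x\<bar> powr p) <= norm (M powr p * ind (cball 0 R) x)"
   using M R assms by (auto simp: indicator_def not_le intro!: powr_mono2)
 qed auto
qed

lemma Cc_inf_integrable: "f : Cc_inf \<Omega> ==> itg f"
 using Cc_inf_powr_integrable[of f \<Omega> 1] Cc_inf_measurable[of f]
 by (simp add: integrable_abs_iff)

lemma Cc_inf_pint: "f : Cc_inf \<Omega> ==> 0 < p ==> inLp p f"
 using Cc_inf_powr_integrable[of f \<Omega> p] Cc_inf_measurable[of f] by (simp add: pint_def)

lemma Cc_inf_pd_diff: "f : Cc_inf \<Omega> ==> g : Cc_inf \<Omega> ==> pd b (%x. f x - g x) x = pd b f x - pd b g x"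
 using has_derivative_diff[OF smooth_has_derivative[OF Cc_inf_smooth, of f \<Omega> x] smooth_has_derivative[OF Cc_inf_smooth, of g \<Omega> x]]
 by (auto dest!: pd_unique)

lemma ex_mollifier:
 assumes "0 < e"
 obtains et :: "'a::euclidean_space => real" where "et : Cc" "!!x. 0 <= et x" "!!x. e < norm x ==> et x = 0"
  "(LBINT x. et x) = 1"
proof -
 \<comment> \<open>Composing with the squared norm keeps \<open>f\<close> smooth at the origin; it
   is positive exactly on the open ball of radius \<open>e\<close>.\<close>
 define f :: "'a => real" where "f x = exp_flat 1 (e^2 - x \<bullet> x)" for x
 have 0: "f x = 0" if "e < norm x" for x
 proof -
  have "e^2 < (norm x)^2" using that assms by (intro power_strict_mono) auto
  then show ?thesis by (simp add: f_def exp_flat_def power2_norm_eq_inner)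
 qed
 have f: "f : Cc"
  unfolding f_def
  by (rule Cc_infI_ball[of _ e])
   (use 0 in "auto intro!: smooth_exp_flat smooth_diff smooth_const smooth_norm_sq simp: f_def")
 have nn: "0 <= f x" for x by (auto simp: f_def exp_flat_def)
 define c where "c = (LBINT x. f x)"
 have "0 < c"
 proof -
  have "c ~= 0"
  proof
   assume "c = 0"
   then have ae: "AE x in lborel. f x = 0"
    unfolding c_def using integral_nonneg_eq_0_iff_AE[OF Cc_inf_integrable[OF f]] nn by simp
   have pos: "f x ~= 0" if "x : ball 0 e" for x
   proof -
    have "(norm x)^2 < e^2" using that by (intro power_strict_mono) auto
    then show ?thesis by (simp add: f_def exp_flat_def power2_norm_eq_inner)
   qed
   from ae have "AE x in lborel. x \<notin> ball (0::'a) e" by eventually_elim (use pos in blast)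
   then have "emeasure lborel (ball (0::'a) e) = 0"
    by (subst (asm) AE_iff_measurable[of "ball 0 e"]) auto
   then have "measure lborel (ball (0::'a) e) = 0" by (simp add: measure_def)
   then show False using content_ball_pos[OF assms, of "0::'a"] by simp
  qed
  moreover have "0 <= c" unfolding c_def using nn by (intro L_integral_nonneg) auto
  ultimately show ?thesis by simp
 qed
 show thesis
 proof
  show "(%x. (1 / c) * f x) : Cc" by (rule Cc_inf_cmult[OF f])
  show "(LBINT x. (1 / c) * f x) = 1" using \<open>0 < c\<close> by (subst integral_mult_right_zero) (simp flip: c_def)
  show "0 <= (1 / c) * f x" for x using nn[of x] \<open>0 < c\<close> by simp
  show "(1 / c) * f x = 0" if "e < norm x" for x by (simp add: 0[OF that])
 qed
qed

section \<open>Convolution and mollification\<close>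

lemma lborel_distr_minus: "distr lborel borel (%x. t - x) = (lborel :: 'a::euclidean_space measure)"
 using lborel_affine[of "-1" t] by (simp add: density_1)

lemma lborel_distr_shift: "distr lborel borel (%x. x + t) = (lborel :: 'a::euclidean_space measure)"
proof -
 have "(%x. x + t) = (+) t" by (auto simp: add.commute)
 then show ?thesis using lborel_distr_plus[of t] by simp
qed

lemma
 fixes f :: "'a::euclidean_space => 'b::{banach, second_countable_topology}"
 assumes [measurable]: "f : Bb"
 shows integral_lborel_minus: "(LBINT z. f (t - z)) = (LBINT z. f z)"
  and integrable_lborel_minus: "itg (%z. f (t - z)) \<longleftrightarrow> itg f"
  and integral_lborel_shift: "(LBINT z. f (z + t)) = (LBINT z. f z)"
  and integrable_lborel_shift: "itg (%z. f (z + t)) \<longleftrightarrow> itg f"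
  and integral_lborel_shift': "(LBINT z. f (z - t)) = (LBINT z. f z)"
  and integrable_lborel_shift': "itg (%z. f (z - t)) \<longleftrightarrow> itg f"
proof -
 have [measurable]: "f : Bl" by simp
 show "(LBINT z. f (t - z)) = (LBINT z. f z)" "itg (%z. f (t - z)) \<longleftrightarrow> itg f"
  using integral_distr[of "%x. t - x" lborel borel f] integrable_distr_eq[of "%x. t - x" lborel borel f]
  by (simp_all add: lborel_distr_minus)
 have *: "(LBINT z. f (z + t)) = (LBINT z. f z)" "itg (%z. f (z + t)) \<longleftrightarrow> itg f" for t
  using integral_distr[of "%x. x + t" lborel borel f] integrable_distr_eq[of "%x. x + t" lborel borel f]
  by (simp_all add: lborel_distr_shift)
 show "(LBINT z. f (z + t)) = (LBINT z. f z)" "itg (%z. f (z + t)) \<longleftrightarrow> itg f"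
  by (rule *)+
 show "(LBINT z. f (z - t)) = (LBINT z. f z)" "itg (%z. f (z - t)) \<longleftrightarrow> itg f"
  using *[of "-t"] by simp_all
qed

lemma nn_integral_lborel_shift':
 fixes f :: "'a::euclidean_space => ennreal"
 assumes [measurable]: "f : Bb"
 shows "(\<integral>\<^sup>+z. f (z - t) \<partial>lborel) = (\<integral>\<^sup>+z. f z \<partial>lborel)"
 using nn_integral_distr[of "%x. x + (-t)" lborel borel f] lborel_distr_shift[of "-t"] by simp

definition conv :: "('a::euclidean_space => real) => ('a => real) => 'a => real" where
 "conv k f x = (LBINT z. k z * f (x - z))"

lemma conv_measurable [measurable]:
 assumes [measurable]: "k : Bb" "f : Bb"
 shows "conv k f : Bb"
proof -
 have "(%x. LBINT z. k z * f (x - z)) : Bb" by measurable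
 then show ?thesis by (simp add: conv_def[abs_def])
qed

lemma conv_commute:
 assumes [measurable]: "k : Bb" "f : Bb"
 shows "conv k f = conv f k"
proof
 fix x
 show "conv k f x = conv f k x"
  using integral_lborel_minus[of "%z. k z * f (x - z)" x] by (simp add: conv_def mult.commute)
qed

text \<open>Minkowski's inequality over the translates of \<open>f\<close>, all of the same norm. It
  is applied to the absolute value first, because this also gives the integrability almost
  everywhere on which linearity of the convolution rests.\<close>

lemma conv_pint:
 assumes k: "itg k" "!!z. 0 <= k z" "(LBINT z. k z) = 1"
  and f: "inLp p f" and p: "1 <= p"
 shows "inLp p (conv k (%x. \<bar>f x\<bar>))" "nrm p (conv k (%x. \<bar>f x\<bar>)) <= nrm p f"
  and "inLp p (conv k f)" "nrm p (conv k f) <= nrm p f"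
  and "AE x in lborel. itg (%z. k z * f (x - z))"
proof -
 have [measurable]: "k : Bb" "f : Bb"
  using k f by (auto simp: pint_def dest!: borel_measurable_integrable)
 have fz: "(\<integral>\<^sup>+x. ennreal (\<bar>f (x - z)\<bar> powr p) \<partial>lborel) = ennreal (nrm p f)" for z
  using nn_integral_lborel_shift'[of "%x. ennreal (\<bar>f x\<bar> powr p)" z] pint_nn[OF f] by simp
 have M: "AE x in lborel. itg (%z. k z * \<bar>f (x - z)\<bar>)"
  "(\<integral>\<^sup>+x. ennreal ((LBINT z. k z * \<bar>f (x - z)\<bar>) powr p) \<partial>lborel) <= ennreal ((LBINT z. k z * 1) powr p * nrm p f)"
  using k p by (intro Minkowski_kernel[where f = "%z x. \<bar>f (x - z)\<bar>" and B = "nrm p f" and m = "%_. 1"];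
   simp add: fz lborel.sigma_finite_measure_axioms)+
 have nn: "0 <= conv k (%x. \<bar>f x\<bar>) x" for x
  unfolding conv_def using k by (intro L_integral_nonneg) auto
 have "(\<integral>\<^sup>+x. ennreal (norm (conv k (%x. \<bar>f x\<bar>) x) powr p) \<partial>lborel) <= ennreal (nrm p f)"
  using M(2) k(3) nn by (simp add: conv_def)
 then show 1: "inLp p (conv k (%x. \<bar>f x\<bar>))" and 2: "nrm p (conv k (%x. \<bar>f x\<bar>)) <= nrm p f"
  by (auto intro!: pintI_nn)
 show "AE x in lborel. itg (%z. k z * f (x - z))"
  using M(1)
 proof eventually_elim
  case (elim x)
  show ?case
   by (rule L_integrable_bound[OF elim]) (use k in "auto simp: abs_mult")
 qed
 have le: "AE x in lborel. norm (conv k f x) <= norm (conv k (%x. \<bar>f x\<bar>) x)"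
 proof (intro AE_I2)
  fix x
  have "\<bar>conv k f x\<bar> <= (LBINT z. \<bar>k z * f (x - z)\<bar>)"
   unfolding conv_def using integral_norm_bound[of lborel "%z. k z * f (x - z)"] by simp
  also have "... = conv k (%x. \<bar>f x\<bar>) x" using k by (simp add: conv_def abs_mult)
  finally show "norm (conv k f x) <= norm (conv k (%x. \<bar>f x\<bar>) x)" using nn by simp
 qed
 have m: "conv k f : Bl" by measurable
 show "inLp p (conv k f)" "nrm p (conv k f) <= nrm p f"
  using pint_mono[OF m 1 le] 2 p by auto
qed

lemma frechet_derivative_expand:
 assumes "smooth f"
 shows "frechet_derivative f (at x) v = (SUM b:Basis. (v \<bullet> b) * pd b f x)"
proof -
 have lin: "linear (frechet_derivative f (at x))"
  using smooth_differentiable[OF assms] by (rule linear_frechet_derivative)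
 have "frechet_derivative f (at x) v = frechet_derivative f (at x) (SUM b:Basis. (v \<bullet> b) *\<^sub>R b)"
  by (simp add: euclidean_representation)
 then show ?thesis using lin by (simp add: linear_sum linear_scale)
qed

lemma Cc_inf_Lipschitz:
 assumes "f : Cc"
 obtains L where "0 <= L" "!!x y. \<bar>f x - f y\<bar> <= L * norm (x - y)"
proof -
 have "ALL b:Basis. EX M. ALL x. \<bar>pd b f x\<bar> <= M"
 proof
  fix b :: 'a assume "b : Basis"
  then show "EX M. ALL x. \<bar>pd b f x\<bar> <= M"
   by (rule Cc_inf_bounded[OF Cc_inf_pd[OF assms]]) blast
 qed
 from bchoice[OF this] obtain M where M: "!!b x. b : Basis ==> \<bar>pd b f x\<bar> <= M b" by blast
 define L where "L = (SUM b:(Basis::'a set). M b)"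
 have "0 <= M b" if "b : Basis" for b using M[OF that, of 0] by linarith
 then have L: "0 <= L" unfolding L_def by (intro sum_nonneg)
 have on: "onorm (frechet_derivative f (at x)) <= L" for x
 proof (rule onorm_bound[OF L])
  fix v
  have "norm (frechet_derivative f (at x) v) <= (SUM b:Basis. \<bar>(v \<bullet> b) * pd b f x\<bar>)"
   unfolding frechet_derivative_expand[OF Cc_inf_smooth[OF assms], of x v] by (simp add: sum_abs)
  also have "... <= (SUM b:Basis. norm v * M b)"
   unfolding abs_mult using M Basis_le_norm by (intro sum_mono mult_mono) auto
  finally show "norm (frechet_derivative f (at x) v) <= L * norm v"
   by (simp add: L_def sum_distrib_left mult.commute)
 qed
 have "\<bar>f x - f y\<bar> <= L * norm (x - y)" for x y
  using differentiable_bound[of UNIV f "%x. frechet_derivative f (at x)" L x y] on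
   smooth_has_derivative[OF Cc_inf_smooth[OF assms]] by simp
 with L that show thesis by blast
qed

text \<open>Lipschitz continuity of the partial derivatives gives a quadratic remainder with one
  constant for all base points. That uniformity is what allows differentiation under a convolution
  integral.\<close>

lemma Cc_inf_linearization:
 assumes "f : Cc"
 obtains C where "0 <= C" "!!x h. \<bar>f (x + h) - f x - (SUM b:Basis. (h \<bullet> b) * pd b f x)\<bar> <= C * (norm h)\<^sup>2"
proof -
 have "ALL b:Basis. EX L. 0 <= L & (ALL x y. \<bar>pd b f x - pd b f y\<bar> <= L * norm (x - y))"
 proof
  fix b :: 'a assume "b : Basis"
  then show "EX L. 0 <= L & (ALL x y. \<bar>pd b f x - pd b f y\<bar> <= L * norm (x - y))"
   by (rule Cc_inf_Lipschitz[OF Cc_inf_pd[OF assms]]) blast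
 qed
 from bchoice[OF this] obtain L where L: "!!b. b : Basis ==> 0 <= L b" "!!b x y. b : Basis ==> \<bar>pd b f x - pd b f y\<bar> <= L b * norm (x - y)" by blast
 define C where "C = (SUM b:(Basis::'a set). L b)"
 have C: "0 <= C" unfolding C_def using L by (intro sum_nonneg) auto
 have "\<bar>f (x + h) - f x - (SUM b:Basis. (h \<bullet> b) * pd b f x)\<bar> <= C * (norm h)\<^sup>2" for x h
 proof -
  have on: "onorm (%v. frechet_derivative f (at y) v - frechet_derivative f (at x) v) <= C * norm h" if y: "y : cball x (norm h)" for y
  proof (rule onorm_bound)
   fix v
   have "frechet_derivative f (at y) v - frechet_derivative f (at x) v = (SUM b:Basis. (v \<bullet> b) * (pd b f y - pd b f x))"
    by (simp add: frechet_derivative_expand[OF Cc_inf_smooth[OF assms], of _ v] sum_subtractf right_diff_distrib)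
   also have "norm ... <= (SUM b:Basis. \<bar>(v \<bullet> b) * (pd b f y - pd b f x)\<bar>)" by (simp add: sum_abs)
   also have "... <= (SUM b:Basis. norm v * (L b * norm h))"
    unfolding abs_mult
   proof (intro sum_mono mult_mono)
    fix b :: 'a assume b: "b : Basis"
    show "\<bar>v \<bullet> b\<bar> <= norm v" using Basis_le_norm[OF b] .
    show "\<bar>pd b f y - pd b f x\<bar> <= L b * norm h"
     using L(2)[OF b, of y x] mult_left_mono[OF _ L(1)[OF b], of "norm (y - x)" "norm h"] y
     by (simp add: dist_norm norm_minus_commute)
   qed auto
   finally show "norm (frechet_derivative f (at y) v - frechet_derivative f (at x) v) <= C * norm h * norm v"
    by (simp add: C_def sum_distrib_left sum_distrib_right ac_simps)
  qed (use C in auto)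
  have seg: "x + t *\<^sub>R (x + h - x) : cball x (norm h)" if "t : {0..1}" for t :: real
   using that by (auto simp: dist_norm mult_left_le_one_le)
  have der: "(f has_derivative frechet_derivative f (at y)) (at y within cball x (norm h))" for y
   using smooth_has_derivative[OF Cc_inf_smooth[OF assms]] by (rule has_derivative_at_withinI)
  have "norm (f (x + h) - f x - frechet_derivative f (at x) (x + h - x)) <= norm (x + h - x) * (C * norm h)"
   using on by (intro differentiable_bound_linearization[OF seg der]) (auto simp: fun_diff_def)
  then show ?thesis by (simp add: frechet_derivative_expand[OF Cc_inf_smooth[OF assms], of x h] power2_eq_square ac_simps)
 qed
 with C that show thesis by blast
qed

text \<open>Counterpart of \<open>locally_integrable\<close> for Borel functions and
  \<open>lborel\<close>, tested on centred balls, which exhaust the space.\<close>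

definition loc_int :: "('a::euclidean_space => real) => bool" where
 "loc_int g \<longleftrightarrow> g : Bb & (ALL R. itg (%y. ind (cball 0 R) y * g y))"

lemma loc_int_mult_integrable:
 fixes g :: "'a::euclidean_space => real"
 assumes "loc_int g" "f : Bb" "!!y. \<bar>f y\<bar> <= M" "!!y. R < norm y ==> f y = 0"
 shows "itg (%y. g y * f y)" "\<bar>LBINT y. g y * f y\<bar> <= M * (LBINT y. \<bar>ind (cball 0 R) y * g y\<bar>)"
proof -
 have [measurable]: "g : Bb" "f : Bb" using assms by (auto simp: loc_int_def)
 have i: "itg (%y. M * \<bar>ind (cball 0 R) y * g y\<bar>)" using assms(1) by (auto simp: loc_int_def)
 have le: "norm (g y * f y) <= M * \<bar>ind (cball 0 R) y * g y\<bar>" for y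
  using mult_right_mono[OF assms(3)[of y], of "\<bar>g y\<bar>"] assms(4)[of y] by (cases "norm y <= R") (auto simp: abs_mult mult.commute)
 show I: "itg (%y. g y * f y)"
  by (rule L_integrable_bound[OF i]) (use order_trans[OF le abs_ge_self] in "auto")
 have "\<bar>LBINT y. g y * f y\<bar> <= (LBINT y. M * \<bar>ind (cball 0 R) y * g y\<bar>)"
  using L_integral_norm_bound_integral[OF I i] le by simp
 then show "\<bar>LBINT y. g y * f y\<bar> <= M * (LBINT y. \<bar>ind (cball 0 R) y * g y\<bar>)" by simp
qed

text \<open>The remainder of the first-order expansion of \<open>f\<close> is quadratic in the
  increment, uniformly in the base point, and is supported in a fixed ball on which \<open>g\<close>
  is integrable; so the derivative may be put on \<open>f\<close> under the integral.\<close>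

lemma conv_Cc_inf_has_derivative:
 fixes g :: "'a::euclidean_space => real"
 assumes g: "loc_int g" and f: "f : Cc"
 shows "(conv g f has_derivative (%v. SUM b:Basis. (v \<bullet> b) * conv g (pd b f) x)) (at x)"
proof -
 obtain R where R: "0 < R" "!!x. R < norm x ==> f x = 0" using Cc_inf_support[OF f] by blast
 obtain C where C: "0 <= C" "!!x h. \<bar>f (x + h) - f x - (SUM b:Basis. (h \<bullet> b) * pd b f x)\<bar> <= C * (norm h)\<^sup>2"
  using Cc_inf_linearization[OF f] by blast
 have [measurable]: "f : Bb" "g : Bb" using f g by (auto simp: loc_int_def Cc_inf_measurable)
 have int: "itg (%y. g y * f' (x - y))" if f': "f' : Cc" for f' :: "'a => real" and x
 proof -
  obtain M where M: "!!x. \<bar>f' x\<bar> <= M" using Cc_inf_bounded[OF f'] by blast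
  obtain R where R: "!!x. R < norm x ==> f' x = 0" using Cc_inf_support[OF f'] by blast
  have [measurable]: "f' : Bb" using f' by (rule Cc_inf_measurable)
  show ?thesis
  proof (rule loc_int_mult_integrable[OF g, where M = M and R = "norm x + R"])
   fix y :: 'a assume "norm x + R < norm y"
   then have "R < norm (x - y)" using norm_triangle_ineq2[of y x] by (simp add: norm_minus_commute)
   then show "f' (x - y) = 0" by (rule R)
  qed (use M in auto)
 qed
 have pdR: "pd b f y = 0" if "R < norm y" "b : Basis" for y b
 proof -
  have "((%x. 0) has_derivative (%h. 0)) (at y)" by simp
  then have "(f has_derivative (%h. 0)) (at y)"
   by (rule has_derivative_transform_within_open[where s = "- cball 0 R"]) (use that R in auto)
  then show ?thesis by (simp add: pd_unique)
 qed
 define A where "A = (LBINT y. \<bar>ind (cball 0 (norm x + R + 1)) y * g y\<bar>)"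
 show ?thesis
 proof (rule has_derivativeI_sandwich[of 1])
  show "bounded_linear (%v. SUM b:Basis. (v \<bullet> b) * conv g (pd b f) x)"
   by (intro bounded_linear_sum bounded_linear_mult_left bounded_linear_compose[OF bounded_linear_mult_left] bounded_linear_inner_left)
  fix y assume y: "y ~= x" "dist y x < 1"
  define h where "h = y - x"
  have h: "norm h < 1" "y = x + h" "h ~= 0" using y by (auto simp: h_def dist_norm)
  define k where "k z = f (x + h - z) - f (x - z) - (SUM b:Basis. (h \<bullet> b) * pd b f (x - z))" for z
  have [measurable]: "pd b f : Bb" if "b : Basis" for b
   using Cc_inf_measurable[OF Cc_inf_pd[OF f that]] .
  have km: "k : Bb" unfolding k_def by measurable
  have kb: "\<bar>k z\<bar> <= C * (norm h)\<^sup>2" for z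
   using C(2)[of "x - z" h] by (simp add: k_def algebra_simps)
  have k0: "k z = 0" if "norm x + R + 1 < norm z" for z
  proof -
   have "R + 1 < norm (x - z)" using norm_triangle_ineq2[of z x] that by (simp add: norm_minus_commute)
   moreover have "norm (x - z) - norm h <= norm (x + h - z)" using norm_triangle_ineq2[of "x - z" "-h"] by (simp add: algebra_simps)
   ultimately have "R < norm (x - z)" "R < norm (x + h - z)" using h by auto
   then show ?thesis using R(2) pdR by (simp add: k_def)
  qed
  have "conv g f y - conv g f x - (SUM b:Basis. ((y - x) \<bullet> b) * conv g (pd b f) x) = (LBINT z. g z * k z)"
  proof -
   have "(LBINT z. g z * k z) = (LBINT z. g z * f (x + h - z) - g z * f (x - z) - (SUM b:Basis. (h \<bullet> b) * (g z * pd b f (x - z))))"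
    by (simp add: k_def right_diff_distrib sum_distrib_left ac_simps)
   also have "... = conv g f (x + h) - conv g f x - (SUM b:Basis. (h \<bullet> b) * conv g (pd b f) x)"
    unfolding conv_def using int[OF f] int[OF Cc_inf_pd[OF f]] by (simp add: integral_sum)
   finally show ?thesis using h by simp
  qed
  then have "norm (conv g f y - conv g f x - (SUM b:Basis. ((y - x) \<bullet> b) * conv g (pd b f) x)) <= C * (norm h)\<^sup>2 * A"
   using loc_int_mult_integrable(2)[OF g km kb k0] by (simp add: A_def)
  then show "norm (conv g f y - conv g f x - (SUM b:Basis. ((y - x) \<bullet> b) * conv g (pd b f) x)) / norm (y - x) <= C * A * norm (y - x)"
   using h by (simp add: field_simps power2_eq_square)
 next
  have "((%y. C * A * norm (y - x)) \<longlongrightarrow> C * A * norm (x - x)) (at x)" by (intro tendsto_intros)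
  then show "((%y. C * A * norm (y - x)) \<longlongrightarrow> 0) (at x)" by simp
 qed auto
qed

lemma pd_conv_Cc_inf:
 fixes g :: "'a::euclidean_space => real"
 assumes "loc_int g" "f : Cc" "b : Basis"
 shows "pd b (conv g f) x = conv g (pd b f) x"
proof -
 have "pd b (conv g f) x = (SUM c:Basis. (b \<bullet> c) * conv g (pd c f) x)"
  using conv_Cc_inf_has_derivative[OF assms(1,2)] by (rule pd_unique)
 also have "... = (SUM c:Basis. if c = b then conv g (pd c f) x else 0)"
  using assms(3) by (intro sum.cong) (auto simp: inner_Basis)
 finally show ?thesis using assms(3) by simp
qed

lemma smooth_conv_Cc_inf:
 fixes g :: "'a::euclidean_space => real"
 assumes "loc_int g" "f : Cc"
 shows "smooth (conv g f)"
proof (rule smooth_coinduct[of _ "{conv g f | f. f : Cc}"])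
 show "f differentiable (at x)" if "f : {conv g f | f. f : Cc}" for f x
  using that conv_Cc_inf_has_derivative[OF assms(1)] by (auto simp: differentiable_def)
 show "pd b f : {conv g f | f. f : Cc}" if "f : {conv g f | f. f : Cc}" "b : Basis" for f b
 proof -
  from that(1) obtain f' where f': "f = conv g f'" "f' : Cc" by blast
  have "pd b f = conv g (pd b f')" using pd_conv_Cc_inf[OF assms(1) f'(2) that(2)] by (auto simp: f'(1))
  then show ?thesis using Cc_inf_pd[OF f'(2) that(2)] by blast
 qed
qed (use assms in auto)

definition mollifier :: "real => ('a::euclidean_space => real) => bool" where
 "mollifier e et \<longleftrightarrow> et : Cc & (ALL x. 0 <= et x) & (ALL x. e < norm x --> et x = 0) & (LBINT x. et x) = 1"

lemma ex_mollifier': "0 < e ==> EX et. mollifier e et"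
 using ex_mollifier[of e] unfolding mollifier_def by metis

lemma conv_mollifier_Cc_inf:
 fixes g :: "'a::euclidean_space => real"
 assumes "loc_int g" "mollifier e et" "!!x. R < norm x ==> g x = 0"
 shows "conv g et : Cc"
proof (rule Cc_infI_ball[of _ "R + e"])
 show "smooth (conv g et)" using assms by (intro smooth_conv_Cc_inf) (auto simp: mollifier_def)
 fix x :: 'a assume x: "R + e < norm x"
 have "g z * et (x - z) = 0" for z
 proof (cases "R < norm z")
  case False
  then have "e < norm (x - z)" using x norm_triangle_ineq2[of x z] by simp
  then show ?thesis using assms(2) by (simp add: mollifier_def)
 qed (simp add: assms(3))
 then show "conv g et x = 0" by (simp only: conv_def) simp
qed

lemma loc_int_bounded:
 fixes g :: "'a::euclidean_space => real"
 assumes [measurable]: "g : Bb" and "!!x. \<bar>g x\<bar> <= M"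
 shows "loc_int g"
 unfolding loc_int_def
proof (intro conjI allI)
 fix R :: real
 have [measurable]: "cball (0::'a) R : sets borel" by (simp add: borel_closed)
 have [measurable]: "g : Bb" using assms(1) by (auto simp: pint_def)
 show "itg (%y. ind (cball 0 R) y * g y)"
 proof (rule L_integrable_bound[of _ "%y. M * ind (cball 0 R) y"])
  show "itg (%y. M * ind (cball (0::'a) R) y)"
   by (intro integrable_mult_right integrable_real_indicator) (use emeasure_lborel_cball_finite[of 0 R] in auto)
  have "\<bar>g y\<bar> <= \<bar>M\<bar>" for y using assms(2)[of y] by linarith
  then show "AE y in lborel. norm (ind (cball 0 R) y * g y) <= norm (M * ind (cball 0 R) y)"
   by (auto simp: indicator_def)
 qed auto
qed fact

lemma loc_int_pint:
 fixes g :: "'a::euclidean_space => real"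
 assumes "inLp p g" "1 <= p"
 shows "loc_int g"
 unfolding loc_int_def
proof (intro conjI allI)
 show [measurable]: "g : Bb" using assms by (auto simp: pint_def)
 fix R :: real
 have [measurable]: "cball (0::'a) R : sets borel" by (simp add: borel_closed)
 have [measurable]: "g : Bb" using assms(1) by (auto simp: pint_def)
 show "itg (%y. ind (cball 0 R) y * g y)"
 proof (rule L_integrable_bound[of _ "%y. ind (cball 0 R) y + \<bar>g y\<bar> powr p"])
  show "itg (%y. ind (cball (0::'a) R) y + \<bar>g y\<bar> powr p)"
   using assms(1) by (intro L_integrable_add integrable_real_indicator)
    (use emeasure_lborel_cball_finite[of 0 R] in "auto simp: pint_def")
  have "\<bar>a\<bar> <= 1 + \<bar>a\<bar> powr p" for a :: real
  proof (cases "\<bar>a\<bar> <= 1")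
   case False
   then have "\<bar>a\<bar> powr 1 <= \<bar>a\<bar> powr p" using assms(2) by (intro powr_mono) auto
   then show ?thesis using False by simp
  qed (auto intro: order_trans)
  then show "AE y in lborel. norm (ind (cball 0 R) y * g y) <= norm (ind (cball 0 R) y + \<bar>g y\<bar> powr p)"
   by (auto simp: indicator_def)
 qed measurable
qed

lemma ex_Cc_inf_cutoff:
 fixes K U :: "'a::euclidean_space set"
 assumes "compact K" "open U" "K \<subseteq> U"
 obtains f where "f : Cc_inf U" "!!x. 0 <= f x" "!!x. f x <= 1" "!!x. x : K ==> f x = 1"
proof (cases "K = {}")
 case True
 then show thesis using that[of "%x. 0"] Cc_inf_zero by auto
next
 case False
 have "closed (- U)" "K \<inter> - U = {}" using assms by auto
 from separate_compact_closed[OF assms(1) this]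
 obtain d where d: "0 < d" "!!x y. x : K ==> y \<notin> U ==> d <= dist x y" by auto
 \<comment> \<open>The mollified indicator of the \<open>e\<close>-neighbourhood \<open>Ke\<close>
   is 1 on \<open>K\<close> and vanishes off the neighbourhood \<open>K2\<close> of twice that
   radius, which still lies in \<open>U\<close>.\<close>
 define e where "e = d / 3"
 have e: "0 < e" using d by (simp add: e_def)
 define Ke where "Ke = {x + y | x y. x : K & y : cball 0 e}"
 have Ke: "compact Ke" unfolding Ke_def using assms by (intro compact_sums) auto
 define K2 where "K2 = {x + y | x y. x : K & y : cball 0 (2 * e)}"
 have K2: "compact K2" unfolding K2_def using assms by (intro compact_sums) auto
 obtain et :: "'a => real" where et: "mollifier e et" using ex_mollifier'[OF e] by blast
 then have et': "et : Cc" "!!x. 0 <= et x" "!!x. e < norm x ==> et x = 0" "(LBINT x. et x) = 1"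
  by (auto simp: mollifier_def)
 have [measurable]: "Ke : sets borel" using Ke by (simp add: borel_compact)
 have [measurable]: "et : Bb" using Cc_inf_measurable[OF et'(1)] .
 define f where "f = conv (ind Ke) et"
 have sub: "K2 \<subseteq> U"
 proof
  fix z assume "z : K2"
  then obtain x y where z: "z = x + y" "x : K" "norm y <= 2 * e" by (auto simp: K2_def)
  show "z : U"
  proof (rule ccontr)
   assume "z \<notin> U"
   from d(2)[OF z(2) this] show False using z d(1) by (simp add: dist_norm e_def)
  qed
 qed
 have "smooth f" unfolding f_def
  by (intro smooth_conv_Cc_inf loc_int_bounded[of _ 1] et') (auto simp: indicator_def)
 moreover have "f x = 0" if "x \<notin> K2" for x
 proof -
  have "ind Ke z * et (x - z) = 0" for z
  proof (cases "z : Ke")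
   case True
   then obtain a b where z: "z = a + b" "a : K" "norm b <= e" by (auto simp: Ke_def)
   have "e < norm (x - z)"
   proof (rule ccontr)
    assume "\<not> e < norm (x - z)"
    then have "norm (b + (x - z)) <= 2 * e" using norm_triangle_ineq[of b "x - z"] z by simp
    moreover have "x = a + (b + (x - z))" using z by simp
    ultimately have "x : K2" using z(2) unfolding K2_def
     by (intro CollectI exI[of _ a] exI[of _ "b + (x - z)"]) auto
    with that show False by simp
   qed
   then show ?thesis using et' by simp
  qed auto
  then show ?thesis by (simp only: f_def conv_def) simp
 qed
 ultimately have "f : Cc_inf U" using K2 sub by (auto simp: Cc_inf_iff)
 moreover have "0 <= f x" for x
  unfolding f_def conv_def using et' by (intro L_integral_nonneg) auto
 moreover have i1: "itg (%z. et (x - z))" "(LBINT z. et (x - z)) = 1" for x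
  using integral_lborel_minus[of et x] integrable_lborel_minus[of et x] Cc_inf_integrable[OF et'(1)] et'(4) by auto
 moreover have "f x <= 1" for x
 proof -
  have "f x <= (LBINT z. et (x - z))" unfolding f_def conv_def
   using i1(1) et' by (intro integral_mono integrable_real_mult_indicator[of Ke lborel "%z. et (x - z)", simplified mult.commute]) (auto simp: indicator_def)
  then show ?thesis using i1 by simp
 qed
 moreover have "f x = 1" if "x : K" for x
 proof -
  have "ind Ke z * et (x - z) = et (x - z)" for z
  proof (cases "e < norm (x - z)")
   case False
   then have "z : Ke" unfolding Ke_def using that
    by (intro CollectI exI[of _ x] exI[of _ "z - x"]) (auto simp: norm_minus_commute)
   then show ?thesis by simp
  qed (simp add: et')
  then show ?thesis using i1 by (simp only: f_def conv_def)
 qed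
 ultimately show thesis by (intro that)
qed

section \<open>Density of test functions\<close>

lemma pnorm_triangle:
 assumes "pint M p (%x. f x - g x)" "pint M p (%x. g x - h x)" "0 <= p"
 shows "pint M p (%x. f x - h x)"
  "pnorm M p (%x. f x - h x) <= 2 powr p * (pnorm M p (%x. f x - g x) + pnorm M p (%x. g x - h x))"
 using pint_add[OF assms] by simp_all

lemma cball_borel [measurable]: "cball (x::'a::euclidean_space) R : sets borel"
 by (simp add: borel_closed)

lemma integrable_indicator_cball: "itg (%x. c * ind (cball (0::'a::euclidean_space) R) x :: real)"
 by (intro integrable_mult_right integrable_real_indicator) (use emeasure_lborel_cball_finite[of 0 R] in auto)

text \<open>Membership in the closure of the test functions, as a predicate: closure under limits
  and linear combinations can then be established ahead of density.\<close>

definition Cc_approx :: "real => ('a::euclidean_space => real) => bool" where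
 "Cc_approx q f \<longleftrightarrow> inLp q f & (ALL e>0. EX ph:Cc. nrm q (%x. f x - ph x) < e)"

lemma Cc_approx_limit:
 assumes f: "inLp q f" and q: "0 < q"
  and *: "!!e. 0 < e ==> EX g. Cc_approx q g & nrm q (%x. f x - g x) < e"
 shows "Cc_approx q f"
 unfolding Cc_approx_def
proof (intro conjI allI impI f)
 fix e :: real assume e: "0 < e"
 define d where "d = e / (2 * 2 powr q)"
 have d: "0 < d" using e by (simp add: d_def)
 obtain g where g: "Cc_approx q g" "nrm q (%x. f x - g x) < d" using *[OF d] by blast
 obtain ph where ph: "ph : Cc" "nrm q (%x. g x - ph x) < d" using g(1) d by (auto simp: Cc_approx_def)
 have "nrm q (%x. f x - ph x) <= 2 powr q * (nrm q (%x. f x - g x) + nrm q (%x. g x - ph x))"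
 proof (rule pnorm_triangle(2))
  have gi: "inLp q g" using g(1) by (simp add: Cc_approx_def)
  show "inLp q (%x. f x - g x)" using f gi q by (intro pint_diff) auto
  show "inLp q (%x. g x - ph x)" using gi Cc_inf_pint[OF ph(1) q] q by (intro pint_diff) auto
 qed (use q in simp)
 also have "... < 2 powr q * (d + d)" using g(2) ph(2) by (intro mult_strict_left_mono add_strict_mono) auto
 also have "... = e" by (simp add: d_def)
 finally show "EX ph:Cc. nrm q (%x. f x - ph x) < e" using ph(1) by blast
qed

lemma Cc_approx_add:
 assumes "Cc_approx q f" "Cc_approx q g" "0 < q"
 shows "Cc_approx q (%x. f x + g x)"
 unfolding Cc_approx_def
proof (intro conjI allI impI)
 have i: "inLp q f" "inLp q g" using assms by (auto simp: Cc_approx_def)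
 show "inLp q (%x. f x + g x)" using i assms by (intro pint_add) auto
 fix e :: real assume e: "0 < e"
 define d where "d = e / (2 * 2 powr q)"
 have d: "0 < d" using e by (simp add: d_def)
 obtain ph where ph: "ph : Cc" "nrm q (%x. f x - ph x) < d" using assms(1) d by (auto simp: Cc_approx_def)
 obtain ps where ps: "ps : Cc" "nrm q (%x. g x - ps x) < d" using assms(2) d by (auto simp: Cc_approx_def)
 have "nrm q (%x. f x - ph x + (g x - ps x)) <= 2 powr q * (nrm q (%x. f x - ph x) + nrm q (%x. g x - ps x))"
  using i assms(3) Cc_inf_pint[OF ph(1) assms(3)] Cc_inf_pint[OF ps(1) assms(3)] by (intro pint_add(2) pint_diff) auto
 also have "... < 2 powr q * (d + d)" using ps(2) ph(2) by (intro mult_strict_left_mono add_strict_mono) auto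
 also have "... = e" by (simp add: d_def)
 finally have "nrm q (%x. f x + g x - (ph x + ps x)) < e" by (simp add: algebra_simps)
 then show "EX ph:Cc. nrm q (%x. f x + g x - ph x) < e"
  using Cc_inf_add[OF ph(1) ps(1)] by (intro bexI[of _ "%x. ph x + ps x"])
qed

lemma Cc_approx_cmult:
 assumes "Cc_approx q f" "0 < q"
 shows "Cc_approx q (%x. c * f x)"
 unfolding Cc_approx_def
proof (intro conjI allI impI)
 have i: "inLp q f" using assms by (auto simp: Cc_approx_def)
 show "inLp q (%x. c * f x)" using i by (rule pint_cmult)
 fix e :: real assume e: "0 < e"
 define d where "d = e / (\<bar>c\<bar> powr q + 1)"
 have cp: "0 <= \<bar>c\<bar> powr q" by simp
 then have d: "0 < d" using e by (simp add: d_def add_nonneg_pos)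
 obtain ph where ph: "ph : Cc" "nrm q (%x. f x - ph x) < d" using assms(1) d by (auto simp: Cc_approx_def)
 have "nrm q (%x. c * f x - c * ph x) = nrm q (%x. c * (f x - ph x))" by (simp add: right_diff_distrib)
 also have "... = \<bar>c\<bar> powr q * nrm q (%x. f x - ph x)"
  using i assms(2) Cc_inf_pint[OF ph(1) assms(2)] by (intro pint_cmult pint_diff) auto
 also have "... <= \<bar>c\<bar> powr q * d" using ph(2) by (intro mult_left_mono) auto
 also have "... < (\<bar>c\<bar> powr q + 1) * d" using d by simp
 also have "... = e" using add_nonneg_pos[OF cp zero_less_one] by (simp add: d_def)
 finally show "EX ph:Cc. nrm q (%x. c * f x - ph x) < e"
  using Cc_inf_cmult[OF ph(1), of c] by (intro bexI[of _ "%x. c * ph x"])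
qed

lemma Cc_approx_zero: "0 < q ==> Cc_approx q (%x. 0)"
 using Cc_inf_zero by (fastforce simp: Cc_approx_def intro!: bexI[of _ "%x. 0"])

lemma Cc_approx_sum:
 assumes "finite I" "!!i. i : I ==> Cc_approx q (f i)" "0 < q"
 shows "Cc_approx q (%x. SUM i:I. f i x)"
 using assms by (induction I rule: finite_induct) (auto intro: Cc_approx_zero Cc_approx_add)

text \<open>Outer regularity is used twice, for \<open>A\<close> and for its complement, and
  encloses \<open>A\<close> between a compact \<open>K\<close> and an open \<open>U\<close>. A
  cutoff between these two differs from the indicator only on the two thin remainders.\<close>

lemma Cc_approx_indicator:
 assumes A: "A : sets borel" "A \<subseteq> cball (0::'a::euclidean_space) R" and q: "0 < q"
 shows "Cc_approx q (ind A)"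
 unfolding Cc_approx_def
proof (intro conjI allI impI)
 have [measurable]: "A : sets borel" by fact
 have Afin: "emeasure lborel A < \<infinity>"
  using emeasure_mono[OF A(2), of lborel] emeasure_lborel_cball_finite[of 0 R] by (auto intro: order.strict_trans1)
 have "norm (ind A x :: real) powr q = (ind A x :: real)" for x using q by (auto simp: indicator_def)
 then show "inLp q (ind A :: 'a => real)" unfolding pint_def using Afin by (auto simp: less_top)
 fix e :: real assume e: "0 < e"
 obtain U where U: "open U" "A \<subseteq> U" "emeasure lborel (U - A) < ennreal (e / 2)"
  using outer_regular_lborel[OF A(1), of "e / 2"] e by auto
 have "- A : sets borel" by measurable
 then obtain V where V: "open V" "- A \<subseteq> V" "emeasure lborel (V - - A) < ennreal (e / 2)"
  using outer_regular_lborel[of "- A" "e / 2"] e by auto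
 have [measurable]: "U : sets borel" "V : sets borel" using U V by auto
 define K where "K = cball 0 R - V"
 have K: "compact K" unfolding K_def using V by (intro compact_diff) auto
 have KA: "K \<subseteq> A" using V by (auto simp: K_def)
 obtain f where f: "f : Cc_inf U" "!!x. 0 <= f x" "!!x. f x <= 1" "!!x. x : K ==> f x = 1"
  using ex_Cc_inf_cutoff[OF K U(1)] KA U(2) by (metis order_trans)
 have f0: "f x = 0" if "x \<notin> U" for x using f(1) that by (auto simp: Cc_inf_iff)
 have fU: "f : Cc" using Cc_inf_mono[OF f(1)] by simp
 have [measurable]: "f : Bb" using f(1) by (rule Cc_inf_measurable)
 have le: "\<bar>ind A x - f x\<bar> powr q <= ind (U - A) x + ind (V - - A) x" for x
 proof -
  have "\<bar>ind A x - f x\<bar> <= 1" using f(2,3)[of x] by (auto simp: indicator_def)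
  then have 1: "\<bar>ind A x - f x\<bar> powr q <= 1" using powr_mono2[of q "\<bar>ind A x - f x\<bar>" 1] q by simp
  consider "x \<notin> U" | "x : U" "x \<notin> A" | "x : A" "x : V" | "x : A" "x \<notin> V" by blast
  then show ?thesis
  proof cases
   case 4
   then have "x : K" using A(2) by (auto simp: K_def)
   then show ?thesis using 4 f(4) by simp
  qed (use 1 f0 U(2) in "auto simp: indicator_def")
 qed
 have "(\<integral>\<^sup>+x. ennreal (norm (ind A x - f x) powr q) \<partial>lborel) <= (\<integral>\<^sup>+x. ind (U - A) x + ind (V - - A) x \<partial>lborel)"
 proof (intro nn_integral_mono)
  fix x
  have "ennreal (norm (ind A x - f x) powr q) <= ennreal (ind (U - A) x + ind (V - - A) x)"
   using le[of x] by (intro ennreal_leI) auto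
  also have "... = ind (U - A) x + ind (V - - A) x"
   by (auto simp: indicator_def)
  finally show "ennreal (norm (ind A x - f x) powr q) <= ind (U - A) x + ind (V - - A) x" .
 qed
 also have "... = emeasure lborel (U - A) + emeasure lborel (V - - A)"
  by (subst nn_integral_add) auto
 also have "... < ennreal (e / 2) + ennreal (e / 2)" using U V by (intro add_strict_mono)
 also have "... = ennreal e" using e by (simp flip: ennreal_plus)
 finally have lt: "(\<integral>\<^sup>+x. ennreal (norm (ind A x - f x) powr q) \<partial>lborel) < ennreal e" .
 have "inLp q (%x. ind A x - f x)"
  using less_imp_le[OF lt] e by (intro pintI_nn[where B = e]) auto
 from pint_nn[OF this] lt have "nrm q (%x. ind A x - f x) < e"
  by (simp add: ennreal_less_iff)
 with fU show "EX ph:Cc. nrm q (%x. ind A x - ph x) < e" by blast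
qed

text \<open>Truncation to a ball and to bounded values, justified by dominated convergence, followed
  by rounding of the values to a grid; the rounded function is a finite combination of indicators of
  bounded Borel sets.\<close>

lemma Cc_inf_dense:
 fixes f :: "'a::euclidean_space => real"
 assumes f: "inLp q f" and q: "0 < q"
 shows "Cc_approx q f"
proof (rule Cc_approx_limit[OF f q])
 fix e :: real assume e: "0 < e"
 have [measurable]: "f : Bb" using f by (simp add: pint_def)
 define h where "h n x = (if norm x <= real n & \<bar>f x\<bar> <= real n then f x else 0)" for n x
 have hm [measurable]: "h n : Bb" for n unfolding h_def by measurable
 have hi: "inLp q (h n)" for n
  using q by (intro pint_mono(1)[OF _ f]) (auto simp: h_def)
 have happ: "Cc_approx q (h n)" for n
 proof (rule Cc_approx_limit[OF hi q])
  fix e :: real assume e: "0 < e"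
  define V where "V = measure lborel (cball (0::'a) (real n))"
  \<comment> \<open>The rounding error is at most \<open>1 / k\<close> on a ball of measure
    \<open>V\<close>; this \<open>k\<close> makes \<open>(1 / k) powr q * V\<close> smaller than
    \<open>e\<close>.\<close>
  define k :: nat where "k = nat \<lceil>(2 * (V + 1) / e) powr (1 / q)\<rceil> + 1"
  have V: "0 <= V" by (simp add: V_def)
  have k: "0 < k" "(2 * (V + 1) / e) powr (1 / q) <= real k" by (auto simp: k_def) linarith
  define s where "s x = (SUM j:{- int (n * k)..int (n * k)}. (real_of_int j / real k) * ind {x. \<lfloor>real k * h n x\<rfloor> = j & norm x <= real n} x)" for x
  have sapp: "Cc_approx q s"
   unfolding s_def
   by (intro Cc_approx_sum Cc_approx_cmult Cc_approx_indicator[where R = "real n"] q) auto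
  have s_eq: "s x = (if norm x <= real n then real_of_int \<lfloor>real k * h n x\<rfloor> / real k else 0)" for x
  proof (cases "norm x <= real n")
   case True
   have "\<bar>h n x\<bar> <= real n" by (auto simp: h_def)
   then have "- real n <= h n x" "h n x <= real n" by auto
   then have "real k * (- real n) <= real k * h n x" "real k * h n x <= real k * real n"
    by (simp_all only: mult_left_mono of_nat_0_le_iff)
   then have in1: "\<lfloor>real k * h n x\<rfloor> : {- int (n * k)..int (n * k)}"
    by (auto simp: le_floor_iff floor_le_iff mult.commute)
   have "s x = (SUM j:{- int (n * k)..int (n * k)}. if j = \<lfloor>real k * h n x\<rfloor> then real_of_int j / real k else 0)"
    unfolding s_def using True by (intro sum.cong) (auto simp: indicator_def)
   also have "... = real_of_int \<lfloor>real k * h n x\<rfloor> / real k"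
    using in1 by (subst sum.delta) auto
   finally show ?thesis using True by simp
  qed (simp add: s_def)
  have diff: "\<bar>h n x - s x\<bar> <= 1 / real k * ind (cball 0 (real n)) x" for x
  proof (cases "norm x <= real n")
   case True
   have "\<bar>real k * h n x - real_of_int \<lfloor>real k * h n x\<rfloor>\<bar> <= 1" by linarith
   then have "\<bar>real k * h n x - real_of_int \<lfloor>real k * h n x\<rfloor>\<bar> / real k <= 1 / real k" using k by (intro divide_right_mono) auto
   moreover have "\<bar>real k * h n x - real_of_int \<lfloor>real k * h n x\<rfloor>\<bar> / real k = \<bar>h n x - s x\<bar>"
   proof -
    have "h n x - s x = (real k * h n x - real_of_int \<lfloor>real k * h n x\<rfloor>) / real k"
     using True k by (simp add: s_eq diff_divide_distrib)
    then show ?thesis by (simp add: abs_divide)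
   qed
   ultimately show ?thesis using True by simp
  qed (simp add: s_eq h_def)
  have "nrm q (%x. h n x - s x) <= (LBINT x. (1 / real k) powr q * ind (cball (0::'a) (real n)) x)"
  proof (rule pint_bound(2)[OF _ integrable_indicator_cball])
   show "(%x. h n x - s x) : Bl" using sapp by (auto simp: Cc_approx_def pint_def)
   show "AE x in lborel. norm (h n x - s x) powr q <= (1 / real k) powr q * ind (cball 0 (real n)) x"
   proof (intro AE_I2)
    fix x show "norm (h n x - s x) powr q <= (1 / real k) powr q * ind (cball 0 (real n)) x"
     using powr_mono2[of q "\<bar>h n x - s x\<bar>" "1 / real k * ind (cball 0 (real n)) x"] diff[of x] q
     by (auto simp: indicator_def split: if_splits)
   qed
  qed
  also have "... = (1 / real k) powr q * V" by (simp add: V_def)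
  also have "... < e"
  proof -
   have "2 * (V + 1) / e = ((2 * (V + 1) / e) powr (1 / q)) powr q" using V e q by (simp add: powr_powr)
   also have "... <= real k powr q" using k q by (intro powr_mono2) auto
   finally have "2 * (V + 1) <= e * real k powr q" using e by (simp add: field_simps)
   moreover have "V < 2 * (V + 1)" using V by simp
   ultimately have "V < e * real k powr q" by (rule order.strict_trans2[rotated])
   then show ?thesis using k by (simp add: powr_divide field_simps)
  qed
  finally show "EX g. Cc_approx q g & nrm q (%x. h n x - g x) < e" using sapp by blast
 qed
 have "(%n. LBINT x. norm (f x - h n x) powr q) ----> (LINT x|(lborel::'a measure). 0)"
 proof (rule integral_dominated_convergence[where w = "%x. norm (f x) powr q"])
  show "itg (%x. norm (f x) powr q)" using f by (simp add: pint_def)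
  show "AE x in lborel. (%n. norm (f x - h n x) powr q) ----> 0"
  proof (intro AE_I2)
   fix x
   obtain N :: nat where N: "norm x + \<bar>f x\<bar> <= real N" using real_arch_simple by blast
   have "norm (f x - h n x) powr q = 0" if "N <= n" for n
   proof -
    have "norm x <= real n" "\<bar>f x\<bar> <= real n" using N of_nat_mono[OF that, where 'a = real] norm_ge_zero[of x] abs_ge_zero[of "f x"] by linarith+
    then show ?thesis by (simp add: h_def)
   qed
   then show "(%n. norm (f x - h n x) powr q) ----> 0"
    by (intro tendsto_eventually eventually_sequentiallyI[of N]) auto
  qed
  show "AE x in lborel. norm (norm (f x - h n x) powr q) <= norm (f x) powr q" for n
   by (auto simp: h_def)
 qed auto
 then have "(%n. nrm q (%x. f x - h n x)) ----> 0" by (simp add: pnorm_def)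
 from LIMSEQ_D[OF this e] obtain n where "nrm q (%x. f x - h n x) < e" by auto
 with happ show "EX g. Cc_approx q g & nrm q (%x. f x - g x) < e" by blast
qed

lemma conv_Cc_inf_near:
 assumes ph: "ph : Cc" and q: "0 < q" and e: "0 < e"
 obtains d where "0 < d" "d <= 1" "!!d' et. 0 < d' ==> d' <= d ==> mollifier d' et ==>
  inLp q (%x. conv ph et x - ph x) & nrm q (%x. conv ph et x - ph x) < e"
proof -
 obtain L where L: "0 <= L" "!!x y. \<bar>ph x - ph y\<bar> <= L * norm (x - y)" using Cc_inf_Lipschitz[OF ph] by blast
 obtain R where R: "0 < R" "!!x. R < norm x ==> ph x = 0" using Cc_inf_support[OF ph] by blast
 define V where "V = measure lborel (cball (0::'a) (R + 1))"
 have V: "0 <= V" by (simp add: V_def)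
 \<comment> \<open>The Lipschitz bound at distance \<open>d\<close>, raised to the power
   \<open>q\<close> and integrated over the ball of radius \<open>R + 1\<close>, stays below
   \<open>e\<close>. The cap at 1 keeps the support of the convolution in that ball.\<close>
 define d where "d = min 1 ((e / (2 * (V + 1))) powr (1 / q) / (L + 1))"
 have d: "0 < d" "d <= 1" using e V L(1) by (auto simp: d_def)
 have "inLp q (%x. conv ph et x - ph x) & nrm q (%x. conv ph et x - ph x) < e"
  if d': "0 < d'" "d' <= d" and et: "mollifier d' et" for d' et
 proof -
  have et': "et : Cc" "!!x. 0 <= et x" "!!x. d' < norm x ==> et x = 0" "(LBINT x. et x) = 1"
   using et by (auto simp: mollifier_def)
  have [measurable]: "ph : Bb" "et : Bb" using ph et' by (auto intro: Cc_inf_measurable)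
  have bound: "\<bar>conv ph et x - ph x\<bar> <= L * d' * ind (cball 0 (R + 1)) x" for x
  proof (cases "norm x <= R + 1")
   case True
   have i: "itg (%z. et z * ph (x - z))"
   proof -
    obtain M where M: "0 < M" "!!x. \<bar>ph x\<bar> <= M" using Cc_inf_bounded[OF ph] by blast
    have "itg (%z. M * et z)" using Cc_inf_integrable[OF et'(1)] by simp
    then show ?thesis
    proof (rule L_integrable_bound)
     have "norm (et z * ph (x - z)) <= norm (M * et z)" for z
      using mult_left_mono[OF M(2)[of "x - z"] et'(2)[of z]] et'(2)[of z] M(1) by (simp add: abs_mult mult.commute)
     then show "AE z in lborel. norm (et z * ph (x - z)) <= norm (M * et z)" by blast
    qed measurable
   qed
   have "conv ph et x = (LBINT z. et z * ph (x - z))" using conv_commute[of ph et] by (simp add: conv_def)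
   moreover have "ph x = (LBINT z. et z * ph x)" using et' by simp
   ultimately have "conv ph et x - ph x = (LBINT z. et z * ph (x - z) - et z * ph x)"
    using i Cc_inf_integrable[OF et'(1)] by simp
   also have "\<bar>...\<bar> <= (LBINT z. et z * (L * d'))"
   proof -
    have "norm (et z * ph (x - z) - et z * ph x) <= et z * (L * d')" for z
    proof (cases "d' < norm z")
     case False
     have "\<bar>ph (x - z) - ph x\<bar> <= L * norm z" using L(2)[of "x - z" x] by simp
     also have "... <= L * d'" using False L by (intro mult_left_mono) auto
     finally have "et z * \<bar>ph (x - z) - ph x\<bar> <= et z * (L * d')" using et' by (intro mult_left_mono) auto
     then show ?thesis using et'(2)[of z] by (simp add: abs_mult flip: right_diff_distrib)
    qed (simp add: et')
    then show ?thesis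
     using L_integral_norm_bound_integral[of lborel "%z. et z * ph (x - z) - et z * ph x" "%z. et z * (L * d')"] i Cc_inf_integrable[OF et'(1)] by simp
   qed
   also have "... = L * d'" using et' by simp
   finally show ?thesis using True by simp
  next
   case False
   have "ph z * et (x - z) = 0" for z
   proof (cases "R < norm z")
    case False2: False
    then have "d' < norm (x - z)" using False d d' norm_triangle_ineq2[of x z] by simp
    then show ?thesis by (simp add: et')
   qed (simp add: R)
   then have "conv ph et x = 0" by (simp only: conv_def) simp
   then show ?thesis using False R(2)[of x] by simp
  qed
  have pt: "norm (conv ph et x - ph x) powr q <= (L * d') powr q * ind (cball 0 (R + 1)) x" for x
   using powr_mono2[of q "\<bar>conv ph et x - ph x\<bar>" "L * d' * ind (cball 0 (R + 1)) x"] bound[of x] q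
   by (auto simp: indicator_def split: if_splits)
  have m: "(%x. conv ph et x - ph x) : Bl" by measurable
  note b = pint_bound[OF m integrable_indicator_cball, OF AE_I2, OF pt]
  have "nrm q (%x. conv ph et x - ph x) <= (L * d') powr q * V" using b(2) by (simp add: V_def)
  also have "... <= (e / (2 * (V + 1))) * V"
  proof (intro mult_right_mono V)
   have "L * d' <= (L + 1) * ((e / (2 * (V + 1))) powr (1 / q) / (L + 1))" using d' L(1) by (intro mult_mono) (auto simp: d_def)
   also have "... = (e / (2 * (V + 1))) powr (1 / q)" using L(1) by simp
   finally have "(L * d') powr q <= ((e / (2 * (V + 1))) powr (1 / q)) powr q" using L d' q by (intro powr_mono2) auto
   also have "... = e / (2 * (V + 1))" using e V q by (simp add: powr_powr)
   finally show "(L * d') powr q <= e / (2 * (V + 1))" .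
  qed
  also have "... < e" using e V by (simp add: field_simps add_nonneg_pos)
  finally show ?thesis using b(1) by blast
 qed
 with d that show thesis by blast
qed

text \<open>A test function near \<open>f\<close> is inserted, and convolution with a mollifier does
  not increase the remaining distance. The claim covers all sufficiently narrow mollifiers, so that
  one mollifier can serve several functions simultaneously.\<close>

lemma conv_mollifier_near:
 assumes f: "inLp q f" and q: "1 <= q" and e: "0 < e"
 obtains d where "0 < d" "d <= 1" "!!d' et. 0 < d' ==> d' <= d ==> mollifier d' et ==>
  inLp q (%x. conv f et x - f x) & nrm q (%x. conv f et x - f x) < e"
proof -
 \<comment> \<open>Three error terms, each of which passes through at most two quasi-triangle
   inequalities.\<close>
 define c where "c = e / (3 * 2 powr q * 2 powr q)"
 have c: "0 < c" using e by (simp add: c_def)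
 obtain ph where ph: "ph : Cc" "nrm q (%x. f x - ph x) < c"
  using Cc_inf_dense[OF f] q c by (auto simp: Cc_approx_def)
 obtain d where d: "0 < d" "d <= 1" "!!d' et. 0 < d' ==> d' <= d ==> mollifier d' et ==>
  inLp q (%x. conv ph et x - ph x) & nrm q (%x. conv ph et x - ph x) < c"
  using conv_Cc_inf_near[OF ph(1) _ c, of q] q by auto
 have "inLp q (%x. conv f et x - f x) & nrm q (%x. conv f et x - f x) < e"
  if d': "0 < d'" "d' <= d" and et: "mollifier d' et" for d' et
 proof -
  have et': "et : Cc" "!!x. 0 <= et x" "(LBINT x. et x) = 1"
   using et by (auto simp: mollifier_def)
  have [measurable]: "ph : Bb" "et : Bb" "f : Bb"
   using ph et' f by (auto intro: Cc_inf_measurable simp: pint_def)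
  have phi: "inLp q ph" using ph(1) q by (intro Cc_inf_pint) auto
  have fi: "inLp q (%x. f x - ph x)" using f phi q by (intro pint_diff) auto
  note cf = conv_pint[OF Cc_inf_integrable[OF et'(1)] et'(2,3) f q]
  note cph = conv_pint[OF Cc_inf_integrable[OF et'(1)] et'(2,3) phi q]
  note cd = conv_pint[OF Cc_inf_integrable[OF et'(1)] et'(2,3) fi q]
  have ae: "AE x in lborel. conv et (%x. f x - ph x) x = conv et f x - conv et ph x"
   using cf(5) cph(5)
  proof eventually_elim
   case (elim x)
   then show ?case by (simp add: conv_def right_diff_distrib)
  qed
  have m: "(%x. conv et f x - conv et ph x) : Bl" by measurable
  have 1: "inLp q (%x. conv f et x - conv ph et x)" "nrm q (%x. conv f et x - conv ph et x) <= c"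
   using pint_cong_AE[OF cd(3) m ae] cd(4) ph(2) by (simp_all add: conv_commute[of _ et])
  have 2: "inLp q (%x. conv ph et x - ph x)" "nrm q (%x. conv ph et x - ph x) < c"
   using d(3)[OF d' et] by auto
  have 3: "inLp q (%x. ph x - f x)" "nrm q (%x. ph x - f x) < c"
   using pint_uminus[OF fi] ph(2) pnorm_minus_commute[of lborel q f ph] by simp_all
  have q0: "0 <= q" using q by simp
  have c2: "c <= 2 powr q * c" using c q ge_one_powr_ge_zero[of 2 q] by simp
  have "nrm q (%x. conv f et x - f x) <= 2 powr q * (nrm q (%x. conv f et x - conv ph et x) + nrm q (%x. conv ph et x - f x))"
   using pnorm_triangle(2)[OF 1(1) pnorm_triangle(1)[OF 2(1) 3(1) q0] q0] .
  also have "... <= 2 powr q * (c + 2 powr q * (nrm q (%x. conv ph et x - ph x) + nrm q (%x. ph x - f x)))"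
   using 1 pnorm_triangle(2)[OF 2(1) 3(1) q0] by (intro mult_left_mono add_mono) auto
  also have "... < 2 powr q * (2 powr q * c + 2 powr q * (c + c))"
   using 2 3 c2 by (intro mult_strict_left_mono add_le_less_mono add_strict_mono) auto
  also have "... = e" by (simp add: c_def)
  finally show ?thesis using pnorm_triangle(1)[OF 1(1) pnorm_triangle(1)[OF 2(1) 3(1) q0] q0] by blast
 qed
 with d that show thesis by blast
qed

text \<open>The sign of \<open>h\<close>, cut off to a ball and mollified, is an admissible test
  function. These test functions are bounded by 1, live in a common ball, and converge almost
  everywhere along a subsequence, so dominated convergence gives a vanishing integral of the
  absolute value of \<open>h\<close> over the ball.\<close>

lemma fundamental_lemma:
 assumes h: "loc_int h" and 0: "!!ph. ph : Cc ==> (LBINT x. h x * ph x) = 0"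
 shows "AE x in lborel. h x = 0"
proof -
 have [measurable]: "h : Bb" using h by (simp add: loc_int_def)
 have "AE x in lborel. x : cball 0 (real n) --> h x = 0" for n
 proof -
  define \<sigma> where "\<sigma> x = sgn (h x) * ind (cball 0 (real n)) x" for x
  have [measurable]: "\<sigma> : Bb" unfolding \<sigma>_def by measurable
  have \<sigma>1: "\<bar>\<sigma> x\<bar> <= 1" for x by (auto simp: \<sigma>_def sgn_if indicator_def)
  have \<sigma>i: "inLp 1 \<sigma>"
  proof (rule pint_bound(1)[OF _ integrable_indicator_cball[of 1 "real n"]])
   show "AE x in lborel. norm (\<sigma> x) powr 1 <= 1 * ind (cball 0 (real n)) x"
    by (auto simp: \<sigma>_def sgn_if indicator_def)
  qed auto
  have \<sigma>l: "loc_int \<sigma>" using \<sigma>1 by (intro loc_int_bounded) auto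
  have "EX et. mollifier 1 et & inLp 1 (%x. conv \<sigma> et x - \<sigma> x) & nrm 1 (%x. conv \<sigma> et x - \<sigma> x) < 1 / Suc k" for k
  proof -
   obtain d where d: "0 < d" "d <= 1" "!!d' et. 0 < d' ==> d' <= d ==> mollifier d' et ==>
    inLp 1 (%x. conv \<sigma> et x - \<sigma> x) & nrm 1 (%x. conv \<sigma> et x - \<sigma> x) < 1 / Suc k"
    using conv_mollifier_near[OF \<sigma>i, of "1 / Suc k"] by auto
   obtain et :: "'a => real" where "mollifier d et" using ex_mollifier'[OF d(1)] by blast
   with d show ?thesis by (intro exI[of _ et]) (auto simp: mollifier_def)
  qed
  then obtain et where et: "!!k. mollifier 1 (et k)" "!!k. inLp 1 (%x. conv \<sigma> (et k) x - \<sigma> x)"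
   "!!k. nrm 1 (%x. conv \<sigma> (et k) x - \<sigma> x) < 1 / Suc k" by metis
  have "(%k. nrm 1 (%x. conv \<sigma> (et k) x - \<sigma> x)) ----> 0"
   by (rule tendsto_sandwich[OF _ _ tendsto_const LIMSEQ_inverse_real_of_nat])
    (use et(3) in "auto simp: inverse_eq_divide intro!: always_eventually less_imp_le")
  then obtain r :: "nat => nat" where r: "strict_mono r" "AE x in lborel. (%k. conv \<sigma> (et (r k)) x) ----> \<sigma> x"
   using pnorm_AE_subseq[of lborel 1 "%k. conv \<sigma> (et k)" \<sigma>, OF et(2)] by auto
  have et': "et k : Cc" "0 <= et k x" "(LBINT x. et k x) = 1" for k x
   using et(1)[of k] by (auto simp: mollifier_def)
  have [measurable]: "et k : Bb" for k using Cc_inf_measurable[OF et'(1)] .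
  have c0: "conv \<sigma> (et k) x = 0" if "real n + 1 < norm x" for k x
  proof -
   have "\<sigma> z * et k (x - z) = 0" for z
   proof (cases "norm z <= real n")
    case True
    then have "1 < norm (x - z)" using that norm_triangle_ineq2[of x z] by simp
    then show ?thesis using et(1)[of k] by (simp add: mollifier_def)
   qed (simp add: \<sigma>_def)
   then show ?thesis by (simp only: conv_def) simp
  qed
  have c1: "\<bar>conv \<sigma> (et k) x\<bar> <= 1" for k x
  proof -
   have i: "itg (%z. et k z * \<sigma> (x - z))"
    by (rule L_integrable_bound[OF Cc_inf_integrable[OF et'(1)[of k]]])
     (use \<sigma>1 et' in "auto simp: abs_mult intro!: mult_left_le")
   have "\<bar>conv (et k) \<sigma> x\<bar> <= (LBINT z. et k z)"
    unfolding conv_def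
    using L_integral_norm_bound_integral[OF i Cc_inf_integrable[OF et'(1)[of k]]] \<sigma>1 et'
    by (auto simp: abs_mult intro!: mult_left_le)
   then show ?thesis using et'(3) by (simp add: conv_commute[of \<sigma>])
  qed
  have w: "itg (%x. \<bar>ind (cball 0 (real n + 1)) x * h x\<bar>)" using h by (auto simp: loc_int_def)
  have "(%k. LBINT x. h x * conv \<sigma> (et (r k)) x) ----> (LBINT x. h x * \<sigma> x)"
  proof (rule integral_dominated_convergence[OF _ _ w])
   show "AE x in lborel. (%k. h x * conv \<sigma> (et (r k)) x) ----> h x * \<sigma> x"
    using r(2) by eventually_elim (intro tendsto_mult tendsto_const)
   have "norm (h x * conv \<sigma> (et (r k)) x) <= \<bar>ind (cball 0 (real n + 1)) x * h x\<bar>" for x k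
    using c0[of x "r k"] c1[of "r k" x] by (cases "norm x <= real n + 1") (auto simp: abs_mult intro!: mult_left_le)
   then show "AE x in lborel. norm (h x * conv \<sigma> (et (r k)) x) <= \<bar>ind (cball 0 (real n + 1)) x * h x\<bar>" for k by blast
  qed measurable
  moreover have "(LBINT x. h x * conv \<sigma> (et k) x) = 0" for k
  proof (rule 0)
   show "conv \<sigma> (et k) : Cc"
    by (rule conv_mollifier_Cc_inf[OF \<sigma>l et(1), of "real n"]) (auto simp: \<sigma>_def)
  qed
  ultimately have "(LBINT x. h x * \<sigma> x) = 0" by (simp add: LIMSEQ_const_iff)
  moreover have "h x * \<sigma> x = \<bar>ind (cball 0 (real n)) x * h x\<bar>" for x
   by (auto simp: \<sigma>_def indicator_def sgn_if)
  ultimately have "(LBINT x. \<bar>ind (cball 0 (real n)) x * h x\<bar>) = 0" by simp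
  moreover have "itg (%x. \<bar>ind (cball 0 (real n)) x * h x\<bar>)" using h by (auto simp: loc_int_def)
  ultimately have "AE x in lborel. \<bar>ind (cball 0 (real n)) x * h x\<bar> = 0"
   by (subst (asm) integral_nonneg_eq_0_iff_AE) auto
  then show ?thesis by eventually_elim (auto simp: indicator_def)
 qed
 then have "AE x in lborel. ALL n. x : cball 0 (real n) --> h x = 0" by (subst AE_all_countable) auto
 then show ?thesis
 proof eventually_elim
  case (elim x)
  obtain n :: nat where "norm x <= real n" using real_arch_simple by blast
  then show ?case using elim by auto
 qed
qed

section \<open>Integration by parts and approximation of Sobolev functions\<close>

lemma pint_norm: "pint M p f ==> pint M p (%x. norm (f x))"
 by (auto simp: pint_def)

lemma loc_int_Cc_inf_integrable:
 fixes g :: "'a::euclidean_space => real"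
 assumes g: "loc_int g" and k: "k : Cc"
 shows "itg (%y. g y * k y)"
proof -
 obtain M where M: "!!x. \<bar>k x\<bar> <= M" using Cc_inf_bounded[OF k] by blast
 obtain R where R: "!!x. R < norm x ==> k x = 0" using Cc_inf_support[OF k] by blast
 show ?thesis by (rule loc_int_mult_integrable(1)[OF g Cc_inf_measurable[OF k] M R])
qed

lemma pd_affine:
 assumes "!!x. f differentiable (at x)"
 shows "((%x. f (c *\<^sub>R x + t)) has_derivative (%v. frechet_derivative f (at (c *\<^sub>R x + t)) (c *\<^sub>R v))) (at x)"
  "pd b (%x. f (c *\<^sub>R x + t)) x = c * pd b f (c *\<^sub>R x + t)"
proof -
 have "((%x. c *\<^sub>R x + t) has_derivative (%v. c *\<^sub>R v)) (at x)"
  by (auto intro!: derivative_eq_intros)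
 from has_derivative_compose[OF this assms[unfolded frechet_derivative_works]]
 show *: "((%x. f (c *\<^sub>R x + t)) has_derivative (%v. frechet_derivative f (at (c *\<^sub>R x + t)) (c *\<^sub>R v))) (at x)" .
 have "linear (frechet_derivative f (at (c *\<^sub>R x + t)))" using assms by (rule linear_frechet_derivative)
 then show "pd b (%x. f (c *\<^sub>R x + t)) x = c * pd b f (c *\<^sub>R x + t)"
  using pd_unique[OF *, of b] by (simp add: linear_scale)
qed

lemma smooth_affine:
 assumes "smooth f"
 shows "smooth (%x. f (c *\<^sub>R x + t))"
proof (rule smooth_coinduct[of _ "{%x. a * f (c *\<^sub>R x + t) | a f. smooth f}"])
 show "(%x. f (c *\<^sub>R x + t)) : {%x. a * f (c *\<^sub>R x + t) | a f. smooth f}"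
  using assms by (auto intro!: exI[of _ 1] exI[of _ f])
 have d: "((%x. a * f (c *\<^sub>R x + t)) has_derivative (%v. a * frechet_derivative f (at (c *\<^sub>R x + t)) (c *\<^sub>R v))) (at x)"
  if "smooth f" for a f x
  using has_derivative_mult_right[OF pd_affine(1)[OF smooth_differentiable[OF that]]] .
 then show "g differentiable (at x)" if "g : {%x. a * f (c *\<^sub>R x + t) | a f. smooth f}" for g x
  using that by (auto simp: differentiable_def)
 show "pd b g : {%x. a * f (c *\<^sub>R x + t) | a f. smooth f}" if g: "g : {%x. a * f (c *\<^sub>R x + t) | a f. smooth f}" and b: "b : Basis" for g b
 proof -
  obtain a f where af: "g = (%x. a * f (c *\<^sub>R x + t))" "smooth f" using g by blast
  have "linear (frechet_derivative f (at (c *\<^sub>R x + t)))" for x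
   using smooth_differentiable[OF af(2)] by (rule linear_frechet_derivative)
  then have "pd b g = (%x. (a * c) * pd b f (c *\<^sub>R x + t))"
   using pd_unique[OF d[OF af(2)]] by (auto simp: af(1) linear_scale)
  then show ?thesis using smooth_pd[OF af(2) b] by (intro CollectI exI[of _ "a * c"] exI[of _ "pd b f"] conjI)
 qed
qed

lemma Cc_inf_reflect:
 fixes ph :: "'a::euclidean_space => real"
 assumes "ph : Cc"
 shows "(%y. ph (x - y)) : Cc" "pd b (%y. ph (x - y)) y = - pd b ph (x - y)"
proof -
 obtain R where R: "!!x. R < norm x ==> ph x = 0" using Cc_inf_support[OF assms] by blast
 have s: "smooth (%y. ph (x - y))" using smooth_affine[OF Cc_inf_smooth[OF assms], of "-1" x] by simp
 show "(%y. ph (x - y)) : Cc"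
 proof (rule Cc_infI_ball[OF s, of "R + norm x"])
  fix y :: 'a assume "R + norm x < norm y"
  then have "R < norm (x - y)" using norm_triangle_ineq2[of y x] by (simp add: norm_minus_commute)
  then show "ph (x - y) = 0" by (rule R)
 qed
 show "pd b (%y. ph (x - y)) y = - pd b ph (x - y)"
  using pd_affine(2)[OF smooth_differentiable[OF Cc_inf_smooth[OF assms]], of "-1" x y b] by simp
qed

text \<open>The convolution with the constant one is constant, so its derivative vanishes.\<close>

lemma integral_pd_Cc_inf:
 fixes ph :: "'a::euclidean_space => real"
 assumes "ph : Cc" "b : Basis"
 shows "(LBINT x. pd b ph x) = 0"
proof -
 have m: "ph : Bb" "pd b ph : Bb"
  using Cc_inf_measurable assms Cc_inf_pd by blast+
 have l: "loc_int (%x::'a. 1)" by (rule loc_int_bounded[of _ 1]) auto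
 have c: "conv (%x. 1) f x = (LBINT x. f x)" if "f : Bb" for f :: "'a => real" and x
  using integral_lborel_minus[OF that, of x] by (simp add: conv_def)
 have "pd b (conv (%x. 1) ph) 0 = conv (%x. 1) (pd b ph) 0" using l assms by (rule pd_conv_Cc_inf)
 moreover have "conv (%x. 1) ph = (%x. LBINT x. ph x)" using c[OF m(1)] by auto
 ultimately show ?thesis using c[OF m(2)] by simp
qed

lemma integration_by_parts_Cc_inf:
 assumes "smooth f" "ph : Cc" "b : Basis"
 shows "(LBINT x. pd b f x * ph x) = - (LBINT x. f x * pd b ph x)"
proof -
 have eq: "pd b (%x. f x * ph x) x = f x * pd b ph x + pd b f x * ph x" for x
  using assms smooth_differentiable Cc_inf_smooth by (intro pd_mult) auto
 have i: "itg (%x. f x * pd b ph x)" "itg (%x. pd b f x * ph x)"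
  using assms by (auto intro!: Cc_inf_integrable[of _ UNIV] Cc_inf_mult_smooth Cc_inf_pd smooth_pd)
 have "(LBINT x. pd b (%x. f x * ph x) x) = 0"
  using assms by (intro integral_pd_Cc_inf Cc_inf_mult_smooth)
 then show ?thesis unfolding eq using i by simp
qed

text \<open>Young's inequality for a kernel of arbitrary sign. Since \<open>conv_pint\<close> wants
  a probability density, a mollifier is added to the absolute value of \<open>k\<close>, which keeps
  the total mass \<open>N\<close> positive even for \<open>k = 0\<close>, and the sum is
  normalised.\<close>

lemma conv_Cc_inf_pnorm_le:
 fixes k :: "'a::euclidean_space => real"
 assumes k: "k : Cc" and p: "1 <= p"
 shows "EX C>=0. ALL h. inLp p h --> inLp p (conv h k) & nrm p (conv h k) <= C * nrm p h"
proof -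
 obtain et :: "'a => real" where et: "mollifier 1 et" using ex_mollifier'[of 1] by auto
 have [measurable]: "k : Bb" "et : Bb"
  using k et by (auto simp: mollifier_def intro: Cc_inf_measurable)
 have ki: "itg (%z. \<bar>k z\<bar>)" "itg et" using Cc_inf_integrable[OF k] et by (auto simp: mollifier_def intro: Cc_inf_integrable)
 have et0: "0 <= et z" for z using et by (simp add: mollifier_def)
 define N where "N = (LBINT z. \<bar>k z\<bar>) + 1"
 have N: "0 < N" unfolding N_def by (intro add_nonneg_pos L_integral_nonneg) auto
 define l where "l z = (1 / N) * (\<bar>k z\<bar> + et z)" for z
 have l: "itg l" "!!z. 0 <= l z" "(LBINT z. l z) = 1"
  unfolding l_def using ki et0 N et by (auto simp: N_def mollifier_def)
 have "inLp p (conv h k) & nrm p (conv h k) <= N powr p * nrm p h" if h: "inLp p h" for h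
 proof -
  have [measurable]: "h : Bb" using pint_measurable[OF h] by simp
  note c = conv_pint[OF l h p]
  note cm = pint_cmult[OF c(1), of N]
  have ae: "AE x in lborel. norm (conv h k x) <= norm (N * conv l (%x. \<bar>h x\<bar>) x)" using c(5)
  proof eventually_elim
   case (elim x)
   have i: "itg (%z. N * (l z * \<bar>h (x - z)\<bar>))" using integrable_norm[OF elim] l(2) by (simp add: abs_mult)
   have le: "norm (k z * h (x - z)) <= N * (l z * \<bar>h (x - z)\<bar>)" for z
    using N et0[of z] by (simp add: l_def abs_mult mult_right_mono)
   have "itg (%z. k z * h (x - z))"
    by (rule L_integrable_bound[OF i]) (use order_trans[OF le abs_ge_self] in auto)
   from L_integral_norm_bound_integral[OF this i le]
   have "norm (conv k h x) <= N * conv l (%x. \<bar>h x\<bar>) x" by (simp add: conv_def)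
   moreover have "conv h k = conv k h" by (rule conv_commute) measurable
   ultimately show ?case by simp
  qed
  have m: "conv h k : Bl" by measurable
  have p0: "0 <= p" using p by simp
  have "nrm p (conv h k) <= N powr p * nrm p (conv l (%x. \<bar>h x\<bar>))"
   using pint_mono(2)[OF m cm(1) ae p0] N unfolding cm(2) by simp
  also have "... <= N powr p * nrm p h" using c(2) by (intro mult_left_mono) auto
  finally show ?thesis using pint_mono(1)[OF m cm(1) ae p0] by simp
 qed
 then show ?thesis by (intro exI[of _ "N powr p"]) simp
qed

text \<open>Compact support is obtained without cutting off. The mollifier \<open>et\<close> is
  fixed first; then \<open>g\<close> is replaced by a test function \<open>f\<close> so close to it
  that convolving the difference with \<open>et\<close> or with any \<open>pd b et\<close> is
  negligible, the constant \<open>K\<close> depending on \<open>et\<close> alone. The convolution of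
  \<open>f\<close> and \<open>et\<close> is a test function.\<close>

lemma W1p_approx:
 fixes g :: "'a::euclidean_space => real" and G :: "'a => 'a => real"
 assumes g: "inLp p g" and G: "!!b. b : Basis ==> inLp p (G b)" and p: "1 <= p"
  and weak: "!!ph b. ph : Cc ==> b : Basis ==> (LBINT x. g x * pd b ph x) = - (LBINT x. G b x * ph x)"
  and e: "0 < e"
 shows "EX ph:Cc. nrm p (%x. ph x - g x) < e & (ALL b:Basis. nrm p (%x. pd b ph x - G b x) < e)"
proof -
 have p0: "0 <= p" "0 < p" using p by auto
 define d where "d = e / (2 * 2 powr p)"
 have d: "0 < d" using e by (simp add: d_def)
 obtain d0 where d0: "0 < d0" "d0 <= 1" "!!d' et. 0 < d' ==> d' <= d0 ==> mollifier d' et ==>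
   inLp p (%x. conv g et x - g x) & nrm p (%x. conv g et x - g x) < d"
  using conv_mollifier_near[OF g p d] by auto
 have "ALL b:Basis. EX d1>0. ALL d' et. 0 < d' --> d' <= d1 --> mollifier d' et -->
   inLp p (%x. conv (G b) et x - G b x) & nrm p (%x. conv (G b) et x - G b x) < d"
 proof
  fix b :: 'a assume b: "b : Basis"
  obtain d1 where "0 < d1" "d1 <= 1" "!!d' et. 0 < d' ==> d' <= d1 ==> mollifier d' et ==>
   inLp p (%x. conv (G b) et x - G b x) & nrm p (%x. conv (G b) et x - G b x) < d"
   using conv_mollifier_near[OF G[OF b] p d] by auto
  then show "EX d1>0. ALL d' et. 0 < d' --> d' <= d1 --> mollifier d' et -->
   inLp p (%x. conv (G b) et x - G b x) & nrm p (%x. conv (G b) et x - G b x) < d"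
   by (intro exI[of _ d1]) auto
 qed
 from bchoice[OF this] obtain d1 where d1: "!!b. b : Basis ==> 0 < d1 b" "!!b d' et. b : Basis ==> 0 < d' ==> d' <= d1 b ==> mollifier d' et ==>
   inLp p (%x. conv (G b) et x - G b x) & nrm p (%x. conv (G b) et x - G b x) < d"
  by blast
 define dd where "dd = min d0 (Min (d1 ` Basis))"
 have dd: "0 < dd" "dd <= d0" "!!b. b : Basis ==> dd <= d1 b"
  using d0(1) d1(1) by (auto simp: dd_def min_le_iff_disj)
 obtain et :: "'a => real" where et: "mollifier dd et" using ex_mollifier'[OF dd(1)] by blast
 have etC: "et : Cc" using et by (simp add: mollifier_def)
 obtain C0 where C0: "0 <= C0" "!!h. inLp p h ==> inLp p (conv h et) & nrm p (conv h et) <= C0 * nrm p h"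
  using conv_Cc_inf_pnorm_le[OF etC p] by auto
 have "ALL b:Basis. EX C>=0. ALL h. inLp p h --> inLp p (conv h (pd b et)) & nrm p (conv h (pd b et)) <= C * nrm p h"
  using conv_Cc_inf_pnorm_le[OF Cc_inf_pd[OF etC] p] by blast
 from bchoice[OF this] obtain C1 where C1: "!!b. b : Basis ==> 0 <= C1 b"
  "!!b h. b : Basis ==> inLp p h ==> inLp p (conv h (pd b et)) & nrm p (conv h (pd b et)) <= C1 b * nrm p h"
  by blast
 define K where "K = C0 + sum C1 Basis + 1"
 have K: "0 < K" "C0 <= K" "C1 b <= K" if "b : Basis" for b
  using C0(1) C1(1) that sum_nonneg[of Basis C1] member_le_sum[of b Basis C1] by (auto simp: K_def)
 have K0: "0 < K" "C0 <= K" using C0(1) C1(1) sum_nonneg[of Basis C1] by (auto simp: K_def)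
 have "0 < d / K" using d K0 by simp
 then obtain f where f: "f : Cc" "nrm p (%x. g x - f x) < d / K"
  using Cc_inf_dense[OF g p0(2)] unfolding Cc_approx_def by blast
 define h where "h x = g x - f x" for x
 have fp: "inLp p f" by (rule Cc_inf_pint[OF f(1) p0(2)])
 have h: "inLp p h" unfolding h_def using pint_diff(1)[OF g fp p0(1)] .
 have hK: "K * nrm p h < d" using f(2) K0 by (simp add: h_def[abs_def] pos_less_divide_eq mult.commute)
 have lg: "loc_int g" and lf: "loc_int f" by (rule loc_int_pint[OF g p], rule loc_int_pint[OF fp p])
 have cd: "conv f k x = conv g k x - conv h k x" if k: "k : Cc" for k x
  using loc_int_Cc_inf_integrable[OF lg Cc_inf_reflect(1)[OF k]] loc_int_Cc_inf_integrable[OF lf Cc_inf_reflect(1)[OF k]]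
  by (simp add: conv_def h_def left_diff_distrib)
 have near: "nrm p (%x. f1 x - f2 x) < e"
  if f1: "inLp p f1" "nrm p f1 < d" and f2: "inLp p f2" "nrm p f2 <= K * nrm p h" for f1 f2 :: "'a => real"
 proof -
  have "nrm p (%x. f1 x - f2 x) <= 2 powr p * (nrm p f1 + nrm p f2)" by (rule pint_diff(2)[OF f1(1) f2(1) p0(1)])
  also have "... < 2 powr p * (d + d)" using f1(2) f2(2) hK by (intro mult_strict_left_mono add_strict_mono) auto
  also have "... = e" by (simp add: d_def)
  finally show ?thesis .
 qed
 \<comment> \<open>The weak derivative is tested against the reflected mollifier
   \<open>%y. et (x - y)\<close>, whose derivative supplies the compensating sign.\<close>
 have grad: "conv g (pd b et) x = conv (G b) et x" if b: "b : Basis" for b x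
  using weak[OF Cc_inf_reflect(1)[OF etC, of x] b] unfolding Cc_inf_reflect(2)[OF etC] by (simp add: conv_def)
 obtain R where R: "!!x. R < norm x ==> f x = 0" using Cc_inf_support[OF f(1)] by blast
 show ?thesis
 proof (intro bexI[of _ "conv f et"] conjI ballI)
  show "conv f et : Cc" by (rule conv_mollifier_Cc_inf[OF lf et R])
  have "conv f et x - g x = (conv g et x - g x) - conv h et x" for x by (simp add: cd[OF etC])
  moreover have "nrm p (%x. (conv g et x - g x) - conv h et x) < e"
   using d0(3)[OF dd(1,2) et] C0(2)[OF h] mult_right_mono[OF K0(2) pnorm_nonneg[of lborel p h]] by (intro near) auto
  ultimately show "nrm p (%x. conv f et x - g x) < e" by (simp only:)
  fix b :: 'a assume b: "b : Basis"
  have "pd b (conv f et) x - G b x = (conv (G b) et x - G b x) - conv h (pd b et) x" for x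
   unfolding pd_conv_Cc_inf[OF lf etC b] cd[OF Cc_inf_pd[OF etC b]] grad[OF b] by simp
  moreover have "nrm p (%x. (conv (G b) et x - G b x) - conv h (pd b et) x) < e"
   using d1(2)[OF b dd(1) dd(3)[OF b] et] C1(2)[OF b h] mult_right_mono[OF K(3)[OF b] pnorm_nonneg[of lborel p h]] by (intro near) auto
  ultimately show "nrm p (%x. pd b (conv f et) x - G b x) < e" by (simp only:)
 qed
qed

section \<open>The heat kernel\<close>

text \<open>The Gauss kernel of the heat equation with generator the Laplacian, unhalved. The next
  two functions are its derivative in direction \<open>b\<close> (\<open>pd_hk\<close>) and its time
  derivative, which is also its Laplacian (\<open>hk_has_time_derivative\<close>,
  \<open>ht_eq\<close>).\<close>

definition hk :: "real => 'a::euclidean_space => real" where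
 "hk t z = (4 * pi * t) powr (- (real DIM('a) / 2)) * exp (- (z \<bullet> z) / (4 * t))"

definition hg :: "'a::euclidean_space => real => 'a => real" where
 "hg b t z = - (z \<bullet> b) / (2 * t) * hk t z"

definition ht :: "real => 'a::euclidean_space => real" where
 "ht t z = ((z \<bullet> z) / (4 * t\<^sup>2) - real DIM('a) / (2 * t)) * hk t z"

lemma hk_measurable [measurable]:
 assumes [measurable]: "f : borel_measurable M" "g : borel_measurable M"
 shows "(%x. hk (f x) (g x)) : borel_measurable M"
 unfolding hk_def by measurable

lemma hg_measurable [measurable]:
 assumes [measurable]: "f : borel_measurable M" "g : borel_measurable M"
 shows "(%x. hg b (f x) (g x)) : borel_measurable M"
 unfolding hg_def by measurable

lemma ht_measurable [measurable]:
 assumes [measurable]: "f : borel_measurable M" "g : borel_measurable M"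
 shows "(%x. ht (f x) (g x)) : borel_measurable M"
 unfolding ht_def by measurable

lemma hk_nonneg [simp]: "0 <= hk t z"
 by (simp add: hk_def)

lemma hk_integral:
 assumes "0 < t"
 shows "itg (hk t :: 'a::euclidean_space => real)" "(LBINT z. hk t (z :: 'a)) = 1"
proof -
 have eq: "hk t z = (\<Prod>b\<in>Basis. normal_density 0 (sqrt (2 * t)) (z \<bullet> b))" for z :: 'a
 proof -
  have "(\<Prod>b\<in>Basis. normal_density 0 (sqrt (2 * t)) (z \<bullet> b)) =
   (1 / sqrt (4 * pi * t)) ^ DIM('a) * (\<Prod>b\<in>Basis. exp (- (z \<bullet> b)\<^sup>2 / (4 * t)))"
  proof -
   have "normal_density 0 (sqrt (2 * t)) x = (1 / sqrt (4 * pi * t)) * exp (- x\<^sup>2 / (4 * t))" for x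
    using assms by (simp add: normal_density_def mult.assoc)
   then show ?thesis by (simp only: prod.distrib prod_constant)
  qed
  also have "(\<Prod>b\<in>Basis. exp (- (z \<bullet> b)\<^sup>2 / (4 * t))) = exp (SUM b:Basis. - (z \<bullet> b)\<^sup>2 / (4 * t))"
   by (simp add: exp_sum)
  also have "(SUM b:Basis. - (z \<bullet> b)\<^sup>2 / (4 * t)) = - (z \<bullet> z) / (4 * t)"
   by (simp add: euclidean_inner[of z z] power2_eq_square sum_divide_distrib sum_negf)
  also have "(1 / sqrt (4 * pi * t)) ^ DIM('a) = (4 * pi * t) powr (- (real DIM('a) / 2))"
  proof -
   have "1 / sqrt (4 * pi * t) = (4 * pi * t) powr (- (1 / 2))"
    using assms by (simp only: powr_minus_divide) (simp add: powr_half_sqrt)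
   moreover have "((4 * pi * t) powr (- (1 / 2))) ^ DIM('a) = (4 * pi * t) powr (- (1 / 2) * real DIM('a))"
    using assms by (subst powr_power) auto
   ultimately show ?thesis by (simp add: field_simps)
  qed
  finally show ?thesis by (simp add: hk_def)
 qed
 have "(\<integral>\<^sup>+z. ennreal (hk t (z :: 'a)) \<partial>lborel) = (\<integral>\<^sup>+z. (\<Prod>b\<in>(Basis::'a set). ennreal (normal_density 0 (sqrt (2 * t)) (z \<bullet> b))) \<partial>lborel)"
  by (simp add: eq prod_ennreal)
 also have "... = (\<Prod>b\<in>(Basis::'a set). \<integral>\<^sup>+x. ennreal (normal_density 0 (sqrt (2 * t)) x) \<partial>lborel)"
  by (rule nn_integral_lborel_prod) auto
 also have "(\<integral>\<^sup>+x. ennreal (normal_density 0 (sqrt (2 * t)) x) \<partial>lborel) = 1"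
  using assms by (subst nn_integral_eq_integral) auto
 finally have nn: "(\<integral>\<^sup>+z. ennreal (hk t (z :: 'a)) \<partial>lborel) = 1" by simp
 show "itg (hk t :: 'a => real)"
  by (rule integrableI_nonneg) (use nn in auto)
 show "(LBINT z. hk t (z :: 'a)) = 1"
  using nn by (subst integral_eq_nn_integral) auto
qed

lemma hk_le: "hk t (z::'a::euclidean_space) <= (4 * pi * t) powr (- (real DIM('a) / 2))" if "0 < t"
 unfolding hk_def using that by (intro mult_left_le) (auto simp: divide_nonpos_pos)

text \<open>Half of the Gaussian exponent is split off. It absorbs the polynomial factors of
  \<open>hg\<close> and \<open>ht\<close>, so that both are bounded by powers of \<open>t\<close>
  times the kernel at the doubled time.\<close>

lemma hk_double:
 assumes "0 < t"
 shows "hk t (z::'a::euclidean_space) = 2 powr (real DIM('a) / 2) * exp (- (z \<bullet> z) / (8 * t)) * hk (2 * t) z"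
proof -
 have "(4 * pi * t) powr (- (real DIM('a) / 2)) = (1/2 * (4 * pi * (2 * t))) powr (- (real DIM('a) / 2))" by (simp add: mult.assoc)
 also have "... = (1/2) powr (- (real DIM('a) / 2)) * (4 * pi * (2 * t)) powr (- (real DIM('a) / 2))"
  by (rule powr_mult)
 also have "(1/2) powr (- (real DIM('a) / 2)) = 2 powr (real DIM('a) / 2)"
  by (simp add: powr_minus powr_divide)
 finally have 1: "(4 * pi * t) powr (- (real DIM('a) / 2)) = 2 powr (real DIM('a) / 2) * (4 * pi * (2 * t)) powr (- (real DIM('a) / 2))" .
 have "- (z \<bullet> z) / (4 * t) = - (z \<bullet> z) / (8 * t) + - (z \<bullet> z) / (4 * (2 * t))" using assms by (simp add: field_simps)
 then have 2: "exp (- (z \<bullet> z) / (4 * t)) = exp (- (z \<bullet> z) / (8 * t)) * exp (- (z \<bullet> z) / (4 * (2 * t)))" by (simp only: exp_add)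
 show ?thesis unfolding hk_def 1 2 by (simp only: ac_simps)
qed

lemma hg_bound:
 assumes "0 < t" "b : Basis"
 shows "\<bar>hg b t (z::'a::euclidean_space)\<bar> <= 2 powr (real DIM('a) / 2) * t powr (- (1/2)) * hk (2 * t) z"
proof -
 define y where "y = norm z / sqrt t"
 have y: "0 <= y" "y\<^sup>2 = (z \<bullet> z) / t" using assms by (auto simp: y_def power_divide power2_norm_eq_inner)
 \<comment> \<open>Completing this square bounds \<open>y / 2\<close> by
   \<open>1 + y ^ 2 / 16\<close>, hence by the exponential of \<open>y ^ 2 / 8\<close>.\<close>
 have "0 <= (1 - y / 4)\<^sup>2" by simp
 then have "y / 2 <= 1 + y\<^sup>2 / 16" by (simp add: power2_eq_square algebra_simps)
 also have "... <= 1 + y\<^sup>2 / 8" by simp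
 also have "... <= exp (y\<^sup>2 / 8)" by (rule exp_ge_add_one_self)
 finally have 1: "y / 2 * exp (- (y\<^sup>2 / 8)) <= 1" by (simp add: exp_minus field_simps)
 have "\<bar>z \<bullet> b\<bar> / (2 * t) * exp (- (z \<bullet> z) / (8 * t)) <= norm z / (2 * t) * exp (- (z \<bullet> z) / (8 * t))"
  using assms Basis_le_norm[OF assms(2), of z] by (intro mult_right_mono divide_right_mono) auto
 also have "... = t powr (- (1/2)) * (y / 2 * exp (- (y\<^sup>2 / 8)))"
 proof -
  have "norm z / (2 * t) = t powr (- (1/2)) * (y / 2)"
   using assms by (simp add: y_def powr_minus_divide powr_half_sqrt)
  moreover have "- (z \<bullet> z) / (8 * t) = - (y\<^sup>2 / 8)" by (simp add: y)
  ultimately show ?thesis by (simp only: mult.assoc)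
 qed
 also have "... <= t powr (- (1/2)) * 1" using 1 by (intro mult_left_mono) auto
 finally have 2: "\<bar>z \<bullet> b\<bar> / (2 * t) * exp (- (z \<bullet> z) / (8 * t)) <= t powr (- (1/2))" by simp
 have "\<bar>hg b t z\<bar> = (\<bar>z \<bullet> b\<bar> / (2 * t) * exp (- (z \<bullet> z) / (8 * t))) * (2 powr (real DIM('a) / 2) * hk (2 * t) z)"
  unfolding hg_def hk_double[OF assms(1)] using assms by (simp add: abs_mult)
 also have "... <= t powr (- (1/2)) * (2 powr (real DIM('a) / 2) * hk (2 * t) z)"
  by (intro mult_right_mono 2) auto
 finally show ?thesis by (simp add: ac_simps)
qed

lemma ht_bound:
 assumes "0 < t"
 shows "\<bar>ht t (z::'a::euclidean_space)\<bar> <= 2 powr (real DIM('a) / 2) * (2 + real DIM('a)) * t powr (- 1) * hk (2 * t) z"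
proof -
 define y where "y = (z \<bullet> z) / t"
 have y: "0 <= y" using assms by (auto simp: y_def)
 have e1: "exp (- (y / 8)) <= 1" using y by simp
 have "y / 8 <= exp (y / 8)" using exp_ge_add_one_self[of "y / 8"] by linarith
 then have e2: "y / 4 * exp (- (y / 8)) <= 2" by (simp add: exp_minus field_simps)
 have "\<bar>(z \<bullet> z) / (4 * t\<^sup>2) - real DIM('a) / (2 * t)\<bar> <= \<bar>(z \<bullet> z) / (4 * t\<^sup>2)\<bar> + \<bar>real DIM('a) / (2 * t)\<bar>"
  by (rule abs_triangle_ineq4)
 also have "... = t powr (- 1) * (y / 4 + real DIM('a) / 2)"
  using assms by (simp add: y_def powr_minus field_simps power2_eq_square)
 finally have "\<bar>(z \<bullet> z) / (4 * t\<^sup>2) - real DIM('a) / (2 * t)\<bar> * exp (- (y / 8)) <= t powr (- 1) * (y / 4 + real DIM('a) / 2) * exp (- (y / 8))"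
  by (intro mult_right_mono) auto
 also have "... = t powr (- 1) * (y / 4 * exp (- (y / 8)) + real DIM('a) / 2 * exp (- (y / 8)))" by (simp add: algebra_simps)
 also have "... <= t powr (- 1) * (2 + real DIM('a) * 1)"
  using e1 e2 by (intro mult_left_mono add_mono mult_mono) auto
 finally have 2: "\<bar>(z \<bullet> z) / (4 * t\<^sup>2) - real DIM('a) / (2 * t)\<bar> * exp (- (y / 8)) <= t powr (- 1) * (2 + real DIM('a))" by simp
 have "\<bar>ht t z\<bar> = (\<bar>(z \<bullet> z) / (4 * t\<^sup>2) - real DIM('a) / (2 * t)\<bar> * exp (- (y / 8))) * (2 powr (real DIM('a) / 2) * hk (2 * t) z)"
  unfolding ht_def hk_double[OF assms(1)] by (simp add: abs_mult y_def)
 also have "... <= t powr (- 1) * (2 + real DIM('a)) * (2 powr (real DIM('a) / 2) * hk (2 * t) z)"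
  by (intro mult_right_mono 2) auto
 finally show ?thesis by (simp add: ac_simps)
qed

lemma hg_integrable:
 assumes "0 < t" "b : Basis"
 shows "itg (hg b t)" "(LBINT z. \<bar>hg b t (z::'a::euclidean_space)\<bar>) <= 2 powr (real DIM('a) / 2) * t powr (- (1/2))"
proof -
 have i: "itg (%z::'a. 2 powr (real DIM('a) / 2) * t powr (- (1/2)) * hk (2 * t) z)"
  using assms hk_integral(1)[of "2 * t"] by (intro integrable_mult_right) auto
 show I: "itg (hg b t)"
  by (rule L_integrable_bound[OF i]) (use order_trans[OF hg_bound[OF assms] abs_ge_self] in auto)
 have "(LBINT z. \<bar>hg b t z\<bar>) <= (LBINT z. 2 powr (real DIM('a) / 2) * t powr (- (1/2)) * hk (2 * t) (z::'a))"
  using I i hg_bound[OF assms] by (intro integral_mono) auto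
 then show "(LBINT z. \<bar>hg b t (z::'a::euclidean_space)\<bar>) <= 2 powr (real DIM('a) / 2) * t powr (- (1/2))"
  using assms hk_integral(2)[of "2 * t", where 'a = 'a] by simp
qed

lemma smooth_exp: "smooth f ==> smooth (%x. exp (f x))"
 by (rule smooth_compose[of exp "{exp}"]) (auto intro!: DERIV_exp)

lemma hk_smooth: "smooth (hk t)"
proof -
 have eq: "hk t = (%z::'a. (4 * pi * t) powr (- (real DIM('a) / 2)) * exp ((- 1 / (4 * t)) * (z \<bullet> z)))"
  by (auto simp: hk_def)
 show ?thesis unfolding eq by (intro smooth_cmult smooth_exp smooth_norm_sq)
qed

lemma hg_smooth: "smooth (hg b t)"
proof -
 have eq: "hg b t = (%z. (- 1 / (2 * t)) * (z \<bullet> b) * hk t z)" by (auto simp: hg_def)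
 show ?thesis unfolding eq by (intro smooth_mult smooth_cmult smooth_inner hk_smooth)
qed

lemma hk_has_derivative: "0 < t ==> (hk t has_derivative (%v. hg v t z)) (at z)"
 unfolding hk_def hg_def
 by (auto intro!: derivative_eq_intros simp: inner_commute algebra_simps add_divide_distrib)

lemma pd_hk: "0 < t ==> pd b (hk t) z = hg b t z"
 using hk_has_derivative[of t z] by (auto dest: pd_unique)

lemma pd_hg:
 assumes "0 < t"
 shows "pd b (hg c t) z = - (b \<bullet> c) / (2 * t) * hk t z - (z \<bullet> c) / (2 * t) * hg b t z"
proof -
 have "(hg c t has_derivative (%v. - (v \<bullet> c) / (2 * t) * hk t z - (z \<bullet> c) / (2 * t) * hg v t z)) (at z)"
  unfolding hg_def[of c, abs_def]
  using assms by (auto intro!: derivative_eq_intros hk_has_derivative simp: field_simps)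
 then show ?thesis by (rule pd_unique)
qed

lemma ht_eq: "0 < t ==> ht t z = (SUM b:Basis. pd b (hg b t) z)"
proof -
 assume t: "0 < t"
 have "(SUM b:Basis. pd b (hg b t) z) = (SUM b:(Basis::'a set). - 1 / (2 * t) * hk t z + (z \<bullet> b) * (z \<bullet> b) * (hk t z / (4 * t\<^sup>2)))"
  unfolding pd_hg[OF t] using t by (intro sum.cong) (auto simp: hg_def power2_eq_square)
 also have "... = ht t z"
 proof -
  have "(SUM b:(Basis::'a set). - 1 / (2 * t) * hk t z + (z \<bullet> b) * (z \<bullet> b) * (hk t z / (4 * t\<^sup>2)))
   = real DIM('a) * (- 1 / (2 * t) * hk t z) + (z \<bullet> z) * (hk t z / (4 * t\<^sup>2))"
   unfolding euclidean_inner[of z z] by (simp only: sum.distrib sum_constant sum_distrib_right)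
  then show ?thesis by (simp add: ht_def algebra_simps)
 qed
 finally show ?thesis by simp
qed

lemma hk_has_time_derivative:
 assumes "0 < t"
 shows "((%t. hk t (z::'a::euclidean_space)) has_real_derivative ht t z) (at t)"
proof -
 have p: "((%t. (4 * pi * t) powr (- (real DIM('a) / 2))) has_real_derivative (- (real DIM('a) / (2 * t)) * (4 * pi * t) powr (- (real DIM('a) / 2)))) (at t)"
 proof -
  define a where "a = - (real DIM('a) / 2)"
  have "((%t. (4 * pi * t) powr a) has_real_derivative (a * (4 * pi * t) powr (a - 1) * (4 * pi))) (at t)"
   using assms by (auto intro!: derivative_eq_intros)
  moreover have "a * (4 * pi * t) powr (a - 1) * (4 * pi) = - (real DIM('a) / (2 * t)) * (4 * pi * t) powr a"
   using assms by (simp add: powr_diff a_def)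
  ultimately show ?thesis by (simp add: a_def)
 qed
 have e: "((%t. exp (- (z \<bullet> z) / (4 * t))) has_real_derivative (z \<bullet> z) / (4 * t\<^sup>2) * exp (- (z \<bullet> z) / (4 * t))) (at t)"
  using assms by (auto intro!: derivative_eq_intros simp: field_simps power2_eq_square)
 show ?thesis unfolding hk_def[abs_def] ht_def
  by (rule DERIV_cong[OF DERIV_mult[OF p e]]) (simp add: algebra_simps)
qed

text \<open>Completing the square in \<open>z\<close>: the product of the two Gaussians is the
  Gaussian of time \<open>t + r\<close> in \<open>w\<close> times a Gaussian of time
  \<open>m\<close> in \<open>z\<close>, centred at \<open>c *\<^sub>R w\<close> and of unit
  mass.\<close>

lemma hk_semigroup:
 assumes "0 < t" "0 < r"
 shows "(LBINT z. hk t z * hk r (w - z)) = hk (t + r) (w::'a::euclidean_space)"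
  "itg (%z. hk t z * hk r (w - z))"
proof -
 define c where "c = t / (t + r)"
 define m where "m = t * r / (t + r)"
 have m: "0 < m" using assms by (simp add: m_def)
 have eq: "hk t z * hk r (w - z) = hk (t + r) w * hk m (z - c *\<^sub>R w)" for z :: 'a
 proof -
  have 1: "(z \<bullet> z) / (4 * t) + ((w - z) \<bullet> (w - z)) / (4 * r) = (w \<bullet> w) / (4 * (t + r)) + ((z - c *\<^sub>R w) \<bullet> (z - c *\<^sub>R w)) / (4 * m)"
  proof -
   have tr: "t + r ~= 0" "t ~= 0" "r ~= 0" using assms by auto
   have "a / (4 * t) + (d - 2 * e + a) / (4 * r) = d / (4 * (t + r)) + (a - 2 * c * e + c * c * d) / (4 * m)" for a d e
    using tr unfolding c_def m_def by (simp add: divide_simps) (simp add: algebra_simps)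
   from this[of "z \<bullet> z" "w \<bullet> w" "z \<bullet> w"] show ?thesis
    by (simp add: inner_diff_left inner_diff_right inner_commute algebra_simps)
  qed
  have "exp (- (z \<bullet> z) / (4 * t)) * exp (- ((w - z) \<bullet> (w - z)) / (4 * r)) = exp (- ((z \<bullet> z) / (4 * t) + ((w - z) \<bullet> (w - z)) / (4 * r)))"
   by (simp add: exp_add[symmetric])
  also have "... = exp (- (w \<bullet> w) / (4 * (t + r))) * exp (- ((z - c *\<^sub>R w) \<bullet> (z - c *\<^sub>R w)) / (4 * m))"
   unfolding 1 by (simp add: exp_add[symmetric])
  finally have e: "exp (- (z \<bullet> z) / (4 * t)) * exp (- ((w - z) \<bullet> (w - z)) / (4 * r)) = exp (- (w \<bullet> w) / (4 * (t + r))) * exp (- ((z - c *\<^sub>R w) \<bullet> (z - c *\<^sub>R w)) / (4 * m))" .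
  have "(4 * pi * t) * (4 * pi * r) = (4 * pi * (t + r)) * (4 * pi * m)"
   using assms by (simp add: m_def field_simps)
  then have p: "(4 * pi * t) powr a * (4 * pi * r) powr a = (4 * pi * (t + r)) powr a * (4 * pi * m) powr a" for a
   by (simp only: powr_mult[symmetric])
  have "hk t z * hk r (w - z) = ((4 * pi * t) powr (- (real DIM('a) / 2)) * (4 * pi * r) powr (- (real DIM('a) / 2)))
   * (exp (- (z \<bullet> z) / (4 * t)) * exp (- ((w - z) \<bullet> (w - z)) / (4 * r)))"
   unfolding hk_def by (simp only: ac_simps)
  also have "... = hk (t + r) w * hk m (z - c *\<^sub>R w)"
   unfolding e p hk_def by (simp only: ac_simps)
  finally show ?thesis .
 qed
 have i: "itg (%z. hk m (z - c *\<^sub>R w))" "(LBINT z. hk m (z - c *\<^sub>R w)) = 1"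
  using integrable_lborel_shift'[of "hk m" "c *\<^sub>R w"] integral_lborel_shift'[of "hk m" "c *\<^sub>R w"] hk_integral[OF m, where 'a = 'a] by auto
 show "(LBINT z. hk t z * hk r (w - z)) = hk (t + r) w" "itg (%z. hk t z * hk r (w - z))"
  unfolding eq using i by simp_all
qed

section \<open>Power integrals and convolution with heat kernels\<close>

lemma powr_integrable_0:
 fixes a c :: real
 assumes "-1 < a" "0 < c"
 shows "itg (%t. ind {0<..c} t * t powr a)"
  "(LBINT t. ind {0<..c} t * t powr a) = c powr (a + 1) / (a + 1)"
proof -
 have "(\<integral>\<^sup>+t. ennreal (ind {0..c} t * t powr a) \<partial>lborel) = ennreal (c powr (a + 1) / (a + 1))"
  using assms by (intro nn_integral_has_integral_lebesgue has_integral_powr_from_0) auto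
 moreover have "ind {0..c} t * t powr a = ind {0<..c} t * t powr a" for t
  by (auto simp: indicator_def)
 ultimately have nn: "(\<integral>\<^sup>+t. ennreal (ind {0<..c} t * t powr a) \<partial>lborel) = ennreal (c powr (a + 1) / (a + 1))" by simp
 show "itg (%t. ind {0<..c} t * t powr a)"
  by (rule integrableI_nonneg) (use nn in auto)
 show "(LBINT t. ind {0<..c} t * t powr a) = c powr (a + 1) / (a + 1)"
  using nn assms by (subst integral_eq_nn_integral) auto
qed

lemma powr_integrable_inf:
 fixes a c :: real
 assumes "a < -1" "0 < c"
 shows "itg (%t. ind {c..} t * t powr a)"
  "(LBINT t. ind {c..} t * t powr a) = - (c powr (a + 1)) / (a + 1)"
proof -
 have 0: "0 <= - (c powr (a + 1)) / (a + 1)" using assms by (simp add: divide_nonneg_neg divide_nonpos_neg)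
 have nn: "(\<integral>\<^sup>+t. ennreal (ind {c..} t * t powr a) \<partial>lborel) = ennreal (- (c powr (a + 1)) / (a + 1))"
  using assms by (intro nn_integral_has_integral_lebesgue has_integral_powr_to_inf) auto
 show "itg (%t. ind {c..} t * t powr a)"
  by (rule integrableI_nonneg) (use nn in auto)
 show "(LBINT t. ind {c..} t * t powr a) = - (c powr (a + 1)) / (a + 1)"
  using nn 0 by (subst integral_eq_nn_integral) auto
qed

lemma (in pair_sigma_finite) integrable_product_bound:
 fixes F :: "'a \<times> 'b => real"
 assumes [measurable]: "F : borel_measurable (M1 \<Otimes>\<^sub>M M2)"
  and a: "integrable M1 a" and b: "integrable M2 b" and le: "!!x y. \<bar>F (x, y)\<bar> <= a x * b y"
 shows "integrable (M1 \<Otimes>\<^sub>M M2) F"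
proof (rule Fubini_integrable)
 have [measurable]: "a : borel_measurable M1" "b : borel_measurable M2" using a b by auto
 have I: "integrable M2 (%y. F (x, y))" if "x : space M1" for x
  by (rule L_integrable_bound[of M2 "%y. a x * b y"])
   (use that b le in "auto intro: order_trans[OF _ abs_ge_self]")
 then show "AE x in M1. integrable M2 (%y. F (x, y))" by auto
 show "integrable M1 (%x. LINT y|M2. norm (F (x, y)))"
 proof (rule L_integrable_bound)
  show "integrable M1 (%x. a x * (LINT y|M2. b y))" using a by simp
  show "AE x in M1. norm (LINT y|M2. norm (F (x, y))) <= norm (a x * (LINT y|M2. b y))"
  proof (intro AE_I2)
   fix x assume x: "x : space M1"
   have "(LINT y|M2. norm (F (x, y))) <= (LINT y|M2. a x * b y)"
    using I[OF x] b le by (intro integral_mono) auto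
   then show "norm (LINT y|M2. norm (F (x, y))) <= norm (a x * (LINT y|M2. b y))"
    using L_integral_nonneg[of M2 "%y. norm (F (x, y))"] by simp
  qed
 qed measurable
qed measurable

lemma conv_bounded:
 fixes k f :: "'a::euclidean_space => real"
 assumes k: "itg k" and f [measurable]: "f : Bb" and M: "!!x. \<bar>f x\<bar> <= M"
 shows "itg (%z. k z * f (x - z))" "\<bar>conv k f x\<bar> <= M * (LBINT z. \<bar>k z\<bar>)"
proof -
 have [measurable]: "k : Bb" using k by auto
 have le: "norm (k z * f (x - z)) <= M * \<bar>k z\<bar>" for z
  using mult_left_mono[OF M[of "x - z"], of "\<bar>k z\<bar>"] by (simp add: abs_mult mult.commute)
 have i: "itg (%z. M * \<bar>k z\<bar>)" using k by auto
 show I: "itg (%z. k z * f (x - z))"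
  by (rule L_integrable_bound[OF i]) (use order_trans[OF le abs_ge_self] in auto)
 show "\<bar>conv k f x\<bar> <= M * (LBINT z. \<bar>k z\<bar>)"
  using L_integral_norm_bound_integral[OF I i] le by (simp add: conv_def)
qed

lemma conv_conv_commute:
 fixes k l f :: "'a::euclidean_space => real"
 assumes k: "itg k" and l: "itg l"
  and f [measurable]: "f : Bb" and M: "!!x. \<bar>f x\<bar> <= M"
 shows "conv k (conv l f) x = conv l (conv k f) x"
proof -
 have [measurable]: "k : Bb" "l : Bb" using k l by auto
 have i: "integrable (lborel \<Otimes>\<^sub>M lborel) (%(z, w). k z * (l w * f (x - z - w)))"
 proof (rule lborel_pair.integrable_product_bound[where a = "%z. M * \<bar>k z\<bar>" and b = "%w. \<bar>l w\<bar>"])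
  fix z w
  show "\<bar>case (z, w) of (z, w) => k z * (l w * f (x - z - w))\<bar> <= M * \<bar>k z\<bar> * \<bar>l w\<bar>"
   using mult_left_mono[OF M[of "x - z - w"], of "\<bar>k z\<bar> * \<bar>l w\<bar>"] by (simp add: abs_mult ac_simps)
 qed (use k l in auto)
 have "conv k (conv l f) x = (LBINT z. LBINT w. k z * (l w * f (x - z - w)))"
  by (simp add: conv_def)
 also have "... = (LBINT w. LBINT z. k z * (l w * f (x - z - w)))"
  using lborel_pair.Fubini_integral[OF i] by simp
 also have "... = (LBINT w. LBINT z. l w * (k z * f (x - w - z)))"
  by (simp add: ac_simps diff_diff_eq add.commute)
 also have "... = conv l (conv k f) x" by (simp add: conv_def)
 finally show ?thesis .
qed

lemma conv_hk_hk:
 fixes f :: "'a::euclidean_space => real"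
 assumes t: "0 < t" "0 < r" and f [measurable]: "f : Bb" and M: "!!x. \<bar>f x\<bar> <= M"
 shows "conv (hk t) (conv (hk r) f) x = conv (hk (t + r)) f x"
proof -
 have i: "integrable (lborel \<Otimes>\<^sub>M lborel) (%(w, z). hk t z * (hk r (w - z) * f (x - w)))"
 proof (rule lborel_pair.Fubini_integrable)
  have I: "itg (%z. hk t z * (hk r (w - z) * f (x - w)))" for w
   using integrable_mult_left[OF hk_semigroup(2)[OF t, of w], of "f (x - w)"] by (simp add: ac_simps)
  then show "AE w in lborel. itg (%z. case (w, z) of (w, z) => hk t z * (hk r (w - z) * f (x - w)))" by simp
  have "(LBINT z. norm (hk t z * (hk r (w - z) * f (x - w)))) = hk (t + r) w * \<bar>f (x - w)\<bar>" for w
  proof -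
   have "(LBINT z. norm (hk t z * (hk r (w - z) * f (x - w)))) = (LBINT z. hk t z * hk r (w - z) * \<bar>f (x - w)\<bar>)"
    by (simp add: abs_mult ac_simps)
   also have "... = hk (t + r) w * \<bar>f (x - w)\<bar>"
    by (subst integral_mult_left_zero) (simp add: hk_semigroup(1)[OF t])
   finally show ?thesis .
  qed
  moreover have "itg (%w. hk (t + r) w * \<bar>f (x - w)\<bar>)"
   using t M by (intro conv_bounded(1)[where f = "%x. \<bar>f x\<bar>" and M = M] hk_integral) auto
  ultimately show "itg (%w. LBINT z. norm (case (w, z) of (w, z) => hk t z * (hk r (w - z) * f (x - w))))" by simp
 qed measurable
 have "conv (hk t) (conv (hk r) f) x = (LBINT z. LBINT w. hk t z * (hk r (w - z) * f (x - w)))"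
 proof -
  have "(LBINT w. hk r w * f (x - z - w)) = (LBINT w. hk r (w - z) * f (x - w))" for z
   using integral_lborel_shift'[of "%w. hk r w * f (x - z - w)" z] by (simp add: algebra_simps)
  then show ?thesis by (simp add: conv_def)
 qed
 also have "... = (LBINT w. LBINT z. hk t z * (hk r (w - z) * f (x - w)))"
  using lborel_pair.Fubini_integral[OF i] by simp
 also have "... = (LBINT w. LBINT z. (hk t z * hk r (w - z)) * f (x - w))" by (simp add: ac_simps)
 also have "... = conv (hk (t + r)) f x"
  by (simp add: conv_def hk_semigroup(1)[OF t])
 finally show ?thesis .
qed

lemma conv_smooth_pd:
 assumes "smooth k" "ph : Cc" "b : Basis"
 shows "conv (pd b k) ph x = conv k (pd b ph) x"
proof -
 note r = Cc_inf_reflect[OF assms(2), of x]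
 have "conv (pd b k) ph x = - (LBINT z. k z * pd b (%z. ph (x - z)) z)"
  unfolding conv_def by (rule integration_by_parts_Cc_inf[OF assms(1) r(1) assms(3)])
 then show ?thesis by (simp add: r(2) conv_def)
qed

lemma conv_hg_Cc_inf:
 assumes "0 < t" "ph : Cc" "b : Basis"
 shows "conv (hg b t) ph x = conv (hk t) (pd b ph) x"
 using conv_smooth_pd[OF hk_smooth assms(2,3), of t x] by (simp add: conv_def pd_hk[OF assms(1)])

lemma conv_sup_bound:
 fixes k ph :: "'a::euclidean_space => real"
 assumes [measurable]: "k : Bb" and k: "!!z. \<bar>k z\<bar> <= A" and ph: "itg ph"
 shows "itg (%z. k z * ph (x - z))" "\<bar>conv k ph x\<bar> <= A * (LBINT z. \<bar>ph z\<bar>)"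
proof -
 have [measurable]: "ph : Bb" using ph by auto
 have i: "itg (%z. A * \<bar>ph (x - z)\<bar>)"
  using integrable_lborel_minus[of "%z. \<bar>ph z\<bar>" x] ph by auto
 have le: "norm (k z * ph (x - z)) <= A * \<bar>ph (x - z)\<bar>" for z
  using mult_right_mono[OF k[of z], of "\<bar>ph (x - z)\<bar>"] by (simp add: abs_mult)
 show I: "itg (%z. k z * ph (x - z))"
  by (rule L_integrable_bound[OF i]) (use order_trans[OF le abs_ge_self] in auto)
 show "\<bar>conv k ph x\<bar> <= A * (LBINT z. \<bar>ph z\<bar>)"
  using L_integral_norm_bound_integral[OF I i] le integral_lborel_minus[of "%z. \<bar>ph z\<bar>" x] by (simp add: conv_def)
qed

lemma conv_hk_bounded:
 fixes f :: "'a::euclidean_space => real"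
 assumes "0 < t" "f : Bb" "!!x. \<bar>f x\<bar> <= M"
 shows "\<bar>conv (hk t) f x\<bar> <= M"
 using conv_bounded(2)[OF hk_integral(1)[OF assms(1)] assms(2,3), of x] hk_integral(2)[OF assms(1), where 'a = 'a] by simp

lemma conv_hg_bounded:
 fixes f :: "'a::euclidean_space => real"
 assumes "0 < t" "b : Basis" "f : Bb" "!!x. \<bar>f x\<bar> <= M" "0 <= M"
 shows "\<bar>conv (hg b t) f x\<bar> <= M * (2 powr (real DIM('a) / 2) * t powr (- (1/2)))"
 using order_trans[OF conv_bounded(2)[OF hg_integrable(1)[OF assms(1,2)] assms(3,4), of x] mult_left_mono[OF hg_integrable(2)[OF assms(1,2)] assms(5)]] .

lemma conv_ht_Cc_inf:
 fixes ph :: "'a::euclidean_space => real"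
 assumes t: "0 < t" and ph: "ph : Cc"
 shows "conv (ht t) ph x = (SUM b:Basis. conv (hk t) (pd b (pd b ph)) x)"
proof -
 have "conv (ht t) ph x = (SUM b:Basis. conv (pd b (hg b t)) ph x)"
 proof -
  have "itg (%z. pd b (hg b t) z * ph (x - z))" if "b : Basis" for b :: 'a
   using Cc_inf_mult_smooth[OF smooth_pd[OF hg_smooth that] Cc_inf_reflect(1)[OF ph]] by (rule Cc_inf_integrable)
  then show ?thesis
   unfolding conv_def ht_eq[OF t] sum_distrib_right by (intro L_integral_sum)
 qed
 also have "... = (SUM b:Basis. conv (hk t) (pd b (pd b ph)) x)"
 proof (intro sum.cong refl)
  fix b :: 'a assume b: "b : Basis"
  have "conv (pd b (hg b t)) ph x = conv (hg b t) (pd b ph) x" by (rule conv_smooth_pd[OF hg_smooth ph b])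
  also have "... = conv (hk t) (pd b (pd b ph)) x" by (rule conv_hg_Cc_inf[OF t Cc_inf_pd[OF ph b] b])
  finally show "conv (pd b (hg b t)) ph x = conv (hk t) (pd b (pd b ph)) x" .
 qed
 finally show ?thesis .
qed

lemma hk_le':
 assumes "0 < t"
 shows "hk t (z::'a::euclidean_space) <= t powr (- (real DIM('a) / 2))"
proof -
 have "(4 * pi * t) powr (- (real DIM('a) / 2)) <= t powr (- (real DIM('a) / 2))"
  using assms pi_gt3 by (intro powr_mono2') (auto simp: mult_le_cancel_right2)
 with hk_le[OF assms, of z] show ?thesis by linarith
qed

lemma ht_le:
 assumes "0 < t"
 shows "\<bar>ht t (z::'a::euclidean_space)\<bar> <= 2 powr (real DIM('a) / 2) * (2 + real DIM('a)) * t powr (- 1 - real DIM('a) / 2)"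
proof -
 have "hk (2 * t) z <= t powr (- (real DIM('a) / 2))"
 proof -
  have "(2 * t) powr (- (real DIM('a) / 2)) <= t powr (- (real DIM('a) / 2))"
   using assms by (intro powr_mono2') auto
  with hk_le'[of "2 * t" z] assms show ?thesis by simp
 qed
 then have "2 powr (real DIM('a) / 2) * (2 + real DIM('a)) * t powr (- 1) * hk (2 * t) z
  <= 2 powr (real DIM('a) / 2) * (2 + real DIM('a)) * t powr (- 1) * t powr (- (real DIM('a) / 2))"
  by (intro mult_left_mono) auto
 also have "... = 2 powr (real DIM('a) / 2) * (2 + real DIM('a)) * t powr (- 1 - real DIM('a) / 2)"
  using powr_add[of t "- 1" "- (real DIM('a) / 2)"] by (simp only: diff_conv_add_uminus mult.assoc)
 finally show ?thesis using ht_bound[OF assms, of z] by linarith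
qed

text \<open>For Lipschitz \<open>ph\<close> the error is bounded by the first moment of the kernel.
  Since the absolute value of \<open>(z \<bullet> b) * hk t z\<close> is \<open>2 * t\<close> times
  that of \<open>hg b t z\<close>, this moment follows from the bound on the integral of
  \<open>hg\<close> and is of order \<open>sqrt t\<close>.\<close>

lemma conv_hk_Lipschitz:
 fixes ph :: "'a::euclidean_space => real"
 assumes ph: "ph : Cc"
 obtains C where "0 <= C" "!!t x. 0 < t ==> \<bar>conv (hk t) ph x - ph x\<bar> <= C * sqrt t"
proof -
 obtain L where L: "0 <= L" "!!x y. \<bar>ph x - ph y\<bar> <= L * norm (x - y)" using Cc_inf_Lipschitz[OF ph] by blast
 obtain M where M: "!!x. \<bar>ph x\<bar> <= M" using Cc_inf_bounded[OF ph] by blast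
 have [measurable]: "ph : Bb" using ph by (rule Cc_inf_measurable)
 define C where "C = L * (2 * real DIM('a) * 2 powr (real DIM('a) / 2))"
 have "\<bar>conv (hk t) ph x - ph x\<bar> <= C * sqrt t" if t: "0 < t" for t x
 proof -
  have "norm z * hk t z <= (SUM b:Basis. 2 * t * \<bar>hg b t z\<bar>)" for z :: 'a
  proof -
   have "norm z * hk t z <= (SUM b:Basis. \<bar>z \<bullet> b\<bar>) * hk t z" by (intro mult_right_mono norm_le_l1) auto
   also have "... = (SUM b:Basis. 2 * t * \<bar>hg b t z\<bar>)"
    using t by (simp add: sum_distrib_right hg_def abs_mult)
   finally show ?thesis .
  qed
  then have le: "norm (hk t z * (ph (x - z) - ph x)) <= L * (SUM b:Basis. 2 * t * \<bar>hg b t z\<bar>)" for z :: 'a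
  proof -
   have "norm (hk t z * (ph (x - z) - ph x)) = \<bar>ph (x - z) - ph x\<bar> * hk t z" by (simp add: abs_mult mult.commute)
   also have "... <= (L * norm z) * hk t z" using L(2)[of "x - z" x] by (intro mult_right_mono) auto
   also have "... <= L * (SUM b:Basis. 2 * t * \<bar>hg b t z\<bar>)"
    using mult_left_mono[OF \<open>norm z * hk t z <= _\<close> L(1)] by (simp add: mult.assoc)
   finally show ?thesis .
  qed
  have i1: "itg (%z. hk t z * ph (x - z))" by (rule conv_bounded(1)[OF hk_integral(1)[OF t] _ M]) auto
  have i2: "itg (%z. L * (SUM b:Basis. 2 * t * \<bar>hg b t (z::'a)\<bar>))"
   using hg_integrable(1)[OF t] by (intro integrable_mult_right L_integrable_sum integrable_abs) auto
  have "conv (hk t) ph x - ph x = (LBINT z. hk t z * (ph (x - z) - ph x))"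
   using i1 hk_integral[OF t, where 'a = 'a] by (simp add: conv_def right_diff_distrib)
  also have "\<bar>...\<bar> <= (LBINT z. L * (SUM b:Basis. 2 * t * \<bar>hg b t (z::'a)\<bar>))"
  proof -
   have "itg (%z. hk t z * (ph (x - z) - ph x))"
    using i1 hk_integral(1)[OF t, where 'a = 'a] by (simp add: right_diff_distrib)
   from L_integral_norm_bound_integral[OF this i2 le] show ?thesis by simp
  qed
  also have "... = L * (SUM b:Basis. 2 * t * (LBINT z. \<bar>hg b t (z::'a)\<bar>))"
   using hg_integrable(1)[OF t] by (subst integral_mult_right_zero, subst L_integral_sum) auto
  also have "... <= L * (SUM b:(Basis::'a set). 2 * t * (2 powr (real DIM('a) / 2) * t powr (- (1/2))))"
   using hg_integrable(2)[OF t] t L(1) by (intro mult_left_mono sum_mono) auto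
  also have "... = C * (t * t powr (- (1/2)))" by (simp add: C_def)
  also have "t * t powr (- (1/2)) = sqrt t"
   using t by (simp only: powr_minus_divide) (simp add: powr_half_sqrt real_div_sqrt)
  finally show ?thesis .
 qed
 moreover have "0 <= C" using L(1) by (simp add: C_def)
 ultimately show thesis using that by blast
qed

section \<open>Evolution of test functions in time\<close>

lemma conv_measurable_param [measurable]:
 assumes [measurable]: "(%(t, z). k t z) : borel_measurable (borel \<Otimes>\<^sub>M borel)" "f : Bb"
 shows "(%t::real. conv (k t) f x) : Bb"
 unfolding conv_def by measurable

text \<open>For small times both derivatives are put on \<open>ph\<close>, for large times both stay
  on the kernel. The two bounds together make the time derivative integrable over the whole
  half-line.\<close>

lemma conv_ht_bound:
 fixes ph :: "'a::euclidean_space => real"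
 assumes ph: "ph : Cc"
 obtains C where "0 <= C" "!!t x. 0 < t ==> \<bar>conv (ht t) ph x\<bar> <= C"
  "!!t x. 0 < t ==> \<bar>conv (ht t) ph x\<bar> <= C * t powr (- 1 - real DIM('a) / 2)"
proof -
 have "ALL b:Basis. EX M. ALL x. \<bar>pd b (pd b ph) x\<bar> <= M"
 proof
  fix b :: 'a assume "b : Basis"
  then have "pd b (pd b ph) : Cc" by (intro Cc_inf_pd ph)
  from Cc_inf_bounded[OF this] show "EX M. ALL x. \<bar>pd b (pd b ph) x\<bar> <= M" by auto
 qed
 from bchoice[OF this] obtain M where M: "!!b x. b : Basis ==> \<bar>pd b (pd b ph) x\<bar> <= M b" by blast
 define C1 where "C1 = (SUM b:(Basis::'a set). M b)"
 define C2 where "C2 = 2 powr (real DIM('a) / 2) * (2 + real DIM('a)) * (LBINT z. \<bar>ph z\<bar>)"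
 have b1: "\<bar>conv (ht t) ph x\<bar> <= C1" if t: "0 < t" for t x
 proof -
  have "\<bar>conv (ht t) ph x\<bar> <= (SUM b:Basis. \<bar>conv (hk t) (pd b (pd b ph)) x\<bar>)"
   unfolding conv_ht_Cc_inf[OF t ph] by (rule sum_abs)
  also have "... <= C1" unfolding C1_def
  proof (intro sum_mono conv_hk_bounded[OF t])
   fix b :: 'a assume b: "b : Basis"
   show "pd b (pd b ph) : Bb" by (rule Cc_inf_measurable[OF Cc_inf_pd[OF Cc_inf_pd[OF ph b] b]])
   show "\<bar>pd b (pd b ph) x\<bar> <= M b" for x using M[OF b] .
  qed
  finally show ?thesis .
 qed
 have b2: "\<bar>conv (ht t) ph x\<bar> <= C2 * t powr (- 1 - real DIM('a) / 2)" if t: "0 < t" for t x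
 proof -
  have "\<bar>conv (ht t) ph x\<bar> <= (2 powr (real DIM('a) / 2) * (2 + real DIM('a)) * t powr (- 1 - real DIM('a) / 2)) * (LBINT z. \<bar>ph z\<bar>)"
   using ht_le[OF t] by (intro conv_sup_bound Cc_inf_integrable[OF ph]) auto
  then show ?thesis by (simp add: C2_def ac_simps)
 qed
 show thesis
 proof (rule that[of "max C1 C2"])
  have "0 <= C1" using b1[of 1 0] by linarith
  then show "0 <= max C1 C2" by simp
  show "\<bar>conv (ht t) ph x\<bar> <= max C1 C2" if "0 < t" for t x using b1[OF that, of x] by simp
  show "\<bar>conv (ht t) ph x\<bar> <= max C1 C2 * t powr (- 1 - real DIM('a) / 2)" if "0 < t" for t x
   using b2[OF that, of x] mult_right_mono[of C2 "max C1 C2" "t powr (- 1 - real DIM('a) / 2)"] by simp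
 qed
qed

lemma integrable_two_regimes:
 fixes h :: "real => real"
 assumes [measurable]: "h : Bb" and a: "-1 < a" and c: "c < -1"
  and le: "!!t. 0 < t ==> t <= 1 ==> \<bar>h t\<bar> <= A * t powr a" "!!t. 1 <= t ==> \<bar>h t\<bar> <= B * t powr c"
 shows "itg (%t. ind {0<..} t * h t)"
  "(LBINT t. ind {0<..} t * \<bar>h t\<bar>) <= A / (a + 1) - B / (c + 1)"
proof -
 define w where "w t = A * (ind {0<..1} t * t powr a) + B * (ind {1..} t * t powr c)" for t
 have wi: "itg w" unfolding w_def
  using powr_integrable_0(1)[OF a, of 1] powr_integrable_inf(1)[OF c, of 1] by auto
 have w1: "(LBINT t. w t) = A / (a + 1) - B / (c + 1)" unfolding w_def
  using powr_integrable_0[OF a, of 1] powr_integrable_inf[OF c, of 1] by (simp add: field_simps)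
 have B: "0 <= B" using le(2)[of 1] by simp
 have A: "0 <= A" using le(1)[of 1] by simp
 have lw: "ind {0<..} t * \<bar>h t\<bar> <= w t" for t
  using le(1)[of t] le(2)[of t] A B by (auto simp: w_def indicator_def)
 show I: "itg (%t. ind {0<..} t * h t)"
  by (rule L_integrable_bound[OF wi])
   (use order_trans[OF lw abs_ge_self] in "auto simp: abs_mult")
 have "itg (%t. ind {0<..} t * \<bar>h t\<bar>)"
  using integrable_abs[OF I] by (simp add: abs_mult)
 then have "(LBINT t. ind {0<..} t * \<bar>h t\<bar>) <= (LBINT t. w t)"
  using wi lw by (intro integral_mono) auto
 with w1 show "(LBINT t. ind {0<..} t * \<bar>h t\<bar>) <= A / (a + 1) - B / (c + 1)" by simp
qed

lemma conv_ht_integrable: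
 fixes ph :: "'a::euclidean_space => real"
 assumes ph: "ph : Cc"
 shows "itg (%t. ind {0<..} t * conv (ht t) ph x)"
proof -
 obtain C where C: "0 <= C" "!!t x. 0 < t ==> \<bar>conv (ht t) ph x\<bar> <= C"
  "!!t x. 0 < t ==> \<bar>conv (ht t) ph x\<bar> <= C * t powr (- 1 - real DIM('a) / 2)"
  using conv_ht_bound[OF ph] by blast
 have [measurable]: "ph : Bb" using ph by (rule Cc_inf_measurable)
 show ?thesis
 proof (rule integrable_two_regimes(1)[where a = 0 and c = "- 1 - real DIM('a) / 2"])
  show "\<bar>conv (ht t) ph x\<bar> <= C * t powr 0" if "0 < t" "t <= 1" for t using C(2)[OF that(1), of x] that by simp
  show "\<bar>conv (ht t) ph x\<bar> <= C * t powr (- 1 - real DIM('a) / 2)" if "1 <= t" for t using C(3)[of t x] that by simp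
 qed auto
qed

lemma heat_FTC:
 fixes ph :: "'a::euclidean_space => real"
 assumes ph: "ph : Cc" and ab: "0 < a" "a <= b"
 shows "(LBINT t. ind {a..b} t * conv (ht t) ph x) = conv (hk b) ph x - conv (hk a) ph x"
proof -
 have [measurable]: "ph : Bb" using ph by (rule Cc_inf_measurable)
 define A where "A = 2 powr (real DIM('a) / 2) * (2 + real DIM('a)) * a powr (- 1 - real DIM('a) / 2)"
 have i: "integrable (lborel \<Otimes>\<^sub>M lborel) (%(t, z). ind {a..b} t * (ht t z * ph (x - z)))"
 proof (rule lborel_pair.integrable_product_bound[where a = "%t. A * ind {a..b} t" and b = "%z. \<bar>ph (x - z)\<bar>"])
  show "itg (%t. A * ind {a..b} t)"
   using ab by (intro integrable_mult_right integrable_real_indicator) auto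
  show "itg (%z. \<bar>ph (x - z)\<bar>)"
   using Cc_inf_integrable[OF Cc_inf_reflect(1)[OF ph], of x] by simp
  fix t z
  show "\<bar>case (t, z) of (t, z) => ind {a..b} t * (ht t z * ph (x - z))\<bar> <= A * ind {a..b} t * \<bar>ph (x - z)\<bar>"
  proof (cases "t : {a..b}")
   case True
   have "\<bar>ht t z\<bar> <= 2 powr (real DIM('a) / 2) * (2 + real DIM('a)) * t powr (- 1 - real DIM('a) / 2)"
    using ht_le[of t z] True ab by simp
   also have "... <= A" unfolding A_def using True ab by (intro mult_left_mono powr_mono2') auto
   finally show ?thesis using True by (simp add: abs_mult mult_right_mono)
  qed simp
 qed measurable
 have "(LBINT t. ind {a..b} t * conv (ht t) ph x) = (LBINT t. LBINT z. ind {a..b} t * (ht t z * ph (x - z)))"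
  by (simp add: conv_def)
 also have "... = (LBINT z. LBINT t. ind {a..b} t * (ht t z * ph (x - z)))"
  using lborel_pair.Fubini_integral[OF i] by simp
 also have "... = (LBINT z. hk b z * ph (x - z) - hk a z * ph (x - z))"
 proof (intro L_integral_cong refl)
  fix z :: 'a
  have cont: "continuous_on {a..b} (%t. ht t z)"
   unfolding ht_def hk_def using ab by (intro continuous_intros) auto
  have "(LBINT t. ind {a..b} t *\<^sub>R ht t z) = hk b z - hk a z"
  proof (rule integral_FTC_atLeastAtMost[OF ab(2) _ cont])
   fix t assume "a <= t" "t <= b"
   then have "((%t. hk t z) has_vector_derivative ht t z) (at t)"
    using hk_has_time_derivative[of t z] ab by (simp add: has_real_derivative_iff_has_vector_derivative)
   then show "((%t. hk t z) has_vector_derivative ht t z) (at t within {a..b})"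
    by (rule has_vector_derivative_at_within)
  qed
  then have "(LBINT t. ind {a..b} t * ht t z * ph (x - z)) = (hk b z - hk a z) * ph (x - z)"
   by (subst integral_mult_left_zero) simp
  then show "(LBINT t. ind {a..b} t * (ht t z * ph (x - z))) = hk b z * ph (x - z) - hk a z * ph (x - z)"
   by (simp add: mult.assoc left_diff_distrib)
 qed
 also have "... = conv (hk b) ph x - conv (hk a) ph x"
 proof -
  obtain M where M: "!!x. \<bar>ph x\<bar> <= M" using Cc_inf_bounded[OF ph] by blast
  have "itg (%z. hk t z * ph (x - z))" if "0 < t" for t
   by (rule conv_bounded(1)[OF hk_integral(1)[OF that] _ M]) auto
  then show ?thesis unfolding conv_def using ab by simp
 qed
 finally show ?thesis .
qed

text \<open>The case distinction is essential: \<open>hk 0\<close> is the zero function, because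
  \<open>0 powr a = 0\<close>, and not a unit mass at the origin.\<close>

definition heat :: "real => ('a::euclidean_space => real) => 'a => real" where
 "heat e ph x = (if e = 0 then ph x else conv (hk e) ph x)"

text \<open>The fundamental theorem of calculus in time, with decay of the flow at infinity. For
  \<open>e = 0\<close> the lower end is approached through positive times, by dominated convergence
  and the \<open>sqrt t\<close> estimate.\<close>

lemma heat_total:
 fixes ph :: "'a::euclidean_space => real"
 assumes ph: "ph : Cc" and e: "0 <= e"
 shows "(LBINT t. ind {e<..} t * conv (ht t) ph x) = - heat e ph x"
proof -
 have [measurable]: "ph : Bb" using ph by (rule Cc_inf_measurable)
 have pos: "(LBINT t. ind {e..} t * conv (ht t) ph x) = - conv (hk e) ph x" if e: "0 < e" for e
 proof -
  have i: "itg (%t. ind {e..} t * conv (ht t) ph x)"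
   by (rule L_integrable_bound[OF conv_ht_integrable[OF ph, of x]])
    (use e in "auto simp: indicator_def")
  have "((%y. LBINT t. ind {..y} t *\<^sub>R (ind {e..} t * conv (ht t) ph x)) \<longlongrightarrow> (LBINT t. ind {e..} t * conv (ht t) ph x)) at_top"
   by (rule tendsto_integral_at_top[OF _ i]) simp
  moreover have "((%y. LBINT t. ind {..y} t *\<^sub>R (ind {e..} t * conv (ht t) ph x)) \<longlongrightarrow> 0 - conv (hk e) ph x) at_top"
  proof (rule Lim_transform_eventually)
   show "((%y. conv (hk y) ph x - conv (hk e) ph x) \<longlongrightarrow> 0 - conv (hk e) ph x) at_top"
   proof (intro tendsto_diff tendsto_const)
    define J where "J = (LBINT z. \<bar>ph z\<bar>)"
    have "((%y. y powr (- (real DIM('a) / 2)) * J) \<longlongrightarrow> 0) at_top"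
     by (intro tendsto_mult_left_zero tendsto_neg_powr filterlim_ident) auto
    then show "((%y. conv (hk y) ph x) \<longlongrightarrow> 0) at_top"
    proof (rule Lim_null_comparison[rotated])
     show "\<forall>\<^sub>F y in at_top. norm (conv (hk y) ph x) <= y powr (- (real DIM('a) / 2)) * J"
      using eventually_gt_at_top[of 0]
     proof eventually_elim
      case (elim y)
      show ?case unfolding J_def real_norm_def
       using hk_le'[OF elim] by (intro conv_sup_bound Cc_inf_integrable[OF ph]) auto
     qed
    qed
   qed
   show "\<forall>\<^sub>F y in at_top. conv (hk y) ph x - conv (hk e) ph x = (LBINT t. ind {..y} t *\<^sub>R (ind {e..} t * conv (ht t) ph x))"
    using eventually_ge_at_top[of e]
   proof eventually_elim
    case (elim y)
    have "(LBINT t. ind {..y} t *\<^sub>R (ind {e..} t * conv (ht t) ph x)) = (LBINT t. ind {e..y} t * conv (ht t) ph x)"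
     by (intro L_integral_cong) (auto simp: indicator_def)
    then show ?case using heat_FTC[OF ph e elim, of x] by simp
   qed
  qed
  ultimately have "(LBINT t. ind {e..} t * conv (ht t) ph x) = 0 - conv (hk e) ph x"
   by (rule tendsto_unique[OF trivial_limit_at_top_linorder])
  then show ?thesis by simp
 qed
 show ?thesis
 proof (cases "e = 0")
  case False
  have "(LBINT t. ind {e<..} t * conv (ht t) ph x) = (LBINT t. ind {e..} t * conv (ht t) ph x)"
  proof (rule integral_cong_AE)
   show "AE t in lborel. ind {e<..} t * conv (ht t) ph x = ind {e..} t * conv (ht t) ph x"
    using AE_lborel_singleton[of e] by eventually_elim (auto simp: indicator_def)
  qed measurable
  then show ?thesis using pos[of e] False e by (simp add: heat_def)
 next
  case True
  define d where "d k = inverse (real (Suc k))" for k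
  have d: "0 < d k" "d ----> 0" for k using LIMSEQ_inverse_real_of_nat by (auto simp: d_def[abs_def])
  have "(%k. LBINT t. ind {d k..} t * conv (ht t) ph x) ----> (LBINT t. ind {0<..} t * conv (ht t) ph x)"
  proof (rule integral_dominated_convergence[where w = "%t. \<bar>ind {0<..} t * conv (ht t) ph x\<bar>"])
   show "itg (%t. \<bar>ind {0<..} t * conv (ht t) ph x\<bar>)" using conv_ht_integrable[OF ph] by (rule integrable_abs)
   show "AE t in lborel. norm (ind {d k..} t * conv (ht t) ph x) <= \<bar>ind {0<..} t * conv (ht t) ph x\<bar>" for k
    using d(1)[of k] by (auto simp: indicator_def)
   show "AE t in lborel. (%k. ind {d k..} t * conv (ht t) ph x) ----> ind {0<..} t * conv (ht t) ph x"
   proof (intro AE_I2 tendsto_mult tendsto_const)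
    fix t :: real
    show "(%k. ind {d k..} t :: real) ----> ind {0<..} t"
    proof (cases "0 < t")
     case True
     have "\<forall>\<^sub>F k in sequentially. d k < t" using order_tendstoD(2)[OF d(2) True] .
     then have "\<forall>\<^sub>F k in sequentially. (ind {d k..} t :: real) = ind {0<..} t"
      by eventually_elim (use True in "auto simp: indicator_def")
     then show ?thesis by (rule tendsto_eventually)
    next
     case False
     then have "(ind {d k..} t :: real) = ind {0<..} t" for k using d(1)[of k] by (auto simp: indicator_def)
     then show ?thesis by simp
    qed
   qed
  qed measurable
  moreover have "(%k. - conv (hk (d k)) ph x) ----> - ph x"
  proof -
   obtain C where C: "0 <= C" "!!t x. 0 < t ==> \<bar>conv (hk t) ph x - ph x\<bar> <= C * sqrt t" using conv_hk_Lipschitz[OF ph] by blast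
   have "(%k. C * sqrt (d k)) ----> C * sqrt 0" by (intro tendsto_intros d)
   then have l: "(%k. C * sqrt (d k)) ----> 0" by simp
   have "\<forall>\<^sub>F k in sequentially. norm (conv (hk (d k)) ph x - ph x) <= C * sqrt (d k)"
    using C(2)[OF d(1)] by (intro always_eventually allI) simp
   then have "(%k. conv (hk (d k)) ph x - ph x) ----> 0"
    using l by (rule Lim_null_comparison)
   then show ?thesis by (intro tendsto_minus) (rule LIM_zero_cancel)
  qed
  ultimately have "(LBINT t. ind {0<..} t * conv (ht t) ph x) = - ph x"
   unfolding pos[OF d(1)] by (rule LIMSEQ_unique)
  then show ?thesis using True by (simp add: heat_def)
 qed
qed

text \<open>The substitution \<open>v = c / t\<close>, carried out by Tonelli:
  \<open>exp (- c / t)\<close> is written as the integral of \<open>exp (- v)\<close> over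
  \<open>v >= c / t\<close>. The inner integral over \<open>t\<close> is then a multiple of
  \<open>v powr a\<close>, and the outer one is \<open>Gamma (a + 1)\<close>.\<close>

lemma Gamma_inverse_integral:
 fixes a c :: real
 assumes a: "0 < a" and c: "0 < c"
 shows "(\<integral>\<^sup>+t. ennreal (ind {0<..} t * t powr (- a - 1) * exp (- c / t)) \<partial>lborel) = ennreal (Gamma a * c powr (- a))"
proof -
 have e: "ennreal (exp (- c / t)) = (\<integral>\<^sup>+v. ennreal (exp (- v)) * ind {c / t..} v \<partial>lborel)" for t
 proof -
  have "((%v::real. - exp (- v)) \<longlongrightarrow> - 0) at_top"
   by (intro tendsto_minus filterlim_compose[OF exp_at_bot] filterlim_uminus_at_bot_at_top)
  then have "((%v::real. - exp (- v)) \<longlongrightarrow> 0) at_top" by simp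
  have "(\<integral>\<^sup>+v. ennreal (exp (- v)) * ind {c / t..} v \<partial>lborel) = ennreal (0 - (- exp (- (c / t))))"
   using \<open>((%v. - exp (- v)) \<longlongrightarrow> 0) at_top\<close>
   by (intro nn_integral_FTC_atLeast) (auto intro!: derivative_eq_intros)
  then show ?thesis by simp
 qed
 have "(\<integral>\<^sup>+t. ennreal (ind {0<..} t * t powr (- a - 1) * exp (- c / t)) \<partial>lborel)
  = (\<integral>\<^sup>+t. \<integral>\<^sup>+v. ennreal (ind {0<..} t * t powr (- a - 1)) * (ennreal (exp (- v)) * ind {c / t..} v) \<partial>lborel \<partial>lborel)"
  by (intro nn_integral_cong, subst nn_integral_cmult) (auto simp: e[symmetric] ennreal_mult')
 also have "... = (\<integral>\<^sup>+v. \<integral>\<^sup>+t. ennreal (ind {0<..} t * t powr (- a - 1)) * (ennreal (exp (- v)) * ind {c / t..} v) \<partial>lborel \<partial>lborel)"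
 proof (rule lborel_pair.Fubini')
  have *: "(%x. ind {c / snd x..} (fst x) :: ennreal) : borel_measurable (lborel \<Otimes>\<^sub>M lborel)"
  proof -
   have "(%x. ind {c / snd x..} (fst x) :: ennreal) = ind {x :: real \<times> real. c / snd x <= fst x}"
    by (auto simp: indicator_def)
   then show ?thesis by simp
  qed
  show "(%(v, t). ennreal (ind {0<..} t * t powr (- a - 1)) * (ennreal (exp (- v)) * ind {c / t..} v)) : borel_measurable (lborel \<Otimes>\<^sub>M lborel)"
   unfolding case_prod_unfold by (intro borel_measurable_times_ennreal *) auto
 qed
 also have "... = (\<integral>\<^sup>+v. ennreal (c powr (- a) / a) * ennreal (ind {0..} v * v powr (a + 1 - 1) / exp v) \<partial>lborel)"
 proof (intro nn_integral_cong_AE, use AE_lborel_singleton[of "0::real"] in eventually_elim)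
  case (elim v)
  show ?case
  proof (cases "0 < v")
   case True
   have "(\<integral>\<^sup>+t. ennreal (ind {0<..} t * t powr (- a - 1)) * (ennreal (exp (- v)) * ind {c / t..} v) \<partial>lborel)
    = (\<integral>\<^sup>+t. ennreal (exp (- v)) * ennreal (ind {c / v..} t * t powr (- a - 1)) \<partial>lborel)"
   proof (intro nn_integral_cong)
    fix t :: real
    have "0 < t & c / t <= v \<longleftrightarrow> c / v <= t"
    proof (intro iffI conjI)
     assume "0 < t & c / t <= v"
     then show "c / v <= t" using True by (auto simp: pos_divide_le_eq mult.commute)
    next
     assume *: "c / v <= t"
     have "0 < c / v" using True c by simp
     with * show t: "0 < t" by linarith
     from * show "c / t <= v" using True t by (auto simp: pos_divide_le_eq mult.commute)
    qed
    then show "ennreal (ind {0<..} t * t powr (- a - 1)) * (ennreal (exp (- v)) * ind {c / t..} v) = ennreal (exp (- v)) * ennreal (ind {c / v..} t * t powr (- a - 1))"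
     by (auto simp: indicator_def mult.commute)
   qed
   also have "... = ennreal (exp (- v)) * (\<integral>\<^sup>+t. ennreal (ind {c / v..} t * t powr (- a - 1)) \<partial>lborel)"
    by (intro nn_integral_cmult) measurable
   also have "(\<integral>\<^sup>+t. ennreal (ind {c / v..} t * t powr (- a - 1)) \<partial>lborel) = ennreal ((c / v) powr (- a) / a)"
    using powr_integrable_inf[of "- a - 1" "c / v"] a c True by (subst nn_integral_eq_integral) auto
   also have "(c / v) powr (- a) = c powr (- a) * v powr a"
    by (simp add: powr_divide powr_minus field_simps)
   finally show ?thesis using True a by (simp add: ennreal_mult'[symmetric] exp_minus field_simps)
  next
   case False
   then have v: "v < 0" using elim by simp
   have "(\<integral>\<^sup>+t. ennreal (ind {0<..} t * t powr (- a - 1)) * (ennreal (exp (- v)) * ind {c / t..} v) \<partial>lborel) = (\<integral>\<^sup>+t. 0 \<partial>(lborel :: real measure))"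
   proof (intro nn_integral_cong)
    fix t :: real
    show "ennreal (ind {0<..} t * t powr (- a - 1)) * (ennreal (exp (- v)) * ind {c / t..} v) = 0"
    proof (cases "0 < t")
     case True
     then have "0 < c / t" using c by simp
     then have "\<not> c / t <= v" using v by linarith
     then show ?thesis by simp
    qed simp
   qed
   then show ?thesis using v by simp
  qed
 qed
 also have "... = ennreal (c powr (- a) / a) * ennreal (Gamma (a + 1))"
  using a by (subst nn_integral_cmult) (auto simp: Gamma_conv_nn_integral_real)
 also have "... = ennreal (Gamma a * c powr (- a))"
  using a Gamma_real_pos[of a] Gamma_plus1[of a] nonpos_Ints_nonpos[of a] by (force simp add: ennreal_mult'[symmetric] field_simps)
 finally show ?thesis .
qed

section \<open>The fractional gradient through the heat semigroup\<close>

text \<open>Heat semigroup form of the fractional gradient, with \<open>be = (1 - s) / 2\<close>.\<close>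

definition FG :: "real => 'a::euclidean_space => ('a => real) => 'a => real" where
 "FG be b ph x = (1 / Gamma be) * (LBINT r. ind {0<..} r * (r powr (be - 1) * conv (hk r) (pd b ph) x))"

lemma FG_measurable [measurable]:
 assumes "ph : Cc" "b : Basis"
 shows "FG be b ph : Bb"
proof -
 have [measurable]: "pd b ph : Bb" using Cc_inf_measurable[OF Cc_inf_pd[OF assms]] .
 show ?thesis unfolding FG_def conv_def by measurable
qed

text \<open>Near 0 the flow of \<open>pd b ph\<close> is bounded and \<open>be > 0\<close> makes the
  weight integrable; at infinity the derivative moves to the kernel, gains
  \<open>r powr (- (1/2))\<close>, and \<open>be < 1/2\<close> suffices. The majorant is free of
  \<open>x\<close>, as the exchanges of integrals require.\<close>

lemma FG_dominated:
 fixes ph :: "'a::euclidean_space => real"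
 assumes ph: "ph : Cc" and b: "b : Basis" and be: "0 < be" "be < 1/2"
 obtains a where "itg a"
  "!!r x. \<bar>ind {0<..} r * (r powr (be - 1) * conv (hk r) (pd b ph) x)\<bar> <= a r"
proof -
 obtain M0 where M0: "0 < M0" "!!x. \<bar>ph x\<bar> <= M0" using Cc_inf_bounded[OF ph] by blast
 obtain M1 where M1: "0 < M1" "!!x. \<bar>pd b ph x\<bar> <= M1" using Cc_inf_bounded[OF Cc_inf_pd[OF ph b]] by blast
 have m: "pd b ph : Bb" using Cc_inf_measurable[OF Cc_inf_pd[OF ph b]] .
 have m0: "ph : Bb" using ph by (rule Cc_inf_measurable)
 define B where "B = M0 * 2 powr (real DIM('a) / 2)"
 define a where "a r = M1 * (ind {0<..1} r * r powr (be - 1)) + B * (ind {1..} r * r powr (be - 3/2))" for r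
 have B: "0 <= B" using M0 by (simp add: B_def)
 have "itg a" unfolding a_def
  using powr_integrable_0(1)[of "be - 1" 1] powr_integrable_inf(1)[of "be - 3/2" 1] be by auto
 moreover have "\<bar>ind {0<..} r * (r powr (be - 1) * conv (hk r) (pd b ph) x)\<bar> <= a r" for r x
 proof -
  consider "r <= 0" | "0 < r" "r <= 1" | "1 < r" by linarith
  then show ?thesis
  proof cases
   case 2
   have "\<bar>r powr (be - 1) * conv (hk r) (pd b ph) x\<bar> <= M1 * r powr (be - 1)"
    using mult_left_mono[OF conv_hk_bounded[OF 2(1) m M1(2), of x], of "r powr (be - 1)"] by (simp add: abs_mult mult.commute)
   then show ?thesis using 2 B by (auto simp: a_def indicator_def)
  next
   case 3
   then have r: "0 < r" by simp
   have "\<bar>r powr (be - 1) * conv (hk r) (pd b ph) x\<bar> = r powr (be - 1) * \<bar>conv (hg b r) ph x\<bar>"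
    by (simp add: abs_mult conv_hg_Cc_inf[OF r ph b])
   also have "... <= r powr (be - 1) * (M0 * (2 powr (real DIM('a) / 2) * r powr (- (1/2))))"
    using conv_hg_bounded[OF r b m0 M0(2), of x] M0(1) by (intro mult_left_mono) auto
   also have "... = B * (r powr (be - 1) * r powr (- (1/2)))" by (simp add: B_def)
   also have "r powr (be - 1) * r powr (- (1/2)) = r powr (be - 3/2)" by (simp add: powr_add[symmetric])
   finally show ?thesis using 3 by (simp add: a_def)
  qed (simp add: a_def)
 qed
 ultimately show thesis using that by blast
qed

lemma FG_integrable:
 fixes ph :: "'a::euclidean_space => real"
 assumes ph: "ph : Cc" and b: "b : Basis" and be: "0 < be" "be < 1/2"
 shows "itg (%r. ind {0<..} r * (r powr (be - 1) * conv (hk r) (pd b ph) x))"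
proof -
 have [measurable]: "pd b ph : Bb" using Cc_inf_measurable[OF Cc_inf_pd[OF ph b]] .
 obtain a where a: "itg a" "!!r x. \<bar>ind {0<..} r * (r powr (be - 1) * conv (hk r) (pd b ph) x)\<bar> <= a r"
  using FG_dominated[OF ph b be] by blast
 show ?thesis by (rule L_integrable_bound[OF a(1)]) (use order_trans[OF a(2) abs_ge_self] in auto)
qed

lemma FG_bounded:
 assumes ph: "ph : Cc" and b: "b : Basis" and be: "0 < be" "be < 1/2"
 shows "EX M. ALL x. \<bar>FG be b ph x\<bar> <= M"
proof -
 obtain a where a: "itg a" "!!r x. \<bar>ind {0<..} r * (r powr (be - 1) * conv (hk r) (pd b ph) x)\<bar> <= a r"
  using FG_dominated[OF ph b be] by blast
 have G: "0 < Gamma be" using be(1) by (rule Gamma_real_pos)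
 have "\<bar>FG be b ph x\<bar> <= (1 / Gamma be) * (LBINT r. a r)" for x
  unfolding FG_def abs_mult using G L_integral_norm_bound_integral[OF FG_integrable[OF ph b be] a(1), of x] a(2)
  by (intro mult_mono) auto
 then show ?thesis by blast
qed

text \<open>The product of \<open>norm z\<close> with \<open>hg\<close> is at most a second moment
  factor, which is a combination of \<open>2 * t * ht t z\<close> and \<open>hk t z\<close>. Its
  integral over \<open>z\<close> is therefore bounded uniformly in \<open>t\<close>.\<close>

lemma norm_hg_bound:
 assumes t: "0 < t" and b: "b : Basis"
 shows "norm z * \<bar>hg b t (z::'a::euclidean_space)\<bar> <= 2 * (2 powr (real DIM('a) / 2) * (2 + real DIM('a))) * hk (2 * t) z + real DIM('a) * hk t z"
proof -
 have "norm z * \<bar>hg b t z\<bar> = norm z * \<bar>z \<bullet> b\<bar> / (2 * t) * hk t z" using t by (simp add: hg_def abs_mult)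
 also have "... <= norm z * norm z / (2 * t) * hk t z"
  using t Basis_le_norm[OF b, of z] by (intro mult_right_mono divide_right_mono mult_left_mono) auto
 also have "... = 2 * t * ht t z + real DIM('a) * hk t z"
  using t by (simp add: ht_def power2_norm_eq_inner[symmetric] power2_eq_square field_simps)
 also have "2 * t * ht t z <= 2 * t * (2 powr (real DIM('a) / 2) * (2 + real DIM('a)) * t powr (- 1) * hk (2 * t) z)"
  using ht_bound[OF t, of z] t by (intro mult_left_mono) auto
 also have "... = 2 * (2 powr (real DIM('a) / 2) * (2 + real DIM('a))) * hk (2 * t) z"
  using t by (simp add: powr_minus)
 finally show ?thesis by simp
qed

lemma hg_integral_zero:
 assumes "0 < t" "b : Basis"
 shows "(LBINT z. hg b t z) = 0"
proof -
 have "(LBINT z. hg b t z) = (LBINT z. hg b t (0 - z))" by (rule integral_lborel_minus[symmetric]) measurable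
 also have "... = - (LBINT z. hg b t z)" by (simp add: hg_def hk_def)
 finally show ?thesis by simp
qed

text \<open>For fixed \<open>z\<close> this is an inverse Gamma integral with \<open>c\<close> a
  quarter of the squared norm; \<open>c powr (- a)\<close> yields the homogeneity of the Riesz
  kernel. The identity matches the normalisation \<open>frac_const\<close> with that of the heat
  representation.\<close>

lemma hg_time_integral:
 fixes z b :: "'a::euclidean_space"
 assumes s: "0 < s" "s < 1" and be: "be = (1 - s) / 2"
 shows "(1 / Gamma be) * (LBINT t. ind {0<..} t * (t powr (be - 1) * hg b t z))
   = - frac_const DIM('a) s * ((z \<bullet> b) / (norm z powr (real DIM('a) + s) * norm z))"
proof (cases "z = 0")
 case True
 then show ?thesis by (simp add: hg_def)
next
 case False
 define n where "n = real DIM('a)"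
 have n: "1 <= n" using DIM_positive[where 'a = 'a] by (simp add: n_def Suc_le_eq)
 \<comment> \<open>With this choice \<open>a - 1\<close> is the Gamma argument in
   \<open>frac_const\<close>; the factor \<open>n + s - 1\<close> there comes from
   \<open>Gamma a = (a - 1) * Gamma (a - 1)\<close>.\<close>
 define a where "a = 1 - be + n / 2"
 have a: "0 < a" "2 * a = n + s + 1" "a - 1 = (n + s - 1) / 2" "0 < a - 1" using be s n by (auto simp: a_def field_simps)
 define c where "c = (z \<bullet> z) / 4"
 have c: "0 < c" using False by (simp add: c_def)
 have nn: "(\<integral>\<^sup>+t. ennreal (ind {0<..} t * t powr (- a - 1) * exp (- c / t)) \<partial>lborel) = ennreal (Gamma a * c powr (- a))"
  by (rule Gamma_inverse_integral[OF a(1) c])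
 have I: "(LBINT t. ind {0<..} t * t powr (- a - 1) * exp (- c / t)) = Gamma a * c powr (- a)"
  using nn Gamma_real_pos[OF a(1)] by (subst integral_eq_nn_integral) auto
 have eq: "ind {0<..} t * (t powr (be - 1) * hg b t z) = - (z \<bullet> b) / 2 * (4 * pi) powr (- (n / 2)) * (ind {0<..} t * t powr (- a - 1) * exp (- c / t))" for t
 proof (cases "0 < t")
  case True
  have 1: "t powr (be - 1) * (1 / t) * t powr (- (n / 2)) = t powr (- a - 1)"
  proof -
   have "1 / t = t powr (- 1)" using True by (simp add: powr_minus_divide)
   then have "t powr (be - 1) * (1 / t) * t powr (- (n / 2)) = t powr (be - 1 + - 1 + - (n / 2))" by (simp only: powr_add)
   also have "be - 1 + - 1 + - (n / 2) = - a - 1" by (simp add: a_def)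
   finally show ?thesis .
  qed
  have 2: "hg b t z = - (z \<bullet> b) / 2 * (1 / t) * ((4 * pi) powr (- (n / 2)) * t powr (- (n / 2))) * exp (- c / t)"
   using True by (simp add: hg_def hk_def n_def c_def powr_mult[of "4 * pi" t, symmetric])
  show ?thesis unfolding 2 1[symmetric] using True by (simp add: ac_simps)
 qed simp
 have J: "(LBINT t. ind {0<..} t * (t powr (be - 1) * hg b t z)) = - (z \<bullet> b) / 2 * (4 * pi) powr (- (n / 2)) * (Gamma a * c powr (- a))"
  unfolding eq by (subst integral_mult_right_zero) (simp only: I)
 have nz: "0 < norm z" using False by simp
 have c2: "c powr (- a) = 4 powr a / (norm z powr (n + s) * norm z)"
 proof -
  have "c = (norm z)\<^sup>2 / 4" by (simp add: c_def power2_norm_eq_inner)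
  then have "c powr (- a) = ((norm z)\<^sup>2) powr (- a) / 4 powr (- a)" by (simp only: powr_divide)
  also have "(norm z)\<^sup>2 = norm z powr 2" using nz by (simp add: powr_numeral)
  also have "(norm z powr 2) powr (- a) = norm z powr (- (n + s + 1))" unfolding powr_powr using a(2) by (simp add: algebra_simps)
  also have "... = 1 / (norm z powr (n + s) * norm z powr 1)" unfolding powr_add[symmetric] by (simp only: powr_minus_divide)
  finally show ?thesis using nz by (simp add: powr_minus field_simps)
 qed
 have K: "frac_const DIM('a) s = (1 / Gamma be) * (1 / 2) * (4 * pi) powr (- (n / 2)) * Gamma a * 4 powr a"
 proof -
  have "a - 1 \<notin> \<int>\<^sub>\<le>\<^sub>0" using a(4) nonpos_Ints_nonpos[of "a - 1"] by force
  from Gamma_plus1[OF this] have G: "Gamma a = (a - 1) * Gamma (a - 1)" by simp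
  have p: "(4 * pi) powr (- (n / 2)) * 4 powr a = 4 powr (1 - be) / pi powr (n / 2)"
  proof -
   have "(4 * pi) powr (- (n / 2)) = 4 powr (- (n / 2)) * pi powr (- (n / 2))" by (rule powr_mult)
   then have "(4 * pi) powr (- (n / 2)) * 4 powr a = (4 powr (- (n / 2)) * 4 powr a) * pi powr (- (n / 2))" by simp
   also have "4 powr (- (n / 2)) * 4 powr a = (4::real) powr (1 - be)" unfolding powr_add[symmetric] by (simp add: a_def)
   finally show ?thesis by (simp add: powr_minus_divide)
  qed
  have "(2::real) powr 2 = 4" by (simp add: powr_numeral)
  then have "(4::real) powr (1 - be) = 2 powr (2 * (1 - be))" by (simp only: powr_powr[symmetric])
  also have "2 * (1 - be) = 2 - (1 - s)" using be by (simp add: field_simps)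
  also have "2 powr (2 - (1 - s)) = 4 / 2 powr (1 - s)" unfolding powr_diff[of 2 2 "1 - s"] by (simp add: powr_numeral)
  finally have q: "(4::real) powr (1 - be) = 4 / 2 powr (1 - s)" .
  have "(1 / Gamma be) * (1 / 2) * (4 * pi) powr (- (n / 2)) * Gamma a * 4 powr a = (1 / Gamma be) * (1 / 2) * Gamma a * ((4 * pi) powr (- (n / 2)) * 4 powr a)" by simp
  also have "... = (1 / Gamma be) * (1 / 2) * ((a - 1) * Gamma (a - 1)) * (4 / 2 powr (1 - s) / pi powr (n / 2))" unfolding p q G ..
  also have "... = frac_const DIM('a) s" unfolding frac_const_def a(3) be n_def[symmetric] by simp
  finally show ?thesis by simp
 qed
 show ?thesis unfolding J K c2 n_def[symmetric] by (simp add: ac_simps)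
qed

text \<open>Fubini between time and space. Subtracting \<open>ph x\<close> is free because
  \<open>hg\<close> has integral zero, and it makes the double integral absolutely convergent: the
  Lipschitz bound on the increment settles small times, its boundedness large ones.\<close>

lemma FG_kernel:
 fixes ph :: "'a::euclidean_space => real"
 assumes ph: "ph : Cc" and b: "b : Basis" and s: "0 < s" "s < 1" and be: "be = (1 - s) / 2"
 shows "itg (%z. frac_const DIM('a) s * ((ph x - ph (x - z)) * ((z \<bullet> b) / (norm z powr (real DIM('a) + s) * norm z))))"
  "(LBINT z. frac_const DIM('a) s * ((ph x - ph (x - z)) * ((z \<bullet> b) / (norm z powr (real DIM('a) + s) * norm z)))) = FG be b ph x"
proof -
 have be': "0 < be" "be < 1/2" using s be by auto
 have [measurable]: "ph : Bb" using ph by (rule Cc_inf_measurable)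
 obtain M where M: "0 < M" "!!x. \<bar>ph x\<bar> <= M" using Cc_inf_bounded[OF ph] by blast
 obtain L where L: "0 <= L" "!!x y. \<bar>ph x - ph y\<bar> <= L * norm (x - y)" using Cc_inf_Lipschitz[OF ph] by blast
 define d where "d z = ph (x - z) - ph x" for z
 have [measurable]: "d : Bb" unfolding d_def by measurable
 have dM: "\<bar>d z\<bar> <= 2 * M" for z using M(2)[of "x - z"] M(2)[of x] unfolding d_def by linarith
 have dL: "\<bar>d z\<bar> <= L * norm z" for z using L(2)[of "x - z" x] by (simp add: d_def)
 have hi: "itg (%z. hg b t z * d z)" if t: "0 < t" for t
 proof (rule L_integrable_bound)
  show "itg (%z. 2 * M * hg b t z)" using hg_integrable(1)[OF t b] by simp
  have "norm (hg b t z * d z) <= norm (2 * M * hg b t z)" for z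
   using mult_left_mono[OF dM[of z], of "\<bar>hg b t z\<bar>"] M(1) by (simp add: abs_mult mult.commute)
  then show "AE z in lborel. norm (hg b t z * d z) <= norm (2 * M * hg b t z)" by blast
 qed measurable
 define A where "A t = (LBINT z. \<bar>hg b t z * d z\<bar>)" for t
 have [measurable]: "A : Bb" unfolding A_def by measurable
 have A0: "0 <= A t" for t unfolding A_def by (intro L_integral_nonneg) auto
 define C3 where "C3 = 2 * (2 powr (real DIM('a) / 2) * (2 + real DIM('a))) + real DIM('a)"
 have A1: "A t <= L * C3" if t: "0 < t" for t
 proof -
  define W where "W z = L * (2 * (2 powr (real DIM('a) / 2) * (2 + real DIM('a))) * hk (2 * t) z + real DIM('a) * hk t z)" for z :: 'a
  have Wi: "itg W" "(LBINT z. W z) = L * C3"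
   unfolding W_def C3_def using hk_integral[OF t, where 'a = 'a] hk_integral[of "2 * t", where 'a = 'a] t by auto
  have "\<bar>hg b t z * d z\<bar> <= W z" for z
  proof -
   have "\<bar>hg b t z * d z\<bar> <= \<bar>hg b t z\<bar> * (L * norm z)" unfolding abs_mult by (intro mult_left_mono dL) auto
   also have "... = L * (norm z * \<bar>hg b t z\<bar>)" by simp
   also have "... <= W z" unfolding W_def by (intro mult_left_mono norm_hg_bound[OF t b] L(1))
   finally show ?thesis .
  qed
  then have "A t <= (LBINT z. W z)" unfolding A_def using hi[OF t] Wi(1) by (intro integral_mono) auto
  then show ?thesis using Wi(2) by simp
 qed
 have A2: "A t <= 2 * M * 2 powr (real DIM('a) / 2) * t powr (- (1/2))" if t: "0 < t" for t
 proof -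
  have "A t <= (LBINT z. \<bar>hg b t z\<bar> * (2 * M))" unfolding A_def abs_mult
   using hi[OF t] hg_integrable(1)[OF t b] dM by (intro integral_mono mult_left_mono) (auto simp: abs_mult[symmetric])
  also have "... = (LBINT z. \<bar>hg b t z\<bar>) * (2 * M)" by simp
  also have "... <= (2 powr (real DIM('a) / 2) * t powr (- (1/2))) * (2 * M)"
   using hg_integrable(2)[OF t b] M(1) by (intro mult_right_mono) auto
  finally show ?thesis by (simp add: ac_simps)
 qed
 have tA: "itg (%t. ind {0<..} t * (t powr (be - 1) * A t))"
 proof (rule integrable_two_regimes(1)[where a = "be - 1" and c = "be - 3/2"])
  show "\<bar>t powr (be - 1) * A t\<bar> <= (L * C3) * t powr (be - 1)" if "0 < t" "t <= 1" for t
   using mult_left_mono[OF A1[OF that(1)], of "t powr (be - 1)"] A0[of t] by (simp add: abs_mult ac_simps)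
  show "\<bar>t powr (be - 1) * A t\<bar> <= (2 * M * 2 powr (real DIM('a) / 2)) * t powr (be - 3/2)" if "1 <= t" for t
  proof -
   have "t powr (be - 1) * A t <= t powr (be - 1) * (2 * M * 2 powr (real DIM('a) / 2) * t powr (- (1/2)))"
    using A2[of t] that by (intro mult_left_mono) auto
   also have "... = (2 * M * 2 powr (real DIM('a) / 2)) * (t powr (be - 1) * t powr (- (1/2)))" by simp
   also have "t powr (be - 1) * t powr (- (1/2)) = t powr (be - 3/2)" by (simp add: powr_add[symmetric])
   finally show ?thesis using A0[of t] by (simp add: abs_mult)
  qed
 qed (use be' in auto)
 define F where "F t z = ind {0<..} t * (t powr (be - 1) * (hg b t z * d z))" for t z
 have Fi: "integrable (lborel \<Otimes>\<^sub>M lborel) (%(t, z). F t z)"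
 proof (rule lborel_pair.Fubini_integrable)
  show "(%(t, z). F t z) : borel_measurable (lborel \<Otimes>\<^sub>M lborel)" unfolding F_def by measurable
  have "(LBINT z. norm (F t z)) = ind {0<..} t * (t powr (be - 1) * A t)" for t
  proof -
   have "norm (F t z) = ind {0<..} t * t powr (be - 1) * \<bar>hg b t z * d z\<bar>" for z by (simp add: F_def abs_mult)
   then show ?thesis by (simp add: A_def)
  qed
  then show "itg (%t. LBINT z. norm (case (t, z) of (t, z) => F t z))" using tA by simp
  have "itg (F t)" for t
  proof (cases "0 < t")
   case True
   then show ?thesis unfolding F_def using hi[OF True] by (intro integrable_mult_right)
  next
   case False
   then have "F t = (%z. 0)" by (auto simp: F_def)
   then show ?thesis by simp
  qed
  then show "AE t in lborel. itg (%z. case (t, z) of (t, z) => F t z)" by simp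
 qed
 have z: "(1 / Gamma be) * (LBINT t. F t z) = frac_const DIM('a) s * ((ph x - ph (x - z)) * ((z \<bullet> b) / (norm z powr (real DIM('a) + s) * norm z)))" for z
 proof -
  have "(LBINT t. F t z) = (LBINT t. ind {0<..} t * (t powr (be - 1) * hg b t z) * d z)"
   by (simp add: F_def ac_simps)
  also have "... = (LBINT t. ind {0<..} t * (t powr (be - 1) * hg b t z)) * d z" by (rule integral_mult_left_zero)
  finally have "(1 / Gamma be) * (LBINT t. F t z) = ((1 / Gamma be) * (LBINT t. ind {0<..} t * (t powr (be - 1) * hg b t z))) * d z" by simp
  also have "... = (- frac_const DIM('a) s * ((z \<bullet> b) / (norm z powr (real DIM('a) + s) * norm z))) * d z"
   unfolding hg_time_integral[OF s be] ..
  also have "... = frac_const DIM('a) s * ((ph x - ph (x - z)) * ((z \<bullet> b) / (norm z powr (real DIM('a) + s) * norm z)))"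
  proof -
   have "(- c * k) * (p - q) = c * ((q - p) * k)" for c k p q :: real by (simp add: algebra_simps)
   then show ?thesis unfolding d_def .
  qed
  finally show ?thesis .
 qed
 have "itg (%z. LBINT t. F t z)"
  using lborel_pair.integrable_fst'[OF lborel_pair.integrable_product_swap[OF Fi]] by (simp add: case_prod_unfold)
 then show "itg (%z. frac_const DIM('a) s * ((ph x - ph (x - z)) * ((z \<bullet> b) / (norm z powr (real DIM('a) + s) * norm z))))"
  unfolding z[symmetric] by simp
 have "(LBINT z. frac_const DIM('a) s * ((ph x - ph (x - z)) * ((z \<bullet> b) / (norm z powr (real DIM('a) + s) * norm z)))) = (1 / Gamma be) * (LBINT z. LBINT t. F t z)"
  unfolding z[symmetric] by simp
 also have "(LBINT z. LBINT t. F t z) = (LBINT t. LBINT z. F t z)"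
  using lborel_pair.Fubini_integral[OF Fi] by simp
 also have "... = (LBINT r. ind {0<..} r * (r powr (be - 1) * conv (hk r) (pd b ph) x))"
 proof (intro L_integral_cong refl)
  fix t :: real
  show "(LBINT z. F t z) = ind {0<..} t * (t powr (be - 1) * conv (hk t) (pd b ph) x)"
  proof (cases "0 < t")
   case True
   have i: "itg (%z. hg b t z * ph (x - z))"
    by (rule conv_bounded(1)[OF hg_integrable(1)[OF True b] _ M(2)]) measurable
   have "(LBINT z. hg b t z * d z) = (LBINT z. hg b t z * ph (x - z) - hg b t z * ph x)" by (simp add: d_def right_diff_distrib)
   also have "... = conv (hg b t) ph x - (LBINT z. hg b t z) * ph x"
    using i hg_integrable(1)[OF True b] by (simp add: conv_def)
   also have "... = conv (hk t) (pd b ph) x" by (simp add: hg_integral_zero[OF True b] conv_hg_Cc_inf[OF True ph b])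
   finally show ?thesis using True by (simp add: F_def)
  qed (simp add: F_def)
 qed
 finally show "(LBINT z. frac_const DIM('a) s * ((ph x - ph (x - z)) * ((z \<bullet> b) / (norm z powr (real DIM('a) + s) * norm z)))) = FG be b ph x"
  by (simp add: FG_def)
qed

lemma frac_const_pos:
 assumes "0 < s" "s < 1" "1 <= n"
 shows "0 < frac_const n s"
 unfolding frac_const_def using assms by (intro mult_pos_pos divide_pos_pos Gamma_real_pos) auto

text \<open>The link between the singular integral of the definition and the heat form.
  Integrability of the vector-valued integrand is assembled from its components, after which the
  inner product may be pulled inside.\<close>

lemma frac_grad_test_inner:
 fixes ph :: "'a::euclidean_space => real"
 assumes ph: "ph : Cc" and b: "b : Basis" and s: "0 < s" "s < 1"
 shows "fgrad s ph x \<bullet> b = FG ((1 - s) / 2) b ph x"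
proof -
 have [measurable]: "ph : Bb" using ph by (rule Cc_inf_measurable)
 define c where "c = frac_const DIM('a) s"
 have c: "0 < c" unfolding c_def using s DIM_positive[where 'a = 'a] by (intro frac_const_pos) auto
 define V where "V y = ((ph x - ph y) / norm (x - y) powr (real DIM('a) + s)) *\<^sub>R ((x - y) /\<^sub>R norm (x - y))" for y
 have Vm [measurable]: "V : Bb" unfolding V_def by measurable
 have Vb: "V (x - z) \<bullet> b = (ph x - ph (x - z)) * ((z \<bullet> b) / (norm z powr (real DIM('a) + s) * norm z))" for z b
  by (simp add: V_def divide_inverse ac_simps)
 have Vi: "itg (%y. V y \<bullet> b)" if "b : Basis" for b
 proof -
  have "itg (%z. (1 / c) * (c * (V (x - z) \<bullet> b)))"
   unfolding Vb c_def by (intro integrable_mult_right FG_kernel(1)[OF ph that s refl])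
  then show ?thesis using c integrable_lborel_minus[of "%y. V y \<bullet> b" x] by simp
 qed
 have "itg (%y. SUM b:Basis. (V y \<bullet> b) *\<^sub>R b)"
  using Vi by (intro L_integrable_sum integrable_scaleR_left) auto
 then have VI: "itg V" by (simp add: euclidean_representation)
 have "fgrad s ph x \<bullet> b = c * ((LBINT y. V y) \<bullet> b)"
  unfolding frac_grad_test_def c_def[symmetric] V_def[symmetric] by (simp add: integral_completion)
 also have "(LBINT y. V y) \<bullet> b = (LBINT y. V y \<bullet> b)" using VI by simp
 also have "... = (LBINT z. V (x - z) \<bullet> b)" using integral_lborel_minus[of "%y. V y \<bullet> b" x] by simp
 also have "c * ... = (LBINT z. c * (V (x - z) \<bullet> b))" by simp
 also have "... = FG ((1 - s) / 2) b ph x"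
  unfolding Vb c_def by (rule FG_kernel(2)[OF ph b s refl])
 finally show ?thesis .
qed

section \<open>Duality, linearity and norm bounds of the fractional gradient\<close>

lemma conv_hg_adjoint:
 fixes ph ps :: "'a::euclidean_space => real"
 assumes ph: "ph : Cc" and ps: "ps : Cc" and t: "0 < t" and b: "b : Basis"
 shows "(LBINT x. conv (hg b t) ph x * ps x) = - (LBINT x. ph x * conv (hg b t) ps x)"
proof -
 have [measurable]: "ph : Bb" "ps : Bb" using ph ps by (auto intro: Cc_inf_measurable)
 obtain M where M: "!!x. \<bar>ph x\<bar> <= M" using Cc_inf_bounded[OF ph] by blast
 obtain M' where M': "!!x. \<bar>ps x\<bar> <= M'" using Cc_inf_bounded[OF ps] by blast
 have i1: "integrable (lborel \<Otimes>\<^sub>M lborel) (%(z, x). hg b t z * ph (x - z) * ps x)"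
 proof (rule lborel_pair.integrable_product_bound[where a = "%z. M * \<bar>hg b t z\<bar>" and b = "%x. \<bar>ps x\<bar>"])
  show "\<bar>case (z, x) of (z, x) => hg b t z * ph (x - z) * ps x\<bar> <= M * \<bar>hg b t z\<bar> * \<bar>ps x\<bar>" for z x
   using mult_right_mono[OF M[of "x - z"], of "\<bar>hg b t z\<bar> * \<bar>ps x\<bar>"] by (simp add: abs_mult ac_simps)
 qed (use hg_integrable(1)[OF t b] Cc_inf_integrable[OF ps] in auto)
 have i2: "integrable (lborel \<Otimes>\<^sub>M lborel) (%(z, x). hg b t z * ph x * ps (x + z))"
 proof (rule lborel_pair.integrable_product_bound[where a = "%z. M' * \<bar>hg b t z\<bar>" and b = "%x. \<bar>ph x\<bar>"])
  show "\<bar>case (z, x) of (z, x) => hg b t z * ph x * ps (x + z)\<bar> <= M' * \<bar>hg b t z\<bar> * \<bar>ph x\<bar>" for z x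
   using mult_right_mono[OF M'[of "x + z"], of "\<bar>hg b t z\<bar> * \<bar>ph x\<bar>"] by (simp add: abs_mult ac_simps)
 qed (use hg_integrable(1)[OF t b] Cc_inf_integrable[OF ph] in auto)
 have "(LBINT x. conv (hg b t) ph x * ps x) = (LBINT x. LBINT z. hg b t z * ph (x - z) * ps x)"
  by (simp add: conv_def)
 also have "... = (LBINT z. LBINT x. hg b t z * ph (x - z) * ps x)"
  using lborel_pair.Fubini_integral[OF i1] by simp
 also have "... = (LBINT z. LBINT x. hg b t z * ph x * ps (x + z))"
 proof -
  have "(LBINT x. hg b t z * ph (x - z) * ps x) = (LBINT x. hg b t z * ph x * ps (x + z))" for z
   using integral_lborel_shift[of "%x. hg b t z * ph (x - z) * ps x" z] by simp
  then show ?thesis by simp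
 qed
 also have "... = (LBINT x. LBINT z. hg b t z * ph x * ps (x + z))"
  using lborel_pair.Fubini_integral[OF i2] by simp
 also have "... = (LBINT x. - (ph x * conv (hg b t) ps x))"
 proof -
  have "(LBINT z. hg b t z * ph x * ps (x + z)) = - (ph x * conv (hg b t) ps x)" for x
  proof -
  \<comment> \<open>Reflection in \<open>z\<close>: the kernel \<open>hg\<close> is odd, and this is
    the origin of the minus sign in all integrations by parts.\<close>
  have "(LBINT z. hg b t z * ph x * ps (x + z)) = (LBINT z. hg b t (0 - z) * ph x * ps (x + (0 - z)))"
   by (rule integral_lborel_minus[symmetric]) measurable
  also have "... = (LBINT z. - ph x * (hg b t z * ps (x - z)))"
   by (simp add: hg_def hk_def ac_simps)
  also have "... = - ph x * conv (hg b t) ps x" unfolding conv_def by (rule integral_mult_right_zero)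
  finally show ?thesis by simp
  qed
  then show ?thesis by simp
 qed
 finally show ?thesis by simp
qed

lemma FG_integration_by_parts:
 fixes ph ps :: "'a::euclidean_space => real"
 assumes ph: "ph : Cc" and ps: "ps : Cc" and b: "b : Basis" and be: "0 < be" "be < 1/2"
 shows "(LBINT x. FG be b ph x * ps x) = - (LBINT x. ph x * FG be b ps x)"
proof -
 define k where "k ph r x = ind {0<..} r * (r powr (be - 1) * conv (hk r) (pd b ph) x)" for ph r x
 have swap: "(LBINT x. FG be b ph x * ps x) = (1 / Gamma be) * (LBINT r. LBINT x. k ph r x * ps x)"
  if ph: "ph : Cc" and ps: "ps : Cc" for ph ps
 proof -
  obtain a where a: "itg a" "!!r x. \<bar>k ph r x\<bar> <= a r" using FG_dominated[OF ph b be] unfolding k_def by blast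
  have [measurable]: "pd b ph : Bb" "ps : Bb"
   using Cc_inf_measurable[OF Cc_inf_pd[OF ph b]] Cc_inf_measurable[OF ps] by auto
  have i: "integrable (lborel \<Otimes>\<^sub>M lborel) (%(r, x). k ph r x * ps x)"
  proof (rule lborel_pair.integrable_product_bound[where a = a and b = "%x. \<bar>ps x\<bar>"])
   show "(%(r, x). k ph r x * ps x) : borel_measurable (lborel \<Otimes>\<^sub>M lborel)" unfolding k_def conv_def by measurable
   show "\<bar>case (r, x) of (r, x) => k ph r x * ps x\<bar> <= a r * \<bar>ps x\<bar>" for r x
    using mult_right_mono[OF a(2), of "\<bar>ps x\<bar>"] by (simp add: abs_mult)
  qed (use a Cc_inf_integrable[OF ps] in auto)
  have "(LBINT x. FG be b ph x * ps x) = (LBINT x. (1 / Gamma be) * (LBINT r. k ph r x * ps x))"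
   by (simp add: FG_def k_def)
  also have "... = (1 / Gamma be) * (LBINT x. LBINT r. k ph r x * ps x)" by (rule integral_mult_right_zero)
  also have "(LBINT x. LBINT r. k ph r x * ps x) = (LBINT r. LBINT x. k ph r x * ps x)"
   using lborel_pair.Fubini_integral[OF i] by simp
  finally show ?thesis .
 qed
 have eq: "(LBINT x. k ph r x * ps x) = - (LBINT x. k ps r x * ph x)" for r
 proof (cases "0 < r")
  case True
  have "(LBINT x. k ph r x * ps x) = (LBINT x. r powr (be - 1) * (conv (hg b r) ph x * ps x))"
   using True by (simp add: k_def conv_hg_Cc_inf[OF True ph b] ac_simps)
  also have "... = - (r powr (be - 1) * (LBINT x. ph x * conv (hg b r) ps x))"
   by (simp add: conv_hg_adjoint[OF ph ps True b])
  also have "... = - (LBINT x. r powr (be - 1) * (ph x * conv (hg b r) ps x))" by simp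
  also have "... = - (LBINT x. k ps r x * ph x)"
   using True by (simp add: k_def conv_hg_Cc_inf[OF True ps b] ac_simps)
  finally show ?thesis .
 qed (simp add: k_def)
 have "(LBINT x. FG be b ph x * ps x) = - (LBINT x. FG be b ps x * ph x)"
  unfolding swap[OF ph ps] swap[OF ps ph] eq by simp
 then show ?thesis by (simp add: mult.commute)
qed

lemma FG_diff:
 fixes ph ps :: "'a::euclidean_space => real"
 assumes ph: "ph : Cc" and ps: "ps : Cc" and b: "b : Basis" and be: "0 < be" "be < 1/2"
 shows "FG be b (%x. ph x - ps x) x = FG be b ph x - FG be b ps x"
proof -
 have i: "itg (%r. ind {0<..} r * (r powr (be - 1) * conv (hk r) (pd b ph) x))" if "ph : Cc" for ph
  by (rule FG_integrable[OF that b be])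
 have c: "conv (hk r) (pd b (%x. ph x - ps x)) x = conv (hk r) (pd b ph) x - conv (hk r) (pd b ps) x" if r: "0 < r" for r
 proof -
  have ci: "itg (%z. hk r z * pd b ph (x - z))" if ph: "ph : Cc" for ph
  proof -
   obtain M1 where M1: "!!x. \<bar>pd b ph x\<bar> <= M1" using Cc_inf_bounded[OF Cc_inf_pd[OF ph b]] by blast
   show ?thesis by (rule conv_bounded(1)[OF hk_integral(1)[OF r] Cc_inf_measurable[OF Cc_inf_pd[OF ph b]] M1])
  qed
  show ?thesis unfolding conv_def Cc_inf_pd_diff[OF ph ps] right_diff_distrib using ci[OF ph] ci[OF ps] by simp
 qed
 have eq: "ind {0<..} r * (r powr (be - 1) * conv (hk r) (pd b (%x. ph x - ps x)) x)
  = ind {0<..} r * (r powr (be - 1) * conv (hk r) (pd b ph) x) - ind {0<..} r * (r powr (be - 1) * conv (hk r) (pd b ps) x)" for r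
  by (cases "0 < r") (simp_all add: c right_diff_distrib)
 show ?thesis unfolding FG_def eq L_integral_diff[OF i[OF ph] i[OF ps]] by (rule right_diff_distrib)
qed

lemma conv_hg_le:
 fixes f :: "'a::euclidean_space => real"
 assumes t: "0 < t" and b: "b : Basis" and f [measurable]: "f : Bb" and M: "!!x. \<bar>f x\<bar> <= M"
 shows "\<bar>conv (hg b t) f x\<bar> <= 2 powr (real DIM('a) / 2) * t powr (- (1/2)) * conv (hk (2 * t)) (%x. \<bar>f x\<bar>) x"
proof -
 have i: "itg (%z. hg b t z * f (x - z))" by (rule conv_bounded(1)[OF hg_integrable(1)[OF t b] f M])
 have i2: "itg (%z. hk (2 * t) z * \<bar>f (x - z)\<bar>)"
  using t M by (intro conv_bounded(1)[where f = "%x. \<bar>f x\<bar>"] hk_integral(1)) auto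
 have "\<bar>conv (hg b t) f x\<bar> <= (LBINT z. 2 powr (real DIM('a) / 2) * t powr (- (1/2)) * (hk (2 * t) z * \<bar>f (x - z)\<bar>))"
 proof -
  have "norm (hg b t z * f (x - z)) <= 2 powr (real DIM('a) / 2) * t powr (- (1/2)) * (hk (2 * t) z * \<bar>f (x - z)\<bar>)" for z
   using mult_right_mono[OF hg_bound[OF t b, of z], of "\<bar>f (x - z)\<bar>"] by (simp add: abs_mult ac_simps)
  from L_integral_norm_bound_integral[OF i integrable_mult_right[OF i2] this]
  show ?thesis by (simp add: conv_def)
 qed
 then show ?thesis by (simp add: conv_def)
qed

text \<open>Minkowski's inequality in time, separately for \<open>r <= 1\<close> with the derivative
  on \<open>ph\<close> and for \<open>r > 1\<close> with the derivative on the kernel. The explicit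
  constants matter: as \<open>be\<close> tends to 0 the first base
  \<open>1 / (be * Gamma be) = 1 / Gamma (be + 1)\<close> tends to 1, and the second base tends to
  0.\<close>

lemma FG_pint:
 fixes ph :: "'a::euclidean_space => real"
 assumes ph: "ph : Cc" and b: "b : Basis" and be: "0 < be" "be < 1/2" and p: "1 <= p"
 shows "inLp p (FG be b ph)"
  "nrm p (FG be b ph) <= 2 powr p * ((1 / (be * Gamma be)) powr p * nrm p (pd b ph)
   + (2 powr (real DIM('a) / 2) / (Gamma be * (1/2 - be))) powr p * nrm p ph)"
proof -
 have G: "0 < Gamma be" using be(1) by (rule Gamma_real_pos)
 note pd = Cc_inf_pd[OF ph b]
 have [measurable]: "pd b ph : Bb" "ph : Bb"
  using Cc_inf_measurable[OF pd] Cc_inf_measurable[OF ph] by auto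
 obtain M0 where M0: "0 < M0" "!!x. \<bar>ph x\<bar> <= M0" using Cc_inf_bounded[OF ph] by blast
 define Cn where "Cn = 2 powr (real DIM('a) / 2)"
 define k1 where "k1 r = ind {0<..1} r * r powr (be - 1)" for r :: real
 define k2 where "k2 r = ind {1..} r * r powr (be - 3/2)" for r :: real
 have k1: "itg k1" "(LBINT r. k1 r) = 1 / be" unfolding k1_def
  using powr_integrable_0[of "be - 1" 1] be by auto
 have k2: "itg k2" "(LBINT r. k2 r) = 1 / (1/2 - be)" unfolding k2_def
  using powr_integrable_inf[of "be - 3/2" 1] be by (auto simp: field_simps)
 have [measurable]: "k1 : Bb" "k2 : Bb" unfolding k1_def k2_def by measurable
 define f1 where "f1 r x = conv (hk r) (%x. \<bar>pd b ph x\<bar>) x" for r x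
 define f2 where "f2 r x = conv (hk (2 * r)) (%x. \<bar>ph x\<bar>) x" for r x
 have nn: "0 <= f1 r x" "0 <= f2 r x" for r x unfolding f1_def f2_def conv_def
  by (intro L_integral_nonneg; simp)+
 have fm [measurable]: "(%(r, x). f1 r x) : borel_measurable (lborel \<Otimes>\<^sub>M lborel)" "(%(r, x). f2 r x) : borel_measurable (lborel \<Otimes>\<^sub>M lborel)"
  unfolding f1_def f2_def conv_def by measurable
 have p1: "inLp p (pd b ph)" "inLp p ph" using p pd ph by (auto intro!: Cc_inf_pint)
 have B1: "(\<integral>\<^sup>+x. ennreal (f1 r x powr p) \<partial>lborel) <= ennreal (nrm p (pd b ph) * 1 powr p)" if "k1 r ~= 0" for r
 proof -
  have r: "0 < r" using that by (auto simp: k1_def indicator_def split: if_splits)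
  note c = conv_pint(1,2)[OF hk_integral(1)[OF r] hk_nonneg hk_integral(2)[OF r] p1(1) p]
  show ?thesis using pint_nn[OF c(1)] c(2) nn by (simp add: f1_def ennreal_leI)
 qed
 have B2: "(\<integral>\<^sup>+x. ennreal (f2 r x powr p) \<partial>lborel) <= ennreal (nrm p ph * 1 powr p)" if "k2 r ~= 0" for r
 proof -
  have r: "0 < 2 * r" using that by (auto simp: k2_def indicator_def split: if_splits)
  note c = conv_pint(1,2)[OF hk_integral(1)[OF r] hk_nonneg hk_integral(2)[OF r] p1(2) p]
  show ?thesis using pint_nn[OF c(1)] c(2) nn by (simp add: f2_def ennreal_leI)
 qed
 have sf: "sigma_finite_measure (lborel :: 'a measure)" "sigma_finite_measure (lborel :: real measure)"
  by (rule sigma_finite_lborel)+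
 have k0: "0 <= k1 r" "0 <= k2 r" for r by (auto simp: k1_def k2_def)
 have m1: "k1 : Bl" "k2 : Bl" "(%_::real. 1::real) : Bl" by auto
 note MK1 = Minkowski_kernel[OF sf m1(1,3) fm(1) k0(1) nn(1) zero_less_one B1 pnorm_nonneg _ p]
 note MK2 = Minkowski_kernel[OF sf m1(2,3) fm(2) k0(2) nn(2) zero_less_one B2 pnorm_nonneg _ p]
 define I1 where "I1 x = (LBINT r. k1 r * f1 r x)" for x
 define I2 where "I2 x = (LBINT r. k2 r * f2 r x)" for x
 have Im [measurable]: "I1 : Bb" "I2 : Bb" unfolding I1_def I2_def by measurable
 have I0: "0 <= I1 x" "0 <= I2 x" for x unfolding I1_def I2_def using k0 nn by (auto intro!: L_integral_nonneg)
 have I1: "inLp p I1" "nrm p I1 <= (1 / be) powr p * nrm p (pd b ph)"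
  using MK1(2) k1 I0 pnorm_nonneg[of lborel p "pd b ph"]
  by (auto intro!: pintI_nn simp: I1_def[symmetric])
 have I2: "inLp p I2" "nrm p I2 <= (1 / (1/2 - be)) powr p * nrm p ph"
  using MK2(2) k2 I0 pnorm_nonneg[of lborel p ph]
  by (auto intro!: pintI_nn simp: I2_def[symmetric])
 define H where "H x = (1 / Gamma be) * I1 x + (Cn / Gamma be) * I2 x" for x
 have c1: "inLp p (%x. (1 / Gamma be) * I1 x)" "inLp p (%x. (Cn / Gamma be) * I2 x)"
  by (rule pint_cmult(1)[OF I1(1)], rule pint_cmult(1)[OF I2(1)])
 have Hp: "inLp p H" unfolding H_def using c1 p by (intro pint_add) auto
 have "nrm p H <= 2 powr p * (nrm p (%x. (1 / Gamma be) * I1 x) + nrm p (%x. (Cn / Gamma be) * I2 x))"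
  unfolding H_def using c1 p by (intro pint_add) auto
 also have "... = 2 powr p * ((1 / Gamma be) powr p * nrm p I1 + (Cn / Gamma be) powr p * nrm p I2)"
  unfolding pint_cmult(2)[OF I1(1)] pint_cmult(2)[OF I2(1)] using G by (simp add: Cn_def)
 also have "... <= 2 powr p * ((1 / Gamma be) powr p * ((1 / be) powr p * nrm p (pd b ph)) + (Cn / Gamma be) powr p * ((1 / (1/2 - be)) powr p * nrm p ph))"
  using I1(2) I2(2) by (intro mult_left_mono add_mono) auto
 also have "... = 2 powr p * ((1 / (be * Gamma be)) powr p * nrm p (pd b ph) + (Cn / (Gamma be * (1/2 - be))) powr p * nrm p ph)"
  by (simp add: powr_mult[symmetric] mult.assoc[symmetric] mult.commute)
 finally have Hn: "nrm p H <= 2 powr p * ((1 / (be * Gamma be)) powr p * nrm p (pd b ph) + (Cn / (Gamma be * (1/2 - be))) powr p * nrm p ph)" .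
 have ae: "AE x in lborel. norm (FG be b ph x) <= norm (H x)"
 proof -
  have "AE x in lborel. itg (%r. k1 r * f1 r x)" "AE x in lborel. itg (%r. k2 r * f2 r x)"
   using MK1(1) MK2(1) k1 k2 by auto
  then show ?thesis
  proof eventually_elim
   case (elim x)
   have pt: "norm (ind {0<..} r * (r powr (be - 1) * conv (hk r) (pd b ph) x)) <= k1 r * f1 r x + Cn * (k2 r * f2 r x)" for r
   proof -
    consider "r <= 0" | "0 < r" "r <= 1" | "1 < r" by linarith
    then show ?thesis
    proof cases
     case 2
     have "\<bar>conv (hk r) (pd b ph) x\<bar> <= f1 r x"
      using integral_norm_bound[of lborel "%z. hk r z * pd b ph (x - z)"] by (simp add: conv_def f1_def abs_mult)
     then have "r powr (be - 1) * \<bar>conv (hk r) (pd b ph) x\<bar> <= r powr (be - 1) * f1 r x" by (intro mult_left_mono) auto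
     then show ?thesis using 2 k0(2)[of r] nn(2)[of r x] by (auto simp: k1_def abs_mult Cn_def intro!: add_increasing2)
    next
     case 3
     then have r: "0 < r" by simp
     have "r powr (be - 1) * \<bar>conv (hk r) (pd b ph) x\<bar> = r powr (be - 1) * \<bar>conv (hg b r) ph x\<bar>"
      by (simp add: conv_hg_Cc_inf[OF r ph b])
     also have "... <= r powr (be - 1) * (Cn * r powr (- (1/2)) * f2 r x)"
      unfolding Cn_def f2_def by (intro mult_left_mono conv_hg_le[OF r b _ M0(2)]) auto
     also have "... = Cn * ((r powr (be - 1) * r powr (- (1/2))) * f2 r x)" by simp
     also have "r powr (be - 1) * r powr (- (1/2)) = r powr (be - 3/2)" by (simp add: powr_add[symmetric])
     finally show ?thesis using 3 by (simp add: k1_def k2_def abs_mult)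
    qed (simp add: k1_def k2_def)
   qed
   have "norm (LBINT r. ind {0<..} r * (r powr (be - 1) * conv (hk r) (pd b ph) x)) <= (LBINT r. k1 r * f1 r x + Cn * (k2 r * f2 r x))"
    using elim by (intro L_integral_norm_bound_integral pt FG_integrable[OF ph b be]) auto
   also have "... = I1 x + Cn * I2 x" using elim by (simp add: I1_def I2_def)
   finally have "norm (FG be b ph x) <= (1 / Gamma be) * (I1 x + Cn * I2 x)"
    unfolding FG_def norm_mult using G by (intro mult_mono) auto
   also have "... = H x" by (simp add: H_def distrib_left)
   finally show ?case by simp
  qed
 qed
 have m: "FG be b ph : Bl" using FG_measurable[OF ph b] by simp
 show "inLp p (FG be b ph)" using pint_mono(1)[OF m Hp ae] p by simp
 have "nrm p (FG be b ph) <= nrm p H" using pint_mono(2)[OF m Hp ae] p by simp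
 with Hn show "nrm p (FG be b ph) <= 2 powr p * ((1 / (be * Gamma be)) powr p * nrm p (pd b ph)
   + (2 powr (real DIM('a) / 2) / (Gamma be * (1/2 - be))) powr p * nrm p ph)"
  unfolding Cn_def by linarith
qed

section \<open>Reconstruction from the fractional gradient\<close>

text \<open>As \<open>be\<close> tends to 0, the weight on (0, 1] has mass
  \<open>rGamma (be + 1)\<close>, close to 1, and concentrates at \<open>r = 0\<close>, where the
  flow returns \<open>pd b ps\<close>. Everything else is a bounded integral multiplied by
  \<open>rGamma be\<close>, and \<open>rGamma\<close> vanishes at 0.\<close>

lemma FG_near:
 fixes ps :: "'a::euclidean_space => real"
 assumes ps: "ps : Cc" and b: "b : Basis"
 obtains A where "0 <= A" "!!be x. 0 < be ==> be <= 1/4 ==>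
  \<bar>FG be b ps x - pd b ps x\<bar> <= A * (rGamma be + \<bar>rGamma (be + 1) - 1\<bar>)"
proof -
 define f where "f = pd b ps"
 have f: "f : Cc" unfolding f_def by (rule Cc_inf_pd[OF ps b])
 have [measurable]: "f : Bb" "ps : Bb" using f ps by (auto intro: Cc_inf_measurable)
 obtain M0 where M0: "0 < M0" "!!x. \<bar>ps x\<bar> <= M0" using Cc_inf_bounded[OF ps] by blast
 obtain M1 where M1: "0 < M1" "!!x. \<bar>f x\<bar> <= M1" using Cc_inf_bounded[OF f] by blast
 obtain C where C: "0 <= C" "!!t x. 0 < t ==> \<bar>conv (hk t) f x - f x\<bar> <= C * sqrt t"
  using conv_hk_Lipschitz[OF f] by blast
 define B where "B = M0 * 2 powr (real DIM('a) / 2)"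
 have B: "0 <= B" using M0 by (simp add: B_def)
 define A where "A = 6 * (C + B) + M1"
 show thesis
 proof (rule that[of A])
  show "0 <= A" using B C M1 by (simp add: A_def)
  fix be :: real and x :: 'a
  assume be: "0 < be" "be <= 1/4"
  \<comment> \<open>On (0, 1] the value of the flow at \<open>r = 0\<close> is subtracted; the
    \<open>sqrt r\<close> estimate improves the singularity to \<open>be - 1/2\<close>, which stays
    integrable uniformly in \<open>be\<close>.\<close>
  define h where "h r = r powr (be - 1) * conv (hk r) f x - ind {..1} r * (r powr (be - 1) * f x)" for r
  have hm: "h : Bb" unfolding h_def by measurable
  have h1: "\<bar>h r\<bar> <= (C + B) * r powr (be - 1/2)" if r: "0 < r" "r <= 1" for r
  proof -
   have "\<bar>h r\<bar> = r powr (be - 1) * \<bar>conv (hk r) f x - f x\<bar>"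
    using r by (simp add: h_def right_diff_distrib[symmetric] abs_mult)
   also have "... <= r powr (be - 1) * (C * r powr (1/2))"
    using C(2)[OF r(1), of x] r by (intro mult_left_mono) (auto simp: powr_half_sqrt)
   also have "... = C * (r powr (be - 1) * r powr (1/2))" by simp
   also have "r powr (be - 1) * r powr (1/2) = r powr (be - 1/2)" by (simp add: powr_add[symmetric])
   also have "C * r powr (be - 1/2) <= (C + B) * r powr (be - 1/2)" using B by (intro mult_right_mono) auto
   finally show ?thesis .
  qed
  have h2: "\<bar>h r\<bar> <= (C + B) * r powr (be - 3/2)" if r1: "1 <= r" for r
  proof (cases "r = 1")
   case True then show ?thesis using h1[of 1] by simp
  next
   case False
   with r1 have r: "0 < r" "1 < r" by auto
   have "\<bar>h r\<bar> = r powr (be - 1) * \<bar>conv (hg b r) ps x\<bar>"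
    using r by (simp add: h_def f_def conv_hg_Cc_inf[OF r(1) ps b] abs_mult)
   also have "... <= r powr (be - 1) * (M0 * (2 powr (real DIM('a) / 2) * r powr (- (1/2))))"
    using M0 by (intro mult_left_mono conv_hg_bounded[OF r(1) b]) auto
   also have "... = B * (r powr (be - 1) * r powr (- (1/2)))" by (simp add: B_def)
   also have "r powr (be - 1) * r powr (- (1/2)) = r powr (be - 3/2)" by (simp add: powr_add[symmetric])
   also have "B * r powr (be - 3/2) <= (C + B) * r powr (be - 3/2)" using C by (intro mult_right_mono) auto
   finally show ?thesis .
  qed
  have e: "-1 < be - 1/2" "be - 3/2 < -1" using be by auto
  note T = integrable_two_regimes[OF hm e h1 h2]
  have Ti: "itg (%r. ind {0<..} r * h r)" by (rule T(1))
  have "\<bar>LBINT r. ind {0<..} r * h r\<bar> <= (LBINT r. ind {0<..} r * \<bar>h r\<bar>)"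
   using integral_norm_bound[of lborel "%r. ind {0<..} r * h r"] by (simp add: abs_mult)
  also have "... <= (C + B) / (be - 1/2 + 1) - (C + B) / (be - 3/2 + 1)" by (rule T(2))
  \<comment> \<open>A factor 2 from the integral near 0 and 4 from the tail; the latter uses
    \<open>be <= 1/4\<close>.\<close>
  also have "... <= 6 * (C + B)"
  proof -
   have "(C + B) / (be - 1/2 + 1) <= 2 * (C + B)"
    using be C B frac_le[of "C + B" "C + B" "1/2" "be - 1/2 + 1"] by simp
   moreover have "- ((C + B) / (be - 3/2 + 1)) = (C + B) / (1/2 - be)" using be by (simp add: field_simps)
   moreover have "(C + B) / (1/2 - be) <= 4 * (C + B)"
    using be C B frac_le[of "C + B" "C + B" "1/4" "1/2 - be"] by simp
   ultimately show ?thesis by linarith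
  qed
  finally have hb: "\<bar>LBINT r. ind {0<..} r * h r\<bar> <= 6 * (C + B)" .
  have p0: "itg (%r. ind {0<..1} r * r powr (be - 1))"
   "(LBINT r. ind {0<..1} r * r powr (be - 1)) = 1 / be"
   using powr_integrable_0[of "be - 1" 1] be by auto
  have "ind {0<..} r * (r powr (be - 1) * conv (hk r) f x) = ind {0<..} r * h r + ind {0<..1} r * r powr (be - 1) * f x" for r
   by (auto simp: h_def indicator_def)
  then have "(LBINT r. ind {0<..} r * (r powr (be - 1) * conv (hk r) f x)) = (LBINT r. ind {0<..} r * h r) + 1 / be * f x"
   using Ti p0 by simp
  then have "FG be b ps x = rGamma be * (LBINT r. ind {0<..} r * h r) + rGamma be / be * f x"
   unfolding FG_def f_def[symmetric] by (simp add: rGamma_inverse_Gamma divide_inverse distrib_left)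
  also have "rGamma be / be = rGamma (be + 1)" using rGamma_plus1[of be] be by (simp add: field_simps)
  finally have eq: "FG be b ps x - f x = rGamma be * (LBINT r. ind {0<..} r * h r) + (rGamma (be + 1) - 1) * f x"
   by (simp add: left_diff_distrib)
  have r0: "0 <= rGamma be" using Gamma_real_pos[OF be(1)] by (simp add: rGamma_inverse_Gamma)
  have "\<bar>FG be b ps x - f x\<bar> <= rGamma be * (6 * (C + B)) + \<bar>rGamma (be + 1) - 1\<bar> * M1"
   unfolding eq using r0 hb M1(2)[of x]
   by (intro order_trans[OF abs_triangle_ineq] add_mono) (auto simp: abs_mult intro!: mult_left_mono)
  also have "... <= rGamma be * A + \<bar>rGamma (be + 1) - 1\<bar> * A"
   using r0 B C M1 by (intro add_mono mult_left_mono) (auto simp: A_def)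
  finally show "\<bar>FG be b ps x - pd b ps x\<bar> <= A * (rGamma be + \<bar>rGamma (be + 1) - 1\<bar>)"
   by (simp add: f_def algebra_simps)
 qed
qed

text \<open>Interpolation: the supremum \<open>S j\<close> of the difference tends to 0, its
  integral \<open>N j\<close> stays bounded, and the \<open>q\<close>-th power is split into a
  factor \<open>q - 1\<close> estimated by the former and a factor 1 estimated by the
  latter.\<close>

lemma FG_tendsto:
 fixes ps :: "'a::euclidean_space => real"
 assumes ps: "ps : Cc" and b: "b : Basis" and q: "1 < q"
  and be: "!!j. 0 < be j" "!!j. be j <= 1/4" "be ----> 0"
 shows "(%j. nrm q (%x. FG (be j) b ps x - pd b ps x)) ----> 0"
proof -
 note pd = Cc_inf_pd[OF ps b]
 have [measurable]: "pd b ps : Bb" using Cc_inf_measurable[OF pd] .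
 obtain A where A: "0 <= A" "!!be x. 0 < be ==> be <= 1/4 ==>
  \<bar>FG be b ps x - pd b ps x\<bar> <= A * (rGamma be + \<bar>rGamma (be + 1) - 1\<bar>)" using FG_near[OF ps b] by auto
 define S where "S j = A * (rGamma (be j) + \<bar>rGamma (be j + 1) - 1\<bar>)" for j
 have S0: "0 <= S j" for j unfolding S_def using A(1) Gamma_real_pos[OF be(1)[of j]] by (simp add: rGamma_inverse_Gamma)
 have g0: "(%j. rGamma (be j)) ----> 0"
  using isCont_tendsto_compose[OF isCont_rGamma[OF continuous_ident, of 0] be(3)] by simp
 have g1: "(%j. rGamma (be j + 1)) ----> 1"
 proof -
  have "(%j. be j + 1) ----> 1" using tendsto_add[OF be(3) tendsto_const, of 1] by simp
  from isCont_tendsto_compose[OF isCont_rGamma[OF continuous_ident, of 1] this] show ?thesis by simp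
 qed
 have "S ----> A * (0 + \<bar>1 - 1\<bar>)" unfolding S_def by (intro tendsto_intros g0 g1)
 then have Sl: "S ----> 0" by simp
 define N where "N j = 2 powr 1 * (2 powr 1 * (rGamma (be j + 1) * nrm 1 (pd b ps)
   + (2 powr (real DIM('a) / 2) * rGamma (be j) / (1/2 - be j)) * nrm 1 ps) + nrm 1 (pd b ps))" for j
 have Nl: "N ----> 2 powr 1 * (2 powr 1 * (1 * nrm 1 (pd b ps)
   + (2 powr (real DIM('a) / 2) * 0 / (1/2 - 0)) * nrm 1 ps) + nrm 1 (pd b ps))"
  unfolding N_def by (intro tendsto_intros g0 g1 be(3)) auto
 have p1: "inLp 1 (%x. FG (be j) b ps x - pd b ps x) & nrm 1 (%x. FG (be j) b ps x - pd b ps x) <= N j" for j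
 proof -
  have bj: "0 < be j" "be j < 1/2" using be(1,2)[of j] by auto
  have G: "0 < Gamma (be j)" using bj(1) by (rule Gamma_real_pos)
  note F = FG_pint[OF ps b bj order_refl]
  have g: "1 / (be j * Gamma (be j)) = rGamma (be j + 1)"
   using rGamma_plus1[of "be j"] bj G by (simp add: rGamma_inverse_Gamma field_simps)
  have g': "2 powr (real DIM('a) / 2) / (Gamma (be j) * (1/2 - be j)) = 2 powr (real DIM('a) / 2) * rGamma (be j) / (1/2 - be j)"
   unfolding rGamma_inverse_Gamma by (simp add: divide_simps)
  have n: "0 <= rGamma (be j + 1)" "0 <= 2 powr (real DIM('a) / 2) * rGamma (be j) / (1/2 - be j)"
   unfolding g[symmetric] g'[symmetric] using G bj by auto
  have F2: "nrm 1 (FG (be j) b ps) <= 2 powr 1 * (rGamma (be j + 1) * nrm 1 (pd b ps)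
   + (2 powr (real DIM('a) / 2) * rGamma (be j) / (1/2 - be j)) * nrm 1 ps)"
   using F(2) unfolding g g' powr_one' abs_of_nonneg[OF n(1)] abs_of_nonneg[OF n(2)] .
  have p: "inLp 1 (pd b ps)" using pd by (rule Cc_inf_pint) simp
  note D = pint_diff[OF F(1) p zero_le_one]
  have "nrm 1 (%x. FG (be j) b ps x - pd b ps x) <= N j"
   using D(2) F2 unfolding N_def by (auto elim!: order_trans intro!: mult_left_mono)
  with D(1) show ?thesis by simp
 qed
 have le: "nrm q (%x. FG (be j) b ps x - pd b ps x) <= S j powr (q - 1) * N j" for j
 proof -
  have m: "(%x. FG (be j) b ps x - pd b ps x) : Bl"
   using pint_measurable[OF conjunct1[OF p1[of j]]] .
  have i: "itg (%x. S j powr (q - 1) * norm (FG (be j) b ps x - pd b ps x))"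
   using pint_integrable[OF conjunct1[OF p1[of j]]] by auto
  have "norm (FG (be j) b ps x - pd b ps x) powr q <= S j powr (q - 1) * norm (FG (be j) b ps x - pd b ps x)" for x
  proof -
   let ?a = "norm (FG (be j) b ps x - pd b ps x)"
   have "?a <= S j" using A(2)[OF be(1,2)[of j], of x] by (simp add: S_def)
   then have "?a powr (q - 1) * ?a <= S j powr (q - 1) * ?a" using q by (intro mult_right_mono powr_mono2) auto
   moreover have "?a powr q = ?a powr (q - 1) * ?a powr 1" using powr_add[of ?a "q - 1" 1] by simp
   ultimately show ?thesis by simp
  qed
  then have "nrm q (%x. FG (be j) b ps x - pd b ps x) <= (LBINT x. S j powr (q - 1) * norm (FG (be j) b ps x - pd b ps x))"
   by (intro pint_bound(2)[OF m i]) auto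
  also have "... = S j powr (q - 1) * nrm 1 (%x. FG (be j) b ps x - pd b ps x)" by (simp add: pnorm_def)
  also have "... <= S j powr (q - 1) * N j" using p1[of j] by (intro mult_left_mono) auto
  finally show ?thesis .
 qed
 have "(%j. S j powr (q - 1)) ----> 0" using Sl S0 q by (intro tendsto_0_powrI) auto
 from tendsto_mult[OF this Nl] have "(%j. S j powr (q - 1) * N j) ----> 0" by simp
 then show ?thesis by (rule tendsto_sandwich[OF _ _ tendsto_const, rotated 2]) (use le in auto)
qed

section \<open>Inversion of the fractional gradient\<close>

lemma Beta_kernel_integral:
 fixes be \<sigma> :: real
 assumes be: "0 < be" "be < 1" and \<sigma>: "0 < \<sigma>"
 shows "itg (%t. ind {0<..<\<sigma>} t * (t powr (- be) * (\<sigma> - t) powr (be - 1)))"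
  "(LBINT t. ind {0<..<\<sigma>} t * (t powr (- be) * (\<sigma> - t) powr (be - 1))) = Gamma (1 - be) * Gamma be"
proof -
 have B: "Beta (1 - be) be = Gamma (1 - be) * Gamma be" by (simp add: Beta_altdef)
 have G: "0 <= Gamma (1 - be) * Gamma be" using Gamma_real_pos[of be] Gamma_real_pos[of "1 - be"] be by simp
 have "((%t. t powr ((1 - be) - 1) * (1 - t) powr (be - 1)) has_integral Beta (1 - be) be) {0..1}"
  using be by (intro has_integral_Beta_real) auto
 then have hi: "((%t. t powr (- be) * (1 - t) powr (be - 1)) has_integral Gamma (1 - be) * Gamma be) {0..1}" using B by simp
 have "(\<integral>\<^sup>+t. ennreal (ind {0..1} t * (t powr (- be) * (1 - t) powr (be - 1))) \<partial>lborel) = ennreal (Gamma (1 - be) * Gamma be)"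
  by (rule nn_integral_has_integral_lebesgue[OF _ hi]) auto
 moreover have "ind {0..1} t * (t powr (- be) * (1 - t) powr (be - 1)) = ind {0<..<1} t * (t powr (- be) * (1 - t) powr (be - 1))" for t :: real
  by (auto simp: indicator_def)
 ultimately have n1: "(\<integral>\<^sup>+t. ennreal (ind {0<..<1} t * (t powr (- be) * (1 - t) powr (be - 1))) \<partial>lborel) = ennreal (Gamma (1 - be) * Gamma be)" by simp
 \<comment> \<open>The exponents \<open>- be\<close> and \<open>be - 1\<close> add up to
   \<open>-1\<close> and cancel the Jacobian of the scaling, so that the integral does not depend on
   \<open>\<sigma>\<close>.\<close>
 have sc: "\<sigma> * (ind {0<..<\<sigma>} (\<sigma> * t) * ((\<sigma> * t) powr (- be) * (\<sigma> - \<sigma> * t) powr (be - 1))) = ind {0<..<1} t * (t powr (- be) * (1 - t) powr (be - 1))" for t :: real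
 proof (cases "0 < t & t < 1")
  case True
  then have "ind {0<..<\<sigma>} (\<sigma> * t) = (1::real)" using \<sigma> by simp
  moreover have "\<sigma> - \<sigma> * t = \<sigma> * (1 - t)" by (simp add: right_diff_distrib)
  moreover have "\<sigma> * (\<sigma> powr (- be) * \<sigma> powr (be - 1)) = 1"
  proof -
   have "\<sigma> powr (- be) * \<sigma> powr (be - 1) = \<sigma> powr (- 1)" by (simp add: powr_add[symmetric])
   then show ?thesis using \<sigma> by (simp add: powr_minus)
  qed
  ultimately show ?thesis using True \<sigma> by (simp add: powr_mult mult.assoc[symmetric])
 next
  case False
  then show ?thesis using \<sigma> by (auto simp: indicator_def zero_less_mult_iff)
 qed
 have "(\<integral>\<^sup>+t. ennreal (ind {0<..<\<sigma>} t * (t powr (- be) * (\<sigma> - t) powr (be - 1))) \<partial>lborel)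
  = ennreal \<sigma> * (\<integral>\<^sup>+t. ennreal (ind {0<..<\<sigma>} (\<sigma> * t) * ((\<sigma> * t) powr (- be) * (\<sigma> - \<sigma> * t) powr (be - 1))) \<partial>lborel)"
  using nn_integral_real_affine[of "%t. ennreal (ind {0<..<\<sigma>} t * (t powr (- be) * (\<sigma> - t) powr (be - 1)))" \<sigma> 0] \<sigma> by simp
 also have "... = (\<integral>\<^sup>+t. ennreal \<sigma> * ennreal (ind {0<..<\<sigma>} (\<sigma> * t) * ((\<sigma> * t) powr (- be) * (\<sigma> - \<sigma> * t) powr (be - 1))) \<partial>lborel)"
  by (rule nn_integral_cmult[symmetric]) measurable
 also have "... = (\<integral>\<^sup>+t. ennreal (ind {0<..<1} t * (t powr (- be) * (1 - t) powr (be - 1))) \<partial>lborel)"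
  using \<sigma> by (simp only: ennreal_mult'[symmetric] less_imp_le sc)
 finally have nn: "(\<integral>\<^sup>+t. ennreal (ind {0<..<\<sigma>} t * (t powr (- be) * (\<sigma> - t) powr (be - 1))) \<partial>lborel) = ennreal (Gamma (1 - be) * Gamma be)"
  using n1 by simp
 show "itg (%t. ind {0<..<\<sigma>} t * (t powr (- be) * (\<sigma> - t) powr (be - 1)))"
  by (rule integrableI_nonneg) (use nn in auto)
 show "(LBINT t. ind {0<..<\<sigma>} t * (t powr (- be) * (\<sigma> - t) powr (be - 1))) = Gamma (1 - be) * Gamma be"
  using nn G by (subst integral_eq_nn_integral) auto
qed

lemma conv_hg_FG:
 fixes ph :: "'a::euclidean_space => real"
 assumes ph: "ph : Cc" and b: "b : Basis" and be: "0 < be" "be < 1/2" and t: "0 < t"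
 shows "itg (%r. ind {0<..} r * (r powr (be - 1) * conv (hk (t + r)) (pd b (pd b ph)) x))"
  "conv (hg b t) (FG be b ph) x = (1 / Gamma be) * (LBINT r. ind {0<..} r * (r powr (be - 1) * conv (hk (t + r)) (pd b (pd b ph)) x))"
proof -
 define k where "k r x = ind {0<..} r * (r powr (be - 1) * conv (hk r) (pd b ph) x)" for r x
 note pd = Cc_inf_pd[OF ph b] and pd2 = Cc_inf_pd[OF Cc_inf_pd[OF ph b] b]
 have [measurable]: "pd b ph : Bb" "pd b (pd b ph) : Bb"
  using Cc_inf_measurable[OF pd] Cc_inf_measurable[OF pd2] by auto
 obtain M1 where M1: "0 < M1" "!!x. \<bar>pd b ph x\<bar> <= M1" using Cc_inf_bounded[OF pd] by blast
 obtain M2 where M2: "0 < M2" "!!x. \<bar>pd b (pd b ph) x\<bar> <= M2" using Cc_inf_bounded[OF pd2] by blast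
 obtain a where a: "itg a" "!!r x. \<bar>k r x\<bar> <= a r" using FG_dominated[OF ph b be] unfolding k_def by blast
 have i: "integrable (lborel \<Otimes>\<^sub>M lborel) (%(r, z). hg b t z * k r (x - z))"
 proof (rule lborel_pair.integrable_product_bound[where a = a and b = "%z. \<bar>hg b t z\<bar>"])
  show "(%(r, z). hg b t z * k r (x - z)) : borel_measurable (lborel \<Otimes>\<^sub>M lborel)" unfolding k_def conv_def by measurable
  show "\<bar>case (r, z) of (r, z) => hg b t z * k r (x - z)\<bar> <= a r * \<bar>hg b t z\<bar>" for r z
   using mult_right_mono[OF a(2)[of r "x - z"], of "\<bar>hg b t z\<bar>"] by (simp add: abs_mult mult.commute)
 qed (use a hg_integrable(1)[OF t b] in auto)
 have inner: "(LBINT z. hg b t z * k r (x - z)) = ind {0<..} r * (r powr (be - 1) * conv (hk (t + r)) (pd b (pd b ph)) x)" for r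
 proof (cases "0 < r")
  case True
  have "(LBINT z. hg b t z * k r (x - z)) = (LBINT z. r powr (be - 1) * (hg b t z * conv (hk r) (pd b ph) (x - z)))"
   using True by (simp add: k_def ac_simps)
  also have "... = r powr (be - 1) * conv (hg b t) (conv (hk r) (pd b ph)) x" by (simp add: conv_def)
  also have "conv (hg b t) (conv (hk r) (pd b ph)) x = conv (hk r) (conv (hg b t) (pd b ph)) x"
   by (rule conv_conv_commute[OF hg_integrable(1)[OF t b] hk_integral(1)[OF True] _ M1(2)]) measurable
  also have "conv (hg b t) (pd b ph) = conv (hk t) (pd b (pd b ph))" by (rule ext) (rule conv_hg_Cc_inf[OF t pd b])
  also have "conv (hk r) (conv (hk t) (pd b (pd b ph))) x = conv (hk (r + t)) (pd b (pd b ph)) x"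
   by (rule conv_hk_hk[OF True t _ M2(2)]) measurable
  finally show ?thesis using True by (simp add: add.commute)
 qed (simp add: k_def)
 show "itg (%r. ind {0<..} r * (r powr (be - 1) * conv (hk (t + r)) (pd b (pd b ph)) x))"
  using lborel_pair.integrable_fst[OF i] by (simp add: inner)
 have "conv (hg b t) (FG be b ph) x = (LBINT z. (1 / Gamma be) * (LBINT r. hg b t z * k r (x - z)))"
  by (simp add: conv_def FG_def k_def)
 also have "... = (1 / Gamma be) * (LBINT z. LBINT r. hg b t z * k r (x - z))" by (rule integral_mult_right_zero)
 also have "(LBINT z. LBINT r. hg b t z * k r (x - z)) = (LBINT r. LBINT z. hg b t z * k r (x - z))"
  using lborel_pair.Fubini_integral[OF i] by simp
 finally show "conv (hg b t) (FG be b ph) x = (1 / Gamma be) * (LBINT r. ind {0<..} r * (r powr (be - 1) * conv (hk (t + r)) (pd b (pd b ph)) x))"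
  by (simp only: inner)
qed

text \<open>Heat kernels of times \<open>t\<close> and \<open>r\<close> compose to time
  \<open>t + r\<close>, and the pure second derivatives sum to the Laplacian. The divergence of the
  smoothed fractional gradient is thus a weighted average of time derivatives of the flow.\<close>

lemma divergence_FG:
 fixes ph :: "'a::euclidean_space => real"
 assumes ph: "ph : Cc" and be: "0 < be" "be < 1/2" and t: "0 < t"
 shows "Gamma be * (SUM b:Basis. conv (hg b t) (FG be b ph) x) = (LBINT r. ind {0<..} r * (r powr (be - 1) * conv (ht (t + r)) ph x))"
proof -
 have G: "Gamma be ~= 0" using Gamma_real_pos[OF be(1)] by simp
 have "Gamma be * (SUM b:Basis. conv (hg b t) (FG be b ph) x)
  = (SUM b:Basis. LBINT r. ind {0<..} r * (r powr (be - 1) * conv (hk (t + r)) (pd b (pd b ph)) x))"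
  unfolding sum_distrib_left using G by (intro sum.cong) (auto simp: conv_hg_FG(2)[OF ph _ be t])
 also have "... = (LBINT r. (SUM b:Basis. ind {0<..} r * (r powr (be - 1) * conv (hk (t + r)) (pd b (pd b ph)) x)))"
  by (rule L_integral_sum[symmetric]) (rule conv_hg_FG(1)[OF ph _ be t])
 also have "... = (LBINT r. ind {0<..} r * (r powr (be - 1) * conv (ht (t + r)) ph x))"
 proof -
  have "(SUM b:Basis. ind {0<..} r * (r powr (be - 1) * conv (hk (t + r)) (pd b (pd b ph)) x)) = ind {0<..} r * (r powr (be - 1) * conv (ht (t + r)) ph x)" for r
   using t conv_ht_Cc_inf[of "t + r", OF _ ph] by (cases "0 < r") (simp_all add: sum_distrib_left)
  then show ?thesis by simp
 qed
 finally show ?thesis .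
qed

text \<open>With \<open>\<sigma> = t + r\<close> the double time integral has the Beta kernel as its
  inner weight, of mass \<open>Gamma (1 - be) * Gamma be\<close> for every \<open>\<sigma>\<close>.
  What remains is the total time derivative of the flow after time \<open>e\<close>, that is, minus
  its state at time \<open>e\<close>.\<close>

lemma reconstruction:
 fixes ph :: "'a::euclidean_space => real"
 assumes ph: "ph : Cc" and be: "0 < be" "be < 1/2" and e: "0 <= e"
 shows "itg (%t. ind {0<..} t * (t powr (- be) * (SUM b:Basis. conv (hg b (t + e)) (FG be b ph) x)))"
  "(LBINT t. ind {0<..} t * (t powr (- be) * (SUM b:Basis. conv (hg b (t + e)) (FG be b ph) x))) = - Gamma (1 - be) * heat e ph x"
proof -
 have G: "0 < Gamma be" "0 < Gamma (1 - be)" using be by (auto intro: Gamma_real_pos)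
 have [measurable]: "ph : Bb" using ph by (rule Cc_inf_measurable)
 \<comment> \<open>Continued by 0 to negative times, as is \<open>w\<close> below, so that Fubini
   and the shifts run over the whole line.\<close>
 define E where "E t = ind {0<..} t * conv (ht t) ph x" for t
 have Em [measurable]: "E : Bb" unfolding E_def by measurable
 have Ei: "itg E" unfolding E_def by (rule conv_ht_integrable[OF ph])
 define w where "w \<sigma> t = ind {0<..<\<sigma>} t * (t powr (- be) * (\<sigma> - t) powr (be - 1))" for \<sigma> t :: real
 have wm [measurable]: "(%(\<sigma>, t). w \<sigma> t) : borel_measurable (lborel \<Otimes>\<^sub>M lborel)"
 proof -
  have "w \<sigma> t = (if 0 < t & t < \<sigma> then t powr (- be) * (\<sigma> - t) powr (be - 1) else 0)" for \<sigma> t by (simp add: w_def)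
  then show ?thesis by (simp only:) measurable
 qed
 have wi: "itg (w \<sigma>)" for \<sigma>
 proof (cases "0 < \<sigma>")
  case True
  then show ?thesis using Beta_kernel_integral(1)[OF be(1), of \<sigma>] be unfolding w_def by simp
 next
  case False
  then have "w \<sigma> = (%_. 0)" by (auto simp: w_def indicator_def fun_eq_iff)
  then show ?thesis by simp
 qed
 have wI: "(LBINT t. w \<sigma> t) = ind {0<..} \<sigma> * (Gamma (1 - be) * Gamma be)" for \<sigma>
  using Beta_kernel_integral(2)[OF be(1), of \<sigma>] be by (cases "0 < \<sigma>") (auto simp: w_def)
 have w0: "0 <= w \<sigma> t" for \<sigma> t by (simp add: w_def)
 have Ee: "itg (%\<sigma>. E (\<sigma> + e))" using Ei by (simp add: integrable_lborel_shift)
 have i: "integrable (lborel \<Otimes>\<^sub>M lborel) (%(\<sigma>, t). w \<sigma> t * E (\<sigma> + e))"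
 proof (rule lborel_pair.Fubini_integrable)
  have "(LBINT t. norm (case (\<sigma>, t) of (\<sigma>, t) => w \<sigma> t * E (\<sigma> + e))) = ind {0<..} \<sigma> * (Gamma (1 - be) * Gamma be * \<bar>E (\<sigma> + e)\<bar>)" for \<sigma>
   using wI[of \<sigma>] w0 by (simp add: abs_mult)
  moreover have "itg (%\<sigma>. ind {0<..} \<sigma> * (Gamma (1 - be) * Gamma be * \<bar>E (\<sigma> + e)\<bar>))"
   by (rule L_integrable_bound[OF integrable_mult_right[OF Ee, of "Gamma (1 - be) * Gamma be"]])
    (use G in "auto simp: abs_mult indicator_def")
  ultimately show "itg (%\<sigma>. LBINT t. norm (case (\<sigma>, t) of (\<sigma>, t) => w \<sigma> t * E (\<sigma> + e)))" by simp
 qed (use wi in "auto simp: case_prod_beta")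
 have inner: "(LBINT \<sigma>. w \<sigma> t * E (\<sigma> + e)) = Gamma be * (ind {0<..} t * (t powr (- be) * (SUM b:Basis. conv (hg b (t + e)) (FG be b ph) x)))" for t
 proof (cases "0 < t")
  case True
  have te: "0 < t + e" using True e by simp
  have "(LBINT \<sigma>. w \<sigma> t * E (\<sigma> + e)) = (LBINT r. w (r + t) t * E (r + t + e))"
   by (rule integral_lborel_shift[symmetric]) measurable
  also have "... = (LBINT r. t powr (- be) * (ind {0<..} r * (r powr (be - 1) * conv (ht (t + e + r)) ph x)))"
  proof -
   have "w (r + t) t * E (r + t + e) = t powr (- be) * (ind {0<..} r * (r powr (be - 1) * conv (ht (t + e + r)) ph x))" for r
    using True e by (cases "0 < r") (simp_all add: w_def E_def ac_simps)
   then show ?thesis by simp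
  qed
  also have "... = t powr (- be) * (LBINT r. ind {0<..} r * (r powr (be - 1) * conv (ht (t + e + r)) ph x))" by simp
  also have "... = t powr (- be) * (Gamma be * (SUM b:Basis. conv (hg b (t + e)) (FG be b ph) x))"
   by (simp only: divergence_FG[OF ph be te])
  finally show ?thesis using True by (simp add: ac_simps)
 qed (simp add: w_def)
 have "itg (%t. LBINT \<sigma>. w \<sigma> t * E (\<sigma> + e))" using lborel_pair.integrable_snd[OF i] by simp
 then show "itg (%t. ind {0<..} t * (t powr (- be) * (SUM b:Basis. conv (hg b (t + e)) (FG be b ph) x)))"
  unfolding inner using G by (simp add: integrable_mult_left_iff)
 have "Gamma be * (LBINT t. ind {0<..} t * (t powr (- be) * (SUM b:Basis. conv (hg b (t + e)) (FG be b ph) x)))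
  = (LBINT t. LBINT \<sigma>. w \<sigma> t * E (\<sigma> + e))" by (simp only: inner integral_mult_right_zero)
 also have "... = (LBINT \<sigma>. LBINT t. w \<sigma> t * E (\<sigma> + e))"
  using lborel_pair.Fubini_integral[OF i] by simp
 also have "... = (LBINT \<sigma>. (Gamma (1 - be) * Gamma be) * (ind {0<..} \<sigma> * E (\<sigma> + e)))"
  by (simp add: wI ac_simps)
 also have "... = (Gamma (1 - be) * Gamma be) * (LBINT \<sigma>. ind {0<..} \<sigma> * E (\<sigma> + e))" by (rule integral_mult_right_zero)
 also have "(LBINT \<sigma>. ind {0<..} \<sigma> * E (\<sigma> + e)) = (LBINT \<sigma>. ind {e<..} \<sigma> * conv (ht \<sigma>) ph x)"
 proof -
  have "(LBINT \<sigma>. ind {e<..} (\<sigma> + e) * E (\<sigma> + e)) = (LBINT \<sigma>. ind {e<..} \<sigma> * E \<sigma>)"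
   by (rule integral_lborel_shift) measurable
  moreover have "ind {e<..} (\<sigma> + e) = (ind {0<..} \<sigma> :: real)" "ind {e<..} \<sigma> * E \<sigma> = ind {e<..} \<sigma> * conv (ht \<sigma>) ph x" for \<sigma>
   using e by (auto simp: indicator_def E_def)
  ultimately show ?thesis by simp
 qed
 also have "(LBINT \<sigma>. ind {e<..} \<sigma> * conv (ht \<sigma>) ph x) = - heat e ph x" by (rule heat_total[OF ph e])
 finally have "Gamma be * (LBINT t. ind {0<..} t * (t powr (- be) * (SUM b:Basis. conv (hg b (t + e)) (FG be b ph) x)))
  = Gamma be * (- Gamma (1 - be) * heat e ph x)" by simp
 then show "(LBINT t. ind {0<..} t * (t powr (- be) * (SUM b:Basis. conv (hg b (t + e)) (FG be b ph) x))) = - Gamma (1 - be) * heat e ph x"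
  using G by (simp only: mult_cancel_left) auto
qed

section \<open>Distance of a function to its heat evolution\<close>

lemma powr_neg_diff_le:
 fixes u t be :: real
 assumes "0 < u" "u < t" "0 < be" "be < 1"
 shows "u powr (- be) - t powr (- be) <= (t - u) * u powr (- be - 1)"
proof -
 have "(u / t) powr 1 <= (u / t) powr be" using assms by (intro powr_mono') auto
 then have "u / t <= (u / t) powr be" using assms by simp
 then have "u powr (- be) * (u / t) <= u powr (- be) * (u / t) powr be" by (intro mult_left_mono) auto
 also have "... = t powr (- be)" using assms by (simp add: powr_divide powr_minus field_simps)
 finally have "u powr (- be) - t powr (- be) <= u powr (- be) * (1 - u / t)" by (simp add: right_diff_distrib)
 also have "... = (t - u) * (u powr (- be) / t)" using assms by (simp add: field_simps)
 also have "... <= (t - u) * (u powr (- be) / u)" using assms by (intro mult_left_mono divide_left_mono) auto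
 also have "u powr (- be) / u = u powr (- be - 1)" using assms by (simp add: powr_diff)
 finally show ?thesis .
qed

text \<open>The weight in the difference of two reconstruction formulas, for time 0 and for time
  \<open>e\<close>, the latter shifted by \<open>e\<close>. It is \<open>t powr (- be)\<close> up to
  \<open>e\<close>, has an integrable singularity just after \<open>e\<close>, and decays like
  \<open>e * t powr (- be - 1)\<close> at infinity; this extra decay makes the integral against
  \<open>t powr (- ka)\<close> converge.\<close>

definition omega :: "real => real => real => real" where
 "omega be e t = ind {0<..} t * t powr (- be) - ind {e<..} t * (t - e) powr (- be)"

lemma omega_measurable [measurable]: "omega be e : Bb"
 unfolding omega_def by measurable

text \<open>Scaling forces the power \<open>e powr \<gamma>\<close>. In the factor, the
  singularities at 0 and at \<open>e\<close> contribute \<open>1 / \<gamma>\<close> each, and the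
  tail contributes \<open>1 / (be + ka)\<close>, at most 2 because \<open>ka\<close> is at least
  \<open>1/2\<close>.\<close>

lemma omega_integral:
 fixes e be ka :: real
 assumes e: "0 < e" and be: "0 < be" and ka: "1/2 <= ka" "be + ka < 1"
 defines "\<gamma> \<equiv> 1 - be - ka"
 shows "itg (%t. \<bar>omega be e t\<bar> * (ind {0<..} t * t powr (- ka)))"
  "(LBINT t. \<bar>omega be e t\<bar> * (ind {0<..} t * t powr (- ka))) <= e powr \<gamma> * (2 / \<gamma> + 2)"
proof -
 define a1 where "a1 t = ind {0<..e} t * t powr (- be - ka)" for t
 define a2 where "a2 t = ind {e..} t * t powr (- be - ka - 1)" for t
 have a1: "itg a1" "(LBINT t. a1 t) = e powr \<gamma> / \<gamma>" unfolding a1_def \<gamma>_def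
  using powr_integrable_0[of "- be - ka" e] e ka by (auto simp: algebra_simps)
 have a2: "itg a2" "(LBINT t. a2 t) = e powr (- be - ka) / (be + ka)" unfolding a2_def
  using powr_integrable_inf[of "- be - ka - 1" e] e ka be by (auto simp: field_simps)
 have m [measurable]: "a1 : Bb" "a2 : Bb" unfolding a1_def a2_def by measurable
 \<comment> \<open>One term per range: up to \<open>e\<close>, where the second power is absent;
   from \<open>e\<close> to \<open>2 * e\<close>, where its singularity at \<open>e\<close>
   dominates; and beyond, where the difference of the two powers gains a factor
   \<open>e\<close>.\<close>
 define A where "A t = a1 t + a1 (t - e) + e * a2 (t - e)" for t
 have Ai: "itg A" unfolding A_def
  using a1(1) a2(1) integrable_lborel_shift'[OF m(1), of e] integrable_lborel_shift'[OF m(2), of e] by auto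
 have "(LBINT t. A t) = e powr \<gamma> / \<gamma> + e powr \<gamma> / \<gamma> + e * (e powr (- be - ka) / (be + ka))" unfolding A_def
  using a1 a2 integrable_lborel_shift'[OF m(1), of e] integrable_lborel_shift'[OF m(2), of e] integral_lborel_shift'[OF m(1), of e] integral_lborel_shift'[OF m(2), of e]
  by simp
 also have "e * (e powr (- be - ka) / (be + ka)) = e powr \<gamma> / (be + ka)"
 proof -
  have "e powr \<gamma> = e powr 1 * e powr (- be - ka)" unfolding powr_add[symmetric] by (simp add: \<gamma>_def algebra_simps)
  then show ?thesis using e by simp
 qed
 also have "... <= e powr \<gamma> / (1/2)" using be ka by (intro divide_left_mono) auto
 finally have AI: "(LBINT t. A t) <= e powr \<gamma> * (2 / \<gamma> + 2)" by (simp add: algebra_simps)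
 have a0: "0 <= a1 t" "0 <= a2 t" for t by (auto simp: a1_def a2_def)
 have le: "\<bar>omega be e t\<bar> * (ind {0<..} t * t powr (- ka)) <= A t" for t
 proof -
  consider "t <= 0" | "0 < t" "t <= e" | "e < t" "t - e <= e" | "e < t - e" by linarith
  then show ?thesis
  proof cases
   case 1 then show ?thesis using a0 e by (simp add: A_def)
  next
   case 2
   then have "\<bar>omega be e t\<bar> * (ind {0<..} t * t powr (- ka)) = a1 t" by (simp add: omega_def a1_def powr_add[symmetric])
   then show ?thesis using a0 e by (simp add: A_def)
  next
   case 3
   then have u: "0 < t - e" "0 < t" using e by auto
   have "(t powr (- be)) <= (t - e) powr (- be)" using u e be by (intro powr_mono2') auto
   then have "\<bar>omega be e t\<bar> <= (t - e) powr (- be)" using u 3 by (simp add: omega_def)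
   then have "\<bar>omega be e t\<bar> * t powr (- ka) <= (t - e) powr (- be) * (t - e) powr (- ka)"
    using u e ka by (intro mult_mono powr_mono2') auto
   also have "... = a1 (t - e)" using u 3 by (simp add: a1_def powr_add[symmetric])
   finally show ?thesis using a0 e u by (simp add: A_def add_increasing add_increasing2)
  next
   case 4
   then have u: "0 < t - e" "0 < t" "e < t" using e by auto
   have m2: "(t powr (- be)) <= (t - e) powr (- be)" using u e be by (intro powr_mono2') auto
   have "(t - e) powr (- be) - t powr (- be) <= e * (t - e) powr (- be - 1)"
    using powr_neg_diff_le[of "t - e" t be] u e be ka by simp
   then have "\<bar>omega be e t\<bar> <= e * (t - e) powr (- be - 1)" using u m2 by (simp add: omega_def)
   then have "\<bar>omega be e t\<bar> * t powr (- ka) <= (e * (t - e) powr (- be - 1)) * (t - e) powr (- ka)"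
    using u e ka by (intro mult_mono powr_mono2') auto
   also have "... = e * ((t - e) powr (- be - 1) * (t - e) powr (- ka))" by simp
   also have "(t - e) powr (- be - 1) * (t - e) powr (- ka) = a2 (t - e)"
   proof -
    have x: "(- be - 1) + (- ka) = - be - ka - 1" by simp
    show ?thesis using 4 unfolding powr_add[symmetric] x by (simp add: a2_def)
   qed
   finally show ?thesis using a0 e u by (simp add: A_def add_increasing add_increasing2)
  qed
 qed
 have nn: "0 <= \<bar>omega be e t\<bar> * (ind {0<..} t * t powr (- ka))" for t by simp
 show I: "itg (%t. \<bar>omega be e t\<bar> * (ind {0<..} t * t powr (- ka)))"
 proof (rule L_integrable_bound[OF Ai])
  show "AE t in lborel. norm (\<bar>omega be e t\<bar> * (ind {0<..} t * t powr (- ka))) <= norm (A t)"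
   using order_trans[OF le abs_ge_self] by (auto simp: abs_mult)
 qed measurable
 have "(LBINT t. \<bar>omega be e t\<bar> * (ind {0<..} t * t powr (- ka))) <= (LBINT t. A t)"
  by (rule integral_mono[OF I Ai le])
 with AI show "(LBINT t. \<bar>omega be e t\<bar> * (ind {0<..} t * t powr (- ka))) <= e powr \<gamma> * (2 / \<gamma> + 2)" by simp
qed

lemma conv_hk_sup:
 fixes f :: "'a::euclidean_space => real"
 assumes f: "inLp p f" and p: "1 <= p" and t: "0 < t"
 shows "itg (%z. hk t z * f (x - z))"
  "(conv (hk t) (%x. \<bar>f x\<bar>) x) powr p <= t powr (- (real DIM('a) / 2)) * nrm p f"
  "\<bar>conv (hk t) f x\<bar> powr p <= t powr (- (real DIM('a) / 2)) * nrm p f"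
proof -
 have [measurable]: "f : Bb" using pint_measurable[OF f] by simp
 have i: "itg (%z. \<bar>f (x - z)\<bar> powr p)" "(LBINT z. \<bar>f (x - z)\<bar> powr p) = nrm p f"
  using pint_integrable[OF f] integrable_lborel_minus[of "%z. \<bar>f z\<bar> powr p" x] integral_lborel_minus[of "%z. \<bar>f z\<bar> powr p" x]
  by (auto simp: pnorm_def)
 have le: "hk t z * \<bar>f (x - z)\<bar> powr p <= t powr (- (real DIM('a) / 2)) * \<bar>f (x - z)\<bar> powr p" for z
  using hk_le'[OF t] by (intro mult_right_mono) auto
 have i2: "itg (%z. t powr (- (real DIM('a) / 2)) * \<bar>f (x - z)\<bar> powr p)" using i(1) by auto
 have i3: "itg (%z. hk t z * \<bar>f (x - z)\<bar> powr p)"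
  by (rule L_integrable_bound[OF i2]) (use le in "auto simp: abs_mult")
 note J = weighted_Jensen[OF hk_integral(1)[OF t] hk_nonneg, of "%z. \<bar>f (x - z)\<bar>" p]
 have J1: "itg (%z. hk t z * \<bar>f (x - z)\<bar>)" using i3 p by (intro J(1)) auto
 then have "itg (%z. norm (hk t z * f (x - z)))" by (simp add: abs_mult)
 then show I: "itg (%z. hk t z * f (x - z))" by (rule integrable_norm_cancel) measurable
 have "(LBINT z. hk t z * \<bar>f (x - z)\<bar>) powr p <= (LBINT z. hk t (z :: 'a)) powr (p - 1) * (LBINT z. hk t z * \<bar>f (x - z)\<bar> powr p)"
  using i3 p by (intro J(2)) auto
 also have "... = (LBINT z. hk t z * \<bar>f (x - z)\<bar> powr p)" by (simp add: hk_integral(2)[OF t])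
 also have "... <= (LBINT z. t powr (- (real DIM('a) / 2)) * \<bar>f (x - z)\<bar> powr p)"
  using i2 i3 le by (intro integral_mono) auto
 also have "... = t powr (- (real DIM('a) / 2)) * nrm p f" using i(2) by simp
 finally show A: "(conv (hk t) (%x. \<bar>f x\<bar>) x) powr p <= t powr (- (real DIM('a) / 2)) * nrm p f"
  by (simp add: conv_def)
 have "\<bar>conv (hk t) f x\<bar> <= conv (hk t) (%x. \<bar>f x\<bar>) x"
  using integral_norm_bound[of lborel "%z. hk t z * f (x - z)"] by (simp add: conv_def abs_mult)
 then have "\<bar>conv (hk t) f x\<bar> powr p <= (conv (hk t) (%x. \<bar>f x\<bar>) x) powr p" using p by (intro powr_mono2) auto
 with A show "\<bar>conv (hk t) f x\<bar> powr p <= t powr (- (real DIM('a) / 2)) * nrm p f" by simp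
qed

lemma frac_grad_test_measurable:
 fixes ph :: "'a::euclidean_space => real"
 assumes ph: "ph : Cc" and s: "0 < s" "s < 1"
 shows "fgrad s ph : Bb"
 by (subst borel_measurable_euclidean_space) (auto simp: frac_grad_test_inner[OF ph _ s] intro: FG_measurable[OF ph])

lemma frac_grad_test_bounded:
 fixes ph :: "'a::euclidean_space => real"
 assumes ph: "ph : Cc" and s: "0 < s" "s < 1"
 obtains M where "0 <= M" "!!x. norm (fgrad s ph x) <= M"
proof -
 have be: "0 < (1 - s) / 2" "(1 - s) / 2 < 1/2" using s by auto
 have "ALL b:Basis. EX M. ALL x. \<bar>FG ((1 - s) / 2) b ph x\<bar> <= M" using FG_bounded[OF ph _ be] by blast
 then obtain M where M: "!!b x. b : Basis ==> \<bar>FG ((1 - s) / 2) b ph x\<bar> <= M b" by metis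
 have le: "norm (fgrad s ph x) <= sum M Basis" for x
 proof -
  have "norm (fgrad s ph x) <= (SUM b:Basis. \<bar>fgrad s ph x \<bullet> b\<bar>)" by (rule norm_le_l1)
  also have "... <= sum M Basis" by (intro sum_mono) (simp add: frac_grad_test_inner[OF ph _ s] M)
  finally show ?thesis .
 qed
 show thesis using that[OF order_trans[OF norm_ge_zero le[of 0]] le] .
qed

lemma frac_grad_test_pint:
 fixes ph :: "'a::euclidean_space => real"
 assumes ph: "ph : Cc" and s: "0 < s" "s < 1" and p: "1 <= p"
 shows "inLp p (fgrad s ph)"
proof (rule pint_mono(1))
 have be: "0 < (1 - s) / 2" "(1 - s) / 2 < 1/2" using s by auto
 show "inLp p (%x. SUM b:Basis. norm (FG ((1 - s) / 2) b ph x))"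
  using FG_pint(1)[OF ph _ be p] p by (intro pint_sum pint_norm) auto
 show "AE x in lborel. norm (fgrad s ph x) <= norm (SUM b:Basis. norm (FG ((1 - s) / 2) b ph x))"
 proof (rule AE_I2)
  fix x :: 'a
  have "norm (fgrad s ph x) <= (SUM b:Basis. \<bar>fgrad s ph x \<bullet> b\<bar>)" by (rule norm_le_l1)
  also have "... = (SUM b:Basis. norm (FG ((1 - s) / 2) b ph x))" by (simp add: frac_grad_test_inner[OF ph _ s])
  finally show "norm (fgrad s ph x) <= norm (SUM b:Basis. norm (FG ((1 - s) / 2) b ph x))" by (simp add: sum_nonneg)
 qed
qed (use frac_grad_test_measurable[OF ph s] p in auto)

text \<open>The two reconstruction formulas are subtracted before absolute values are taken, which
  is what leaves the favourable weight \<open>omega\<close>. The doubled time in \<open>f\<close>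
  comes from \<open>hg_bound\<close>, the exponent \<open>1/2\<close> in \<open>k\<close> from the
  derivative.\<close>

lemma smoothing_pointwise:
 fixes ph :: "'a::euclidean_space => real"
 assumes ph: "ph : Cc" and s: "0 < s" "s < 1" and e: "0 < e"
 defines "be \<equiv> (1 - s) / 2"
 defines "k \<equiv> (%t. \<bar>omega be e t\<bar> * (ind {0<..} t * t powr (- (1/2))))"
 defines "f \<equiv> (%t. conv (hk (2 * t)) (%x. norm (fgrad s ph x)))"
 shows "itg (%t. k t * f t x)"
  "\<bar>ph x - conv (hk e) ph x\<bar> <= real DIM('a) * 2 powr (real DIM('a) / 2) * rGamma (1 - be) * (LBINT t. k t * f t x)"
proof -
 define K where "K = real DIM('a) * 2 powr (real DIM('a) / 2)"
 have be: "0 < be" "be < 1/2" using s by (auto simp: be_def)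
 have G: "0 < Gamma (1 - be)" using be by (intro Gamma_real_pos) auto
 have Fm [measurable]: "fgrad s ph : Bb" by (rule frac_grad_test_measurable[OF ph s])
 obtain M where M: "0 <= M" "!!x. norm (fgrad s ph x) <= M" using frac_grad_test_bounded[OF ph s] by auto
 have nM: "\<bar>norm (fgrad s ph x)\<bar> <= M" for x using M(2) by simp
 have fm [measurable]: "(%t. f t x) : Bb" unfolding f_def by measurable
 have f0: "0 <= f t x" for t unfolding f_def conv_def by (intro L_integral_nonneg) simp
 have fM: "f t x <= M" if "0 < t" for t
  using conv_hk_bounded[of "2 * t" "%x. norm (fgrad s ph x)" M x] that nM unfolding f_def by (simp add: abs_le_iff)
 have km [measurable]: "k : Bb" unfolding k_def by measurable
 have ki: "itg k" unfolding k_def using omega_integral(1)[OF e be(1), of "1/2"] be by simp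
 have k0: "0 <= k t" for t by (simp add: k_def)
 show kf: "itg (%t. k t * f t x)"
 proof (rule L_integrable_bound[OF integrable_mult_left[OF ki, of M]])
  show "AE t in lborel. norm (k t * f t x) <= norm (k t * M)"
  proof (rule AE_I2)
   fix t :: real
   show "norm (k t * f t x) <= norm (k t * M)"
   proof (cases "0 < t")
    case True
    show ?thesis using mult_left_mono[OF fM[OF True] k0[of t]] f0[of t] M(1) k0[of t] by simp
   next
    case False
    then show ?thesis by (simp add: k_def)
   qed
  qed
 qed measurable
 define D where "D t = (SUM b:Basis. conv (hg b t) (FG be b ph) x)" for t
 have R0: "itg (%t. ind {0<..} t * (t powr (- be) * D t))"
  "(LBINT t. ind {0<..} t * (t powr (- be) * D t)) = - Gamma (1 - be) * ph x"
  using reconstruction[OF ph be, of 0 x] by (simp_all add: heat_def D_def)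
 \<comment> \<open>The formula for the evolution up to time \<open>e\<close>, translated by
   \<open>e\<close>, so that both formulas involve the same \<open>D t\<close>.\<close>
 define h where "h t = ind {e<..} t * ((t - e) powr (- be) * D t)" for t
 have hs: "h (e + 1 * t) = ind {0<..} t * (t powr (- be) * D (t + e))" for t
  by (simp add: h_def indicator_def add.commute)
 have R1: "itg h" "(LBINT t. h t) = - Gamma (1 - be) * conv (hk e) ph x"
  using reconstruction[OF ph be, of e x] e lborel_integrable_real_affine_iff[of 1 h e] lborel_integral_real_affine[of 1 h e]
  unfolding hs by (simp_all add: heat_def D_def)
 have om: "omega be e t * D t = ind {0<..} t * (t powr (- be) * D t) - h t" for t
  by (simp add: omega_def h_def left_diff_distrib)
 have oi: "itg (%t. omega be e t * D t)" unfolding om using R0 R1 by auto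
 have oI: "(LBINT t. omega be e t * D t) = - Gamma (1 - be) * (ph x - conv (hk e) ph x)"
  unfolding om L_integral_diff[OF R0(1) R1(1)] R0(2) R1(2) by (simp add: right_diff_distrib)
 have D: "\<bar>D t\<bar> <= K * (t powr (- (1/2)) * f t x)" if t: "0 < t" for t
 proof -
  have "\<bar>conv (hg b t) (FG be b ph) x\<bar> <= 2 powr (real DIM('a) / 2) * t powr (- (1/2)) * f t x" if b: "b : Basis" for b
  proof -
   have [measurable]: "FG be b ph : Bb" by (rule FG_measurable[OF ph b])
   have le: "\<bar>FG be b ph y\<bar> <= norm (fgrad s ph y)" for y
    using Basis_le_norm[OF b, of "fgrad s ph y"] by (simp add: frac_grad_test_inner[OF ph b s] be_def)
   have b1: "\<bar>conv (hg b t) (FG be b ph) x\<bar> <= 2 powr (real DIM('a) / 2) * t powr (- (1/2)) * conv (hk (2 * t)) (%x. \<bar>FG be b ph x\<bar>) x"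
    by (rule conv_hg_le[OF t b _ order_trans[OF le M(2)]]) measurable
   have "conv (hk (2 * t)) (%x. \<bar>FG be b ph x\<bar>) x <= f t x" unfolding f_def conv_def
   proof (rule integral_mono)
    have t2: "0 < 2 * t" using t by simp
    show "itg (%z. hk (2 * t) z * \<bar>FG be b ph (x - z)\<bar>)"
     using order_trans[OF le M(2)] by (intro conv_bounded(1)[OF hk_integral(1)[OF t2], of "%x. \<bar>FG be b ph x\<bar>" M]) auto
    show "itg (%z. hk (2 * t) z * norm (fgrad s ph (x - z)))"
     using nM by (intro conv_bounded(1)[OF hk_integral(1)[OF t2], of "%x. norm (fgrad s ph x)" M]) auto
   qed (use le in "auto intro!: mult_left_mono")
   then have "2 powr (real DIM('a) / 2) * t powr (- (1/2)) * conv (hk (2 * t)) (%x. \<bar>FG be b ph x\<bar>) x <= 2 powr (real DIM('a) / 2) * t powr (- (1/2)) * f t x"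
    by (intro mult_left_mono) auto
   with b1 show ?thesis by linarith
  qed
  then have "\<bar>D t\<bar> <= (SUM b:(Basis :: 'a set). 2 powr (real DIM('a) / 2) * t powr (- (1/2)) * f t x)"
   unfolding D_def by (intro order_trans[OF sum_abs] sum_mono)
  then show ?thesis by (simp add: K_def mult.assoc)
 qed
 have le: "norm (omega be e t * D t) <= K * (k t * f t x)" for t
 proof (cases "0 < t")
  case True
  then show ?thesis using mult_left_mono[OF D[OF True], of "\<bar>omega be e t\<bar>"] by (simp add: k_def abs_mult ac_simps)
 next
  case False then show ?thesis using e by (simp add: omega_def k_def)
 qed
 have "Gamma (1 - be) * \<bar>ph x - conv (hk e) ph x\<bar> = \<bar>LBINT t. omega be e t * D t\<bar>"
  unfolding oI abs_mult using G by simp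
 also have "... <= (LBINT t. K * (k t * f t x))"
  using L_integral_norm_bound_integral[OF oi integrable_mult_right[OF kf, of K] le] by simp
 also have "... = K * (LBINT t. k t * f t x)" by simp
 finally have "\<bar>ph x - conv (hk e) ph x\<bar> <= K * (LBINT t. k t * f t x) / Gamma (1 - be)"
  using G by (simp add: field_simps)
 then show "\<bar>ph x - conv (hk e) ph x\<bar> <= real DIM('a) * 2 powr (real DIM('a) / 2) * rGamma (1 - be) * (LBINT t. k t * f t x)"
  unfolding K_def rGamma_inverse_Gamma divide_inverse by (simp only: mult_ac)
qed

text \<open>The \<open>q\<close>-th power is split into a power \<open>q - p\<close>, bounded
  through the supremum estimate, and a power \<open>p\<close>, for which the flow is a contraction.
  This gives the smoothing rate from \<open>p\<close> to \<open>q\<close> from the case of the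
  supremum alone.\<close>

lemma conv_hk_interpolation:
 fixes h :: "'a::euclidean_space => real"
 assumes h: "inLp p h" and p: "1 <= p" and pq: "p <= q" and t: "0 < t"
 shows "inLp q (conv (hk t) (%x. \<bar>h x\<bar>))"
  "nrm q (conv (hk t) (%x. \<bar>h x\<bar>)) <= t powr (- (real DIM('a) / 2) * (q / p - 1)) * nrm p h powr (q / p)"
proof -
 define N where "N = nrm p h"
 have [measurable]: "h : Bb" using pint_measurable[OF h] by simp
 note c = conv_pint(1,2)[OF hk_integral(1)[OF t] hk_nonneg hk_integral(2)[OF t] h p]
 define H where "H = conv (hk t) (%x. \<bar>h x\<bar>)"
 have H0: "0 <= H x" for x unfolding H_def conv_def by (intro L_integral_nonneg) simp
 define T where "T = (t powr (- (real DIM('a) / 2)) * N) powr (q / p - 1)"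
 have le: "norm (H x) powr q <= T * norm (H x) powr p" for x
 proof -
  have "norm (H x) powr q = (norm (H x) powr p) powr (q / p - 1) * norm (H x) powr p"
  proof -
   have "p * (q / p - 1) + p = q" using p by (simp add: field_simps)
   then show ?thesis unfolding powr_powr powr_add[symmetric] by simp
  qed
  also have "... <= T * norm (H x) powr p"
  proof -
   have "0 <= q / p - 1" using p pq by simp
   then have "(norm (H x) powr p) powr (q / p - 1) <= T" unfolding T_def N_def
    using conv_hk_sup(2)[OF h p t, of x] H0 by (intro powr_mono2) (auto simp: H_def)
   then show ?thesis by (intro mult_right_mono) auto
  qed
  finally show ?thesis .
 qed
 have m: "H : Bl" unfolding H_def by measurable
 have i: "itg (%x. T * norm (H x) powr p)" using pint_integrable[OF c(1)] by (auto simp: H_def)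
 show "inLp q (conv (hk t) (%x. \<bar>h x\<bar>))" using pint_bound(1)[OF m i] le by (auto simp: H_def)
 have "nrm q H <= (LBINT x. T * norm (H x) powr p)" using le by (intro pint_bound(2)[OF m i]) auto
 also have "... = T * nrm p H" by (simp add: pnorm_def)
 also have "... <= T * N" using c(2) by (intro mult_left_mono) (auto simp: T_def H_def N_def)
 also have "... = t powr (- (real DIM('a) / 2) * (q / p - 1)) * (N powr (q / p - 1) * N powr 1)"
  unfolding T_def powr_mult powr_powr by (simp add: N_def)
 also have "N powr (q / p - 1) * N powr 1 = N powr (q / p)" unfolding powr_add[symmetric] by simp
 finally show "nrm q (conv (hk t) (%x. \<bar>h x\<bar>)) <= t powr (- (real DIM('a) / 2) * (q / p - 1)) * nrm p h powr (q / p)"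
  unfolding H_def N_def .
qed

text \<open>Minkowski's inequality in time, with the slices sized by
  \<open>conv_hk_interpolation\<close>. The total singularity \<open>1/2 + ka\<close> is then fed to
  \<open>omega_integral\<close>, and \<open>1 - be - (1/2 + ka)\<close> equals
  \<open>\<gamma>\<close>.\<close>

lemma smoothing_test:
 fixes ph :: "'a::euclidean_space => real"
 assumes ph: "ph : Cc" and s: "0 < s" "s < 1" and e: "0 < e" and p: "1 <= p" and pq: "p <= q"
  and \<gamma>: "\<gamma> = s / 2 - real DIM('a) / 2 * (1 / p - 1 / q)" "0 < \<gamma>"
 shows "nrm q (%x. ph x - conv (hk e) ph x) <=
  (real DIM('a) * 2 powr (real DIM('a) / 2) * rGamma (1 - (1 - s) / 2) * (e powr \<gamma> * (2 / \<gamma> + 2))) powr q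
   * nrm p (fgrad s ph) powr (q / p)"
proof -
 define be where "be = (1 - s) / 2"
 have be: "0 < be" "be < 1/2" using s by (auto simp: be_def)
 define N where "N = nrm p (fgrad s ph)"
 define k where "k t = \<bar>omega be e t\<bar> * (ind {0<..} t * t powr (- (1/2)))" for t
 define f where "f t = conv (hk (2 * t)) (%x. norm (fgrad s ph x))" for t
 \<comment> \<open>The cost of passing from exponent \<open>p\<close> to \<open>q\<close>; it
   vanishes for \<open>q = p\<close>.\<close>
 define ka where "ka = real DIM('a) / 2 * (1 / p - 1 / q)"
 define m where "m t = t powr (- ka)" for t :: real
 have q: "1 <= q" using p pq by simp
 have ka: "0 <= ka" unfolding ka_def using p pq by (intro mult_nonneg_nonneg) (auto simp: divide_simps)
 have Fm [measurable]: "fgrad s ph : Bb" by (rule frac_grad_test_measurable[OF ph s])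
 have F: "inLp p (%x. norm (fgrad s ph x))" by (rule pint_norm[OF frac_grad_test_pint[OF ph s p]])
 have Nn: "nrm p (%x. norm (fgrad s ph x)) = N" by (simp add: N_def pnorm_def)
 have km: "k t * m t = \<bar>omega be e t\<bar> * (ind {0<..} t * t powr (- (1/2 + ka)))" for t
 proof -
  have "t powr (- (1/2 + ka)) = t powr (- (1/2)) * t powr (- ka)" unfolding powr_add[symmetric] by simp
  then show ?thesis by (simp add: k_def m_def)
 qed
 have g: "1 - be - (1/2 + ka) = \<gamma>" unfolding \<gamma> ka_def be_def by (simp add: field_simps)
 have bk: "be + (1/2 + ka) < 1" using g \<gamma>(2) by linarith
 have half: "1/2 <= 1/2 + ka" using ka by simp
 note O = omega_integral[OF e be(1) half bk, unfolded g, folded km]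
 have f0: "0 <= f t x" for t x unfolding f_def conv_def by (intro L_integral_nonneg) simp
 have B: "(\<integral>\<^sup>+x. ennreal (f t x powr q) \<partial>lborel) <= ennreal (N powr (q / p) * m t powr q)" if "k t ~= 0" for t
 proof -
  have t: "0 < t" using that by (auto simp: k_def indicator_def split: if_splits)
  then have t2: "0 < 2 * t" by simp
  note c = conv_hk_interpolation[OF F p pq t2, unfolded Nn]
  have "(\<integral>\<^sup>+x. ennreal (f t x powr q) \<partial>lborel) = ennreal (nrm q (f t))"
   using pint_nn[OF c(1)] f0 by (simp add: f_def)
  also have "nrm q (f t) <= (2 * t) powr (- (real DIM('a) / 2) * (q / p - 1)) * N powr (q / p)"
   using c(2) by (simp add: f_def)
  also have "... <= t powr (- (real DIM('a) / 2) * (q / p - 1)) * N powr (q / p)"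
  proof -
   have "0 <= real DIM('a) / 2 * (q / p - 1)" using p pq by (intro mult_nonneg_nonneg) auto
   then have "- (real DIM('a) / 2) * (q / p - 1) <= 0" by simp
   then show ?thesis using t by (intro mult_right_mono powr_mono2') auto
  qed
  also have "t powr (- (real DIM('a) / 2) * (q / p - 1)) = m t powr q"
  proof -
   have "- (real DIM('a) / 2) * (q / p - 1) = - ka * q" unfolding ka_def using p q by (simp add: field_simps)
   then show ?thesis unfolding m_def powr_powr by simp
  qed
  finally show ?thesis by (simp add: mult.commute ennreal_leI)
 qed
 have meas: "k : Bl" "m : Bl" "(%(t, x). f t x) : borel_measurable (lborel \<Otimes>\<^sub>M lborel)"
  unfolding k_def m_def f_def conv_def by measurable
 have k0: "0 <= k t" for t by (simp add: k_def)
 have m0: "0 < m t" if "k t ~= 0" for t using that by (auto simp: k_def m_def indicator_def split: if_splits)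
 have sf: "sigma_finite_measure (lborel :: 'a measure)" "sigma_finite_measure (lborel :: real measure)" by (rule sigma_finite_lborel)+
 note MK = Minkowski_kernel(2)[OF sf meas k0 f0 m0 B powr_ge_zero O(1) q]
 define I where "I x = (LBINT t. k t * f t x)" for x
 have I0: "0 <= I x" for x unfolding I_def using k0 f0 by (intro L_integral_nonneg) auto
 have Im: "I : Bl" unfolding I_def using meas by measurable
 have "(\<integral>\<^sup>+x. ennreal (norm (I x) powr q) \<partial>lborel) <= ennreal ((LBINT t. k t * m t) powr q * N powr (q / p))"
  using MK I0 by (simp add: I_def[symmetric])
 note Ip = pintI_nn[OF Im this]
 have Ip1: "inLp q I" by (rule Ip(1)) simp
 have "nrm q I <= (LBINT t. k t * m t) powr q * N powr (q / p)" by (rule Ip(2)) simp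
 also have "... <= (e powr \<gamma> * (2 / \<gamma> + 2)) powr q * N powr (q / p)"
  using O(2) q k0 by (intro mult_right_mono powr_mono2 L_integral_nonneg) (auto simp: m_def)
 finally have IN: "nrm q I <= (e powr \<gamma> * (2 / \<gamma> + 2)) powr q * N powr (q / p)" .
 define K where "K = real DIM('a) * 2 powr (real DIM('a) / 2) * rGamma (1 - be)"
 have G: "0 < Gamma (1 - be)" using be by (intro Gamma_real_pos) auto
 have K0: "0 <= K" using G by (simp add: K_def rGamma_inverse_Gamma)
 note c = pint_cmult[OF Ip1, of K]
 have pt: "\<bar>ph x - conv (hk e) ph x\<bar> <= K * I x" for x
  using smoothing_pointwise(2)[OF ph s e, of x] unfolding K_def I_def k_def f_def be_def .
 have [measurable]: "ph : Bb" using ph by (rule Cc_inf_measurable)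
 have dm: "(%x. ph x - conv (hk e) ph x) : Bl" by measurable
 have "nrm q (%x. ph x - conv (hk e) ph x) <= nrm q (%x. K * I x)"
  using q K0 I0 by (intro pint_mono(2)[OF dm c(1)] AE_I2) (auto simp: abs_mult intro: order_trans[OF pt])
 also have "... <= K powr q * ((e powr \<gamma> * (2 / \<gamma> + 2)) powr q * N powr (q / p))"
  unfolding c(2) using K0 IN by (simp add: mult_left_mono)
 also have "... = (K * (e powr \<gamma> * (2 / \<gamma> + 2))) powr q * N powr (q / p)" by (simp add: powr_mult)
 finally show ?thesis unfolding K_def N_def be_def .
qed

section \<open>Uniform estimates and compactness\<close>

text \<open>Counterpart of \<open>has_frac_grad\<close> for Borel functions, \<open>lborel\<close>
  and \<open>p\<close>-th powers of norms. The gradient \<open>F\<close> stays an explicit argument,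
  so that linearity and limits are statements about pairs.\<close>

definition frac_pair :: "real => real => ('a::euclidean_space => real) => ('a => 'a) => bool" where
 "frac_pair s p u F \<longleftrightarrow> inLp p u & inLp p F &
  (EX ph. (ALL j::nat. ph j : Cc) & (%j. nrm p (%x. ph j x - u x)) ----> 0 &
   (%j. nrm p (%x. fgrad s (ph j) x - F x)) ----> 0)"

lemma conv_hk_diff:
 assumes "inLp p f" "inLp p g" "1 <= p" "0 < t"
 shows "conv (hk t) (%x. f x - g x) x = conv (hk t) f x - conv (hk t) g x"
 using conv_hk_sup(1)[OF assms(1,3,4)] conv_hk_sup(1)[OF assms(2,3,4)] by (simp add: conv_def right_diff_distrib)

lemma conv_hk_tendsto:
 fixes u :: "'a::euclidean_space => real"
 assumes f: "!!j. inLp p (f j)" and u: "inLp p u" and p: "1 <= p" and t: "0 < t"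
  and l: "(%j. nrm p (%x. f j x - u x)) ----> 0"
 shows "(%j. conv (hk t) (f j) x) ----> conv (hk t) u x"
proof -
 have d: "inLp p (%x. f j x - u x)" for j using f u p by (intro pint_diff) auto
 have "(%j. \<bar>conv (hk t) (%x. f j x - u x) x\<bar> powr p) ----> 0"
 proof (rule tendsto_sandwich[OF _ _ tendsto_const])
  show "(%j. t powr (- (real DIM('a) / 2)) * nrm p (%x. f j x - u x)) ----> 0"
   using tendsto_mult_left[OF l, of "t powr (- (real DIM('a) / 2))"] by simp
 qed (use conv_hk_sup(3)[OF d p t] in auto)
 from tendsto_0_powrD[OF this] have "(%j. \<bar>conv (hk t) (%x. f j x - u x) x\<bar>) ----> 0" using p by simp
 then have "(%j. conv (hk t) (f j) x - conv (hk t) u x) ----> 0"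
  unfolding conv_hk_diff[OF f u p t] by (rule tendsto_rabs_zero_cancel)
 then show ?thesis by (simp add: LIM_zero_iff)
qed

text \<open>Dropping the initial terms gives fractional gradients within distance 1 of
  \<open>F\<close>, hence a uniform norm bound; a further subsequence converges almost everywhere,
  which prepares the use of Fatou.\<close>

lemma frac_pair_approx:
 fixes u :: "'a::euclidean_space => real"
 assumes fp: "frac_pair s p u F" and s: "0 < s" "s < 1" and p: "1 <= p"
 obtains ph where "!!j::nat. ph j : Cc" "!!j. nrm p (fgrad s (ph j)) <= 2 powr p * (1 + nrm p F)"
  "AE x in lborel. (%j. ph j x) ----> u x" "(%j. nrm p (%x. ph j x - u x)) ----> 0"
proof -
 have u: "inLp p u" and F: "inLp p F" using fp by (auto simp: frac_pair_def)
 obtain ph where ph: "!!j::nat. ph j : Cc" "(%j. nrm p (%x. ph j x - u x)) ----> 0"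
   "(%j. nrm p (%x. fgrad s (ph j) x - F x)) ----> 0"
  using fp unfolding frac_pair_def by auto
 have "\<forall>\<^sub>F j in sequentially. nrm p (%x. fgrad s (ph j) x - F x) < 1"
  by (rule order_tendstoD(2)[OF ph(3)]) simp
 then obtain N where N: "!!j. N <= j ==> nrm p (%x. fgrad s (ph j) x - F x) < 1"
  by (auto simp: eventually_sequentially)
 have b: "nrm p (fgrad s (ph j)) <= 2 powr p * (1 + nrm p F)" if "N <= j" for j
 proof -
  have d: "inLp p (%x. fgrad s (ph j) x - F x)"
   using frac_grad_test_pint[OF ph(1) s p] F p by (intro pint_diff) auto
  have "nrm p (%x. (fgrad s (ph j) x - F x) + F x) <= 2 powr p * (nrm p (%x. fgrad s (ph j) x - F x) + nrm p F)"
   using d F p by (intro pint_add(2)) auto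
  also have "... <= 2 powr p * (1 + nrm p F)" using N[OF that] by (intro mult_left_mono) auto
  finally show ?thesis by simp
 qed
 have l: "(%j. nrm p (%x. ph (j + N) x - u x)) ----> 0" using LIMSEQ_ignore_initial_segment[OF ph(2)] .
 have d: "inLp p (%x. ph (j + N) x - u x)" for j using Cc_inf_pint[OF ph(1)] u p by (intro pint_diff) auto
 have p0: "0 < p" using p by simp
 obtain r :: "nat => nat" where r: "strict_mono r" "AE x in lborel. (%j. ph (r j + N) x) ----> u x"
  using pnorm_AE_subseq[OF d l p0] by auto
 show thesis
 proof (rule that[of "%j. ph (r j + N)"])
  show "(%j. nrm p (%x. ph (r j + N) x - u x)) ----> 0" using LIMSEQ_subseq_LIMSEQ[OF l r(1)] by (simp add: o_def)
 qed (use ph(1) b r(2) in auto)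
qed

lemma rGamma_bounded:
 obtains C :: real where "0 < C" "!!x. 1/2 <= x ==> x <= 1 ==> \<bar>rGamma x\<bar> <= C"
proof -
 have "compact (rGamma ` {1/2..1::real})" by (intro compact_continuous_image continuous_on_rGamma) simp
 then have "bounded (rGamma ` {1/2..1::real})" by (rule compact_imp_bounded)
 then obtain C where "0 < C" "ALL y:rGamma ` {1/2..1::real}. norm y <= C" using bounded_pos by blast
 then show thesis using that[of C] by auto
qed

text \<open>For \<open>e <= 1\<close> the smallest exponent gives the largest power, for
  \<open>e > 1\<close> the largest exponent, which is \<open>1/2\<close>. The sum of both serves all
  exponents between \<open>\<gamma>0\<close> and \<open>1/2\<close>.\<close>

lemma smoothing_factor_le:
 fixes e \<gamma> \<gamma>0 :: real
 assumes "0 < e" "0 < \<gamma>0" "\<gamma>0 <= \<gamma>" "\<gamma> <= 1/2"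
 shows "e powr \<gamma> * (2 / \<gamma> + 2) <= (e powr \<gamma>0 + e powr (1/2)) * (2 / \<gamma>0 + 2)"
proof (rule mult_mono)
 show "e powr \<gamma> <= e powr \<gamma>0 + e powr (1/2)"
 proof (cases "e <= 1")
  case True
  then have "e powr \<gamma> <= e powr \<gamma>0" using assms by (intro powr_mono') auto
  then show ?thesis by (simp add: add_increasing2)
 next
  case False
  then have "e powr \<gamma> <= e powr (1/2)" using assms by (intro powr_mono) auto
  then show ?thesis by (simp add: add_increasing)
 qed
 show "2 / \<gamma> + 2 <= 2 / \<gamma>0 + 2" using assms by (simp add: divide_left_mono)
qed (use assms in auto)

text \<open>The estimate for test functions is transferred by Fatou. The only constant depending on
  \<open>s\<close> besides \<open>\<gamma>\<close> is \<open>rGamma\<close> at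
  \<open>(1 + s) / 2\<close>, which stays in a compact interval. That \<open>C\<close> is also
  independent of \<open>q\<close> will allow \<open>q\<close> to tend to infinity, and that it holds
  for all \<open>e\<close> serves both the Poincare inequality and compactness.\<close>

lemma smoothing_uniform:
 fixes p \<gamma>0 M :: real
 assumes p: "1 <= p" and g0: "0 < \<gamma>0" and M: "0 <= M"
 obtains C where "0 <= C" "!!q s (u :: 'a::euclidean_space => real) F e. p <= q ==> frac_pair s p u F ==> 0 < s ==> s < 1 ==> nrm p F <= M ==>
  \<gamma>0 <= s / 2 - real DIM('a) / 2 * (1 / p - 1 / q) ==> 0 < e ==>
  inLp q (%x. u x - conv (hk e) u x) & nrm q (%x. u x - conv (hk e) u x) <= (C * (e powr \<gamma>0 + e powr (1/2))) powr q"
proof -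
 obtain G :: real where G: "0 < G" "!!x. 1/2 <= x ==> x <= 1 ==> \<bar>rGamma x\<bar> <= G" using rGamma_bounded by auto
 define N where "N = 2 powr p * (1 + M)"
 define K where "K = real DIM('a) * 2 powr (real DIM('a) / 2) * G * (2 / \<gamma>0 + 2)"
 define C where "C = K * N powr (1 / p)"
 show thesis
 proof (rule that[of C])
  show "0 <= C" using G g0 by (simp add: C_def K_def)
  fix q s e :: real and u :: "'a => real" and F
  assume pq: "p <= q" and fp: "frac_pair s p u F" and s: "0 < s" "s < 1" and FM: "nrm p F <= M"
   and gs: "\<gamma>0 <= s / 2 - real DIM('a) / 2 * (1 / p - 1 / q)" and e: "0 < e"
  have q: "1 <= q" using p pq by simp
  define \<gamma> where "\<gamma> = s / 2 - real DIM('a) / 2 * (1 / p - 1 / q)"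
  have ka: "0 <= real DIM('a) / 2 * (1 / p - 1 / q)" using p pq by (intro mult_nonneg_nonneg) (auto simp: divide_simps)
  have \<gamma>: "0 < \<gamma>" "\<gamma>0 <= \<gamma>" "\<gamma> <= 1/2" using gs g0 ka s unfolding \<gamma>_def by linarith+
  have u: "inLp p u" using fp by (auto simp: frac_pair_def)
  have [measurable]: "u : Bb" using pint_measurable[OF u] by simp
  obtain ph where ph: "!!j::nat. ph j : Cc" "!!j. nrm p (fgrad s (ph j)) <= 2 powr p * (1 + nrm p F)"
   "AE x in lborel. (%j. ph j x) ----> u x" "(%j. nrm p (%x. ph j x - u x)) ----> 0"
   using frac_pair_approx[OF fp s p] by auto
  define B where "B = (C * (e powr \<gamma>0 + e powr (1/2))) powr q"
  have pj: "inLp q (%x. ph j x - conv (hk e) (ph j) x)" for j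
  proof -
   have "inLp q (ph j)" using ph(1) q by (intro Cc_inf_pint) auto
   then show ?thesis using conv_pint(3)[OF hk_integral(1)[OF e] hk_nonneg hk_integral(2)[OF e] _ q] q by (intro pint_diff(1)) auto
  qed
  have nj: "nrm q (%x. ph j x - conv (hk e) (ph j) x) <= B" for j
  proof -
   have FN: "nrm p (fgrad s (ph j)) <= N"
    using ph(2)[of j] FM unfolding N_def by (auto elim!: order_trans intro!: mult_left_mono)
   have G0: "0 <= rGamma (1 - (1 - s) / 2)"
    unfolding rGamma_inverse_Gamma using s Gamma_real_pos[of "1 - (1 - s) / 2"] by simp
   have h1: "e powr \<gamma> * (2 / \<gamma> + 2) <= (e powr \<gamma>0 + e powr (1/2)) * (2 / \<gamma>0 + 2)" by (rule smoothing_factor_le[OF e g0 \<gamma>(2,3)])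
   have h2: "rGamma (1 - (1 - s) / 2) <= G" using G(2)[of "1 - (1 - s) / 2"] s by simp
   have h3: "real DIM('a) * 2 powr (real DIM('a) / 2) * rGamma (1 - (1 - s) / 2) * (e powr \<gamma> * (2 / \<gamma> + 2))
     <= real DIM('a) * 2 powr (real DIM('a) / 2) * G * ((e powr \<gamma>0 + e powr (1/2)) * (2 / \<gamma>0 + 2))"
    by (rule mult_mono[OF mult_left_mono[OF h2] h1]) (use G(1) \<gamma>(1) in auto)
   have h4: "0 <= real DIM('a) * 2 powr (real DIM('a) / 2) * rGamma (1 - (1 - s) / 2) * (e powr \<gamma> * (2 / \<gamma> + 2))"
    using G0 \<gamma>(1) by simp
   have "nrm q (%x. ph j x - conv (hk e) (ph j) x) <=
    (real DIM('a) * 2 powr (real DIM('a) / 2) * rGamma (1 - (1 - s) / 2) * (e powr \<gamma> * (2 / \<gamma> + 2))) powr q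
    * nrm p (fgrad s (ph j)) powr (q / p)"
    by (rule smoothing_test[OF ph(1) s e p pq \<gamma>_def \<gamma>(1)])
   also have "... <= (real DIM('a) * 2 powr (real DIM('a) / 2) * G * ((e powr \<gamma>0 + e powr (1/2)) * (2 / \<gamma>0 + 2))) powr q * N powr (q / p)"
    by (rule mult_mono[OF powr_mono2[OF _ h4 h3] powr_mono2[OF _ _ FN]]) (use p q in auto)
   also have "real DIM('a) * 2 powr (real DIM('a) / 2) * G * ((e powr \<gamma>0 + e powr (1/2)) * (2 / \<gamma>0 + 2)) = K * (e powr \<gamma>0 + e powr (1/2))"
    by (simp only: K_def mult_ac)
   also have "(K * (e powr \<gamma>0 + e powr (1/2))) powr q * N powr (q / p) = B" unfolding B_def C_def powr_mult powr_powr by (simp add: mult_ac)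
   finally show ?thesis .
  qed
  have cl: "(%j. conv (hk e) (ph j) x) ----> conv (hk e) u x" for x
   using p by (intro conv_hk_tendsto[OF Cc_inf_pint[OF ph(1)] u p e ph(4)]) auto
  have ae: "AE x in lborel. (%j. ph j x - conv (hk e) (ph j) x) ----> u x - conv (hk e) u x"
   using ph(3) by eventually_elim (intro tendsto_diff cl)
  have m: "(%x. u x - conv (hk e) u x) : Bl" by measurable
  have q0: "0 < q" using q by simp
  show "inLp q (%x. u x - conv (hk e) u x) & nrm q (%x. u x - conv (hk e) u x) <= (C * (e powr \<gamma>0 + e powr (1/2))) powr q"
   using pint_Fatou[OF pj nj ae m q0] unfolding B_def by simp
 qed
qed

text \<open>The part \<open>u - conv (hk T) u\<close> is controlled for any fixed \<open>T\<close>.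
  The flow itself is pointwise of order \<open>T powr (- (n/2))\<close> times the norm of
  \<open>u\<close>, so on the bounded set \<open>A\<close> it is a small fraction of that norm when
  \<open>T\<close> is large, and is absorbed; outside \<open>A\<close> the function is
  \<open>g\<close>.\<close>

lemma Poincare:
 fixes A :: "'a::euclidean_space set" and p M :: real
 assumes A [measurable]: "A : sets borel" "A \<subseteq> cball 0 R" and p: "1 <= p" and M: "0 <= M"
 obtains C where "0 <= C" "!!s u F g. frac_pair s p u F ==> 1/2 <= s ==> s < 1 ==> nrm p F <= M ==>
  inLp p g ==> nrm p g <= M ==> (AE x in lborel. x \<notin> A --> u x = g x) ==> nrm p u <= C"
proof -
 \<comment> \<open>For \<open>q = p\<close> the exponent is \<open>s / 2\<close>, and
   \<open>s >= 1/2\<close> gives the lower bound \<open>1/4\<close>.\<close>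
 have q: "0 < (1/4 :: real)" by simp
 obtain C where C: "0 <= C" "!!q s (u :: 'a => real) F e. p <= q ==> frac_pair s p u F ==> 0 < s ==> s < 1 ==> nrm p F <= M ==>
  1/4 <= s / 2 - real DIM('a) / 2 * (1 / p - 1 / q) ==> 0 < e ==>
  inLp q (%x. u x - conv (hk e) u x) & nrm q (%x. u x - conv (hk e) u x) <= (C * (e powr (1/4) + e powr (1/2))) powr q"
  by (rule smoothing_uniform[OF p q M, where 'a = 'a]) (rule that)
 define V where "V = (LBINT x. ind A x :: real)"
 have Ai: "itg (%x. ind A x :: real)"
  by (rule L_integrable_bound[OF integrable_indicator_cball[of 1 R]]) (use A(2) in "auto simp: indicator_def subset_iff")
 have V: "0 <= V" unfolding V_def by (intro L_integral_nonneg) simp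
 \<comment> \<open>Chosen so that \<open>8 powr p * T powr (- (n/2)) * V\<close> is at most
   \<open>1/2\<close>; the factor \<open>8 powr p\<close> collects the quasi-triangle inequalities
   applied to the flow term.\<close>
 define T where "T = (2 * 8 powr p * (V + 1)) powr (2 / real DIM('a))"
 have T: "0 < T" using V by (simp add: T_def)
 have Tn: "T powr (- (real DIM('a) / 2)) = 1 / (2 * 8 powr p * (V + 1))"
  unfolding T_def powr_powr using V by (simp add: powr_minus_divide)
 define E where "E = (C * (T powr (1/4) + T powr (1/2))) powr p"
 define C' where "C' = 2 * (2 powr p * (2 powr p * E + 4 powr p * M + M))"
 show thesis
 proof (rule that[of C'])
  show "0 <= C'" using C(1) M by (simp add: C'_def E_def)
  fix s u F g
  assume fp: "frac_pair s p u F" and s: "1/2 <= s" "s < 1" and FM: "nrm p F <= M"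
   and g: "inLp p g" "nrm p g <= M" and ug: "AE x in lborel. x \<notin> A --> u x = g x"
  have u: "inLp p u" using fp by (auto simp: frac_pair_def)
  have S: "inLp p (%x. u x - conv (hk T) u x)" "nrm p (%x. u x - conv (hk T) u x) <= E"
   using C(2)[OF order_refl fp _ s(2) FM _ T] s unfolding E_def by auto
  define U where "U = nrm p u"
  define h where "h x = 2 powr p * norm (u x - conv (hk T) u x) powr p + (4 powr p * (T powr (- (real DIM('a) / 2)) * U)) * ind A x + 4 powr p * norm (g x) powr p" for x
  have d: "inLp p (%x. u x - g x)" using u g(1) p by (intro pint_diff) auto
  have hi: "itg h" unfolding h_def
   using pint_integrable[OF S(1)] pint_integrable[OF g(1)] Ai by (intro L_integrable_add integrable_mult_right)
  have le: "AE x in lborel. norm (u x - g x) powr p <= h x" using ug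
  proof eventually_elim
   case (elim x)
   show ?case
   proof (cases "x : A")
    case True
    have "norm (u x - g x) powr p = norm ((u x - conv (hk T) u x) + (conv (hk T) u x + - g x)) powr p" by simp
    also have "... <= 2 powr p * (norm (u x - conv (hk T) u x) powr p + norm (conv (hk T) u x + - g x) powr p)"
     using p by (intro norm_add_powr_le) simp
    also have "... <= 2 powr p * (norm (u x - conv (hk T) u x) powr p + 2 powr p * (norm (conv (hk T) u x) powr p + norm (- g x) powr p))"
     using p by (intro mult_left_mono add_left_mono norm_add_powr_le) auto
    also have "... = 2 powr p * norm (u x - conv (hk T) u x) powr p + (2 powr p * 2 powr p) * norm (conv (hk T) u x) powr p + (2 powr p * 2 powr p) * norm (g x) powr p"
     by (simp add: algebra_simps)
    also have "2 powr p * 2 powr p = (4::real) powr p" by (simp add: powr_mult[symmetric])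
    also have "2 powr p * norm (u x - conv (hk T) u x) powr p + 4 powr p * norm (conv (hk T) u x) powr p + 4 powr p * norm (g x) powr p <= h x"
     unfolding h_def using conv_hk_sup(3)[OF u p T, of x] True by (auto simp: U_def intro!: mult_left_mono add_mono)
    finally show ?thesis .
   next
    case False
    then show ?thesis using elim by (simp add: h_def)
   qed
  qed
  have "nrm p (%x. u x - g x) <= (LBINT x. h x)" using pint_bound(2)[OF pint_measurable[OF d] hi le] .
  also have "... = 2 powr p * nrm p (%x. u x - conv (hk T) u x) + (4 powr p * (T powr (- (real DIM('a) / 2)) * U)) * V + 4 powr p * nrm p g"
   unfolding h_def pnorm_def V_def using pint_integrable[OF S(1)] pint_integrable[OF g(1)] Ai by simp
  also have "... <= 2 powr p * E + (4 powr p * (T powr (- (real DIM('a) / 2)) * U)) * V + 4 powr p * M"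
   using S(2) g(2) by (intro add_mono mult_left_mono order_refl) auto
  finally have 1: "nrm p (%x. u x - g x) <= 2 powr p * E + (4 powr p * (T powr (- (real DIM('a) / 2)) * U)) * V + 4 powr p * M" .
  have "nrm p (%x. (u x - g x) + g x) <= 2 powr p * (nrm p (%x. u x - g x) + nrm p g)"
   using d g(1) p by (intro pint_add(2)) auto
  also have "... <= 2 powr p * ((2 powr p * E + (4 powr p * (T powr (- (real DIM('a) / 2)) * U)) * V + 4 powr p * M) + M)"
   using 1 g(2) by (intro mult_left_mono add_mono) auto
  also have "... = C' / 2 + (2 powr p * 4 powr p) * T powr (- (real DIM('a) / 2)) * V * U" by (simp add: C'_def algebra_simps)
  also have "2 powr p * 4 powr p = (8::real) powr p" by (simp add: powr_mult[symmetric])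
  also have "8 powr p * T powr (- (real DIM('a) / 2)) * V * U <= U / 2"
  proof -
   have "8 powr p * T powr (- (real DIM('a) / 2)) * V = V / (2 * (V + 1))" 
   proof -
    have "V + 1 ~= 0" "(8::real) powr p ~= 0" using V by auto
    then have "(a::real) * (1 / (2 * a * (V + 1))) * V = V / (2 * (V + 1))" if "a ~= 0" for a using that by simp
    then show ?thesis unfolding Tn by simp
   qed
   also have "... <= 1 / 2" using V by (simp add: divide_simps)
   finally have "8 powr p * T powr (- (real DIM('a) / 2)) * V * U <= 1 / 2 * U" by (rule mult_right_mono) (simp add: U_def)
   then show ?thesis by simp
  qed
  finally have "U <= C' / 2 + U / 2" by (simp add: U_def)
  then show "nrm p u <= C'" by (simp add: U_def)
 qed
qed

section \<open>Compactness\<close>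

lemma hk_Lipschitz:
 assumes t: "0 < t"
 obtains L where "0 < L" "!!x y :: 'a::euclidean_space. \<bar>hk t x - hk t y\<bar> <= L * norm (x - y)"
proof -
 define c where "c = 2 powr (real DIM('a) / 2) * t powr (- (1/2)) * (2 * t) powr (- (real DIM('a) / 2))"
 have c: "0 <= c" by (simp add: c_def)
 have hg: "\<bar>hg b t z\<bar> <= c" if b: "b : Basis" for b z :: 'a
  using order_trans[OF hg_bound[OF t b, of z] mult_left_mono[OF hk_le'[of "2 * t" z], of "2 powr (real DIM('a) / 2) * t powr (- (1/2))"]] t
  by (simp add: c_def)
 have le: "\<bar>hg v t z\<bar> <= (real DIM('a) * c) * norm v" for v z :: 'a
 proof -
  have "z \<bullet> v = (SUM b:Basis. (v \<bullet> b) * (z \<bullet> b))" by (subst euclidean_inner[of z v]) (simp add: mult.commute)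
  then have "hg v t z = (SUM b:Basis. (v \<bullet> b) * hg b t z)"
   by (simp add: hg_def sum_distrib_right sum_divide_distrib sum_negf[symmetric] mult.assoc)
  also have "\<bar>...\<bar> <= (SUM b:(Basis :: 'a set). norm v * c)"
   by (intro order_trans[OF sum_abs] sum_mono) (auto simp: abs_mult intro!: mult_mono hg Basis_le_norm)
  finally show ?thesis by (simp add: ac_simps)
 qed
 have "\<bar>hk t x - hk t y\<bar> <= (real DIM('a) * c + 1) * norm (x - y)" for x y :: 'a
 proof -
  have "norm (hk t x - hk t y) <= (real DIM('a) * c + 1) * norm (x - y)"
  proof (rule differentiable_bound[where S = UNIV and f' = "%z v. hg v t z"])
   show "onorm (%v. hg v t z) <= real DIM('a) * c + 1" for z :: 'a
   proof (rule onorm_bound)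
    show "norm (hg v t z) <= (real DIM('a) * c + 1) * norm v" for v using le[of v z] by (simp add: distrib_right add_increasing2)
   qed (use c in simp)
  qed (use hk_has_derivative[OF t] in "auto intro: has_derivative_at_withinI")
  then show ?thesis by simp
 qed
 then show thesis using that[of "real DIM('a) * c + 1"] c by (auto simp: add_nonneg_pos)
qed

text \<open>The difference of two values of the flow is the pairing of \<open>u\<close> with a
  difference \<open>w\<close> of translated kernels. In the conjugate exponent \<open>w\<close> is
  small by interpolation: its supremum is Lipschitz in the points and its integral is bounded. The
  resulting \<open>d\<close> is common to all \<open>u\<close> of norm at most
  \<open>M\<close>.\<close>

lemma heat_equicontinuous:
 fixes p t M et :: real
 assumes p: "1 < p" and t: "0 < t" and M: "0 <= M" and et: "0 < et"
 obtains d where "0 < d" "!!(u :: 'a::euclidean_space => real) x y. inLp p u ==> nrm p u <= M ==> norm (x - y) < d ==>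
  \<bar>conv (hk t) u x - conv (hk t) u y\<bar> < et"
proof -
 define p' where "p' = p / (p - 1)"
 have p': "1 < p'" using p by (simp add: p'_def)
 obtain L where L: "0 < L" "!!x y :: 'a. \<bar>hk t x - hk t y\<bar> <= L * norm (x - y)" using hk_Lipschitz[OF t] by auto
 have d0: "0 < et / (2 * (M + 1))" using et M by simp
 obtain C where C: "0 <= C" "!!(f :: 'a => real) w. inLp p f ==> inLp (dual p) w ==>
   \<bar>LBINT x. f x \<bullet> w x\<bar> <= et / (2 * (M + 1)) * nrm p f + C * nrm (dual p) w"
 proof (rule pnorm_pairing_le[OF p d0, where M = "lborel :: 'a measure" and 'b = real])
  fix C assume "0 <= C" and "!!(f :: 'a => real) w. inLp p f ==> inLp (dual p) w ==>
   \<bar>LBINT x. f x \<bullet> w x\<bar> <= et / (2 * (M + 1)) * nrm p f + C * nrm (dual p) w"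
  then show thesis by (rule that)
 qed
 \<comment> \<open>Solves \<open>(L * d) powr (p' - 1) = et / (4 * (C + 1))\<close>, so that the
   term with the large constant \<open>C\<close> costs at most \<open>et / 2\<close>.\<close>
 define d where "d = (1 / L) * (et / (4 * (C + 1))) powr (1 / (p' - 1))"
 have d: "0 < d" using L et C(1) by (simp add: d_def)
 have Ld: "(L * d) powr (p' - 1) = et / (4 * (C + 1))"
  unfolding d_def using L et C(1) p' by (simp add: powr_powr)
 show thesis
 proof (rule that[OF d])
  fix u :: "'a => real" and x y :: 'a
  assume u: "inLp p u" "nrm p u <= M" and xy: "norm (x - y) < d"
  have [measurable]: "u : Bb" using pint_measurable[OF u(1)] by simp
  define w where "w z = hk t (x - z) - hk t (y - z)" for z
  have hi: "itg (%z. hk t (x - z))" "(LBINT z. hk t (x - z)) = 1" for x :: 'a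
   using integrable_lborel_minus[of "hk t" x] integral_lborel_minus[of "hk t" x] hk_integral[OF t, where 'a = 'a] by auto
  define k where "k z = (L * norm (x - y)) powr (p' - 1) * (hk t (x - z) + hk t (y - z))" for z
  have ki: "itg k" unfolding k_def using hi(1) by (intro integrable_mult_right L_integrable_add)
  have "norm (w z) powr p' <= k z" for z
  proof -
   have "\<bar>w z\<bar> <= L * norm (x - y)" using L(2)[of "x - z" "y - z"] by (simp add: w_def)
   moreover have "\<bar>w z\<bar> <= hk t (x - z) + hk t (y - z)" unfolding w_def using hk_nonneg[of t "x - z"] hk_nonneg[of t "y - z"] by linarith
   ultimately have "\<bar>w z\<bar> powr (p' - 1) * \<bar>w z\<bar> powr 1 <= (L * norm (x - y)) powr (p' - 1) * (hk t (x - z) + hk t (y - z))"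
    using p' by (intro mult_mono powr_mono2) auto
   then show ?thesis unfolding powr_add[symmetric] k_def by simp
  qed
  then have kle: "AE z in lborel. norm (w z) powr p' <= k z" by simp
  have wm: "w : Bl" unfolding w_def by measurable
  note W = pint_bound[OF wm ki kle]
  have "(LBINT z. k z) = 2 * (L * norm (x - y)) powr (p' - 1)" unfolding k_def using hi by simp
  also have "... <= 2 * (et / (4 * (C + 1)))"
   unfolding Ld[symmetric] using L xy p' by (intro mult_left_mono powr_mono2) auto
  finally have W2: "nrm p' w <= 2 * (et / (4 * (C + 1)))" using W(2) by linarith
  have cu: "conv (hk t) u x = (LBINT z. u z * hk t (x - z))" "itg (%z. u z * hk t (x - z))" for x
  proof -
   have "conv (hk t) u = conv u (hk t)" by (rule conv_commute) measurable
   then show "conv (hk t) u x = (LBINT z. u z * hk t (x - z))" by (simp add: conv_def)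
   have "itg (%z. hk t (x - z) * u (x - (x - z)))"
    using conv_hk_sup(1)[OF u(1) _ t, of x] p integrable_lborel_minus[of "%z. hk t z * u (x - z)" x] by simp
   then show "itg (%z. u z * hk t (x - z))" by (simp add: mult.commute)
  qed
  have "conv (hk t) u x - conv (hk t) u y = (LBINT z. u z \<bullet> w z)"
   unfolding cu(1) using cu(2) by (simp add: w_def right_diff_distrib)
  then have "\<bar>conv (hk t) u x - conv (hk t) u y\<bar> <= et / (2 * (M + 1)) * nrm p u + C * nrm p' w"
   using C(2)[OF u(1) W(1)[unfolded p'_def]] by (simp add: p'_def)
  also have "... <= et / (2 * (M + 1)) * M + C * (2 * (et / (4 * (C + 1))))"
   using u(2) W2 C(1) d0 by (intro add_mono mult_left_mono) auto
  also have "... < et"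
  proof -
   have "et / (2 * (M + 1)) * M < et / 2" using et M by (simp add: divide_simps)
   moreover have "C * (2 * (et / (4 * (C + 1)))) <= et / 2" using et C(1) by (simp add: divide_simps)
   ultimately show ?thesis by linarith
  qed
  finally show "\<bar>conv (hk t) u x - conv (hk t) u y\<bar> < et" .
 qed
qed

lemma conv_hk_abs_le:
 fixes u :: "'a::euclidean_space => real"
 assumes "inLp p u" "nrm p u <= M" "1 <= p" "0 < t"
 shows "\<bar>conv (hk t) u x\<bar> <= (t powr (- (real DIM('a) / 2)) * M) powr (1 / p)"
proof -
 have "\<bar>conv (hk t) u x\<bar> powr p <= t powr (- (real DIM('a) / 2)) * M"
  using conv_hk_sup(3)[OF assms(1,3,4), of x] mult_left_mono[OF assms(2), of "t powr (- (real DIM('a) / 2))"] by simp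
 then have "(\<bar>conv (hk t) u x\<bar> powr p) powr (1 / p) <= (t powr (- (real DIM('a) / 2)) * M) powr (1 / p)"
  using assms(3) by (intro powr_mono2) auto
 then show ?thesis unfolding powr_powr using assms(3) by simp
qed

text \<open>The Arzela-Ascoli argument: a diagonal sequence converges at all pairs of a time
  \<open>1 / (k + 1)\<close> and a point of a countable dense set, and equicontinuity at each fixed
  time extends convergence to every point.\<close>

lemma heat_diagonal:
 fixes u :: "nat => 'a::euclidean_space => real"
 assumes u: "!!j. inLp p (u j)" "!!j. nrm p (u j) <= M" and p: "1 < p"
 obtains r :: "nat => nat" where "strict_mono r" "!!k x. convergent (%j. conv (hk (1 / (real k + 1))) (u (r j)) x)"
proof -
 define c where "c j y = conv (hk (1 / (real (fst y) + 1))) (u j) (snd y)" for j :: nat and y :: "nat \<times> 'a"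
 have p1: "1 <= p" using p by simp
 have M: "0 <= M" using u(2)[of 0] pnorm_nonneg[of lborel p "u 0"] by linarith
 obtain D :: "'a set" where D: "countable D" "!!X. open X ==> X ~= {} ==> EX d:D. d : X"
  using countable_dense_exists by auto
 define S where "S = (UNIV :: nat set) \<times> D"
 have S: "countable S" "S ~= {}" using D D(2)[of UNIV] by (auto simp: S_def)
 define P where "P n s \<longleftrightarrow> convergent (%j. c (s j) (from_nat_into S n))" for n and s :: "nat => nat"
 interpret subseqs P
 proof
  fix n and s :: "nat => nat"
  define y where "y = from_nat_into S n"
  have t: "0 < 1 / (real (fst y) + 1)" by simp
  have "bounded (range (%j. c (s j) y))"
   by (rule boundedI[where B = "((1 / (real (fst y) + 1)) powr (- (real DIM('a) / 2)) * M) powr (1 / p)"])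
    (use conv_hk_abs_le[OF u p1 t] in "auto simp: c_def")
  then obtain l r where r: "strict_mono r" "((%j. c (s j) y) \<circ> r) ----> l"
   using bounded_imp_convergent_subsequence[of "%j. c (s j) y"] by blast
  then show "EX r'. strict_mono r' & P n (s \<circ> r')"
   by (intro exI[of _ r]) (auto simp: P_def y_def o_def convergent_def)
 qed
 have Pn: "convergent (%j. c (diagseq j) (from_nat_into S n))" for n
 proof -
  have "P n (diagseq \<circ> ((+) (Suc n)))"
  proof (rule diagseq_holds)
   fix r s :: "nat => nat" and n
   assume "strict_mono r" "P n s"
   then show "P n (s \<circ> r)" unfolding P_def convergent_def
    using LIMSEQ_subseq_LIMSEQ[of "%j. c (s j) (from_nat_into S n)"] by (auto simp: o_def)
  qed
  then obtain l where "(%j. c (diagseq (j + Suc n)) (from_nat_into S n)) ----> l"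
   by (auto simp: P_def convergent_def o_def add.commute)
  from LIMSEQ_offset[OF this] show ?thesis by (auto simp: convergent_def)
 qed
 have cD: "convergent (%j. conv (hk (1 / (real k + 1))) (u (diagseq j)) x)" if "x : D" for k x
 proof -
  have "(k, x) : S" using that by (simp add: S_def)
  then obtain n where "from_nat_into S n = (k, x)" using from_nat_into_surj[OF S(1)] by auto
  then show ?thesis using Pn[of n] by (simp add: c_def)
 qed
 have "convergent (%j. conv (hk (1 / (real k + 1))) (u (diagseq j)) x)" for k x
 proof -
  have t: "0 < 1 / (real k + 1)" by simp
  have "Cauchy (%j. conv (hk (1 / (real k + 1))) (u (diagseq j)) x)"
  proof (rule metric_CauchyI)
   fix e :: real assume e: "0 < e"
   then have e3: "0 < e / 3" by simp
   obtain d where d: "0 < d" "!!(u :: 'a => real) x y. inLp p u ==> nrm p u <= M ==> norm (x - y) < d ==>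
     \<bar>conv (hk (1 / (real k + 1))) u x - conv (hk (1 / (real k + 1))) u y\<bar> < e / 3"
    by (rule heat_equicontinuous[OF p t M e3, where 'a = 'a]) (rule that)
   obtain x0 where x0: "x0 : D" "norm (x - x0) < d" using D(2)[of "ball x d"] d(1) by (auto simp: dist_norm)
   have "Cauchy (%j. conv (hk (1 / (real k + 1))) (u (diagseq j)) x0)"
    using cD[OF x0(1)] by (rule convergent_Cauchy)
   from metric_CauchyD[OF this e3] obtain N where N: "!!i j. N <= i ==> N <= j ==>
    \<bar>conv (hk (1 / (real k + 1))) (u (diagseq i)) x0 - conv (hk (1 / (real k + 1))) (u (diagseq j)) x0\<bar> < e / 3"
    by (auto simp: dist_real_def)
   show "EX N. ALL i>=N. ALL j>=N. dist (conv (hk (1 / (real k + 1))) (u (diagseq i)) x) (conv (hk (1 / (real k + 1))) (u (diagseq j)) x) < e"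
   proof (intro exI allI impI)
    fix i j assume "N <= i" "N <= j"
    from N[OF this] d(2)[OF u x0(2), of "diagseq i"] d(2)[OF u x0(2), of "diagseq j"]
    show "dist (conv (hk (1 / (real k + 1))) (u (diagseq i)) x) (conv (hk (1 / (real k + 1))) (u (diagseq j)) x) < e"
     unfolding dist_real_def by linarith
   qed
  qed
  then show ?thesis by (rule Cauchy_convergent)
 qed
 with subseq_diagseq show thesis by (rule that)
qed

lemma smoothing_error_tendsto:
 assumes "0 < (\<gamma>::real)" "0 < q" "0 <= C"
 shows "(%k. (C * ((1 / (real k + 1)) powr \<gamma> + (1 / (real k + 1)) powr (1/2))) powr q) ----> 0"
proof -
 have t: "(%k. 1 / (real k + 1)) ----> 0" using LIMSEQ_inverse_real_of_nat by (simp add: inverse_eq_divide add.commute)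
 have "(%k. (1 / (real k + 1)) powr \<gamma>) ----> 0" "(%k. (1 / (real k + 1)) powr (1/2)) ----> 0"
  by (rule tendsto_0_powrI[OF t], use assms in auto)+
 from tendsto_mult_left[OF tendsto_add[OF this], of C]
 have "(%k. C * ((1 / (real k + 1)) powr \<gamma> + (1 / (real k + 1)) powr (1/2))) ----> 0" by simp
 from tendsto_0_powrI[OF this _ assms(2)] show ?thesis using assms(3) by simp
qed

text \<open>Chebyshev at a level \<open>d\<close> above \<open>c\<close>: the measure of the
  exceptional set is bounded by a geometric sequence as \<open>q\<close> grows. This is how
  estimates uniform in \<open>q\<close> reach the supremum norm.\<close>

lemma AE_le_of_pnorm_le:
 fixes f :: "'x => real"
 assumes f: "!!q. p <= q ==> pint M q f & pnorm M q f <= c powr q" and c: "0 <= c" and p: "0 <= p"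
 shows "AE x in M. \<bar>f x\<bar> <= c"
proof -
 have [measurable]: "f : borel_measurable M" using f[of p] by (auto dest: pint_measurable)
 have le: "AE x in M. \<bar>f x\<bar> <= d" if d: "c < d" for d
 proof -
  define A where "A = {x \<in> space M. d < \<bar>f x\<bar>}"
  have A [measurable]: "A : sets M" unfolding A_def by measurable
  \<comment> \<open>With the mean of \<open>c\<close> and \<open>d\<close> in place of
    \<open>c\<close>, the ratio is less than 1 and stays positive even for
    \<open>c = 0\<close>.\<close>
  define \<rho> where "\<rho> = (c + d) / 2 / d"
  have d0: "0 < d" "0 < (c + d) / 2" "c <= (c + d) / 2" using c d by auto
  have \<rho>: "0 < \<rho>" "\<rho> < 1" using c d by (auto simp: \<rho>_def divide_less_eq)
  have I: "integrable M (%x. ind A x :: real) & (LINT x|M. ind A x :: real) <= \<rho> powr p * \<rho> ^ n" for n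
  proof -
   define q where "q = p + real n"
   have q: "p <= q" "0 <= q" using p by (auto simp: q_def)
   have i: "integrable M (%x. d powr (- q) * norm (f x) powr q)" using f[OF q(1)] by (intro integrable_mult_right pint_integrable) auto
   have b: "norm (ind A x :: real) <= d powr (- q) * norm (f x) powr q" for x
   proof (cases "x : A")
    case True
    then have "d powr q <= norm (f x) powr q" using d0 q by (intro powr_mono2) (auto simp: A_def)
    then have "d powr (- q) * d powr q <= d powr (- q) * norm (f x) powr q" by (intro mult_left_mono) auto
    moreover have "d powr (- q) * d powr q = 1" using d0 by (simp add: powr_add[symmetric])
    ultimately show ?thesis using True by simp
   qed simp
   have Ii: "integrable M (%x. ind A x :: real)"
    by (rule L_integrable_bound[OF i]) (use b in auto)
   have "(LINT x|M. ind A x :: real) <= (LINT x|M. d powr (- q) * norm (f x) powr q)"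
    using b by (intro integral_mono Ii i) auto
   also have "... = d powr (- q) * pnorm M q f" by (simp add: pnorm_def)
   also have "... <= d powr (- q) * ((c + d) / 2) powr q"
    using f[OF q(1)] powr_mono2[OF q(2) c d0(3)] by (intro mult_left_mono) auto
   also have "... = \<rho> powr q" unfolding \<rho>_def powr_divide[of "(c + d) / 2"] by (simp add: powr_minus_divide)
   also have "... = \<rho> powr p * \<rho> ^ n" unfolding q_def powr_add using \<rho> by (simp add: powr_realpow)
   finally show ?thesis using Ii by simp
  qed
  have "(%n. \<rho> powr p * \<rho> ^ n) ----> \<rho> powr p * 0" using \<rho> by (intro tendsto_intros LIMSEQ_realpow_zero) auto
  then have "(LINT x|M. ind A x :: real) <= \<rho> powr p * 0" by (rule LIMSEQ_le_const) (use I in blast)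
  moreover have "0 <= (LINT x|M. ind A x :: real)" by (rule L_integral_nonneg) simp
  ultimately have z: "(LINT x|M. ind A x :: real) = 0" by linarith
  have "AE x in M. ind A x = (0::real)"
   by (rule integral_nonneg_eq_0_iff_AE[THEN iffD1, OF conjunct1[OF I]]) (simp, rule z)
  then show ?thesis using AE_space by eventually_elim (auto simp: A_def indicator_def split: if_splits)
 qed
 have "AE x in M. ALL n. \<bar>f x\<bar> <= c + inverse (real (Suc n))" unfolding AE_all_countable by (intro allI le) simp
 then show ?thesis
 proof eventually_elim
  case (elim x)
  have "(%n. c + inverse (real (Suc n))) ----> c + 0" by (intro tendsto_intros LIMSEQ_inverse_real_of_nat)
  from LIMSEQ_le_const[OF this, of "\<bar>f x\<bar>"] elim show ?case by auto
 qed
qed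

text \<open>Outside \<open>A\<close> the differences vanish, all functions being equal to
  \<open>g\<close> there. On \<open>A\<close> each function is replaced by its flow at one small
  time, with an error uniform in \<open>j\<close>; the flows converge pointwise and are bounded, so
  dominated convergence applies on the bounded set.\<close>

lemma Lp_Cauchy_of_heat:
 fixes u :: "nat => 'a::euclidean_space => real" and A :: "'a set"
 assumes fp: "!!j. frac_pair (s j) p (u j) (F j)" and s: "!!j. 1/2 <= s j" "!!j. s j < 1" and p: "1 < p"
  and FM: "!!j. nrm p (F j) <= M" and uM: "!!j. nrm p (u j) <= M"
  and A: "A : sets borel" "A \<subseteq> cball 0 R" and ug: "!!j. AE x in lborel. x \<notin> A --> u j x = g x"
  and cv: "!!k x. convergent (%j. conv (hk (1 / (real k + 1))) (u j) x)" and e: "0 < e"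
 shows "EX N. ALL i>=N. ALL j>=N. nrm p (%x. u i x - u j x) < e"
proof -
 have p1: "1 <= p" "0 < p" using p by auto
 have u: "inLp p (u j)" for j using fp[of j] by (auto simp: frac_pair_def)
 have um [measurable]: "u j : Bb" for j using pint_measurable[OF u[of j]] by simp
 have M: "0 <= M" using uM[of 0] pnorm_nonneg[of lborel p "u 0"] by linarith
 have q: "0 < (1/4 :: real)" by simp
 obtain C where C: "0 <= C" "!!q s (u :: 'a => real) F e. p <= q ==> frac_pair s p u F ==> 0 < s ==> s < 1 ==> nrm p F <= M ==>
  1/4 <= s / 2 - real DIM('a) / 2 * (1 / p - 1 / q) ==> 0 < e ==>
  inLp q (%x. u x - conv (hk e) u x) & nrm q (%x. u x - conv (hk e) u x) <= (C * (e powr (1/4) + e powr (1/2))) powr q"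
  by (rule smoothing_uniform[OF p1(1) q M, where 'a = 'a]) (rule that)
 define t where "t k = 1 / (real k + 1)" for k
 define E where "E k = (C * (t k powr (1/4) + t k powr (1/2))) powr p" for k
 have "E ----> 0" unfolding E_def t_def using p C(1) by (intro smoothing_error_tendsto) auto
 \<comment> \<open>Four error terms will share \<open>e\<close>, each weighted by
   \<open>4 powr p\<close> from two quasi-triangle inequalities. The time index \<open>k\<close> is
   fixed here, before \<open>N\<close>.\<close>
 from order_tendstoD(2)[OF this, of "e / (4 * 4 powr p)"] e
 obtain k where k: "E k < e / (4 * 4 powr p)" by (auto simp: eventually_sequentially)
 have t: "0 < t k" by (simp add: t_def)
 define c where "c j = conv (hk (t k)) (u j)" for j
 have cm [measurable]: "c j : Bb" for j unfolding c_def by measurable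
 have S: "inLp p (%x. u j x - c j x)" "nrm p (%x. u j x - c j x) <= E k" for j
  using C(2)[OF order_refl fp[of j] _ s(2) FM _ t] s(1)[of j] unfolding E_def c_def by auto
 define V where "V x = lim (%j. c j x)" for x
 have cV: "(%j. c j x) ----> V x" for x
  using cv[of k x] unfolding V_def c_def t_def by (simp add: convergent_LIMSEQ_iff)
 have Vm [measurable]: "V : Bb" by (rule borel_measurable_LIMSEQ_metric[of c]) (use cV in auto)
 define B where "B = (t k powr (- (real DIM('a) / 2)) * M) powr (1 / p)"
 have cB: "\<bar>c j x\<bar> <= B" for j x unfolding c_def B_def by (rule conv_hk_abs_le[OF u uM p1(1) t])
 have VB: "\<bar>V x\<bar> <= B" for x using tendsto_rabs[OF cV[of x]] by (rule LIMSEQ_le_const2) (use cB in auto)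
 have [measurable]: "A : sets borel" by (rule A(1))
 define h where "h j x = ind A x * \<bar>c j x - V x\<bar> powr p" for j x
 have Ai: "itg (%x. (2 * B) powr p * ind A x :: real)"
  by (rule L_integrable_bound[OF integrable_indicator_cball[of "(2 * B) powr p" R]])
   (use A(2) in "auto simp: indicator_def subset_iff")
 have hB: "norm (h j x) <= (2 * B) powr p * ind A x" for j x
 proof -
  have "\<bar>c j x - V x\<bar> <= 2 * B" using cB[of j x] VB[of x] by linarith
  then have "\<bar>c j x - V x\<bar> powr p <= (2 * B) powr p" using p by (intro powr_mono2) auto
  then show ?thesis by (auto simp: h_def indicator_def)
 qed
 have hm [measurable]: "h j : Bb" for j unfolding h_def by measurable
 have h0: "(%j. h j x) ----> 0" for x
 proof -
  have "(%j. \<bar>c j x - V x\<bar>) ----> 0" using tendsto_rabs[OF LIM_zero[OF cV[of x]]] by simp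
  from tendsto_0_powrI[OF this _ p1(2)] have "(%j. \<bar>c j x - V x\<bar> powr p) ----> 0" by simp
  from tendsto_mult_left[OF this, of "ind A x"] show ?thesis by (simp add: h_def)
 qed
 have hi: "itg (h j)" for j
  by (rule L_integrable_bound[OF Ai]) (use hB in "auto intro: order_trans[OF _ abs_ge_self]")
 have "(%j. LBINT x. h j x) ----> (LINT x|(lborel :: 'a measure). (0::real))"
  by (rule integral_dominated_convergence[OF _ _ Ai]) (use h0 hB in auto)
 then have "(%j. LBINT x. h j x) ----> 0" by simp
 from order_tendstoD(2)[OF this, of "e / (4 * 4 powr p)"] e
 obtain N where N: "!!j. N <= j ==> (LBINT x. h j x) < e / (4 * 4 powr p)" by (auto simp: eventually_sequentially)
 have main: "nrm p (%x. u i x - u j x) < e" if ij: "N <= i" "N <= j" for i j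
 proof -
  define H where "H x = 4 powr p * (norm (u i x - c i x) powr p + norm (u j x - c j x) powr p + h i x + h j x)" for x
  have Hi: "itg H" unfolding H_def
   using pint_integrable[OF S(1)] hi by (intro integrable_mult_right L_integrable_add)
  have le: "AE x in lborel. norm (u i x - u j x) powr p <= H x" using ug[of i] ug[of j]
  proof eventually_elim
   case (elim x)
   show ?case
   proof (cases "x : A")
    case True
    let ?a = "u i x - c i x" and ?b = "- (u j x - c j x)" and ?v = "c i x - V x" and ?w = "- (c j x - V x)"
    have "norm (u i x - u j x) powr p = norm ((?a + ?b) + (?v + ?w)) powr p" by simp
    also have "... <= 2 powr p * (norm (?a + ?b) powr p + norm (?v + ?w) powr p)" using p by (intro norm_add_powr_le) simp
    also have "... <= 2 powr p * (2 powr p * (norm ?a powr p + norm ?b powr p) + 2 powr p * (norm ?v powr p + norm ?w powr p))"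
     using p by (intro mult_left_mono add_mono norm_add_powr_le) auto
    also have "... = (2 powr p * 2 powr p) * (norm ?a powr p + norm ?b powr p + norm ?v powr p + norm ?w powr p)"
     by (simp only: distrib_left mult.assoc add.assoc)
    also have "2 powr p * 2 powr p = (4::real) powr p" by (simp add: powr_mult[symmetric])
    also have "4 powr p * (norm ?a powr p + norm ?b powr p + norm ?v powr p + norm ?w powr p) = H x"
     unfolding H_def norm_minus_cancel using True by (simp add: h_def)
    finally show ?thesis .
   next
    case False
    then show ?thesis using elim by (simp add: H_def h_def)
   qed
  qed
  have d: "(%x. u i x - u j x) : Bl" by measurable
  have "nrm p (%x. u i x - u j x) <= (LBINT x. H x)" by (rule pint_bound(2)[OF d Hi le])
  also have "... = 4 powr p * (nrm p (%x. u i x - c i x) + nrm p (%x. u j x - c j x) + (LBINT x. h i x) + (LBINT x. h j x))"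
   unfolding H_def pnorm_def using pint_integrable[OF S(1)] hi by simp
  also have "... < 4 powr p * (e / (4 * 4 powr p) + e / (4 * 4 powr p) + e / (4 * 4 powr p) + e / (4 * 4 powr p))"
  proof (rule mult_strict_left_mono)
   show "nrm p (%x. u i x - c i x) + nrm p (%x. u j x - c j x) + (LBINT x. h i x) + (LBINT x. h j x)
    < e / (4 * 4 powr p) + e / (4 * 4 powr p) + e / (4 * 4 powr p) + e / (4 * 4 powr p)"
    using S(2)[of i] S(2)[of j] k N[OF ij(1)] N[OF ij(2)] by linarith
  qed simp
  also have "... = e" by simp
  finally show ?thesis .
 qed
 then show ?thesis by blast
qed

text \<open>The difference of each function and its flow is small in exponent \<open>q\<close> at a
  small time, uniformly from index \<open>J\<close> on; at that fixed time the flow maps exponent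
  \<open>p\<close> into exponent \<open>q\<close>, so the Cauchy property in \<open>p\<close> takes
  care of the rest.\<close>

lemma Lq_Cauchy_of_Lp:
 fixes u :: "nat => 'a::euclidean_space => real"
 assumes fp: "!!j. frac_pair (s j) p (u j) (F j)" and s: "!!j. 0 < s j" "!!j. s j < 1" and p: "1 <= p" "p <= q"
  and FM: "!!j. nrm p (F j) <= M" and \<gamma>: "0 < \<gamma>" "!!j. J <= j ==> \<gamma> <= s j / 2 - real DIM('a) / 2 * (1 / p - 1 / q)"
  and ca: "!!e. 0 < e ==> EX N. ALL i>=N. ALL j>=N. nrm p (%x. u i x - u j x) < e"
 shows "J <= j ==> inLp q (u j)"
  "0 < e ==> EX N. ALL i>=N. ALL j>=N. nrm q (%x. u i x - u j x) < e"
proof -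
 have q: "1 <= q" using p by simp
 have u: "inLp p (u j)" for j using fp[of j] by (auto simp: frac_pair_def)
 have um [measurable]: "u j : Bb" for j using pint_measurable[OF u[of j]] by simp
 have M: "0 <= M" using FM[of 0] pnorm_nonneg[of lborel p "F 0"] by linarith
 obtain C where C: "0 <= C" "!!q s (u :: 'a => real) F e. p <= q ==> frac_pair s p u F ==> 0 < s ==> s < 1 ==> nrm p F <= M ==>
  \<gamma> <= s / 2 - real DIM('a) / 2 * (1 / p - 1 / q) ==> 0 < e ==>
  inLp q (%x. u x - conv (hk e) u x) & nrm q (%x. u x - conv (hk e) u x) <= (C * (e powr \<gamma> + e powr (1/2))) powr q"
  by (rule smoothing_uniform[OF p(1) \<gamma>(1) M, where 'a = 'a]) (rule that)
 define t where "t k = 1 / (real k + 1)" for k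
 define E where "E k = (C * (t k powr \<gamma> + t k powr (1/2))) powr q" for k
 have t: "0 < t k" for k by (simp add: t_def)
 have S: "inLp q (%x. u j x - conv (hk (t k)) (u j) x)" "nrm q (%x. u j x - conv (hk (t k)) (u j) x) <= E k" if "J <= j" for j k
  using C(2)[OF p(2) fp[of j] s FM \<gamma>(2)[OF that] t] unfolding E_def by auto
 have ch: "inLp q (conv (hk (t k)) h)"
  "nrm q (conv (hk (t k)) h) <= t k powr (- (real DIM('a) / 2) * (q / p - 1)) * nrm p h powr (q / p)"
  if h: "inLp p h" for h :: "'a => real" and k
 proof -
  have [measurable]: "h : Bb" using pint_measurable[OF h] by simp
  note I = conv_hk_interpolation[OF h p t[of k]]
  have m: "conv (hk (t k)) h : Bl" by measurable
  have le: "AE x in lborel. norm (conv (hk (t k)) h x) <= norm (conv (hk (t k)) (%x. \<bar>h x\<bar>) x)"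
  proof (rule AE_I2)
   fix x
   have "\<bar>conv (hk (t k)) h x\<bar> <= conv (hk (t k)) (%x. \<bar>h x\<bar>) x"
    using integral_norm_bound[of lborel "%z. hk (t k) z * h (x - z)"] by (simp add: conv_def abs_mult)
   then show "norm (conv (hk (t k)) h x) <= norm (conv (hk (t k)) (%x. \<bar>h x\<bar>) x)" by simp
  qed
  show "inLp q (conv (hk (t k)) h)" using q by (intro pint_mono(1)[OF m I(1) le]) simp
  have "nrm q (conv (hk (t k)) h) <= nrm q (conv (hk (t k)) (%x. \<bar>h x\<bar>))"
   using q by (intro pint_mono(2)[OF m I(1) le]) simp
  with I(2) show "nrm q (conv (hk (t k)) h) <= t k powr (- (real DIM('a) / 2) * (q / p - 1)) * nrm p h powr (q / p)" by linarith
 qed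
 show uq: "inLp q (u j)" if "J <= j" for j
 proof -
  have "inLp q (%x. (u j x - conv (hk (t 0)) (u j) x) + conv (hk (t 0)) (u j) x)"
   using S(1)[OF that] ch(1)[OF u] q by (intro pint_add(1)) auto
  then show ?thesis by simp
 qed
 assume e: "0 < e"
 have "E ----> 0" unfolding E_def t_def using \<gamma> q C(1) by (intro smoothing_error_tendsto) auto
 from order_tendstoD(2)[OF this, of "e / (4 * 4 powr q)"] e
 obtain k where k: "E k < e / (4 * 4 powr q)" by (auto simp: eventually_sequentially)
 define T where "T = t k powr (- (real DIM('a) / 2) * (q / p - 1))"
 have T: "0 < T" using t[of k] by (simp add: T_def)
 \<comment> \<open>The tolerance in exponent \<open>p\<close> that the flow at time
   \<open>t k\<close>, with its possibly large constant \<open>T\<close>, turns into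
   \<open>e / (4 * 4 powr q)\<close> in exponent \<open>q\<close>.\<close>
 define \<delta> where "\<delta> = (e / (4 * 4 powr q * T)) powr (p / q)"
 have \<delta>: "0 < \<delta>" using e T by (simp add: \<delta>_def)
 have \<delta>p: "T * \<delta> powr (q / p) = e / (4 * 4 powr q)" unfolding \<delta>_def powr_powr using e T p q by simp
 obtain N where N: "!!i j. N <= i ==> N <= j ==> nrm p (%x. u i x - u j x) < \<delta>" using ca[OF \<delta>] by blast
 have "nrm q (%x. u i x - u j x) < e" if "max N J <= i" "max N J <= j" for i j
 proof -
  have ij: "N <= i" "N <= j" "J <= i" "J <= j" using that by auto
  let ?c = "%j. conv (hk (t k)) (u j)"
  have d: "inLp p (%x. u i x - u j x)" using u p by (intro pint_diff) auto
  have q0: "0 <= q" using q by simp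
  note D1 = pint_diff[OF S(1)[OF ij(3), of k] S(1)[OF ij(4), of k] q0]
  have ceq: "conv (hk (t k)) (%x. u i x - u j x) = (%x. ?c i x - ?c j x)"
   by (rule ext) (rule conv_hk_diff[OF u u p(1) t])
  note cc = ch[OF d, of k, folded T_def, unfolded ceq]
  note D2 = pint_add[OF D1(1) cc(1) q0]
  have eq: "(u i x - ?c i x - (u j x - ?c j x)) + (?c i x - ?c j x) = u i x - u j x" for x by simp
  have "nrm q (%x. u i x - u j x) <= 2 powr q * (2 powr q * (E k + E k) + T * \<delta> powr (q / p))"
  proof -
   have "nrm p (%x. u i x - u j x) powr (q / p) <= \<delta> powr (q / p)" using N[OF ij(1,2)] p q by (intro powr_mono2) auto
   then have c2: "nrm q (%x. ?c i x - ?c j x) <= T * \<delta> powr (q / p)"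
    using cc(2) T by (auto elim!: order_trans intro!: mult_left_mono)
   have d2: "nrm q (%x. u i x - ?c i x - (u j x - ?c j x)) <= 2 powr q * (E k + E k)"
    using S(2)[OF ij(3), of k] S(2)[OF ij(4), of k] by (intro order_trans[OF D1(2)] mult_left_mono add_mono) auto
   show ?thesis using D2(2) unfolding eq
    by (rule order_trans) (intro mult_left_mono add_mono c2 d2, simp)
  qed
  also have "... = (2 powr q * 2 powr q) * (E k + E k) + 2 powr q * (e / (4 * 4 powr q))" unfolding \<delta>p by (simp only: distrib_left mult.assoc)
  also have "... <= (2 powr q * 2 powr q) * (E k + E k) + 4 powr q * (e / (4 * 4 powr q))"
   using e q by (intro add_left_mono mult_right_mono powr_mono2) auto
  also have "2 powr q * 2 powr q = (4::real) powr q" by (simp add: powr_mult[symmetric])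
  also have "4 powr q * (E k + E k) + 4 powr q * (e / (4 * 4 powr q)) < 4 powr q * (e / (4 * 4 powr q) + e / (4 * 4 powr q)) + 4 powr q * (e / (4 * 4 powr q))"
   using k by (intro add_strict_right_mono mult_strict_left_mono add_strict_mono) auto
  also have "... = 3 * e / 4" by (simp add: distrib_left)
  also have "... < e" using e by simp
  finally show ?thesis .
 qed
 then show "EX N. ALL i>=N. ALL j>=N. nrm q (%x. u i x - u j x) < e" by blast
qed

text \<open>The gap is assumed with \<open>1 / q\<close> replaced by 0, the worst case, so it holds
  for every \<open>q >= p\<close> with the same \<open>\<gamma>\<close>;
  \<open>AE_le_of_pnorm_le\<close> then turns the smoothing estimate into a bound almost
  everywhere.\<close>

lemma sup_Cauchy_of_Lp:
 fixes u :: "nat => 'a::euclidean_space => real"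
 assumes fp: "!!j. frac_pair (s j) p (u j) (F j)" and s: "!!j. 0 < s j" "!!j. s j < 1" and p: "1 <= p"
  and FM: "!!j. nrm p (F j) <= M" and \<gamma>: "0 < \<gamma>" "!!j. J <= j ==> \<gamma> <= s j / 2 - real DIM('a) / 2 * (1 / p)"
  and ca: "!!e. 0 < e ==> EX N. ALL i>=N. ALL j>=N. nrm p (%x. u i x - u j x) < e"
 shows "J <= j ==> EX B. AE x in lborel. \<bar>u j x\<bar> <= B"
  "0 < e ==> EX N. ALL i>=N. ALL j>=N. AE x in lborel. \<bar>u i x - u j x\<bar> <= e"
proof -
 have u: "inLp p (u j)" for j using fp[of j] by (auto simp: frac_pair_def)
 have M: "0 <= M" using FM[of 0] pnorm_nonneg[of lborel p "F 0"] by linarith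
 obtain C where C: "0 <= C" "!!q s (u :: 'a => real) F e. p <= q ==> frac_pair s p u F ==> 0 < s ==> s < 1 ==> nrm p F <= M ==>
  \<gamma> <= s / 2 - real DIM('a) / 2 * (1 / p - 1 / q) ==> 0 < e ==>
  inLp q (%x. u x - conv (hk e) u x) & nrm q (%x. u x - conv (hk e) u x) <= (C * (e powr \<gamma> + e powr (1/2))) powr q"
  by (rule smoothing_uniform[OF p \<gamma>(1) M, where 'a = 'a]) (rule that)
 define t where "t k = 1 / (real k + 1)" for k
 \<comment> \<open>The exponent 1 brings the error into the form of
   \<open>smoothing_error_tendsto\<close>.\<close>
 define E where "E k = (C * (t k powr \<gamma> + t k powr (1/2))) powr 1" for k
 have t: "0 < t k" for k by (simp add: t_def)
 have S: "AE x in lborel. \<bar>u j x - conv (hk (t k)) (u j) x\<bar> <= E k" if "J <= j" for j k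
 proof -
  have e0: "0 <= C * (t k powr \<gamma> + t k powr (1/2))" using C(1) by simp
  have g: "\<gamma> <= s j / 2 - real DIM('a) / 2 * (1 / p - 1 / q)" if "p <= q" for q
   by (rule order_trans[OF \<gamma>(2)[OF \<open>J <= j\<close>] diff_left_mono[OF mult_left_mono]]) (use that p in auto)
  have "AE x in lborel. \<bar>u j x - conv (hk (t k)) (u j) x\<bar> <= C * (t k powr \<gamma> + t k powr (1/2))"
   by (rule AE_le_of_pnorm_le[of p, OF C(2)[OF _ fp[of j] s FM g t] e0]) (use p in auto)
  then show ?thesis using e0 by (simp add: E_def)
 qed
 show "EX B. AE x in lborel. \<bar>u j x\<bar> <= B" if "J <= j" for j
 proof -
  have "AE x in lborel. \<bar>u j x\<bar> <= E 0 + (t 0 powr (- (real DIM('a) / 2)) * nrm p (u j)) powr (1 / p)"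
   using S[OF that, of 0]
  proof eventually_elim
   case (elim x)
   then show ?case using conv_hk_abs_le[OF u[of j] order_refl p t[of 0], of x] by linarith
  qed
  then show ?thesis by blast
 qed
 assume e: "0 < e"
 have "E ----> 0" unfolding E_def t_def using \<gamma> C(1) by (intro smoothing_error_tendsto) auto
 from order_tendstoD(2)[OF this, of "e / 3"] e
 obtain k where k: "E k < e / 3" by (auto simp: eventually_sequentially)
 define T where "T = t k powr (- (real DIM('a) / 2))"
 have T: "0 < T" using t[of k] by (simp add: T_def)
 define \<delta> where "\<delta> = (e / 3) powr p / T"
 have \<delta>: "0 < \<delta>" using e T by (simp add: \<delta>_def)
 have \<delta>p: "(T * \<delta>) powr (1 / p) = e / 3" unfolding \<delta>_def using e T p by (simp add: powr_powr)
 obtain N where N: "!!i j. N <= i ==> N <= j ==> nrm p (%x. u i x - u j x) < \<delta>" using ca[OF \<delta>] by blast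
 have "AE x in lborel. \<bar>u i x - u j x\<bar> <= e" if "max N J <= i" "max N J <= j" for i j
 proof -
  have ij: "N <= i" "N <= j" "J <= i" "J <= j" using that by auto
  have d: "inLp p (%x. u i x - u j x)" using u p by (intro pint_diff) auto
  have c: "\<bar>conv (hk (t k)) (u i) x - conv (hk (t k)) (u j) x\<bar> <= e / 3" for x
   using conv_hk_abs_le[OF d less_imp_le[OF N[OF ij(1,2)]] p t[of k], of x, folded T_def]
   unfolding \<delta>p conv_hk_diff[OF u u p t] .
  show ?thesis using S[OF ij(3), of k] S[OF ij(4), of k]
  proof eventually_elim
   case (elim x)
   with c[of x] k show ?case by linarith
  qed
 qed
 then show "EX N. ALL i>=N. ALL j>=N. AE x in lborel. \<bar>u i x - u j x\<bar> <= e" by blast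
qed

text \<open>A subsequence converges to \<open>v\<close> almost everywhere because of the convergence
  in exponent \<open>p\<close>. Fatou along it, in the Cauchy estimate for exponent
  \<open>q\<close>, shows that the limit in \<open>q\<close> is the same \<open>v\<close>.\<close>

lemma Lq_limit:
 fixes u :: "nat => 'a::euclidean_space => real"
 assumes u: "!!j. inLp p (u j)" and v: "inLp p v" and l: "(%j. nrm p (%x. u j x - v x)) ----> 0"
  and p: "1 <= p" "p <= q" and uq: "!!j. J <= j ==> inLp q (u j)"
  and ca: "!!e. 0 < e ==> EX N. ALL i>=N. ALL j>=N. nrm q (%x. u i x - u j x) < e"
 shows "inLp q v" "(%j. nrm q (%x. u j x - v x)) ----> 0"
proof -
 have q: "0 < q" "0 < p" using p by auto
 have d: "inLp p (%x. u j x - v x)" for j using u v q by (intro pint_diff) auto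
 obtain r :: "nat => nat" where r: "strict_mono r" "AE x in lborel. (%j. u (r j) x) ----> v x"
  using pnorm_AE_subseq[OF d l q(2)] by auto
 have vm: "v : Bl" using pint_measurable[OF v] .
 have lim: "EX N. ALL j>=N. inLp q (%x. u j x - v x) & nrm q (%x. u j x - v x) <= e" if e: "0 < e" for e
 proof -
  obtain N where N: "!!i j. N <= i ==> N <= j ==> nrm q (%x. u i x - u j x) < e" using ca[OF e] by blast
  have "inLp q (%x. u j x - v x) & nrm q (%x. u j x - v x) <= e" if j: "max N J <= j" for j
  proof -
   let ?f = "%i x. u j x - u (r (i + max N J)) x"
   have ri: "max N J <= r (i + max N J)" for i
    using seq_suble[OF r(1), of "i + max N J"] by linarith
   have f: "inLp q (?f i)" for i using uq[of j] uq[of "r (i + max N J)"] j ri[of i] q by (intro pint_diff) auto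
   have fn: "nrm q (?f i) <= e" for i using N[of j "r (i + max N J)"] j ri[of i] by simp
   have ae: "AE x in lborel. (%i. ?f i x) ----> u j x - v x" using r(2)
   proof eventually_elim
    case (elim x)
    from LIMSEQ_ignore_initial_segment[OF this, of "max N J"] show ?case by (intro tendsto_diff tendsto_const)
   qed
   have m: "(%x. u j x - v x) : Bl" using pint_measurable[OF d] .
   show ?thesis using pint_Fatou[OF f fn ae m q(1)] by simp
  qed
  then show ?thesis by blast
 qed
 obtain N where N: "!!j. N <= j ==> inLp q (%x. u j x - v x)" using lim[of 1] by auto
 have "inLp q (%x. u (max N J) x - (u (max N J) x - v x))"
  by (rule pint_diff(1)[OF uq N]) (use q in auto)
 then show "inLp q v" by simp
 show "(%j. nrm q (%x. u j x - v x)) ----> 0"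
 proof (rule LIMSEQ_I)
  fix e :: real assume "0 < e"
  then have "0 < e / 2" by simp
  from lim[OF this] obtain N where "!!j. N <= j ==> nrm q (%x. u j x - v x) <= e / 2" by auto
  then have "norm (nrm q (%x. u j x - v x) - 0) < e" if "N <= j" for j using that \<open>0 < e\<close> by force
  then show "EX N. ALL j>=N. norm (nrm q (%x. u j x - v x) - 0) < e" by blast
 qed
qed

lemma sup_limit:
 fixes u :: "nat => 'a::euclidean_space => real"
 assumes u: "!!j. inLp p (u j)" and v: "inLp p v" and l: "(%j. nrm p (%x. u j x - v x)) ----> 0"
  and p: "1 <= p"
  and ca: "EX N. ALL i>=N. ALL j>=N. AE x in lborel. \<bar>u i x - u j x\<bar> <= e"
 shows "EX N. ALL j>=N. AE x in lborel. \<bar>u j x - v x\<bar> <= e"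
proof -
 have q: "0 < p" using p by auto
 have d: "inLp p (%x. u j x - v x)" for j using u v q by (intro pint_diff) auto
 obtain r :: "nat => nat" where r: "strict_mono r" "AE x in lborel. (%j. u (r j) x) ----> v x"
  using pnorm_AE_subseq[OF d l q] by auto
 obtain N where N: "!!i j. N <= i ==> N <= j ==> AE x in lborel. \<bar>u i x - u j x\<bar> <= e" using ca by blast
 have "AE x in lborel. \<bar>u j x - v x\<bar> <= e" if j: "N <= j" for j
 proof -
  have "AE x in lborel. ALL i. \<bar>u j x - u (r (i + N)) x\<bar> <= e"
   unfolding AE_all_countable
  proof
   fix i
   have "N <= r (i + N)" using seq_suble[OF r(1), of "i + N"] by linarith
   then show "AE x in lborel. \<bar>u j x - u (r (i + N)) x\<bar> <= e" by (rule N[OF j])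
  qed
  then show ?thesis using r(2)
  proof eventually_elim
   case (elim x)
   from LIMSEQ_ignore_initial_segment[OF elim(2), of N]
   have "(%i. \<bar>u j x - u (r (i + N)) x\<bar>) ----> \<bar>u j x - v x\<bar>" by (intro tendsto_rabs tendsto_diff tendsto_const)
   then show ?case by (rule LIMSEQ_le_const2) (use elim(1) in auto)
  qed
 qed
 then show ?thesis by blast
qed

section \<open>Weak limits\<close>

lemma pairing_bound:
 fixes M :: "'x measure"
 assumes "1 < p" "0 < d"
 shows "EX C>=0. ALL (f :: 'x => 'b::euclidean_space) w. pint M p f --> pint M (dual p) w -->
  \<bar>LINT x|M. f x \<bullet> w x\<bar> <= d * pnorm M p f + C * pnorm M (dual p) w"
proof (rule pnorm_pairing_le[OF assms, where M = M and 'b = 'b])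
 fix C assume "0 <= C" and "!!(f :: 'x => 'b) w. pint M p f ==> pint M (dual p) w ==>
   \<bar>LINT x|M. f x \<bullet> w x\<bar> <= d * pnorm M p f + C * pnorm M (dual p) w"
 then show ?thesis by (intro exI[of _ C] conjI allI impI)
qed

lemma pairing_tendsto_0:
 fixes F w :: "nat => 'x => 'b::euclidean_space"
 assumes p: "1 < p" and F: "!!j. pint M p (F j)" "!!j. pnorm M p (F j) <= B"
  and w: "!!j. pint M (dual p) (w j)" "(%j. pnorm M (dual p) (w j)) ----> 0"
 shows "(%j. LINT x|M. F j x \<bullet> w j x) ----> 0"
proof (rule LIMSEQ_I)
 fix e :: real assume e: "0 < e"
 have B: "0 <= B" using F(2)[of 0] pnorm_nonneg[of M p "F 0"] by linarith
 have d: "0 < e / (2 * (B + 1))" using e B by simp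
 obtain C where C: "0 <= C" "!!(f :: 'x => 'b) w. pint M p f ==> pint M (dual p) w ==>
  \<bar>LINT x|M. f x \<bullet> w x\<bar> <= e / (2 * (B + 1)) * pnorm M p f + C * pnorm M (dual p) w"
  using pairing_bound[OF p d, of M, where 'b = 'b] by auto
 have e2: "0 < e / (2 * (C + 1))" using e C(1) by simp
 from order_tendstoD(2)[OF w(2) e2] obtain N where N: "!!j. N <= j ==> pnorm M (dual p) (w j) < e / (2 * (C + 1))"
  by (auto simp: eventually_sequentially)
 have "norm ((LINT x|M. F j x \<bullet> w j x) - 0) < e" if "N <= j" for j
 proof -
  have "\<bar>LINT x|M. F j x \<bullet> w j x\<bar> <= e / (2 * (B + 1)) * pnorm M p (F j) + C * pnorm M (dual p) (w j)"
   by (rule C(2)[OF F(1) w(1)])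
  also have "... <= e / (2 * (B + 1)) * B + C * (e / (2 * (C + 1)))"
   using F(2)[of j] N[OF that] C(1) d by (intro add_mono mult_left_mono) auto
  also have "... < e"
  proof -
   have "e / (2 * (B + 1)) * B < e / 2" using e B by (simp add: divide_simps)
   moreover have "C * (e / (2 * (C + 1))) <= e / 2" using e C(1) by (simp add: divide_simps)
   ultimately show ?thesis by linarith
  qed
  finally show ?thesis by simp
 qed
 then show "EX N. ALL j>=N. norm ((LINT x|M. F j x \<bullet> w j x) - 0) < e" by blast
qed

lemma conjugate_exponent:
 assumes "1 < (p::real)"
 shows "1 < p / (p - 1)" "p / (p - 1) / (p / (p - 1) - 1) = p"
proof -
 show "1 < p / (p - 1)" using assms by simp
 have "p / (p - 1) - 1 = 1 / (p - 1)" using assms by (simp add: field_simps)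
 then show "p / (p - 1) / (p / (p - 1) - 1) = p" using assms by simp
qed

lemma pairing_tendsto:
 fixes f :: "nat => 'x => 'b::euclidean_space"
 assumes p: "1 < p" and f: "!!j. pint M p (f j)" and F: "pint M p F" and l: "(%j. pnorm M p (%x. f j x - F x)) ----> 0"
  and w: "pint M (dual p) w"
 shows "(%j. LINT x|M. f j x \<bullet> w x) ----> (LINT x|M. F x \<bullet> w x)"
proof -
 note c = conjugate_exponent[OF p]
 have d: "pint M p (%x. f j x - F x)" for j using f F p by (intro pint_diff) auto
 have "(%j. LINT x|M. w x \<bullet> (f j x - F x)) ----> 0"
  by (rule pairing_tendsto_0[OF c(1) w order_refl, unfolded c(2), OF d l])
 moreover have "(LINT x|M. w x \<bullet> (f j x - F x)) = (LINT x|M. f j x \<bullet> w x) - (LINT x|M. F x \<bullet> w x)" for j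
 proof -
  have "(LINT x|M. w x \<bullet> (f j x - F x)) = (LINT x|M. f j x \<bullet> w x - F x \<bullet> w x)" by (simp add: inner_diff_right inner_commute)
  then show ?thesis using pint_inner_integrable[OF p f w] pint_inner_integrable[OF p F w] by simp
 qed
 ultimately show ?thesis by (simp add: LIM_zero_iff)
qed

lemma pint_scaleR_const:
 fixes f :: "'x => real" and b :: "'b::euclidean_space"
 assumes "pint M p f"
 shows "pint M p (%x. f x *\<^sub>R b)" "pnorm M p (%x. f x *\<^sub>R b) = norm b powr p * pnorm M p f"
proof -
 have eq: "norm (f x *\<^sub>R b) powr p = norm b powr p * norm (f x) powr p" for x by (simp add: powr_mult)
 have [measurable]: "f : borel_measurable M" using pint_measurable[OF assms] .
 show "pint M p (%x. f x *\<^sub>R b)" unfolding pint_def eq using pint_integrable[OF assms] by simp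
 show "pnorm M p (%x. f x *\<^sub>R b) = norm b powr p * pnorm M p f" unfolding pnorm_def eq by simp
qed

lemma Cc_inf_dense_vector:
 fixes w :: "'a::euclidean_space => 'a"
 assumes w: "inLp q w" and q: "0 < q" and e: "0 < e"
 obtains ps where "!!b. b : Basis ==> ps b : Cc" "nrm q (%x. w x - (SUM b:Basis. ps b x *\<^sub>R b)) < e"
proof -
 have "finite (Basis :: 'a set)" "0 <= q" using q by auto
 from pnorm_sum_le[OF this, of lborel, where 'b = 'a] obtain K where K0: "0 <= K"
  "ALL f :: 'a => 'a => 'a. (ALL i:Basis. inLp q (f i)) --> nrm q (%x. SUM i:Basis. f i x) <= K * (SUM i:Basis. nrm q (f i))"
  by blast
 have K: "0 <= K"
  "!!f :: 'a => 'a => 'a. (!!i. i : Basis ==> inLp q (f i)) ==> nrm q (%x. SUM i:Basis. f i x) <= K * (SUM i:Basis. nrm q (f i))"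
  using K0 by auto
 define d where "d = e / (real DIM('a) * (K + 1))"
 have d: "0 < d" using e K(1) by (simp add: d_def)
 have "ALL b:Basis. EX ph:Cc. nrm q (%x. w x \<bullet> b - ph x) < d"
 proof
  fix b :: 'a assume b: "b : Basis"
  have "Cc_approx q (%x. w x \<bullet> b)" using pint_component(1)[OF w b] q by (intro Cc_inf_dense) auto
  then show "EX ph:Cc. nrm q (%x. w x \<bullet> b - ph x) < d" using d by (simp add: Cc_approx_def)
 qed
 then obtain ps where ps: "!!b. b : Basis ==> ps b : Cc" "!!b. b : Basis ==> nrm q (%x. w x \<bullet> b - ps b x) < d"
  by metis
 have D: "inLp q (%x. w x \<bullet> b - ps b x)" if b: "b : Basis" for b
  using pint_component(1)[OF w b] Cc_inf_pint[OF ps(1)[OF b] q] q by (intro pint_diff) auto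
 have "w x - (SUM b:Basis. ps b x *\<^sub>R b) = (SUM b:Basis. (w x \<bullet> b - ps b x) *\<^sub>R b)" for x
  by (simp add: scaleR_diff_left sum_subtractf euclidean_representation)
 then have "nrm q (%x. w x - (SUM b:Basis. ps b x *\<^sub>R b)) <= K * (SUM b:Basis. nrm q (%x. (w x \<bullet> b - ps b x) *\<^sub>R b))"
  using K(2)[of "%b x. (w x \<bullet> b - ps b x) *\<^sub>R b", OF pint_scaleR_const(1)[OF D]] by simp
 also have "(SUM b:Basis. nrm q (%x. (w x \<bullet> b - ps b x) *\<^sub>R b)) = (SUM b:Basis. nrm q (%x. w x \<bullet> b - ps b x))"
  by (intro sum.cong) (auto simp: pint_scaleR_const(2)[OF D])
 also have "K * ... <= K * (SUM b:(Basis :: 'a set). d)" using ps(2) K(1) by (intro mult_left_mono sum_mono) (auto intro: less_imp_le)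
 also have "... = K * (e / (K + 1))" by (simp add: d_def)
 also have "... < e" using e K(1) by (simp add: divide_simps)
 finally show thesis using that[of ps] ps(1) by simp
qed

text \<open>For test functions this is the antisymmetry of \<open>FG\<close>; both sides are
  continuous along the approximating sequence, since \<open>FG\<close> of a test function belongs to
  the conjugate space.\<close>

lemma frac_pair_integration_by_parts:
 fixes u :: "'a::euclidean_space => real"
 assumes fp: "frac_pair s p u F" and s: "0 < s" "s < 1" and p: "1 < p" and ps: "ps : Cc" and b: "b : Basis"
 shows "(LBINT x. F x \<bullet> (ps x *\<^sub>R b)) = - (LBINT x. u x \<bullet> FG ((1 - s) / 2) b ps x)"
proof -
 define be where "be = (1 - s) / 2"
 have be: "0 < be" "be < 1/2" using s by (auto simp: be_def)
 have p1: "1 <= p" "0 < p" using p by auto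
 note c = conjugate_exponent(1)[OF p]
 have u: "inLp p u" and F: "inLp p F" using fp by (auto simp: frac_pair_def)
 obtain ph where ph: "!!j::nat. ph j : Cc" "(%j. nrm p (%x. ph j x - u x)) ----> 0"
   "(%j. nrm p (%x. fgrad s (ph j) x - F x)) ----> 0"
  using fp unfolding frac_pair_def by auto
 have w1: "inLp (dual p) (%x. ps x *\<^sub>R b)" using c Cc_inf_pint[OF ps] by (intro pint_scaleR_const(1)) auto
 have w2: "inLp (dual p) (FG be b ps)" using c by (intro FG_pint(1)[OF ps b be]) auto
 have l1: "(%j. LBINT x. fgrad s (ph j) x \<bullet> (ps x *\<^sub>R b)) ----> (LBINT x. F x \<bullet> (ps x *\<^sub>R b))"
  by (rule pairing_tendsto[OF p frac_grad_test_pint[OF ph(1) s p1(1)] F ph(3) w1])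
 have l2: "(%j. LBINT x. ph j x \<bullet> FG be b ps x) ----> (LBINT x. u x \<bullet> FG be b ps x)"
  by (rule pairing_tendsto[OF p Cc_inf_pint[OF ph(1) p1(2)] u ph(2) w2])
 have "(LBINT x. fgrad s (ph j) x \<bullet> (ps x *\<^sub>R b)) = - (LBINT x. ph j x \<bullet> FG be b ps x)" for j
  using FG_integration_by_parts[OF ph(1) ps b be] by (simp add: frac_grad_test_inner[OF ph(1) b s] be_def mult.commute)
 with l1 have "(%j. - (LBINT x. ph j x \<bullet> FG be b ps x)) ----> (LBINT x. F x \<bullet> (ps x *\<^sub>R b))" by (simp only:)
 from LIMSEQ_unique[OF this tendsto_minus[OF l2]] show ?thesis by (simp add: be_def)
qed

text \<open>Against test fields the pairings converge: integration by parts moves \<open>FG\<close>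
  to the test function, where it tends to the classical derivative in the conjugate exponent, while
  \<open>u j\<close> tends to \<open>v\<close>. A weak cluster point \<open>G\<close> must reproduce
  these limits, hence is the weak gradient of \<open>v\<close>; density of test fields and
  boundedness of \<open>F\<close> extend convergence to all \<open>w\<close>, without another
  subsequence.\<close>

lemma weak_limit:
 fixes u :: "nat => 'a::euclidean_space => real"
 assumes fp: "!!j. frac_pair (s j) p (u j) (F j)" and s: "!!j. 1/2 <= s j" "!!j. s j < 1" "s ----> 1" and p: "1 < p"
  and FM: "!!j. nrm p (F j) <= M" and uM: "!!j. nrm p (u j) <= M"
  and v: "inLp p v" "(%j. nrm p (%x. u j x - v x)) ----> 0"
 obtains G where "inLp p G"
  "!!ps b. ps : Cc ==> b : Basis ==> (LBINT x. v x * pd b ps x) = - (LBINT x. (G x \<bullet> b) * ps x)"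
  "!!w. inLp (dual p) w ==> (%j. LBINT x. F j x \<bullet> w x) ----> (LBINT x. G x \<bullet> w x)"
proof -
 note c = conjugate_exponent(1)[OF p]
 have u: "inLp p (u j)" and F: "inLp p (F j)" for j using fp[of j] by (auto simp: frac_pair_def)
 have s0: "0 < s j" for j using s(1)[of j] by linarith
 have w: "inLp (dual p) (%x. ps x *\<^sub>R b)" if "ps : Cc" for ps :: "'a => real" and b :: 'a
  using c Cc_inf_pint[OF that] by (intro pint_scaleR_const(1)) auto
 have lim: "(%j. LBINT x. F j x \<bullet> (ps x *\<^sub>R b)) ----> - (LBINT x. v x * pd b ps x)"
  if ps: "ps : Cc" and b: "b : Basis" for ps and b :: 'a
 proof -
  define be where "be j = (1 - s j) / 2" for j
  have be: "0 < be j" "be j <= 1/4" "be j < 1/2" for j using s(1,2)[of j] by (auto simp: be_def)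
  have "be ----> (1 - 1) / 2" unfolding be_def by (intro tendsto_intros s(3)) simp
  then have be0: "be ----> 0" by simp
  have fg: "inLp (dual p) (FG (be j) b ps)" for j using c by (intro FG_pint(1)[OF ps b be(1,3)]) auto
  have pd: "inLp (dual p) (pd b ps)" using c by (intro Cc_inf_pint[OF Cc_inf_pd[OF ps b]]) auto
  have d: "inLp (dual p) (%x. FG (be j) b ps x - pd b ps x)" for j using fg pd c by (intro pint_diff) auto
  have l1: "(%j. LBINT x. u j x \<bullet> (FG (be j) b ps x - pd b ps x)) ----> 0"
   by (rule pairing_tendsto_0[OF p u uM d FG_tendsto[OF ps b c be(1,2) be0]])
  have l2: "(%j. LBINT x. u j x \<bullet> pd b ps x) ----> (LBINT x. v x \<bullet> pd b ps x)"
   by (rule pairing_tendsto[OF p u v(1) v(2) pd])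
  have "(LBINT x. F j x \<bullet> (ps x *\<^sub>R b)) = - ((LBINT x. u j x \<bullet> (FG (be j) b ps x - pd b ps x)) + (LBINT x. u j x \<bullet> pd b ps x))" for j
  proof -
   have "(LBINT x. u j x \<bullet> (FG (be j) b ps x - pd b ps x)) + (LBINT x. u j x \<bullet> pd b ps x)
    = (LBINT x. u j x \<bullet> (FG (be j) b ps x - pd b ps x) + u j x \<bullet> pd b ps x)"
    by (rule L_integral_add[symmetric, OF pint_inner_integrable[OF p u d] pint_inner_integrable[OF p u pd]])
   also have "... = (LBINT x. u j x \<bullet> FG (be j) b ps x)" by (simp add: right_diff_distrib)
   finally show ?thesis using frac_pair_integration_by_parts[OF fp[of j] s0 s(2) p ps b] by (simp add: be_def)
  qed
  with tendsto_minus[OF tendsto_add[OF l1 l2]] show ?thesis by simp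
 qed
 obtain G where G: "inLp p G"
  "!!w L. inLp (dual p) w ==> (%j. LBINT x. F j x \<bullet> w x) ----> L ==> (LBINT x. G x \<bullet> w x) = L"
  by (rule pint_weak_cluster[OF F FM p]) (rule that)
 have Gb: "(LBINT x. G x \<bullet> (ps x *\<^sub>R b)) = - (LBINT x. v x * pd b ps x)"
  if "ps : Cc" "b : Basis" for ps b by (rule G(2)[OF w[OF that(1)] lim[OF that]])
 show thesis
 proof (rule that[OF G(1)])
  fix ps :: "'a => real" and b :: 'a assume "ps : Cc" "b : Basis"
  from Gb[OF this] show "(LBINT x. v x * pd b ps x) = - (LBINT x. (G x \<bullet> b) * ps x)" by (simp add: mult.commute)
 next
  fix w :: "'a => 'a" assume wp: "inLp (dual p) w"
  define B where "B = M + nrm p G"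
  have "0 <= M" using FM[of 0] pnorm_nonneg[of lborel p "F 0"] by linarith
  then have B: "0 <= B" "nrm p (F j) <= B" "nrm p G <= B" for j
   using FM[of j] pnorm_nonneg[of lborel p G] unfolding B_def by linarith+
  show "(%j. LBINT x. F j x \<bullet> w x) ----> (LBINT x. G x \<bullet> w x)"
  proof (rule LIMSEQ_I)
   fix e :: real assume e: "0 < e"
   have d: "0 < e / (6 * (B + 1))" using e B by simp
   obtain C where C: "0 <= C" "!!(f :: 'a => 'a) w. inLp p f ==> inLp (dual p) w ==>
    \<bar>LBINT x. f x \<bullet> w x\<bar> <= e / (6 * (B + 1)) * nrm p f + C * nrm (dual p) w"
    using pairing_bound[OF p d, of lborel, where 'b = 'a] by auto
   have e2: "0 < e / (6 * (C + 1))" using e C(1) by simp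
   have c0: "0 < p / (p - 1)" using c by simp
   obtain ps where ps: "!!b. b : Basis ==> ps b : Cc" "nrm (dual p) (%x. w x - (SUM b:Basis. ps b x *\<^sub>R b)) < e / (6 * (C + 1))"
    using Cc_inf_dense_vector[OF wp c0 e2] by auto
   define w' where "w' x = (SUM b:Basis. ps b x *\<^sub>R b)" for x
   have w': "inLp (dual p) w'" unfolding w'_def using w[OF ps(1)] c by (intro pint_sum) auto
   have wd: "inLp (dual p) (%x. w x - w' x)" using wp w' c by (intro pint_diff) auto
   \<comment> \<open>Uniform over the ball of radius \<open>B\<close>, so it serves all
     \<open>F j\<close> and \<open>G\<close> alike; the denominators with 6 give two contributions
     of \<open>e / 6\<close>.\<close>
   have near: "\<bar>(LBINT x. f x \<bullet> w x) - (LBINT x. f x \<bullet> w' x)\<bar> <= e / 3" if f: "inLp p f" "nrm p f <= B" for f :: "'a => 'a"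
   proof -
    have "(LBINT x. f x \<bullet> w x) - (LBINT x. f x \<bullet> w' x) = (LBINT x. f x \<bullet> (w x - w' x))"
     using pint_inner_integrable[OF p f(1) wp] pint_inner_integrable[OF p f(1) w'] by (simp add: inner_diff_right)
    also have "\<bar>...\<bar> <= e / (6 * (B + 1)) * nrm p f + C * nrm (dual p) (%x. w x - w' x)" by (rule C(2)[OF f(1) wd])
    also have "... <= e / (6 * (B + 1)) * B + C * (e / (6 * (C + 1)))"
     using f(2) ps(2) C(1) d by (intro add_mono mult_left_mono) (auto simp: w'_def)
    also have "... <= e / 3"
    proof -
     have "e / (6 * (B + 1)) * B <= e / 6" using e B(1) by (simp add: divide_simps)
     moreover have "C * (e / (6 * (C + 1))) <= e / 6" using e C(1) by (simp add: divide_simps)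
     ultimately show ?thesis by linarith
    qed
    finally show ?thesis .
   qed
   have sw: "(LBINT x. f x \<bullet> w' x) = (SUM b:Basis. LBINT x. f x \<bullet> (ps b x *\<^sub>R b))" if f: "inLp p f" for f :: "'a => 'a"
    unfolding w'_def inner_sum_right by (rule L_integral_sum) (rule pint_inner_integrable[OF p f w[OF ps(1)]])
   have "(%j. LBINT x. F j x \<bullet> w' x) ----> (LBINT x. G x \<bullet> w' x)"
    unfolding sw[OF F] sw[OF G(1)] by (intro tendsto_sum) (simp only: Gb[OF ps(1)] lim[OF ps(1)])
   from LIMSEQ_D[OF this, of "e / 3"] e obtain N where N: "!!j. N <= j ==> \<bar>(LBINT x. F j x \<bullet> w' x) - (LBINT x. G x \<bullet> w' x)\<bar> < e / 3" by auto
   have "norm ((LBINT x. F j x \<bullet> w x) - (LBINT x. G x \<bullet> w x)) < e" if "N <= j" for j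
    using N[OF that] near[OF F B(2), of j] near[OF G(1) B(3)] unfolding real_norm_def by linarith
   then show "EX N. ALL j>=N. norm ((LBINT x. F j x \<bullet> w x) - (LBINT x. G x \<bullet> w x)) < e" by blast
  qed
 qed
qed

section \<open>Sobolev functions have fractional gradients\<close>

lemma frac_grad_test_diff:
 fixes ph ps :: "'a::euclidean_space => real"
 assumes ph: "ph : Cc" and ps: "ps : Cc" and s: "0 < s" "s < 1"
 shows "fgrad s (%x. ph x - ps x) x = fgrad s ph x - fgrad s ps x"
proof (rule euclidean_eqI)
 fix b :: 'a assume b: "b : Basis"
 have be: "0 < (1 - s) / 2" "(1 - s) / 2 < 1/2" using s by auto
 show "fgrad s (%x. ph x - ps x) x \<bullet> b = (fgrad s ph x - fgrad s ps x) \<bullet> b"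
  unfolding inner_diff_left frac_grad_test_inner[OF ph b s] frac_grad_test_inner[OF ps b s] frac_grad_test_inner[OF Cc_inf_diff[OF ph ps] b s]
  by (rule FG_diff[OF ph ps b be])
qed

lemma frac_grad_test_add:
 fixes ph ps :: "'a::euclidean_space => real"
 assumes ph: "ph : Cc" and ps: "ps : Cc" and s: "0 < s" "s < 1"
 shows "fgrad s (%x. ph x + ps x) x = fgrad s ph x + fgrad s ps x"
proof -
 \<comment> \<open>A sum is rewritten as the difference with \<open>0 - ps\<close>, so that
   additivity follows from the rule for differences.\<close>
 have z: "(%x::'a. 0) : Cc" by (rule Cc_inf_zero)
 have "fgrad s (%x::'a. 0 - 0) x = 0" using frac_grad_test_diff[OF z z s, of x] by simp
 then have m: "fgrad s (%x. 0 - ps x) x = - fgrad s ps x" using frac_grad_test_diff[OF z ps s, of x] by simp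
 have eq: "(%x. ph x - (0 - ps x)) = (%x. ph x + ps x)" by simp
 show ?thesis using frac_grad_test_diff[OF ph Cc_inf_diff[OF z ps] s, of x] unfolding m eq by simp
qed

lemma pnorm_add_tendsto_0:
 assumes "!!j. pint M p (f j)" "!!j. pint M p (g j)" "0 <= p" "(%j. pnorm M p (f j)) ----> 0" "(%j. pnorm M p (g j)) ----> 0"
 shows "(%j. pnorm M p (%x. f j x + g j x)) ----> 0"
proof (rule tendsto_sandwich[OF _ _ tendsto_const])
 show "(%j. 2 powr p * (pnorm M p (f j) + pnorm M p (g j))) ----> 0"
  using tendsto_mult_left[OF tendsto_add[OF assms(4,5)], of "2 powr p"] by simp
qed (use pint_add(2)[OF assms(1,2,3)] in auto)

lemma frac_pair_add:
 fixes u v :: "'a::euclidean_space => real"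
 assumes "frac_pair s p u F" "frac_pair s p v G" and s: "0 < s" "s < 1" and p: "1 <= p"
 shows "frac_pair s p (%x. u x + v x) (%x. F x + G x)"
proof -
 have u: "inLp p u" "inLp p F" "inLp p v" "inLp p G" using assms(1,2) by (auto simp: frac_pair_def)
 have p0: "0 <= p" "0 < p" using p by auto
 obtain ph where ph: "!!j::nat. ph j : Cc" "(%j. nrm p (%x. ph j x - u x)) ----> 0"
   "(%j. nrm p (%x. fgrad s (ph j) x - F x)) ----> 0"
  using assms(1) unfolding frac_pair_def by auto
 obtain ps where ps: "!!j::nat. ps j : Cc" "(%j. nrm p (%x. ps j x - v x)) ----> 0"
   "(%j. nrm p (%x. fgrad s (ps j) x - G x)) ----> 0"
  using assms(2) unfolding frac_pair_def by auto
 note P = Cc_inf_pint[OF ph(1) p0(2)] Cc_inf_pint[OF ps(1) p0(2)]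
 note Q = frac_grad_test_pint[OF ph(1) s p] frac_grad_test_pint[OF ps(1) s p]
 have 1: "(%j. nrm p (%x. (ph j x - u x) + (ps j x - v x))) ----> 0"
  by (rule pnorm_add_tendsto_0[OF pint_diff(1)[OF P(1) u(1) p0(1)] pint_diff(1)[OF P(2) u(3) p0(1)] p0(1) ph(2) ps(2)])
 have 2: "(%j. nrm p (%x. (fgrad s (ph j) x - F x) + (fgrad s (ps j) x - G x))) ----> 0"
  by (rule pnorm_add_tendsto_0[OF pint_diff(1)[OF Q(1) u(2) p0(1)] pint_diff(1)[OF Q(2) u(4) p0(1)] p0(1) ph(3) ps(3)])
 show ?thesis unfolding frac_pair_def
 proof (intro conjI exI[of _ "%j x. ph j x + ps j x"] allI)
  show "(%j. nrm p (%x. ph j x + ps j x - (u x + v x))) ----> 0" using 1 by (simp add: algebra_simps)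
  show "(%j. nrm p (%x. fgrad s (%x. ph j x + ps j x) x - (F x + G x))) ----> 0"
   unfolding frac_grad_test_add[OF ph(1) ps(1) s] using 2 by (simp add: algebra_simps)
 qed (use u p0 ph(1) ps(1) in "auto intro: pint_add Cc_inf_add")
qed

text \<open>Continuity of the fractional gradient with respect to the first-order Sobolev norm, for
  fixed \<open>s\<close>; the componentwise bounds come from \<open>FG_pint\<close>.\<close>

lemma frac_grad_test_pnorm_le:
 fixes s p :: real
 assumes s: "0 < s" "s < 1" and p: "1 <= p"
 shows "EX K>=0. ALL ph :: 'a::euclidean_space => real. ph : Cc -->
  nrm p (fgrad s ph) <= K * (nrm p ph + (SUM b:Basis. nrm p (pd b ph)))"
proof -
 define be where "be = (1 - s) / 2"
 have be: "0 < be" "be < 1/2" using s by (auto simp: be_def)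
 have "finite (Basis :: 'a set)" "0 <= p" using p by auto
 from pnorm_sum_le[OF this, of lborel, where 'b = real] obtain K where K0: "0 <= K"
  "ALL f :: 'a => 'a => real. (ALL i:Basis. inLp p (f i)) --> nrm p (%x. SUM i:Basis. f i x) <= K * (SUM i:Basis. nrm p (f i))"
  by blast
 have K: "0 <= K"
  "!!f :: 'a => 'a => real. (!!i. i : Basis ==> inLp p (f i)) ==> nrm p (%x. SUM i:Basis. f i x) <= K * (SUM i:Basis. nrm p (f i))"
  using K0 by auto
 define a where "a = 2 powr p * (1 / (be * Gamma be)) powr p"
 define c where "c = 2 powr p * (2 powr (real DIM('a) / 2) / (Gamma be * (1/2 - be))) powr p"
 have ac: "0 <= a" "0 <= c" by (auto simp: a_def c_def)
 have "nrm p (fgrad s ph) <= (K * (a + real DIM('a) * c)) * (nrm p ph + (SUM b:Basis. nrm p (pd b ph)))"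
  if ph: "ph : Cc" for ph :: "'a => real"
 proof -
  have n: "inLp p (%x. norm (FG be b ph x))" if "b : Basis" for b by (rule pint_norm[OF FG_pint(1)[OF ph that be p]])
  have N: "inLp p (%x. SUM b:Basis. norm (FG be b ph x))" using n p by (intro pint_sum) auto
  have "nrm p (fgrad s ph) <= nrm p (%x. SUM b:Basis. norm (FG be b ph x))"
  proof (rule pint_mono(2)[OF _ N AE_I2])
   fix x :: 'a
   have "norm (fgrad s ph x) <= (SUM b:Basis. \<bar>fgrad s ph x \<bullet> b\<bar>)" by (rule norm_le_l1)
   also have "... = (SUM b:Basis. norm (FG be b ph x))" by (simp add: frac_grad_test_inner[OF ph _ s] be_def)
   finally show "norm (fgrad s ph x) <= norm (SUM b:Basis. norm (FG be b ph x))" by (simp add: sum_nonneg)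
  qed (use p frac_grad_test_measurable[OF ph s] in auto)
  also have "... <= K * (SUM b:Basis. nrm p (%x. norm (FG be b ph x)))" by (rule K(2)[OF n])
  also have "... <= K * (SUM b:Basis. a * nrm p (pd b ph) + c * nrm p ph)"
  proof (intro mult_left_mono sum_mono K(1))
   fix b :: 'a assume b: "b : Basis"
   have "nrm p (%x. norm (FG be b ph x)) = nrm p (FG be b ph)" by (simp add: pnorm_def)
   then show "nrm p (%x. norm (FG be b ph x)) <= a * nrm p (pd b ph) + c * nrm p ph"
    using FG_pint(2)[OF ph b be p] unfolding a_def c_def by (simp only: distrib_left mult.assoc)
  qed
  also have "(SUM b:Basis. a * nrm p (pd b ph) + c * nrm p ph) = a * (SUM b:Basis. nrm p (pd b ph)) + real DIM('a) * c * nrm p ph"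
   by (simp add: sum.distrib sum_distrib_left)
  also have "... <= (a + real DIM('a) * c) * (SUM b:Basis. nrm p (pd b ph)) + (a + real DIM('a) * c) * nrm p ph"
   using ac by (intro add_mono mult_right_mono sum_nonneg) auto
  finally have "nrm p (fgrad s ph)
   <= K * ((a + real DIM('a) * c) * (SUM b:Basis. nrm p (pd b ph)) + (a + real DIM('a) * c) * nrm p ph)"
   using K(1) by (simp add: mult_left_mono)
  also have "... = (K * (a + real DIM('a) * c)) * (nrm p ph + (SUM b:Basis. nrm p (pd b ph)))"
   unfolding distrib_left[symmetric] by (simp only: mult.assoc add.commute)
  finally show ?thesis .
 qed
 moreover have "0 <= K * (a + real DIM('a) * c)" using K(1) ac by simp
 ultimately show ?thesis by blast
qed

text \<open>Test functions that converge to \<open>g\<close> together with their gradients have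
  Cauchy fractional gradients, by \<open>frac_grad_test_pnorm_le\<close> applied to differences;
  completeness supplies \<open>F\<close>. This puts the boundary datum \<open>g\<close> into the
  fractional setting.\<close>

lemma frac_pair_W1p:
 fixes g :: "'a::euclidean_space => real" and G :: "'a => 'a => real"
 assumes g: "inLp p g" and G: "!!b. b : Basis ==> inLp p (G b)" and p: "1 <= p" and s: "0 < s" "s < 1"
  and weak: "!!ph b. ph : Cc ==> b : Basis ==> (LBINT x. g x * pd b ph x) = - (LBINT x. G b x * ph x)"
 shows "EX F. frac_pair s p g F"
proof -
 have p0: "0 <= p" "0 < p" using p by auto
 have "ALL k::nat. EX ph. ph : Cc & nrm p (%x. ph x - g x) < 1 / (real k + 1) & (ALL b:Basis. nrm p (%x. pd b ph x - G b x) < 1 / (real k + 1))"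
 proof
  fix k :: nat
  have "0 < 1 / (real k + 1)" by simp
  from W1p_approx[OF g G p weak this]
  show "EX ph. ph : Cc & nrm p (%x. ph x - g x) < 1 / (real k + 1) & (ALL b:Basis. nrm p (%x. pd b ph x - G b x) < 1 / (real k + 1))"
   by blast
 qed
 from choice[OF this] obtain ph where ph: "!!k. ph k : Cc" "!!k. nrm p (%x. ph k x - g x) < 1 / (real k + 1)"
  "!!k b. b : Basis ==> nrm p (%x. pd b (ph k) x - G b x) < 1 / (real k + 1)" by blast
 have t0: "(%k. 1 / (real k + 1)) ----> 0" using LIMSEQ_inverse_real_of_nat by (simp add: inverse_eq_divide add.commute)
 have l: "(%k. nrm p (%x. ph k x - g x)) ----> 0"
  by (rule tendsto_sandwich[OF _ _ tendsto_const t0]) (use ph(2) in "auto intro!: always_eventually less_imp_le")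
 obtain K where K: "0 <= K" "!!ph :: 'a => real. ph : Cc ==>
  nrm p (fgrad s ph) <= K * (nrm p ph + (SUM b:Basis. nrm p (pd b ph)))"
  using frac_grad_test_pnorm_le[OF s p, where 'a = 'a] by auto
 have tri: "nrm p (%x. f x - h x) <= 2 powr p * (d + d')"
  if "inLp p f" "inLp p h" "inLp p k" "nrm p (%x. f x - k x) < d" "nrm p (%x. h x - k x) < d'"
  for f h k :: "'a => real" and d d'
 proof -
  have "nrm p (%x. f x - h x) <= 2 powr p * (nrm p (%x. f x - k x) + nrm p (%x. k x - h x))"
   by (rule pnorm_triangle(2)[OF pint_diff(1)[OF that(1,3) p0(1)] pint_diff(1)[OF that(3,2) p0(1)] p0(1)])
  also have "nrm p (%x. k x - h x) = nrm p (%x. h x - k x)" by (rule pnorm_minus_commute)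
  finally show ?thesis using that(4,5) by (elim order_trans) (intro mult_left_mono add_mono, auto)
 qed
 define Q where "Q = K * ((1 + real DIM('a)) * 2 powr p)"
 have Q: "0 <= Q" using K(1) by (simp add: Q_def)
 have bd: "nrm p (%x. fgrad s (ph i) x - fgrad s (ph j) x) <= Q * (1 / (real i + 1) + 1 / (real j + 1))" for i j
 proof -
  have D: "(%x. ph i x - ph j x) : Cc" by (rule Cc_inf_diff[OF ph(1) ph(1)])
  have "nrm p (%x. fgrad s (ph i) x - fgrad s (ph j) x) = nrm p (fgrad s (%x. ph i x - ph j x))"
   by (simp only: frac_grad_test_diff[OF ph(1) ph(1) s, symmetric])
  also have "... <= K * (nrm p (%x. ph i x - ph j x) + (SUM b:Basis. nrm p (pd b (%x. ph i x - ph j x))))" by (rule K(2)[OF D])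
  also have "... <= K * (2 powr p * (1 / (real i + 1) + 1 / (real j + 1)) + (SUM b:(Basis :: 'a set). 2 powr p * (1 / (real i + 1) + 1 / (real j + 1))))"
  proof (intro mult_left_mono add_mono sum_mono K(1))
   show "nrm p (%x. ph i x - ph j x) <= 2 powr p * (1 / (real i + 1) + 1 / (real j + 1))"
    by (rule tri[OF Cc_inf_pint[OF ph(1) p0(2)] Cc_inf_pint[OF ph(1) p0(2)] g ph(2) ph(2)])
   fix b :: 'a assume b: "b : Basis"
   show "nrm p (pd b (%x. ph i x - ph j x)) <= 2 powr p * (1 / (real i + 1) + 1 / (real j + 1))"
    unfolding Cc_inf_pd_diff[OF ph(1) ph(1)]
    by (rule tri[OF Cc_inf_pint[OF Cc_inf_pd[OF ph(1) b] p0(2)] Cc_inf_pint[OF Cc_inf_pd[OF ph(1) b] p0(2)] G[OF b] ph(3)[OF b] ph(3)[OF b]])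
  qed
  also have "... = Q * (1 / (real i + 1) + 1 / (real j + 1))"
   unfolding sum_constant Q_def by (simp only: distrib_right distrib_left mult_1_left mult.assoc)
  finally show ?thesis .
 qed
 have cau: "EX N. ALL i>=N. ALL j>=N. nrm p (%x. fgrad s (ph i) x - fgrad s (ph j) x) < e" if e: "0 < e" for e
 proof -
  have "(%k. Q * (1 / (real k + 1))) ----> 0" using tendsto_mult_left[OF t0, of Q] by simp
  from order_tendstoD(2)[OF this, of "e / 2"] e obtain N where N: "!!k. N <= k ==> Q * (1 / (real k + 1)) < e / 2"
   by (auto simp: eventually_sequentially)
  have "nrm p (%x. fgrad s (ph i) x - fgrad s (ph j) x) < e" if "N <= i" "N <= j" for i j
   using bd[of i j] N[OF that(1)] N[OF that(2)] unfolding distrib_left by linarith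
  then show ?thesis by blast
 qed
 obtain F where F: "inLp p F" "(%j. nrm p (%x. fgrad s (ph j) x - F x)) ----> 0"
  using pint_complete[OF frac_grad_test_pint[OF ph(1) s p] cau p0(2)] by auto
 have "frac_pair s p g F" unfolding frac_pair_def using g F(1) ph(1) l F(2) by blast
 then show ?thesis by blast
qed

section \<open>Transfer to the Lebesgue spaces\<close>

lemma Lp_iff: "f : Lp (ereal p) \<longleftrightarrow> pint lebesgue p f"
 by (simp add: Lp_def pint_def)

lemma Lp_norm_eq: "Lp_norm (ereal p) f = pnorm lebesgue p f powr (1 / p)"
 by (simp add: Lp_norm_def pnorm_def)

lemma borel_lebesgue_measurable:
 fixes f :: "'a::euclidean_space => 'b::euclidean_space"
 shows "f : Bb ==> f : BL"
 by (rule measurable_completion) simp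

lemma pint_lebesgue:
 fixes f :: "'a::euclidean_space => 'b::euclidean_space"
 assumes f: "f : Bb"
 shows "pint lebesgue p f \<longleftrightarrow> inLp p f" "pnorm lebesgue p f = nrm p f"
proof -
 have [measurable]: "f : Bl" using f by simp
 have m: "(%x. norm (f x) powr p) : Bl" by measurable
 show "pint lebesgue p f \<longleftrightarrow> inLp p f"
  unfolding pint_def integrable_completion[OF m] using borel_lebesgue_measurable[OF f] f by simp
 show "pnorm lebesgue p f = nrm p f" unfolding pnorm_def by (rule integral_completion[OF m])
qed

text \<open>Each component agrees with a Borel function off a null set, and only finitely many null
  sets have to be united.\<close>

lemma ex_borel_representative:
 fixes f :: "'a::euclidean_space => 'b::euclidean_space"
 assumes f: "f : BL"
 obtains f' where "f' : Bb" "AE x in lebesgue. f x = f' x"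
proof -
 have "ALL b:Basis. EX h. h : Bb & (AE x in lebesgue. f x \<bullet> b = h x)"
 proof
  fix b :: 'b assume "b : Basis"
  have "(%x. f x \<bullet> b) : BL" using f by measurable
  from completion_ex_borel_measurable_real[OF this] obtain h where "h : Bl" "AE x in lborel. f x \<bullet> b = h x" by auto
  then show "EX h. h : Bb & (AE x in lebesgue. f x \<bullet> b = h x)" by (auto simp: AE_completion_iff)
 qed
 from bchoice[OF this] obtain h where h: "ALL b:Basis. h b : Bb & (AE x in lebesgue. f x \<bullet> b = h b x)" by auto
 define f' where "f' x = (SUM b:Basis. h b x *\<^sub>R b)" for x
 have m: "f' : Bb" unfolding f'_def
 proof (rule borel_measurable_sum)
  fix b :: 'b assume "b : Basis"
  then have [measurable]: "h b : Bb" using h by auto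
  show "(%x. h b x *\<^sub>R b) : Bb" by measurable
 qed
 have "AE x in lebesgue. ALL b:Basis. f x \<bullet> b = h b x" using h by (subst AE_finite_all) auto
 then have "AE x in lebesgue. f x = f' x"
 proof eventually_elim
  case (elim x)
  have "f x = (SUM b:Basis. (f x \<bullet> b) *\<^sub>R b)" by (simp add: euclidean_representation)
  also have "... = f' x" unfolding f'_def using elim by (intro sum.cong) auto
  finally show ?case .
 qed
 with m show thesis by (rule that)
qed

lemma pint_borel_representative:
 fixes f :: "'a::euclidean_space => 'b::euclidean_space"
 assumes f: "pint lebesgue p f"
 obtains f' where "inLp p f'" "AE x in lebesgue. f x = f' x"
proof -
 obtain f' where f': "f' : Bb" "AE x in lebesgue. f x = f' x"
  using ex_borel_representative[OF pint_measurable[OF f]] by auto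
 have "pint lebesgue p f'" using pint_cong_AE(1)[OF f borel_lebesgue_measurable[OF f'(1)] f'(2)] .
 then show thesis using that f' by (simp add: pint_lebesgue(1))
qed

lemma pnorm_representative:
 fixes f f' :: "'a::euclidean_space => 'b::euclidean_space"
 assumes "f : BL" "f' : Bb" "AE x in lebesgue. f x = f' x"
 shows "pnorm lebesgue p f = nrm p f'" "pint lebesgue p f \<longleftrightarrow> inLp p f'"
proof -
 have [measurable]: "f : BL" "f' : BL"
  using assms borel_lebesgue_measurable by auto
 have "pnorm lebesgue p f = pnorm lebesgue p f'" unfolding pnorm_def
  by (rule integral_cong_AE) (use assms(3) in "measurable, auto")
 then show "pnorm lebesgue p f = nrm p f'" using pint_lebesgue(2)[OF assms(2)] by simp
 have "AE x in lebesgue. f' x = f x" using assms(3) by eventually_elim simp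
 then have "pint lebesgue p f \<longleftrightarrow> pint lebesgue p f'"
  using pint_cong_AE(1)[OF _ _ assms(3)] pint_cong_AE(1)[of lebesgue p f' f] by auto
 then show "pint lebesgue p f \<longleftrightarrow> inLp p f'" using pint_lebesgue(1)[OF assms(2)] by simp
qed

lemma integral_inner_representative:
 fixes f f' w w' :: "'a::euclidean_space => 'b::euclidean_space"
 assumes "f : BL" "w : BL" "f' : Bb" "w' : Bb"
  and "AE x in lebesgue. f x = f' x" "AE x in lebesgue. w x = w' x"
 shows "(LINT x|lebesgue. f x \<bullet> w x) = (LBINT x. f' x \<bullet> w' x)"
proof -
 have [measurable]: "f : BL" "f' : BL" "w : BL" "w' : BL"
  using assms borel_lebesgue_measurable by auto
 have ae: "AE x in lebesgue. f x \<bullet> w x = f' x \<bullet> w' x" using assms(5,6) by eventually_elim simp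
 have "(LINT x|lebesgue. f x \<bullet> w x) = (LINT x|lebesgue. f' x \<bullet> w' x)"
  by (rule integral_cong_AE[OF _ _ ae]) measurable
 also have "... = (LBINT x. f' x \<bullet> w' x)" by (rule integral_completion) (use assms in measurable)
 finally show ?thesis .
qed

lemma Lp_norm_tendsto_0_iff:
 assumes "0 < p"
 shows "(%j. Lp_norm (ereal p) (f j)) ----> 0 \<longleftrightarrow> (%j. pnorm lebesgue p (f j)) ----> 0"
 unfolding Lp_norm_eq
proof
 assume "(%j. pnorm lebesgue p (f j) powr (1 / p)) ----> 0"
 from tendsto_0_powrD[OF this] show "(%j. pnorm lebesgue p (f j)) ----> 0" using assms by simp
next
 assume "(%j. pnorm lebesgue p (f j)) ----> 0"
 from tendsto_0_powrI[OF this] show "(%j. pnorm lebesgue p (f j) powr (1 / p)) ----> 0" using assms by simp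
qed

lemma Lp_tendsto_iff:
 assumes "0 < p"
 shows "Lp_tendsto (ereal p) f F \<longleftrightarrow> pint lebesgue p F & (\<forall>\<^sub>F j in sequentially. pint lebesgue p (f j)) &
  (%j. pnorm lebesgue p (%x. f j x - F x)) ----> 0"
 unfolding Lp_tendsto_def Lp_iff Lp_norm_tendsto_0_iff[OF assms] ..

lemma pnorm_diff_representative:
 fixes f f' g g' :: "'a::euclidean_space => 'b::euclidean_space"
 assumes "f : BL" "f' : Bb" "AE x in lebesgue. f x = f' x"
  "g : BL" "g' : Bb" "AE x in lebesgue. g x = g' x"
 shows "pnorm lebesgue p (%x. f x - g x) = nrm p (%x. f' x - g' x)"
proof (rule pnorm_representative(1))
 show "AE x in lebesgue. f x - g x = f' x - g' x" using assms(3,6) by eventually_elim simp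
qed (use assms in measurable)

lemma frac_pair_of_has_frac_grad:
 fixes u u' :: "'a::euclidean_space => real"
 assumes h: "has_frac_grad s p u F" and s: "0 < s" "s < 1" and p: "1 <= p"
  and u': "inLp p u'" "AE x in lebesgue. u x = u' x" and F': "inLp p F'" "AE x in lebesgue. F x = F' x"
 shows "frac_pair s p u' F'"
proof -
 have p0: "0 < p" using p by simp
 obtain ph where ph: "!!j::nat. ph j : Cc" "Lp_tendsto p ph u" "Lp_tendsto p (%j. fgrad s (ph j)) F"
  using h unfolding has_frac_grad_def by auto
 note m = Cc_inf_measurable[OF ph(1)] and mF = frac_grad_test_measurable[OF ph(1) s]
 have "pint lebesgue p u" "pint lebesgue p F"
  and l: "(%j. pnorm lebesgue p (%x. ph j x - u x)) ----> 0" "(%j. pnorm lebesgue p (%x. fgrad s (ph j) x - F x)) ----> 0"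
  using ph(2,3) unfolding Lp_tendsto_iff[OF p0] by auto
 then have um: "u : BL" "F : BL" by (auto dest: pint_measurable)
 have u'm: "u' : Bb" "F' : Bb" using u'(1) F'(1) by (auto dest: pint_measurable)
 have "pnorm lebesgue p (%x. ph j x - u x) = nrm p (%x. ph j x - u' x)" for j
  by (rule pnorm_diff_representative[OF borel_lebesgue_measurable[OF m] m _ um(1) u'm(1) u'(2)]) simp
 moreover have "pnorm lebesgue p (%x. fgrad s (ph j) x - F x) = nrm p (%x. fgrad s (ph j) x - F' x)" for j
  by (rule pnorm_diff_representative[OF borel_lebesgue_measurable[OF mF] mF _ um(2) u'm(2) F'(2)]) simp
 ultimately show ?thesis unfolding frac_pair_def using u' F' ph(1) l by auto
qed

lemma has_frac_grad_of_frac_pair: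
 fixes u u' :: "'a::euclidean_space => real"
 assumes fp: "frac_pair s p u' F'" and s: "0 < s" "s < 1" and p: "1 <= p"
  and u: "u : BL" "AE x in lebesgue. u x = u' x"
 shows "has_frac_grad s p u F'"
proof -
 have p0: "0 < p" using p by simp
 have u': "inLp p u'" "inLp p F'" using fp by (auto simp: frac_pair_def)
 have u'm: "u' : Bb" "F' : Bb" using u' by (auto dest: pint_measurable)
 obtain ph where ph: "!!j::nat. ph j : Cc" "(%j. nrm p (%x. ph j x - u' x)) ----> 0"
   "(%j. nrm p (%x. fgrad s (ph j) x - F' x)) ----> 0"
  using fp unfolding frac_pair_def by auto
 note m = Cc_inf_measurable[OF ph(1)] and mF = frac_grad_test_measurable[OF ph(1) s]
 have "pnorm lebesgue p (%x. ph j x - u x) = nrm p (%x. ph j x - u' x)" for j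
  by (rule pnorm_diff_representative[OF borel_lebesgue_measurable[OF m] m _ u(1) u'm(1) u(2)]) simp
 moreover have "pnorm lebesgue p (%x. fgrad s (ph j) x - F' x) = nrm p (%x. fgrad s (ph j) x - F' x)" for j
  by (rule pnorm_diff_representative[OF borel_lebesgue_measurable[OF mF] mF _ borel_lebesgue_measurable[OF u'm(2)] u'm(2)]) simp_all
 moreover have "pint lebesgue p u" "pint lebesgue p F'" "pint lebesgue p (ph j)" "pint lebesgue p (fgrad s (ph j))" for j
  using pnorm_representative(2)[OF u(1) u'm(1) u(2)] u' pint_lebesgue(1)[OF u'm(2)] pint_lebesgue(1)[OF m] pint_lebesgue(1)[OF mF]
   Cc_inf_pint[OF ph(1) p0] frac_grad_test_pint[OF ph(1) s p] by auto
 ultimately have "Lp_tendsto p ph u" "Lp_tendsto p (%j. fgrad s (ph j)) F'"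
  unfolding Lp_tendsto_iff[OF p0] using ph(2,3) by simp_all
 then show ?thesis unfolding has_frac_grad_def using ph(1) by blast
qed

lemma Hsp_frac_pair:
 fixes u :: "'a::euclidean_space => real"
 assumes u: "u : Hsp s p" and s: "0 < s" "s < 1" and p: "1 <= p"
 obtains u' F' where "frac_pair s p u' F'" "AE x in lebesgue. u x = u' x"
proof -
 have p0: "0 < p" using p by simp
 obtain ph where ph: "!!j::nat. ph j : Cc" "Lp_tendsto p ph u" "Lp_Cauchy p (%j. fgrad s (ph j))"
  using u unfolding Hsp_def by auto
 note mF = frac_grad_test_measurable[OF ph(1) s]
 have pu: "pint lebesgue p u" using u by (simp add: Hsp_def Lp_iff)
 obtain u' where u': "inLp p u'" "AE x in lebesgue. u x = u' x" using pint_borel_representative[OF pu] by auto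
 have ca: "EX N. ALL i>=N. ALL j>=N. nrm p (%x. fgrad s (ph i) x - fgrad s (ph j) x) < e" if e: "0 < e" for e
 proof -
  \<comment> \<open>\<open>Lp_Cauchy\<close> speaks of norms with the root; this threshold
    translates it to \<open>p\<close>-th powers.\<close>
  have "0 < e powr (1 / p)" using e by simp
  then obtain N where N: "!!i j. N <= i ==> N <= j ==> Lp_norm p (%x. fgrad s (ph i) x - fgrad s (ph j) x) < e powr (1 / p)"
   using ph(3) unfolding Lp_Cauchy_def by blast
  have "nrm p (%x. fgrad s (ph i) x - fgrad s (ph j) x) < e" if "N <= i" "N <= j" for i j
  proof -
   have m: "(%x. fgrad s (ph i) x - fgrad s (ph j) x) : Bb" using mF by measurable
   have lt: "nrm p (%x. fgrad s (ph i) x - fgrad s (ph j) x) powr (1 / p) < e powr (1 / p)"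
    using N[OF that] unfolding Lp_norm_eq pint_lebesgue(2)[OF m] .
   show ?thesis
   proof (rule ccontr)
    assume "\<not> ?thesis"
    then have "e powr (1 / p) <= nrm p (%x. fgrad s (ph i) x - fgrad s (ph j) x) powr (1 / p)"
     using e p0 by (intro powr_mono2) auto
    with lt show False by simp
   qed
  qed
  then show ?thesis by blast
 qed
 obtain F where F: "inLp p F" "(%j. nrm p (%x. fgrad s (ph j) x - F x)) ----> 0"
  using pint_complete[OF frac_grad_test_pint[OF ph(1) s p] ca p0] by auto
 note m = Cc_inf_measurable[OF ph(1)]
 have u'm: "u' : Bb" using u' by (auto dest: pint_measurable)
 have "pnorm lebesgue p (%x. ph j x - u x) = nrm p (%x. ph j x - u' x)" for j
  by (rule pnorm_diff_representative[OF borel_lebesgue_measurable[OF m] m _ pint_measurable[OF pu] u'm u'(2)]) simp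
 then have "(%j. nrm p (%x. ph j x - u' x)) ----> 0" using ph(2) unfolding Lp_tendsto_iff[OF p0] by simp
 then have "frac_pair s p u' F" unfolding frac_pair_def using u' F ph(1) by blast
 then show thesis using u'(2) by (rule that)
qed

text \<open>Existence of some fractional gradient makes the chosen \<open>frac_grad\<close> a
  genuine one. Reading its approximating sequence back gives a pair with a Borel version
  \<open>F''\<close> of the chosen function; all later estimates refer to \<open>F''\<close>, which
  is not compared with \<open>F'\<close>.\<close>

lemma frac_pair_frac_grad:
 fixes u u' :: "'a::euclidean_space => real"
 assumes fp: "frac_pair s p u' F'" and s: "0 < s" "s < 1" and p: "1 <= p"
  and u: "u : BL" "AE x in lebesgue. u x = u' x"
 obtains F'' where "frac_pair s p u' F''" "AE x in lebesgue. frac_grad s p u x = F'' x" "frac_grad s p u : Lp p"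
proof -
 have p0: "0 < p" using p by simp
 have h: "has_frac_grad s p u (frac_grad s p u)"
  unfolding frac_grad_def by (rule someI[of "has_frac_grad s p u", OF has_frac_grad_of_frac_pair[OF fp s p u]])
 then have L: "frac_grad s p u : Lp p" by (auto simp: has_frac_grad_def Lp_tendsto_def)
 obtain F'' where F'': "inLp p F''" "AE x in lebesgue. frac_grad s p u x = F'' x"
  using pint_borel_representative L unfolding Lp_iff by blast
 have "inLp p u'" using fp by (simp add: frac_pair_def)
 from frac_pair_of_has_frac_grad[OF h s p this u(2) F''] F''(2) L show thesis by (rule that)
qed

text \<open>The \<open>Lp_norm\<close> part of \<open>Hsp_norm\<close> already gives a subsequence
  of test functions converging to \<open>v\<close> almost everywhere, and these vanish off
  \<open>\<Omega>\<close>.\<close>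

lemma Hsp0_zero_outside:
 fixes v :: "'a::euclidean_space => real"
 assumes v: "v : Hsp0 s p \<Omega>" and p: "1 <= p"
 shows "AE x in lebesgue. x \<notin> \<Omega> --> v x = 0"
proof -
 have p0: "0 < p" using p by simp
 have pv: "pint lebesgue p v" using v by (simp add: Hsp0_def Hsp_def Lp_iff)
 obtain ph where ph: "!!j::nat. ph j : Cc_inf \<Omega>" "(%j. Hsp_norm s p (%x. ph j x - v x)) ----> 0"
  using v by (auto simp: Hsp0_def)
 have "(%j. Lp_norm p (%x. ph j x - v x)) ----> 0"
  by (rule tendsto_sandwich[OF _ _ tendsto_const ph(2)]) (auto simp: Hsp_norm_def Lp_norm_eq)
 then have l: "(%j. pnorm lebesgue p (%x. ph j x - v x)) ----> 0" unfolding Lp_norm_tendsto_0_iff[OF p0] .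
 have d: "pint lebesgue p (%x. ph j x - v x)" for j
  using Cc_inf_pint[OF ph(1) p0, of j] pv p0 pint_lebesgue(1)[OF Cc_inf_measurable[OF ph(1)], of p j] by (intro pint_diff) auto
 obtain r :: "nat => nat" where r: "strict_mono r" "AE x in lebesgue. (%j. ph (r j) x) ----> v x"
  using pnorm_AE_subseq[OF d l p0] by auto
 have z: "ph j x = 0" if "x \<notin> \<Omega>" for j x using ph(1)[of j] that unfolding Cc_inf_iff by blast
 show ?thesis using r(2)
 proof eventually_elim
  case (elim x)
  show ?case
  proof
   assume "x \<notin> \<Omega>"
   then have "(%j. ph (r j) x) = (%j. 0)" by (simp add: z)
   with elim have "(%j::nat. 0::real) ----> v x" by simp
   then show "v x = 0" by (simp add: LIMSEQ_const_iff)
  qed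
 qed
qed

lemma W1p_representative:
 fixes g :: "'a::euclidean_space => real"
 assumes g: "g : W1p p" and p: "1 <= p"
 obtains g' where "inLp p g'" "AE x in lebesgue. g x = g' x" "!!s. 0 < s ==> s < 1 ==> EX F. frac_pair s p g' F"
proof -
 have pg: "pint lebesgue p g" using g by (simp add: W1p_def Lp_iff)
 obtain w where w: "pint lebesgue p w" "has_weak_grad g w" using g by (auto simp: W1p_def Lp_iff)
 obtain g' where g': "inLp p g'" "AE x in lebesgue. g x = g' x" using pint_borel_representative[OF pg] by auto
 obtain w' where w': "inLp p w'" "AE x in lebesgue. w x = w' x" using pint_borel_representative[OF w(1)] by auto
 have m: "g' : Bb" "w' : Bb" using g' w' by (auto dest: pint_measurable)
 have weak: "(LBINT x. g' x * pd b ph x) = - (LBINT x. (w' x \<bullet> b) * ph x)"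
  if ph: "ph : Cc" and b: "b : Basis" for ph b
 proof -
  have pm: "pd b ph : Bb" "ph : Bb" using Cc_inf_measurable[OF Cc_inf_pd[OF ph b]] Cc_inf_measurable[OF ph] by auto
  have "(LINT x|lebesgue. g x \<bullet> pd b ph x) = (LBINT x. g' x \<bullet> pd b ph x)"
   by (rule integral_inner_representative[OF pint_measurable[OF pg] borel_lebesgue_measurable[OF pm(1)] m(1) pm(1) g'(2)]) simp
  moreover have "(LINT x|lebesgue. (w x \<bullet> b) \<bullet> ph x) = (LBINT x. (w' x \<bullet> b) \<bullet> ph x)"
  proof (rule integral_inner_representative)
   show "(%x. w x \<bullet> b) : BL" using pint_measurable[OF w(1)] by measurable
   show "ph : BL" by (rule borel_lebesgue_measurable[OF pm(2)])
   show "(%x. w' x \<bullet> b) : Bb" using m(2) by measurable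
   show "AE x in lebesgue. w x \<bullet> b = w' x \<bullet> b" using w'(2) by eventually_elim simp
  qed (use pm in auto)
  ultimately show ?thesis using w(2) ph b unfolding has_weak_grad_def by simp
 qed
 have "EX F. frac_pair s p g' F" if s: "0 < s" "s < 1" for s
 proof (rule frac_pair_W1p[OF g'(1) _ p s weak])
  show "inLp p (%x. w' x \<bullet> b)" if "b : Basis" for b using pint_component(1)[OF w'(1) that] p by simp
 qed
 with g' show thesis by (rule that)
qed

text \<open>The passage from the affine space to the analysis. The datum and the representative of
  the correction add up to a pair, \<open>frac_grad\<close> receives a Borel version, and off
  \<open>\<Omega>\<close> the function equals \<open>g'\<close>, which is the boundary condition
  consumed by \<open>Poincare\<close> and \<open>Lp_Cauchy_of_heat\<close>.\<close>

lemma Hsp_aff_representative: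
 fixes u g g' :: "'a::euclidean_space => real"
 assumes u: "u : Hsp_aff s p \<Omega> g" and s: "0 < s" "s < 1" and p: "1 <= p"
  and g: "g : BL" "AE x in lebesgue. g x = g' x" and G: "frac_pair s p g' G"
 shows "EX u' F'. frac_pair s p u' F' & (AE x in lebesgue. u x = u' x) & (AE x in lebesgue. frac_grad s p u x = F' x) &
  (AE x in lborel. x \<notin> \<Omega> --> u' x = g' x) & u : BL & frac_grad s p u : Lp p"
proof -
 obtain v where v: "v : Hsp0 s p \<Omega>" "u = (%x. g x + v x)" using u by (auto simp: Hsp_aff_def)
 have vH: "v : Hsp s p" using v(1) by (simp add: Hsp0_def)
 then have vm: "v : BL" by (auto simp: Hsp_def Lp_iff dest: pint_measurable)
 have um: "u : BL" unfolding v(2) using g(1) vm by measurable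
 obtain v' F where v': "frac_pair s p v' F" "AE x in lebesgue. v x = v' x" using Hsp_frac_pair[OF vH s p] by auto
 have fp: "frac_pair s p (%x. g' x + v' x) (%x. G x + F x)" by (rule frac_pair_add[OF G v'(1) s p])
 have ae: "AE x in lebesgue. u x = g' x + v' x" using g(2) v'(2) unfolding v(2) by eventually_elim simp
 obtain F'' where F'': "frac_pair s p (%x. g' x + v' x) F''" "AE x in lebesgue. frac_grad s p u x = F'' x" "frac_grad s p u : Lp p"
  using frac_pair_frac_grad[OF fp s p um ae] by auto
 have "AE x in lebesgue. x \<notin> \<Omega> --> g' x + v' x = g' x" using Hsp0_zero_outside[OF v(1) p] v'(2) by eventually_elim simp
 then have "AE x in lborel. x \<notin> \<Omega> --> g' x + v' x = g' x" by (simp only: AE_completion_iff)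
 with F'' ae um show ?thesis by blast
qed

section \<open>Weak gradients, essential suprema and admissible exponents\<close>

lemma pint_locally_integrable:
 fixes f :: "'a::euclidean_space => 'b::euclidean_space"
 assumes f: "inLp p f" and p: "1 <= p"
 shows "locally_integrable f"
 unfolding locally_integrable_def
proof (intro allI impI)
 fix K :: "'a set" assume K: "compact K"
 have [measurable]: "K : sets borel" using K by (simp add: compact_imp_closed borel_closed)
 have [measurable]: "f : Bb" using pint_measurable[OF f] by simp
 have Ki: "itg (%x. ind K x :: real)" 
  using emeasure_bounded_finite[OF compact_imp_bounded[OF K]] by (intro integrable_real_indicator) auto
 have i: "itg (%x. ind K x + norm (f x) powr p)" using Ki pint_integrable[OF f] by auto
 have "itg (%x. ind K x *\<^sub>R f x)"
 proof (rule L_integrable_bound[OF i])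
  show "AE x in lborel. norm (ind K x *\<^sub>R f x) <= norm (ind K x + norm (f x) powr p)"
  proof (rule AE_I2)
   fix x
   have "norm (f x) <= 1 + norm (f x) powr p"
   proof (cases "norm (f x) <= 1")
    case False
    then have "norm (f x) powr 1 <= norm (f x) powr p" using p by (intro powr_mono) auto
    then show ?thesis using False by simp
   qed (simp add: add_increasing2)
   then show "norm (ind K x *\<^sub>R f x) <= norm (ind K x + norm (f x) powr p)" by (auto simp: indicator_def)
  qed
 qed measurable
 then show "set_integrable lebesgue K f" unfolding set_integrable_def by (subst integrable_completion) auto
qed

lemma locally_integrable_measurable:
 fixes f :: "'a::euclidean_space => 'b::euclidean_space"
 assumes f: "locally_integrable f"
 shows "f : BL"
proof (rule borel_measurable_LIMSEQ_metric)
 show "(%x. ind (cball 0 (real n)) x *\<^sub>R f x) : BL" for n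
  using f unfolding locally_integrable_def set_integrable_def by (intro borel_measurable_integrable) auto
 show "(%n. ind (cball 0 (real n)) x *\<^sub>R f x) ----> f x" for x
 proof (rule tendsto_eventually)
  obtain N :: nat where N: "norm x <= real N" using real_arch_simple by auto
  show "\<forall>\<^sub>F n in sequentially. ind (cball 0 (real n)) x *\<^sub>R f x = f x"
   using eventually_ge_at_top[of N] by eventually_elim (use N in "auto simp: indicator_def")
 qed
qed

text \<open>Each component of the difference of two weak gradients is annihilated by all test
  functions, so \<open>fundamental_lemma\<close> applies. The purpose is to identify the
  representative picked by \<open>weak_grad\<close>, so far known only to be locally integrable,
  with the weak limit.\<close>

lemma weak_grad_unique:
 fixes v :: "'a::euclidean_space => real"
 assumes W: "has_weak_grad v W" and G: "inLp p G" and p: "1 <= p" and v: "v : Bb"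
  and weak: "!!ph b. ph : Cc ==> b : Basis ==> (LBINT x. v x * pd b ph x) = - (LBINT x. (G x \<bullet> b) * ph x)"
 shows "AE x in lebesgue. W x = G x"
proof -
 have Wl: "locally_integrable W" using W by (simp add: has_weak_grad_def)
 have Wm: "W : BL" by (rule locally_integrable_measurable[OF Wl])
 obtain W' where W': "W' : Bb" "AE x in lebesgue. W x = W' x" using ex_borel_representative[OF Wm] by auto
 have Gm: "G : Bb" using pint_measurable[OF G] by simp
 have "AE x in lborel. (W' x - G x) \<bullet> b = 0" if b: "b : Basis" for b
 proof (rule fundamental_lemma)
  have Wb: "loc_int (%x. W' x \<bullet> b)" unfolding loc_int_def
  proof (intro conjI allI)
   show "(%x. W' x \<bullet> b) : Bb" using W'(1) by measurable
   fix R
   have [measurable]: "W' : Bb" "W : BL" "W' : BL"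
    using W'(1) Wm borel_lebesgue_measurable by auto
   have [measurable]: "cball (0::'a) R : sets lebesgue" by simp
   have "integrable lebesgue (%x. ind (cball 0 R) x *\<^sub>R W x)"
    using Wl unfolding locally_integrable_def set_integrable_def by simp
   moreover have "AE x in lebesgue. ind (cball 0 R) x *\<^sub>R W x = ind (cball 0 R) x *\<^sub>R W' x"
    using W'(2) by eventually_elim simp
   ultimately have "integrable lebesgue (%x. ind (cball 0 R) x *\<^sub>R W' x)"
    by (subst (asm) integrable_cong_AE) auto
   then have "itg (%x. ind (cball 0 R) x *\<^sub>R W' x)" by (subst (asm) integrable_completion) auto
   then have "itg (%x. (ind (cball 0 R) x *\<^sub>R W' x) \<bullet> b)" by (rule integrable_inner_left)
   then show "itg (%x. ind (cball 0 R) x * (W' x \<bullet> b))" by simp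
  qed
  have Gb: "loc_int (%x. G x \<bullet> b)" using pint_component(1)[OF G b] p by (intro loc_int_pint) auto
  show "loc_int (%x. (W' x - G x) \<bullet> b)"
   using Wb Gb unfolding loc_int_def by (auto simp: inner_diff_left right_diff_distrib)
  fix ph :: "'a => real" assume ph: "ph : Cc"
  have pm: "pd b ph : Bb" "ph : Bb" using Cc_inf_measurable[OF Cc_inf_pd[OF ph b]] Cc_inf_measurable[OF ph] by auto
  have "(LINT x|lebesgue. v x \<bullet> pd b ph x) = (LBINT x. v x \<bullet> pd b ph x)"
   by (rule integral_inner_representative[OF borel_lebesgue_measurable[OF v] borel_lebesgue_measurable[OF pm(1)] v pm(1)]) simp_all
  moreover have "(LINT x|lebesgue. (W x \<bullet> b) \<bullet> ph x) = (LBINT x. (W' x \<bullet> b) \<bullet> ph x)"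
  proof (rule integral_inner_representative)
   show "(%x. W x \<bullet> b) : BL" using Wm by measurable
   show "ph : BL" by (rule borel_lebesgue_measurable[OF pm(2)])
   show "(%x. W' x \<bullet> b) : Bb" using W'(1) by measurable
   show "AE x in lebesgue. W x \<bullet> b = W' x \<bullet> b" using W'(2) by eventually_elim simp
  qed (use pm in auto)
  ultimately have eq: "(LBINT x. (W' x \<bullet> b) * ph x) = (LBINT x. (G x \<bullet> b) * ph x)"
   using W weak[OF ph b] ph b unfolding has_weak_grad_def by simp
  show "(LBINT x. (W' x - G x) \<bullet> b * ph x) = 0"
   using eq loc_int_Cc_inf_integrable[OF Wb ph] loc_int_Cc_inf_integrable[OF Gb ph] by (simp add: inner_diff_left left_diff_distrib)
 qed
 then have "AE x in lborel. ALL b:Basis. (W' x - G x) \<bullet> b = 0" by (subst AE_finite_all) auto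
 then have "AE x in lebesgue. ALL b:Basis. (W' x - G x) \<bullet> b = 0" by (simp only: AE_completion_iff)
 with W'(2) show ?thesis
 proof eventually_elim
  case (elim x)
  have "W' x - G x = 0" by (rule euclidean_eqI) (use elim in simp)
  with elim show ?case by simp
 qed
qed

lemma has_weak_gradI:
 fixes v :: "'a::euclidean_space => real"
 assumes v: "inLp p v" and G: "inLp p G" and p: "1 <= p"
  and weak: "!!ph b. ph : Cc ==> b : Basis ==> (LBINT x. v x * pd b ph x) = - (LBINT x. (G x \<bullet> b) * ph x)"
 shows "has_weak_grad v G"
 unfolding has_weak_grad_def
proof (intro conjI ballI)
 have m [measurable]: "v : Bb" "G : Bb" using v G by (auto dest: pint_measurable)
 fix ph :: "'a => real" and b :: 'a assume ph: "ph : Cc" and b: "b : Basis"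
 have [measurable]: "pd b ph : Bb" "ph : Bb" using Cc_inf_measurable[OF Cc_inf_pd[OF ph b]] Cc_inf_measurable[OF ph] by auto
 have "(LINT x|lebesgue. v x * pd b ph x) = (LBINT x. v x * pd b ph x)" by (rule integral_completion) measurable
 moreover have "(LINT x|lebesgue. (G x \<bullet> b) * ph x) = (LBINT x. (G x \<bullet> b) * ph x)" by (rule integral_completion) measurable
 ultimately show "(LINT x|lebesgue. v x * pd b ph x) = - (LINT x|lebesgue. (G x \<bullet> b) * ph x)" using weak[OF ph b] by simp
qed (use pint_locally_integrable[OF _ p] v G in auto)

text \<open>The essential supremum lives in the extended reals and \<open>real_of_ereal\<close>
  sends infinite values to 0; bounding it from both sides shows that it is finite and that the
  conversion is faithful.\<close>

lemma Linf_norm_le: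
 fixes f :: "'a::euclidean_space => 'b::euclidean_space"
 assumes f: "f : BL" and e: "AE x in lebesgue. norm (f x) <= e"
 shows "0 <= Lp_norm \<infinity> f" "Lp_norm \<infinity> f <= e"
proof -
 have [measurable]: "f : BL" by (rule f)
 let ?E = "esssup lebesgue (%x. ereal (norm (f x)))"
 have 1: "?E <= ereal e" using e by (intro esssup_I) auto
 have n: "emeasure (lebesgue :: 'a measure) (space lebesgue) ~= 0" by simp
 have "esssup (lebesgue :: 'a measure) (%x. 0 :: ereal) = 0" by (rule esssup_const[OF n])
 moreover have "esssup (lebesgue :: 'a measure) (%x. 0 :: ereal) <= ?E" by (rule esssup_mono) auto
 ultimately have 2: "0 <= ?E" by simp
 have E: "Lp_norm \<infinity> f = real_of_ereal ?E" by (simp add: Lp_norm_def)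
 from 1 2 show "0 <= Lp_norm \<infinity> f" "Lp_norm \<infinity> f <= e" unfolding E by (cases ?E; simp)+
qed

text \<open>All three ranges of exponents amount to the same inequality, which says that the
  smoothing exponent is positive in the limit \<open>s = 1\<close>. For \<open>p < n\<close> it is
  the condition \<open>q < p * n / (n - p)\<close> with the denominator cleared.\<close>

lemma subcritical_gap:
 fixes p q :: real and n :: nat
 assumes q: "ereal q : subcritical_exponents n p" and p: "1 < p" and n: "0 < n"
 shows "p <= q" "real n * (1 / p - 1 / q) < 1"
proof -
 show pq: "p <= q" using q by (auto simp: subcritical_exponents_def split: if_splits)
 have q0: "0 < q" using pq p by simp
 consider "p < real n" "q < p * real n / (real n - p)" | "p = real n" | "real n < p"
  using q by (auto simp: subcritical_exponents_def sobolev_exponent_def split: if_splits)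
 then show "real n * (1 / p - 1 / q) < 1"
 proof cases
  case 1
  then have "q * (real n - p) < p * real n" by (simp add: pos_less_divide_eq)
  then have "real n * (q - p) < p * q" by (simp add: algebra_simps)
  then show ?thesis using p q0 by (simp add: field_simps)
 next
  case 2
  then show ?thesis using n q0 by (simp add: field_simps)
 next
  case 3
  then have "real n / p < 1" using p by simp
  moreover have "0 <= real n / q" using q0 by simp
  ultimately show ?thesis by (simp add: right_diff_distrib)
 qed
qed

text \<open>One subsequence, extracted in exponent \<open>p\<close>, serves every \<open>q\<close>:
  the stronger convergences are upgrades of convergence to the same \<open>v\<close>, and only the
  index from which they make sense depends on \<open>q\<close>.\<close>

theorem theorem4p2:
  fixes \<Omega> :: "'a::euclidean_space set"
    and p :: real
    and g :: "'a \<Rightarrow> real"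
    and u :: "real \<Rightarrow> 'a \<Rightarrow> real"
  assumes "open \<Omega>" and "bounded \<Omega>"
    and "1 < p"
    and "g \<in> W1p p"
    and "\<And>s. s \<in> {0<..<1} \<Longrightarrow> u s \<in> Hsp_aff s p \<Omega> g"
    and "\<exists>C. \<forall>s\<in>{0<..<1}. Lp_norm p (frac_grad s p (u s)) \<le> C"
  shows "\<exists>v \<in> W1p p. \<exists>\<sigma> :: nat \<Rightarrow> real.
           range \<sigma> \<subseteq> {0<..<1} \<and> strict_mono \<sigma> \<and> \<sigma> \<longlonglongrightarrow> 1 \<and>
           (\<forall>q \<in> subcritical_exponents DIM('a) p.
              \<exists>J. (\<forall>j\<ge>J. u (\<sigma> j) \<in> Lp q) \<and>
                  Lp_tendsto q (\<lambda>j. u (\<sigma> j)) v \<and>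
                  Lp_weak_tendsto p (\<lambda>j. frac_grad (\<sigma> j) p (u (\<sigma> j))) (weak_grad v))"
proof -
 note p = \<open>1 < p\<close>
 have p1: "1 <= p" "0 < p" using p by auto
 from assms(6) obtain C where "ALL s:{0<..<1}. Lp_norm p (frac_grad s p (u s)) <= C" by blast
 then have C: "Lp_norm p (frac_grad s p (u s)) <= C" if "0 < s" "s < 1" for s using that by simp
 obtain R where "ALL x:\<Omega>. norm x <= R" using \<open>bounded \<Omega>\<close> by (auto simp: bounded_iff)
 then have R: "\<Omega> \<subseteq> cball 0 R" by auto
 have \<Omega>: "\<Omega> : sets borel" using \<open>open \<Omega>\<close> by simp
 obtain g' where g': "inLp p g'" "AE x in lebesgue. g x = g' x" "!!s. 0 < s ==> s < 1 ==> EX F. frac_pair s p g' F"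
  using W1p_representative[OF \<open>g : W1p p\<close> p1(1)] by auto
 have gm: "g : BL" using \<open>g : W1p p\<close> by (auto simp: W1p_def Lp_iff dest: pint_measurable)
 \<comment> \<open>Starts at \<open>1/2\<close>, the lower bound under which the Poincare inequality
   is uniform.\<close>
 define s where "s j = 1 - 1 / (real j + 2)" for j :: nat
 have s: "1/2 <= s j" "s j < 1" "0 < s j" for j by (auto simp: s_def field_simps)
 have smono: "strict_mono s" unfolding s_def by (intro strict_monoI) (auto simp: field_simps)
 have s1: "s ----> 1"
 proof -
  have "(%j. 1 / real (j + 2)) ----> 0" by (rule LIMSEQ_ignore_initial_segment[OF lim_1_over_n])
  from tendsto_diff[OF tendsto_const[of 1] this] show ?thesis unfolding s_def by (simp add: add.commute)
 qed
 \<comment> \<open>Function and gradient are packed into one pair, so that a single choice yields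
   matching sequences \<open>U\<close> and \<open>F\<close>.\<close>
 have "ALL j. EX P. frac_pair (s j) p (fst P) (snd P) & (AE x in lebesgue. u (s j) x = fst P x) & (AE x in lebesgue. frac_grad (s j) p (u (s j)) x = snd P x) &
  (AE x in lborel. x \<notin> \<Omega> --> fst P x = g' x) & u (s j) : BL & frac_grad (s j) p (u (s j)) : Lp p"
 proof
  fix j
  obtain G where G: "frac_pair (s j) p g' G" using g'(3)[OF s(3,2)] by auto
  from Hsp_aff_representative[OF assms(5) s(3,2) p1(1) gm g'(2) this] s(2,3)[of j]
  show "EX P. frac_pair (s j) p (fst P) (snd P) & (AE x in lebesgue. u (s j) x = fst P x) & (AE x in lebesgue. frac_grad (s j) p (u (s j)) x = snd P x) &
   (AE x in lborel. x \<notin> \<Omega> --> fst P x = g' x) & u (s j) : BL & frac_grad (s j) p (u (s j)) : Lp p"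
   by auto
 qed
 from choice[OF this] obtain P where P: "!!j. frac_pair (s j) p (fst (P j)) (snd (P j))" "!!j. AE x in lebesgue. u (s j) x = fst (P j) x"
  "!!j. AE x in lebesgue. frac_grad (s j) p (u (s j)) x = snd (P j) x" "!!j. AE x in lborel. x \<notin> \<Omega> --> fst (P j) x = g' x"
  "!!j. u (s j) : BL" "!!j. frac_grad (s j) p (u (s j)) : Lp p" by auto
 define U where "U j = fst (P j)" for j
 define F where "F j = snd (P j)" for j
 note P = P[folded U_def F_def]
 have Up: "inLp p (U j)" and Fp: "inLp p (F j)" for j using P(1)[of j] by (auto simp: frac_pair_def)
 have Um: "U j : Bb" and Fm: "F j : Bb" for j
  using pint_measurable[OF Up[of j]] pint_measurable[OF Fp[of j]] by auto
 have fgm: "frac_grad (s j) p (u (s j)) : BL" for j using P(6)[of j] by (auto simp: Lp_iff dest: pint_measurable)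
 have FC: "nrm p (F j) <= \<bar>C\<bar> powr p" for j
 proof -
  have "nrm p (F j) powr (1 / p) <= C"
   using C[OF s(3,2), of j] unfolding Lp_norm_eq pnorm_representative(1)[OF fgm Fm P(3)] .
  then have "(nrm p (F j) powr (1 / p)) powr p <= \<bar>C\<bar> powr p" using p1 by (intro powr_mono2) auto
  then show ?thesis unfolding powr_powr using p1 by simp
 qed
 \<comment> \<open>The Poincare inequality takes one bound for the fractional gradients and for the
   datum.\<close>
 define M0 where "M0 = \<bar>C\<bar> powr p + nrm p g'"
 have M0: "0 <= M0" "nrm p g' <= M0" "!!j. nrm p (F j) <= M0" unfolding M0_def
  using FC by (auto intro: add_increasing2)
 obtain C' where C': "!!s u F g. frac_pair s p u F ==> 1/2 <= s ==> s < 1 ==> nrm p F <= M0 ==>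
  inLp p g ==> nrm p g <= M0 ==> (AE x in lborel. x \<notin> \<Omega> --> u x = g x) ==> nrm p u <= C'"
  by (rule Poincare[OF \<Omega> R p1(1) M0(1)]) (rule that)
 define M where "M = max M0 C'"
 have FM: "nrm p (F j) <= M" and UM: "nrm p (U j) <= M" for j
  using M0(3)[of j] C'[OF P(1) s(1,2) M0(3) g'(1) M0(2) P(4), of j] by (auto simp: M_def)
 obtain r :: "nat => nat" where r: "strict_mono r" "!!k x. convergent (%j. conv (hk (1 / (real k + 1))) (U (r j)) x)"
  by (rule heat_diagonal[OF Up UM p]) (rule that)
 have ca: "EX N. ALL i>=N. ALL j>=N. nrm p (%x. U (r i) x - U (r j) x) < e" if "0 < e" for e
  by (rule Lp_Cauchy_of_heat[OF P(1) s(1,2) p FM UM \<Omega> R P(4) r(2) that])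
 obtain v where v: "inLp p v" "(%j. nrm p (%x. U (r j) x - v x)) ----> 0"
  using pint_complete[OF Up ca p1(2)] by auto
 have vm: "v : Bb" using pint_measurable[OF v(1)] by simp
 have sr1: "(%j. s (r j)) ----> 1" using LIMSEQ_subseq_LIMSEQ[OF s1 r(1)] by (simp add: o_def)
 obtain G where G: "inLp p G"
  "!!ps b. ps : Cc ==> b : Basis ==> (LBINT x. v x * pd b ps x) = - (LBINT x. (G x \<bullet> b) * ps x)"
  "!!w. inLp (dual p) w ==> (%j. LBINT x. F (r j) x \<bullet> w x) ----> (LBINT x. G x \<bullet> w x)"
  by (rule weak_limit[OF P(1) s(1,2) sr1 p FM UM v]) (rule that)
 have Gm: "G : Bb" using pint_measurable[OF G(1)] by simp
 have hw: "has_weak_grad v G" by (rule has_weak_gradI[OF v(1) G(1) p1(1) G(2)])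
 have hW: "has_weak_grad v (weak_grad v)" unfolding weak_grad_def by (rule someI[of "has_weak_grad v", OF hw])
 have WG: "AE x in lebesgue. weak_grad v x = G x" by (rule weak_grad_unique[OF hW G(1) p1(1) vm G(2)])
 have Wm: "weak_grad v : BL"
  using hW by (intro locally_integrable_measurable) (simp add: has_weak_grad_def)
 define \<sigma> where "\<sigma> j = s (r j)" for j
 have "v : Lp p" "G : Lp p" unfolding Lp_iff pint_lebesgue(1)[OF vm] pint_lebesgue(1)[OF Gm] by (rule v(1), rule G(1))
 then have W1: "v : W1p p" unfolding W1p_def using hw by blast
 \<comment> \<open>The exponent \<open>q\<close> does not occur here, so this is settled once;
   passing to Borel versions of all functions reduces it to the conclusion of
   \<open>weak_limit\<close>.\<close>
 have weak: "Lp_weak_tendsto p (%j. frac_grad (\<sigma> j) p (u (\<sigma> j))) (weak_grad v)"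
  unfolding Lp_weak_tendsto_def
 proof (intro conjI allI ballI)
  show "weak_grad v : Lp p" unfolding Lp_iff pnorm_representative(2)[OF Wm Gm WG] by (rule G(1))
  show "frac_grad (\<sigma> j) p (u (\<sigma> j)) : Lp p" for j unfolding \<sigma>_def by (rule P(6))
  fix w :: "'a => 'a" assume "w : Lp (ereal (dual p))"
  then have w: "pint lebesgue (dual p) w" by (simp only: Lp_iff)
  obtain w' where w': "inLp (dual p) w'" "AE x in lebesgue. w x = w' x" using pint_borel_representative[OF w] by auto
  have wm: "w' : Bb" using pint_measurable[OF w'(1)] by simp
  show "(%j. LINT x|lebesgue. frac_grad (\<sigma> j) p (u (\<sigma> j)) x \<bullet> w x) ----> (LINT x|lebesgue. weak_grad v x \<bullet> w x)"
   unfolding \<sigma>_def integral_inner_representative[OF fgm pint_measurable[OF w] Fm wm P(3) w'(2)]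
    integral_inner_representative[OF Wm pint_measurable[OF w] Gm wm WG w'(2)]
   by (rule G(3)[OF w'(1)])
 qed
 have strong: "EX J. (ALL j>=J. u (\<sigma> j) : Lp q) & Lp_tendsto q (%j. u (\<sigma> j)) v" if q: "q : subcritical_exponents DIM('a) p" for q
 proof -
  have gap: "EX \<gamma> J. 0 < \<gamma> & (ALL j>=J. \<gamma> <= s (r j) / 2 - real DIM('a) / 2 * t)" if t: "real DIM('a) * t < 1" for t
  proof -
   \<comment> \<open>Half of the gap in the limit \<open>s = 1\<close>, hence exceeded for all large
     \<open>j\<close>.\<close>
   define \<gamma> where "\<gamma> = (1 - real DIM('a) * t) / 4"
   have \<gamma>: "0 < \<gamma>" using t by (simp add: \<gamma>_def)
   have "(%j. s (r j) / 2 - real DIM('a) / 2 * t) ----> 1 / 2 - real DIM('a) / 2 * t" by (intro tendsto_intros sr1) simp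
   moreover have "\<gamma> < 1 / 2 - real DIM('a) / 2 * t"
   proof -
    have eq: "real DIM('a) / 2 * t = (real DIM('a) * t) / 2" by simp
    have "(1 - y) / 4 < 1 / 2 - y / 2" if "y < 1" for y :: real using that by simp
    from this[OF t] show ?thesis unfolding \<gamma>_def eq .
   qed
   ultimately have "\<forall>\<^sub>F j in sequentially. \<gamma> < s (r j) / 2 - real DIM('a) / 2 * t" by (rule order_tendstoD(1))
   then obtain J where "ALL j>=J. \<gamma> < s (r j) / 2 - real DIM('a) / 2 * t" by (auto simp: eventually_sequentially)
   then have "ALL j>=J. \<gamma> <= s (r j) / 2 - real DIM('a) / 2 * t" by (auto intro: less_imp_le)
   with \<gamma> show ?thesis by blast
  qed
  consider (fin) t where "q = ereal t" | (inf) "q = \<infinity>" using q by (cases q) (auto simp: subcritical_exponents_def split: if_splits)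
  then show ?thesis
  proof cases
   case fin
   have "ereal t : subcritical_exponents DIM('a) p" using q fin by simp
   note sg = subcritical_gap[OF this p DIM_positive]
   obtain \<gamma> J where \<gamma>: "0 < \<gamma>" "!!j. J <= j ==> \<gamma> <= s (r j) / 2 - real DIM('a) / 2 * (1 / p - 1 / t)" using gap[OF sg(2)] by auto
   have L1: "inLp t (U (r j))" if "J <= j" for j
    by (rule Lq_Cauchy_of_Lp(1)[OF P(1) s(3,2) p1(1) sg(1) FM \<gamma>(1) _ ca that]) (rule \<gamma>(2))
   have L2: "EX N. ALL i>=N. ALL j>=N. nrm t (%x. U (r i) x - U (r j) x) < e" if "0 < e" for e
    by (rule Lq_Cauchy_of_Lp(2)[OF P(1) s(3,2) p1(1) sg(1) FM \<gamma>(1) _ ca that, of J]) (rule \<gamma>(2))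
   have l: "inLp t v" "(%j. nrm t (%x. U (r j) x - v x)) ----> 0"
    using Lq_limit[OF Up v p1(1) sg(1), of J] L1 L2 by blast+
   have t0: "0 < t" using sg(1) p1 by simp
   have ul: "pint lebesgue t (u (\<sigma> j))" if "J <= j" for j
    unfolding \<sigma>_def pnorm_representative(2)[OF P(5) Um P(2)] by (rule L1[OF that])
   have "pnorm lebesgue t (%x. u (\<sigma> j) x - v x) = nrm t (%x. U (r j) x - v x)" for j
    unfolding \<sigma>_def by (rule pnorm_diff_representative[OF P(5) Um P(2) borel_lebesgue_measurable[OF vm] vm]) simp
   then have "Lp_tendsto q (%j. u (\<sigma> j)) v" unfolding fin Lp_tendsto_iff[OF t0]
    using l pint_lebesgue(1)[OF vm] ul by (auto simp: eventually_sequentially)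
   then show ?thesis using ul unfolding fin Lp_iff by blast
  next
   case inf
   then have np: "real DIM('a) < p" using q by (auto simp: subcritical_exponents_def split: if_splits)
   \<comment> \<open>The endpoint enters \<open>gap\<close> with \<open>1 / q\<close> read as
     0.\<close>
   then have "real DIM('a) * (1 / p) < 1" using p by simp
   from gap[OF this] obtain \<gamma> J where \<gamma>: "0 < \<gamma>" "!!j. J <= j ==> \<gamma> <= s (r j) / 2 - real DIM('a) / 2 * (1 / p)" by auto
   have L1: "EX B. AE x in lborel. \<bar>U (r j) x\<bar> <= B" if "J <= j" for j
    by (rule sup_Cauchy_of_Lp(1)[OF P(1) s(3,2) p1(1) FM \<gamma>(1) _ ca that]) (rule \<gamma>(2))
   have L2: "EX N. ALL i>=N. ALL j>=N. AE x in lborel. \<bar>U (r i) x - U (r j) x\<bar> <= e" if "0 < e" for e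
    by (rule sup_Cauchy_of_Lp(2)[OF P(1) s(3,2) p1(1) FM \<gamma>(1) _ ca that, of J]) (rule \<gamma>(2))
   have lim: "EX N. ALL j>=N. AE x in lebesgue. \<bar>u (\<sigma> j) x - v x\<bar> <= e" if e: "0 < e" for e
   proof -
    obtain N where N: "!!j. N <= j ==> AE x in lborel. \<bar>U (r j) x - v x\<bar> <= e"
     using sup_limit[OF Up v p1(1) L2[OF e]] by auto
    have "AE x in lebesgue. \<bar>u (\<sigma> j) x - v x\<bar> <= e" if "N <= j" for j
     using AE_completion[OF N[OF that]] P(2)[of "r j"] unfolding \<sigma>_def by eventually_elim simp
    then show ?thesis by blast
   qed
   have uB: "EX B. AE x in lebesgue. \<bar>u (\<sigma> j) x\<bar> <= B" if "J <= j" for j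
   proof -
    obtain B where B: "AE x in lborel. \<bar>U (r j) x\<bar> <= B" using L1[OF \<open>J <= j\<close>] by auto
    have "AE x in lebesgue. \<bar>u (\<sigma> j) x\<bar> <= B"
     using AE_completion[OF B] P(2)[of "r j"] unfolding \<sigma>_def by eventually_elim simp
    then show ?thesis by blast
   qed
   have ul: "u (\<sigma> j) : Lp q" if "J <= j" for j using uB[OF that] P(5) unfolding inf Lp_def \<sigma>_def by auto
   obtain N where N: "!!j. N <= j ==> AE x in lebesgue. \<bar>u (\<sigma> j) x - v x\<bar> <= 1" using lim[of 1] by auto
   obtain B where B: "AE x in lebesgue. \<bar>u (\<sigma> (max N J)) x\<bar> <= B" using uB[of "max N J"] by auto
   have "AE x in lebesgue. norm (v x) <= B + 1" using B N[of "max N J", OF max.cobounded1]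
    by eventually_elim (unfold real_norm_def, linarith)
   then have vL: "v : Lp q" unfolding inf Lp_def using borel_lebesgue_measurable[OF vm] by auto
   have dm: "(%x. u (\<sigma> j) x - v x) : BL" for j
    using P(5)[of "r j"] borel_lebesgue_measurable[OF vm] unfolding \<sigma>_def by measurable
   have "(%j. Lp_norm q (%x. u (\<sigma> j) x - v x)) ----> 0"
   proof (rule LIMSEQ_I)
    fix e :: real assume e: "0 < e"
    then have "0 < e / 2" by simp
    from lim[OF this] obtain N where N: "!!j. N <= j ==> AE x in lebesgue. \<bar>u (\<sigma> j) x - v x\<bar> <= e / 2" by auto
    have "norm (Lp_norm q (%x. u (\<sigma> j) x - v x) - 0) < e" if j: "N <= j" for j
    proof -
     have "AE x in lebesgue. norm (u (\<sigma> j) x - v x) <= e / 2" using N[OF j] by simp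
     from Linf_norm_le[OF dm this] show ?thesis using e unfolding inf by simp
    qed
    then show "EX N. ALL j>=N. norm (Lp_norm q (%x. u (\<sigma> j) x - v x) - 0) < e" by blast
   qed
   then have "Lp_tendsto q (%j. u (\<sigma> j)) v" unfolding Lp_tendsto_def using vL ul by (auto simp: eventually_sequentially)
   then show ?thesis using ul by blast
  qed
 qed
 have "range \<sigma> \<subseteq> {0<..<1}" using s by (auto simp: \<sigma>_def)
 moreover have "strict_mono \<sigma>" unfolding \<sigma>_def using strict_mono_o[OF smono r(1)] by (simp add: o_def)
 moreover have "\<sigma> ----> 1" using sr1 by (simp add: \<sigma>_def[abs_def])
 ultimately show ?thesis using W1 strong weak by blast
qed

end
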